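(* Let $(M,g)$ be a Riemannian manifold of dimension $d\ge 3$, let $\Delta$ be the associated Laplace–Beltrami operator, and let $V$ be a smooth nonnegative potential on $M$. Then there exists a sequence $(W_n)$ of smooth bounded potentials on $M$ such that $$\forall p\in\left[1,\tfrac d2\right),\quad \lim_{n\to+\infty}\|W_n\|_{L^p(M)}=0,$$ $$\forall T>0,\quad \lim_{n\to+\infty}\left\|e^{-it(-\Delta+V+W_n)}-e^{-it(-\Delta+V)}\right\|_{L^\infty([0,T];\,\mathcal L(L^2(M)))}=2 .$$
   Context: Potentials are real-valued functions on $M$, acting by multiplication. $L^p(M)$ is taken with respect to the Riemannian volume measure. The operators $-\Delta+V$ and $-\Delta+V+W_n$ are regarded as self-adjoint operators on $L^2(M)$ with the common domain $\{u\in L^2(M):\ \Delta u\in L^2(M),\ Vu\in L^2(M)\}$. For such a self-adjoint operator $H$, $e^{-itH}$ denotes the associated unitary group. $\mathcal L(L^2(M))$ is the space of bounded linear operators on $L^2(M)$ with the operator norm, and for an operator-valued function $t\mapsto A(t)$, $\|A\|_{L^\infty([0,T];\mathcal L(L^2(M)))}$ is the (essential) supremum over $t\in[0,T]$ of $\|A(t)\|_{\mathcal L(L^2(M))}$. *)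

theory Defs
  imports "HOL-Analysis.Analysis" "HOL-Probability.Essential_Supremum"
begin

section \<open>Smooth functions on open subsets of Euclidean space\<close>

fun times_differentiable_on ::
  "nat \<Rightarrow> ('e::real_normed_vector \<Rightarrow> 'f::real_normed_vector) \<Rightarrow> 'e set \<Rightarrow> bool" where
  "times_differentiable_on 0 f S \<longleftrightarrow> continuous_on S f"
| "times_differentiable_on (Suc k) f S \<longleftrightarrow>
     (\<forall>x\<in>S. f differentiable (at x)) \<and>
     (\<forall>v. times_differentiable_on k (\<lambda>x. frechet_derivative f (at x) v) S)"

definition smooth_on :: "'e set \<Rightarrow> ('e::real_normed_vector \<Rightarrow> 'f::real_normed_vector) \<Rightarrow> bool" where
  "smooth_on S f \<longleftrightarrow> (\<forall>k. times_differentiable_on k f S)"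

definition partial :: "'d::finite \<Rightarrow> (real^'d \<Rightarrow> 'f::real_normed_vector) \<Rightarrow> real^'d \<Rightarrow> 'f" where
  "partial i f y = frechet_derivative f (at y) (axis i 1)"


section \<open>Riemannian manifolds\<close>

text \<open>The underlying topological space is a whole type, assumed Hausdorff and second countable
  by sort constraints; it is automatically nonempty. The dimension is \<^term>\<open>CARD('d)\<close>. A chart is
  a pair of its domain and its coordinate map (whose values outside the domain are irrelevant).
  The metric tensor is given by its coefficient matrix in each chart, as a function on the manifold;
  only the values for charts of the atlas, at points of their domain, are relevant.\<close>

type_synonym ('a, 'd) chart = "'a set \<times> ('a \<Rightarrow> real^'d)"

record ('a, 'd) riemannian =
  atlas :: "('a, 'd::finite) chart set"
  metric :: "('a, 'd) chart \<Rightarrow> 'a \<Rightarrow> real^'d^'d"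

definition chart_image :: "('a, 'd::finite) chart \<Rightarrow> (real^'d) set" where
  "chart_image c = snd c ` fst c"

definition chart_inv :: "('a, 'd::finite) chart \<Rightarrow> real^'d \<Rightarrow> 'a" where
  "chart_inv c = inv_into (fst c) (snd c)"

definition transition :: "('a, 'd::finite) chart \<Rightarrow> ('a, 'd) chart \<Rightarrow> real^'d \<Rightarrow> real^'d" where
  "transition c c' = snd c' \<circ> chart_inv c"

definition smooth_atlas ::
  "('a::{t2_space, second_countable_topology}, 'd::finite) chart set \<Rightarrow> bool" where
  "smooth_atlas A \<longleftrightarrow>
     (\<Union>c\<in>A. fst c) = UNIV \<and>
     (\<forall>c\<in>A. open (fst c) \<and> open (chart_image c) \<and>
        homeomorphism (fst c) (chart_image c) (snd c) (chart_inv c)) \<and>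
     (\<forall>c\<in>A. \<forall>c'\<in>A. smooth_on (snd c ` (fst c \<inter> fst c')) (transition c c'))"

definition riemannian_manifold ::
  "('a::{t2_space, second_countable_topology}, 'd::finite) riemannian \<Rightarrow> bool" where
  "riemannian_manifold M \<longleftrightarrow>
     smooth_atlas (atlas M) \<and>
     (\<forall>c\<in>atlas M.
        (\<forall>i j. smooth_on (chart_image c) (\<lambda>y. metric M c (chart_inv c y) $ i $ j)) \<and>
        (\<forall>p\<in>fst c. transpose (metric M c p) = metric M c p \<and>
           (\<forall>v. v \<noteq> 0 \<longrightarrow> 0 < v \<bullet> (metric M c p *v v)))) \<and>
     (\<forall>c\<in>atlas M. \<forall>c'\<in>atlas M. \<forall>p\<in>fst c \<inter> fst c'.
        let J = matrix (frechet_derivative (transition c c') (at (snd c p)))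
        in metric M c p = transpose J ** metric M c' p ** J)"

definition smooth_fun ::
  "('a::{t2_space, second_countable_topology}, 'd::finite) riemannian
     \<Rightarrow> ('a \<Rightarrow> 'f::real_normed_vector) \<Rightarrow> bool" where
  "smooth_fun M f \<longleftrightarrow> (\<forall>c\<in>atlas M. smooth_on (chart_image c) (f \<circ> chart_inv c))"

definition test_fun ::
  "('a::{t2_space, second_countable_topology}, 'd::finite) riemannian \<Rightarrow> ('a \<Rightarrow> real) \<Rightarrow> bool" where
  "test_fun M f \<longleftrightarrow> smooth_fun M f \<and> (\<exists>K. compact K \<and> (\<forall>p. p \<notin> K \<longrightarrow> f p = 0))"

definition volume_density :: "('a, 'd::finite) riemannian \<Rightarrow> ('a, 'd) chart \<Rightarrow> real^'d \<Rightarrow> real" where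
  "volume_density M c y = sqrt (det (metric M c (chart_inv c y)))"

text \<open>On a Riemannian manifold exactly one Borel measure has these local densities: the atlas has a
  countable subcover, and the densities agree on overlaps by the change of variables formula.\<close>

definition vol ::
  "('a::{t2_space, second_countable_topology}, 'd::finite) riemannian \<Rightarrow> 'a measure" where
  "vol M = (THE \<mu>. sets \<mu> = sets borel \<and>
     (\<forall>c\<in>atlas M. \<forall>B\<in>sets borel. B \<subseteq> fst c \<longrightarrow>
        emeasure \<mu> B = (\<integral>\<^sup>+ y\<in>snd c ` B. ennreal (volume_density M c y) \<partial>lborel)))"

definition laplacian_in_chart ::
  "('a, 'd::finite) riemannian \<Rightarrow> ('a, 'd) chart \<Rightarrow> ('a \<Rightarrow> real) \<Rightarrow> 'a \<Rightarrow> real" where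
  "laplacian_in_chart M c f p =
     (\<Sum>i\<in>UNIV. partial i
        (\<lambda>y. \<Sum>j\<in>UNIV. volume_density M c y * matrix_inv (metric M c (chart_inv c y)) $ i $ j *
                 partial j (f \<circ> chart_inv c) y) (snd c p))
     / volume_density M c (snd c p)"

text \<open>For smooth \<^term>\<open>f\<close> the value does not depend on the chart that is chosen.\<close>

definition laplace_beltrami ::
  "('a, 'd::finite) riemannian \<Rightarrow> ('a \<Rightarrow> real) \<Rightarrow> 'a \<Rightarrow> real" where
  "laplace_beltrami M f p = laplacian_in_chart M (SOME c. c \<in> atlas M \<and> p \<in> fst c) f p"


section \<open>Lebesgue spaces\<close>

text \<open>Elements of \<open>L\<^sup>2\<close> are represented by functions; all notions below are invariant under
  modification on null sets.\<close>

definition L2 :: "'a measure \<Rightarrow> ('a \<Rightarrow> complex) set" where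
  "L2 \<mu> = {u \<in> borel_measurable \<mu>. integrable \<mu> (\<lambda>x. (cmod (u x))\<^sup>2)}"

definition L2_inner :: "'a measure \<Rightarrow> ('a \<Rightarrow> complex) \<Rightarrow> ('a \<Rightarrow> complex) \<Rightarrow> complex" where
  "L2_inner \<mu> u v = (\<integral>x. u x * cnj (v x) \<partial>\<mu>)"

definition L2_norm :: "'a measure \<Rightarrow> ('a \<Rightarrow> complex) \<Rightarrow> real" where
  "L2_norm \<mu> u = sqrt (\<integral>x. (cmod (u x))\<^sup>2 \<partial>\<mu>)"

text \<open>Takes the value \<open>\<infinity>\<close> outside \<open>L\<^sup>p\<close>.\<close>

definition Lp_norm :: "'a measure \<Rightarrow> real \<Rightarrow> ('a \<Rightarrow> real) \<Rightarrow> ennreal" where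
  "Lp_norm \<mu> p f =
     (let I = (\<integral>\<^sup>+ x. ennreal (\<bar>f x\<bar> powr p) \<partial>\<mu>)
      in if I = \<infinity> then \<infinity> else ennreal (enn2real I powr (1 / p)))"

definition op_norm :: "'a measure \<Rightarrow> (('a \<Rightarrow> complex) \<Rightarrow> ('a \<Rightarrow> complex)) \<Rightarrow> ennreal" where
  "op_norm \<mu> A = (SUP u\<in>{u \<in> L2 \<mu>. L2_norm \<mu> u \<le> 1}. ennreal (L2_norm \<mu> (A u)))"


section \<open>Self-adjoint operators and their unitary groups\<close>

text \<open>An unbounded operator \<^term>\<open>H\<close> on \<open>L\<^sup>2\<close> is represented by its graph: \<^term>\<open>(u, h) \<in> H\<close> means that
  \<^term>\<open>u\<close> is in the domain and \<^term>\<open>h\<close> is a representative of its image.\<close>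

type_synonym 'a operator = "(('a \<Rightarrow> complex) \<times> ('a \<Rightarrow> complex)) set"

definition densely_defined :: "'a measure \<Rightarrow> 'a operator \<Rightarrow> bool" where
  "densely_defined \<mu> H \<longleftrightarrow>
     (\<forall>u\<in>L2 \<mu>. \<forall>\<epsilon>>0. \<exists>v\<in>Domain H. L2_norm \<mu> (\<lambda>x. u x - v x) < \<epsilon>)"

definition adjoint_op :: "'a measure \<Rightarrow> 'a operator \<Rightarrow> 'a operator" where
  "adjoint_op \<mu> H = {(v, k). v \<in> L2 \<mu> \<and> k \<in> L2 \<mu> \<and>
     (\<forall>(u, h)\<in>H. L2_inner \<mu> h v = L2_inner \<mu> u k)}"

definition self_adjoint :: "'a measure \<Rightarrow> 'a operator \<Rightarrow> bool" where
  "self_adjoint \<mu> H \<longleftrightarrow> densely_defined \<mu> H \<and> adjoint_op \<mu> H = H"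

definition unitary_op :: "'a measure \<Rightarrow> (('a \<Rightarrow> complex) \<Rightarrow> ('a \<Rightarrow> complex)) \<Rightarrow> bool" where
  "unitary_op \<mu> U \<longleftrightarrow>
     (\<forall>u\<in>L2 \<mu>. U u \<in> L2 \<mu> \<and> L2_norm \<mu> (U u) = L2_norm \<mu> u) \<and>
     (\<forall>u\<in>L2 \<mu>. \<forall>v\<in>L2 \<mu>. \<forall>a b.
        AE x in \<mu>. U (\<lambda>y. a * u y + b * v y) x = a * U u x + b * U v x) \<and>
     (\<forall>v\<in>L2 \<mu>. \<exists>u\<in>L2 \<mu>. AE x in \<mu>. U u x = v x)"

definition unitary_group ::
  "'a measure \<Rightarrow> (real \<Rightarrow> ('a \<Rightarrow> complex) \<Rightarrow> ('a \<Rightarrow> complex)) \<Rightarrow> bool" where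
  "unitary_group \<mu> U \<longleftrightarrow>
     (\<forall>t. unitary_op \<mu> (U t)) \<and>
     (\<forall>u\<in>L2 \<mu>. AE x in \<mu>. U 0 u x = u x) \<and>
     (\<forall>s t. \<forall>u\<in>L2 \<mu>. AE x in \<mu>. U (s + t) u x = U s (U t u) x) \<and>
     (\<forall>u\<in>L2 \<mu>. \<forall>s. ((\<lambda>t. L2_norm \<mu> (\<lambda>x. U t u x - U s u x)) \<longlongrightarrow> 0) (at s))"

text \<open>The operator \<^term>\<open>H\<close> for which the infinitesimal generator of \<^term>\<open>U\<close> is \<open>-\<i>H\<close>.\<close>

definition group_hamiltonian ::
  "'a measure \<Rightarrow> (real \<Rightarrow> ('a \<Rightarrow> complex) \<Rightarrow> ('a \<Rightarrow> complex)) \<Rightarrow> 'a operator" where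
  "group_hamiltonian \<mu> U = {(u, h). u \<in> L2 \<mu> \<and> h \<in> L2 \<mu> \<and>
     ((\<lambda>t. L2_norm \<mu> (\<lambda>x. (U t u x - u x) / of_real t + \<i> * h x)) \<longlongrightarrow> 0) (at 0)}"

text \<open>The group \<open>e\<^sup>-\<^sup>i\<^sup>t\<^sup>H\<close>. For self-adjoint \<^term>\<open>H\<close> it exists by Stone's theorem, and it is unique up to
  the choice of representatives of elements of \<open>L\<^sup>2\<close>, which is all that the choice operator decides.\<close>

definition exp_group ::
  "'a measure \<Rightarrow> 'a operator \<Rightarrow> real \<Rightarrow> ('a \<Rightarrow> complex) \<Rightarrow> ('a \<Rightarrow> complex)" where
  "exp_group \<mu> H = (SOME U. unitary_group \<mu> U \<and> group_hamiltonian \<mu> U = H)"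


section \<open>Schroedinger operators\<close>

text \<open>\<open>\<Delta>u = f\<close> in the sense of distributions.\<close>

definition weak_laplacian ::
  "('a::{t2_space, second_countable_topology}, 'd::finite) riemannian
     \<Rightarrow> ('a \<Rightarrow> complex) \<Rightarrow> ('a \<Rightarrow> complex) \<Rightarrow> bool" where
  "weak_laplacian M u f \<longleftrightarrow>
     (\<forall>\<phi>. test_fun M \<phi> \<longrightarrow>
        (\<integral>x. u x * of_real (laplace_beltrami M \<phi> x) \<partial>vol M) =
        (\<integral>x. f x * of_real (\<phi> x) \<partial>vol M))"

text \<open>The operator \<open>-\<Delta> + V + W\<close>; its domain is determined by \<^term>\<open>V\<close> alone. It is meant for
  bounded \<^term>\<open>W\<close>, so that \<open>W u\<close> is in \<open>L\<^sup>2\<close> as well.\<close>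

definition schroedinger ::
  "('a::{t2_space, second_countable_topology}, 'd::finite) riemannian
     \<Rightarrow> ('a \<Rightarrow> real) \<Rightarrow> ('a \<Rightarrow> real) \<Rightarrow> 'a operator" where
  "schroedinger M V W = {(u, h). u \<in> L2 (vol M) \<and> h \<in> L2 (vol M) \<and>
     (\<lambda>x. of_real (V x) * u x) \<in> L2 (vol M) \<and>
     (\<exists>f\<in>L2 (vol M). weak_laplacian M u f \<and>
        (AE x in vol M. h x = - f x + of_real (V x) * u x + of_real (W x) * u x))}"

end

theory Submission
  imports Defs "HOL-Real_Asymp.Real_Asymp" "HOL-Computational_Algebra.Polynomial"
    "HOL-Probability.Discrete_Topology"
begin

text \<open>The potentials are \<open>W\<^sub>n = \<lambda>\<^sub>n \<phi>\<^sub>n\<close>, where \<open>\<phi>\<^sub>n\<close> is a plateau function in a fixed chart, equal to 1 on a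
  ball of radius \<open>2 s\<^sub>n\<close> and supported in the ball of radius \<open>4 s\<^sub>n\<close>, with \<open>s\<^sub>n \<sim> 1 / n\<close> and
  \<open>\<lambda>\<^sub>n = ln (n + 2) / s\<^sub>n\<^sup>2\<close>. Since \<open>\<lambda>\<^sub>n\<^sup>p s\<^sub>n\<^sup>d\<close> tends to 0 for \<open>2 p < d\<close>, so does the \<open>L\<^sup>p\<close> norm. A bump \<open>u\<close> of
  radius \<open>2 s\<^sub>n\<close> satisfies \<open>W\<^sub>n u = \<lambda>\<^sub>n u\<close> and \<open>\<parallel>H u\<parallel> \<le> C s\<^sub>n\<^sup>-\<^sup>2 \<parallel>u\<parallel>\<close> for \<open>H = -\<Delta> + V\<close>. At the time
  \<open>t\<^sub>n = \<pi> / \<lambda>\<^sub>n\<close> the unperturbed group has not moved \<open>u\<close>, while the perturbed group has turned it into \<open>-u\<close>,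
  both up to \<open>t\<^sub>n \<parallel>H u\<parallel> \<le> C' \<parallel>u\<parallel> / ln (n + 2)\<close>. So the difference has norm almost 2, the largest
  value possible for two isometries.\<close>

section \<open>Generation of isometric groups\<close>

text \<open>Three notions of the statement are fixed only by a choice or a description: the group
  \<open>exp_group\<close>, the measure \<open>vol\<close>, and the chart inside
  \<open>laplace_beltrami\<close>. Nothing can be said of them before Stone's theorem, the existence
  and uniqueness of the Riemannian measure, and the chart independence of the Laplacian are
  established; this takes up most of the development. The depth must beat \<open>1 / s^2\<close>, so
  that the phase turns by \<pi> before the free evolution moves the bump, and must still give decay
  for every \<open>p\<close> below \<open>d / 2\<close> at once. A power of \<open>1 / s\<close>
  with exponent above 2 fails for \<open>p\<close> near \<open>d / 2\<close>; a logarithmic factor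
  serves all \<open>p\<close>. Self-adjointness of the perturbed operator comes from the boundedness
  of the real multiplier. The turning time tends to 0, so it lies in \<open>[0, T]\<close> for every
  \<open>T\<close> from some index on. The groups are only strongly continuous, so the norm of their
  difference need not be continuous in time. It is a supremum of continuous functions, hence lower
  semicontinuous, and this suffices to bound the essential supremum from below by the value at a
  single time.\<close>

text \<open>The group generated by \<open>G\<close> is the limit of \<open>(1 - (t / 2\<^sup>k) G)\<^sup>-\<^sup>m\<close> with \<open>m = 2\<^sup>k\<close>. On the domain of
  \<open>G\<^sup>2\<close> the resolvents are multiplicative up to a quadratic error in the step size; this single
  estimate gives convergence as well as the group law.\<close>

locale isometric_generator =
  fixes S :: "'b::real_normed_vector set" and G :: "('b \<times> 'b) set"
  assumes subspace_S: "subspace S"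
    and complete_S: "complete S"
    and subspace_G: "subspace G"
    and G_subset: "G \<subseteq> S \<times> S"
    and dense: "\<And>x e. x \<in> S \<Longrightarrow> e > 0 \<Longrightarrow> \<exists>(y, z)\<in>G. norm (x - y) < e"
    and dissipative: "\<And>x y h. (x, y) \<in> G \<Longrightarrow> norm x \<le> norm (x - h *\<^sub>R y)"
    and range_full: "\<And>g h. g \<in> S \<Longrightarrow> h \<noteq> 0 \<Longrightarrow> \<exists>(x, y)\<in>G. x - h *\<^sub>R y = g"
begin

section \<open>Resolvents of the generator\<close>

lemma S_add [intro]: "x \<in> S \<Longrightarrow> y \<in> S \<Longrightarrow> x + y \<in> S"
  and S_diff [intro]: "x \<in> S \<Longrightarrow> y \<in> S \<Longrightarrow> x - y \<in> S"
  and S_scale [intro]: "x \<in> S \<Longrightarrow> a *\<^sub>R x \<in> S"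
  using subspace_S by (auto simp: subspace_add subspace_diff subspace_scale)

lemma G_add: "(x, y) \<in> G \<Longrightarrow> (x', y') \<in> G \<Longrightarrow> (x + x', y + y') \<in> G"
  and G_diff: "(x, y) \<in> G \<Longrightarrow> (x', y') \<in> G \<Longrightarrow> (x - x', y - y') \<in> G"
  and G_scale: "(x, y) \<in> G \<Longrightarrow> (a *\<^sub>R x, a *\<^sub>R y) \<in> G"
  using subspace_add[OF subspace_G, of "(x, y)" "(x', y')"]
    subspace_diff[OF subspace_G, of "(x, y)" "(x', y')"]
    subspace_scale[OF subspace_G, of "(x, y)" a]
  by (auto simp: scaleR_prod_def)

lemma G_S: "(x, y) \<in> G \<Longrightarrow> x \<in> S" "(x, y) \<in> G \<Longrightarrow> y \<in> S"
  using G_subset by auto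

text \<open>For \<open>h = 0\<close> the description would only be meaningful on the domain of \<open>G\<close>.\<close>

definition resolv :: "real \<Rightarrow> 'b \<Rightarrow> 'b" where
  "resolv h g = (if h = 0 then g else (THE x. \<exists>y. (x, y) \<in> G \<and> x - h *\<^sub>R y = g))"

lemma resolv_0 [simp]: "resolv 0 g = g"
  by (simp add: resolv_def)

text \<open>Dissipativity makes \<open>1 - h G\<close> injective: the difference of two solutions
  with the same right-hand side has norm at most that of 0. Afterwards a resolvent is computed by
  exhibiting a pair of \<open>G\<close>.\<close>

lemma resolv_eq: "resolv h (x - h *\<^sub>R y) = x" if "(x, y) \<in> G"
proof (cases "h = 0")
  case False
  have "(THE x'. \<exists>y'. (x', y') \<in> G \<and> x' - h *\<^sub>R y' = x - h *\<^sub>R y) = x"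
  proof (rule the_equality)
    fix x' assume "\<exists>y'. (x', y') \<in> G \<and> x' - h *\<^sub>R y' = x - h *\<^sub>R y"
    then obtain y' where y': "(x', y') \<in> G" "x' - h *\<^sub>R y' = x - h *\<^sub>R y" by blast
    have "norm (x' - x) \<le> norm ((x' - x) - h *\<^sub>R (y' - y))"
      by (rule dissipative[OF G_diff[OF y'(1) that]])
    also have "(x' - x) - h *\<^sub>R (y' - y) = 0" using y'(2) by (simp add: algebra_simps)
    finally show "x' = x" by simp
  qed (use that in blast)
  then show ?thesis using False by (simp add: resolv_def)
qed (simp add: that)

lemma resolv_obtain:
  assumes "g \<in> S" "h \<noteq> 0"
  obtains w where "(resolv h g, w) \<in> G" "resolv h g - h *\<^sub>R w = g"
proof -
  obtain x y where "(x, y) \<in> G" "x - h *\<^sub>R y = g" using range_full[OF assms] by blast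
  then show ?thesis using resolv_eq[of x y h] that[of y] by simp
qed

text \<open>Conditions are imposed on \<open>S\<close> only, because the maps are total functions on
  the ambient space. Scalars are real; compatibility with the complex structure is recovered later
  by \<open>grp_intertwine\<close>.\<close>

definition contr :: "('b \<Rightarrow> 'b) \<Rightarrow> bool" where
  "contr P \<longleftrightarrow> (\<forall>x\<in>S. P x \<in> S \<and> norm (P x) \<le> norm x \<and> (\<forall>a. P (a *\<^sub>R x) = a *\<^sub>R P x))
     \<and> (\<forall>x\<in>S. \<forall>y\<in>S. P (x + y) = P x + P y)"

lemma contrD:
  assumes "contr P" "x \<in> S"
  shows "P x \<in> S" "norm (P x) \<le> norm x" "P (a *\<^sub>R x) = a *\<^sub>R P x"
    "y \<in> S \<Longrightarrow> P (x + y) = P x + P y" "y \<in> S \<Longrightarrow> P (x - y) = P x - P y"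
proof -
  show "P (x - y) = P x - P y" if "y \<in> S"
  proof -
    have "P (x + (-1) *\<^sub>R y) = P x + (-1) *\<^sub>R P y"
      using assms that S_scale[of y "-1"] unfolding contr_def by metis
    then show ?thesis by simp
  qed
qed (use assms in \<open>auto simp: contr_def\<close>)

lemma contr_comp: "contr P \<Longrightarrow> contr Q \<Longrightarrow> contr (P \<circ> Q)"
  unfolding contr_def by (metis comp_apply order_trans)

lemma contr_id: "contr id" and contr_ident: "contr (\<lambda>x. x)"
  unfolding contr_def by auto

lemma contr_funpow: "contr P \<Longrightarrow> contr (P ^^ n)"
  by (induction n) (auto intro: contr_comp contr_id simp: contr_ident id_def)

lemma contr_resolv: "contr (resolv h)"
proof (cases "h = 0")
  case True
  then show ?thesis by (simp add: contr_def)
next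
  case False
  show ?thesis unfolding contr_def
  proof (intro conjI ballI allI)
    fix x assume x: "x \<in> S"
    obtain w where w: "(resolv h x, w) \<in> G" "resolv h x - h *\<^sub>R w = x"
      using resolv_obtain[OF x False] .
    show "resolv h x \<in> S" using w G_S by blast
    show "norm (resolv h x) \<le> norm x" using dissipative[OF w(1), of h] w(2) by simp
    show "resolv h (a *\<^sub>R x) = a *\<^sub>R resolv h x" for a
      using resolv_eq[OF G_scale[OF w(1), of a], of h] w(2)
      by (metis scaleR_left_commute scaleR_right_diff_distrib)
    fix y assume y: "y \<in> S"
    obtain v where v: "(resolv h y, v) \<in> G" "resolv h y - h *\<^sub>R v = y"
      using resolv_obtain[OF y False] .
    have "resolv h x + resolv h y - h *\<^sub>R (w + v) = x + y"
      using w(2) v(2) by (simp add: algebra_simps)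
    then show "resolv h (x + y) = resolv h x + resolv h y"
      using resolv_eq[OF G_add[OF w(1) v(1)], of h] by simp
  qed
qed

lemmas resolv_S = contrD(1)[OF contr_resolv]
  and resolv_norm = contrD(2)[OF contr_resolv]
  and resolv_scale = contrD(3)[OF contr_resolv]
  and resolv_add = contrD(4)[OF contr_resolv]
  and resolv_diff = contrD(5)[OF contr_resolv]

text \<open>Let \<open>R\<close> be the resolvent of step \<open>h\<close> and \<open>y\<close> the
  image of \<open>x\<close>. The vector \<open>x + h R y\<close> has image
  \<open>y + h G R y = R y\<close>, so it solves the resolvent equation for \<open>x\<close>. Thus
  resolvents commute with \<open>G\<close> and expand to first order in \<open>h\<close>.\<close>

lemma resolv_G:
  assumes "(x, y) \<in> G"
  shows "resolv h x = x + h *\<^sub>R resolv h y" "(resolv h x, resolv h y) \<in> G"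
proof -
  have "resolv h x = x + h *\<^sub>R resolv h y \<and> (resolv h x, resolv h y) \<in> G"
  proof (cases "h = 0")
    case False
    obtain v where v: "(resolv h y, v) \<in> G" "resolv h y - h *\<^sub>R v = y"
      using resolv_obtain[OF G_S(2)[OF assms] False] .
    have *: "(x + h *\<^sub>R resolv h y, y + h *\<^sub>R v) \<in> G"
      by (intro G_add G_scale assms v)
    have "y + h *\<^sub>R v = resolv h y" using v(2) by (simp add: algebra_simps)
    with * have **: "(x + h *\<^sub>R resolv h y, resolv h y) \<in> G" by simp
    with resolv_eq[OF this, of h] show ?thesis by simp
  qed (use assms in simp)
  then show "resolv h x = x + h *\<^sub>R resolv h y" "(resolv h x, resolv h y) \<in> G" by auto
qed

lemma resolv_commute:
  assumes "g \<in> S"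
  shows "resolv h (resolv k g) = resolv k (resolv h g)"
proof (cases "k = 0")
  case False
  obtain w where w: "(resolv k g, w) \<in> G" "resolv k g - k *\<^sub>R w = g"
    using resolv_obtain[OF assms False] .
  have "resolv h g = resolv h (resolv k g) - k *\<^sub>R resolv h w"
    using w(2) resolv_diff[of "resolv k g" "k *\<^sub>R w" h] resolv_scale[of w h k] G_S[OF w(1)]
    by auto
  with resolv_eq[OF resolv_G(2)[OF w(1)], of k h] show ?thesis by simp
qed simp

text \<open>Write \<open>P^(n+1) - Q^(n+1) = P^n (P - Q) + Q (P^n - Q^n)\<close>. Commutation lets
  the one-step error be measured at \<open>x\<close> alone, where the second-order estimate is
  available, and contractivity keeps the \<open>n\<close> errors from growing.\<close>

lemma telescope:
  assumes P: "contr P" and Q: "contr Q" and comm: "\<And>y. y \<in> S \<Longrightarrow> P (Q y) = Q (P y)" and x: "x \<in> S"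
  shows "norm ((P ^^ n) x - (Q ^^ n) x) \<le> real n * norm (P x - Q x)"
proof (induction n)
  case (Suc n)
  have PnQ: "(P ^^ m) (Q y) = Q ((P ^^ m) y)" if "y \<in> S" for m y
    by (induction m) (auto simp: comm contrD(1)[OF contr_funpow[OF P] that])
  have [simp]: "P x \<in> S" "Q x \<in> S" "(P ^^ n) x \<in> S" "(Q ^^ n) x \<in> S"
    using x contrD(1) P Q contr_funpow by blast+
  have "(P ^^ Suc n) x - (Q ^^ Suc n) x = (P ^^ n) (P x - Q x) + Q ((P ^^ n) x - (Q ^^ n) x)"
    using PnQ[OF x, of n]
    by (simp add: contrD(5)[OF contr_funpow[OF P]] contrD(5)[OF Q] funpow_swap1)
  then have "norm ((P ^^ Suc n) x - (Q ^^ Suc n) x)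
      \<le> norm (P x - Q x) + norm ((P ^^ n) x - (Q ^^ n) x)"
    using contrD(2)[OF contr_funpow[OF P, of n], of "P x - Q x"]
      contrD(2)[OF Q, of "(P ^^ n) x - (Q ^^ n) x"]
    by (smt (verit, best) S_diff \<open>(P ^^ n) x \<in> S\<close> \<open>(Q ^^ n) x \<in> S\<close> \<open>P x \<in> S\<close> \<open>Q x \<in> S\<close> norm_triangle_ineq)
  with Suc show ?case by (simp add: algebra_simps)
qed simp

section \<open>Second-order estimates on the domain of the square of the generator\<close>

definition D2 :: "'b \<Rightarrow> 'b \<Rightarrow> 'b \<Rightarrow> bool" where
  "D2 x y z \<longleftrightarrow> (x, y) \<in> G \<and> (y, z) \<in> G"

lemma D2_S: "D2 x y z \<Longrightarrow> x \<in> S" "D2 x y z \<Longrightarrow> y \<in> S" "D2 x y z \<Longrightarrow> z \<in> S"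
  unfolding D2_def using G_S by blast+

lemma D2_resolv: "D2 x y z \<Longrightarrow> resolv h x = x + h *\<^sub>R y + h\<^sup>2 *\<^sub>R resolv h z"
  unfolding D2_def using resolv_G(1)[of x y h] resolv_G(1)[of y z h]
  by (simp add: algebra_simps power2_eq_square)

text \<open>Both sides expand to \<open>x + (h + k) y\<close> plus terms carrying the factor
  \<open>z\<close>, and the first-order parts cancel. The constant 2 is crude: the remainders of
  either side are bounded by \<open>(|h| + |k|)^2\<close>.\<close>

lemma resolv_near_mult:
  assumes "D2 x y z"
  shows "norm (resolv h (resolv k x) - resolv (h + k) x) \<le> 2 * (\<bar>h\<bar> + \<bar>k\<bar>)\<^sup>2 * norm z"
proof -
  note S = D2_S[OF assms]
  have y: "(y, z) \<in> G" using assms by (simp add: D2_def)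
  have "resolv h (resolv k x) = resolv h (x + k *\<^sub>R y + k\<^sup>2 *\<^sub>R resolv k z)"
    by (simp add: D2_resolv[OF assms])
  also have "\<dots> = resolv h x + k *\<^sub>R resolv h y + k\<^sup>2 *\<^sub>R resolv h (resolv k z)"
    by (simp add: resolv_add resolv_scale S S_add S_scale resolv_S)
  finally have "resolv h (resolv k x) - resolv (h + k) x
     = h\<^sup>2 *\<^sub>R resolv h z + (h * k) *\<^sub>R resolv h z + k\<^sup>2 *\<^sub>R resolv h (resolv k z)
        - (h + k)\<^sup>2 *\<^sub>R resolv (h + k) z"
    by (simp add: D2_resolv[OF assms] resolv_G(1)[OF y, of h] algebra_simps)
  also have "norm \<dots> \<le> h\<^sup>2 * norm (resolv h z) + \<bar>h * k\<bar> * norm (resolv h z)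
      + k\<^sup>2 * norm (resolv h (resolv k z)) + (h + k)\<^sup>2 * norm (resolv (h + k) z)"
    by (intro order_trans[OF norm_triangle_ineq4] order_trans[OF norm_triangle_ineq] add_mono) simp_all
  also have "\<dots> \<le> h\<^sup>2 * norm z + \<bar>h * k\<bar> * norm z + k\<^sup>2 * norm z + (h + k)\<^sup>2 * norm z"
    using resolv_norm[OF S(3)] resolv_norm[OF resolv_S[OF S(3)]]
    by (intro add_mono mult_left_mono) (auto intro: order_trans)
  also have "\<dots> = (h\<^sup>2 + \<bar>h * k\<bar> + k\<^sup>2 + (h + k)\<^sup>2) * norm z" by (simp add: algebra_simps)
  also have "\<dots> \<le> (2 * (\<bar>h\<bar> + \<bar>k\<bar>)\<^sup>2) * norm z"
  proof (rule mult_right_mono)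
    have "(h + k)\<^sup>2 \<le> (\<bar>h\<bar> + \<bar>k\<bar>)\<^sup>2" by (rule abs_le_square_iff[THEN iffD1]) auto
    moreover have "h\<^sup>2 + \<bar>h * k\<bar> + k\<^sup>2 \<le> (\<bar>h\<bar> + \<bar>k\<bar>)\<^sup>2"
      by (simp add: power2_sum abs_mult)
    ultimately show "h\<^sup>2 + \<bar>h * k\<bar> + k\<^sup>2 + (h + k)\<^sup>2 \<le> 2 * (\<bar>h\<bar> + \<bar>k\<bar>)\<^sup>2" by simp
  qed simp
  finally show ?thesis .
qed

text \<open>Dyadic step numbers make one step of level \<open>k\<close> comparable with exactly two
  half steps of level \<open>k + 1\<close>, so that consecutive levels differ by \<open>2^k\<close>
  copies of one quadratic error.\<close>

definition euler :: "nat \<Rightarrow> real \<Rightarrow> 'b \<Rightarrow> 'b" where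
  "euler k t = resolv (t / 2 ^ k) ^^ (2 ^ k)"

lemma contr_euler: "contr (euler k t)"
  unfolding euler_def by (intro contr_funpow contr_resolv)

lemma euler_step:
  assumes "D2 x y z"
  shows "norm (euler (Suc k) t x - euler k t x) \<le> 2 * t\<^sup>2 * norm z / 2 ^ k"
proof -
  define h where "h = t / 2 ^ k"
  have x: "x \<in> S" using D2_S[OF assms] by simp
  have "euler (Suc k) t = ((resolv (h / 2)) ^^ 2) ^^ (2 ^ k)"
    unfolding euler_def h_def by (simp add: funpow_mult mult.commute)
  then have "euler (Suc k) t = (resolv (h / 2) \<circ> resolv (h / 2)) ^^ (2 ^ k)"
    by (simp add: numeral_2_eq_2)
  moreover have "norm (((resolv (h / 2) \<circ> resolv (h / 2)) ^^ (2 ^ k)) x - ((resolv h) ^^ (2 ^ k)) x)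
      \<le> real (2 ^ k) * norm ((resolv (h / 2) \<circ> resolv (h / 2)) x - resolv h x)"
    by (intro telescope contr_comp contr_resolv x) (simp add: resolv_commute resolv_S)
  moreover have "norm ((resolv (h / 2) \<circ> resolv (h / 2)) x - resolv h x) \<le> 2 * h\<^sup>2 * norm z"
    using resolv_near_mult[OF assms, of "h / 2" "h / 2"] by simp
  ultimately have "norm (euler (Suc k) t x - euler k t x) \<le> real (2 ^ k) * (2 * h\<^sup>2 * norm z)"
    unfolding h_def by (smt (verit, best) euler_def mult_left_mono of_nat_0_le_iff)
  also have "\<dots> = 2 * t\<^sup>2 * norm z / 2 ^ k"
    by (simp add: h_def power2_eq_square)
  finally show ?thesis .
qed

text \<open>The geometric series of the errors between consecutive levels is kept as a difference of
  its tails, which makes the induction step an identity.\<close>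

lemma euler_diff:
  assumes "D2 x y z"
  shows "norm (euler (k + j) t x - euler k t x) \<le> 4 * t\<^sup>2 * norm z * (1 / 2 ^ k - 1 / 2 ^ (k + j))"
proof (induction j)
  case (Suc j)
  have "norm (euler (k + Suc j) t x - euler k t x)
     \<le> norm (euler (Suc (k + j)) t x - euler (k + j) t x) + norm (euler (k + j) t x - euler k t x)"
    by (metis add_Suc_right norm_triangle_ineq diff_add_cancel add_diff_eq)
  also have "\<dots> \<le> 2 * t\<^sup>2 * norm z / 2 ^ (k + j) + 4 * t\<^sup>2 * norm z * (1 / 2 ^ k - 1 / 2 ^ (k + j))"
    by (intro add_mono euler_step[OF assms] Suc)
  also have "\<dots> = 4 * t\<^sup>2 * norm z * (1 / 2 ^ k - 1 / 2 ^ (k + Suc j))"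
    by (simp add: field_simps)
  finally show ?case .
qed simp

text \<open>On the domain \<open>R y - y = h R z\<close> is small with \<open>h\<close>; density and
  contractivity carry this to all of \<open>S\<close>.\<close>

lemma resolv_approx:
  assumes "x \<in> S" "e > 0"
  obtains h where "h \<noteq> 0" "norm (resolv h x - x) < e"
proof -
  obtain y z where yz: "(y, z) \<in> G" "norm (x - y) < e / 3"
    using dense[OF assms(1), of "e / 3"] assms(2) by auto
  \<comment> \<open>The summand 1 keeps the denominator positive when \<open>z\<close> is zero;
    \<open>h * norm z\<close> stays below \<open>e / 3\<close>.\<close>
  define h where "h = e / 3 / (norm z + 1)"
  have z1: "norm z + 1 > 0" using norm_ge_zero[of z] by linarith
  have h: "h > 0" using assms(2) z1 by (simp add: h_def)
  have "norm (resolv h y - y) = h * norm (resolv h z)"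
    using resolv_G(1)[OF yz(1), of h] h by simp
  also have "\<dots> \<le> h * norm z" using resolv_norm[OF G_S(2)[OF yz(1)]] h by simp
  also have "\<dots> < h * (norm z + 1)" using h by simp
  also have "\<dots> = e / 3" unfolding h_def using z1 by (metis less_irrefl nonzero_eq_divide_eq)
  finally have 1: "norm (resolv h y - y) < e / 3" .
  have "norm (resolv h (x - y)) \<le> norm (x - y)"
    by (intro resolv_norm S_diff assms G_S[OF yz(1)])
  then have 2: "norm (resolv h x - resolv h y) < e / 3"
    using yz(2) by (simp add: resolv_diff assms G_S[OF yz(1)])
  have "resolv h x - x = (resolv h x - resolv h y) + (resolv h y - y) + (y - x)" by simp
  then have "norm (resolv h x - x) \<le> norm (resolv h x - resolv h y) + norm (resolv h y - y) + norm (y - x)"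
    by (metis norm_triangle_le norm_triangle_ineq order_refl add_right_mono)
  then have "norm (resolv h x - x) < e" using 1 2 yz(2) by (simp add: norm_minus_commute)
  with h show ?thesis by (intro that[of h]) auto
qed

lemma D2_resolv_G:
  assumes "(x, y) \<in> G" "h \<noteq> 0"
  shows "\<exists>z. D2 (resolv h x) (resolv h y) z"
  unfolding D2_def
  by (rule resolv_obtain[OF G_S(2)[OF assms(1)] assms(2)]) (use resolv_G(2)[OF assms(1)] in blast)

text \<open>A resolvent with nonzero step maps the domain of \<open>G\<close> into the domain of its
  square and can move a vector as little as desired, so the smaller domain is dense as well.\<close>

lemma D2_dense:
  assumes "x \<in> S" "e > 0"
  obtains x' y' z' where "D2 x' y' z'" "norm (x - x') < e"
proof -
  obtain y z where yz: "(y, z) \<in> G" "norm (x - y) < e / 2"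
    using dense[OF assms(1), of "e / 2"] assms(2) by auto
  obtain h where h: "h \<noteq> 0" "norm (resolv h y - y) < e / 2"
    using resolv_approx[OF G_S(1)[OF yz(1)], of "e / 2"] assms(2) by auto
  have "norm (x - resolv h y) < e"
    using norm_triangle_ineq[of "x - y" "y - resolv h y"] yz(2) h(2) by (simp add: norm_minus_commute)
  then show ?thesis using D2_resolv_G[OF yz(1) h(1)] that by blast
qed

text \<open>The quantitative estimate holds on the domain of the square only. The approximations are
  contractions uniformly in \<open>k\<close>, so density transfers convergence at the price of four
  errors of size \<open>e / 4\<close>.\<close>

lemma euler_Cauchy:
  assumes x: "x \<in> S"
  shows "Cauchy (\<lambda>k. euler k t x)"
proof (rule CauchyI)
  fix e :: real assume e: "e > 0"
  obtain x' y' z' where x': "D2 x' y' z'" "norm (x - x') < e / 4"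
    using D2_dense[OF x, of "e / 4"] e by auto
  have near: "norm (euler k t x - euler k t x') < e / 4" for k
    using contrD(2)[OF contr_euler, of "x - x'" k t] x' D2_S(1)[OF x'(1)] x
    by (simp add: contrD(5)[OF contr_euler] S_diff)
  obtain K :: nat where K: "4 * t\<^sup>2 * norm z' / 2 ^ K < e / 4"
  proof -
    have "(\<lambda>k. 4 * t\<^sup>2 * norm z' / 2 ^ k) \<longlonglongrightarrow> 0" by real_asymp
    then have "\<forall>\<^sub>F k in sequentially. 4 * t\<^sup>2 * norm z' / 2 ^ k < e / 4"
      using e by (intro order_tendstoD) auto
    then show ?thesis using that by (auto simp: eventually_sequentially)
  qed
  have late: "norm (euler m t x' - euler K t x') < e / 4" if "m \<ge> K" for m
  proof -
    have "norm (euler m t x' - euler K t x') \<le> 4 * t\<^sup>2 * norm z' * (1 / 2 ^ K - 1 / 2 ^ m)"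
      using euler_diff[OF x'(1), of K "m - K" t] that by simp
    also have "\<dots> \<le> 4 * t\<^sup>2 * norm z' * (1 / 2 ^ K)"
      by (intro mult_left_mono) auto
    finally show ?thesis using K by simp
  qed
  show "\<exists>M. \<forall>m\<ge>M. \<forall>n\<ge>M. norm (euler m t x - euler n t x) < e"
  proof (intro exI[of _ K] allI impI)
    fix m n assume "m \<ge> K" "n \<ge> K"
    have "euler m t x - euler n t x = (euler m t x - euler m t x') + (euler m t x' - euler K t x')
       + ((euler K t x' - euler n t x') + (euler n t x' - euler n t x))" by simp
    then have "norm (euler m t x - euler n t x) \<le>
       (norm (euler m t x - euler m t x') + norm (euler m t x' - euler K t x'))
       + (norm (euler K t x' - euler n t x') + norm (euler n t x' - euler n t x))"
      by (metis norm_triangle_mono norm_triangle_ineq)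
    then show "norm (euler m t x - euler n t x) < e"
      using near[of m] near[of n] late[OF \<open>m \<ge> K\<close>] late[OF \<open>n \<ge> K\<close>]
      by (simp add: norm_minus_commute)
  qed
qed

section \<open>The limit group and its generator\<close>

definition grp :: "real \<Rightarrow> 'b \<Rightarrow> 'b" where
  "grp t x = lim (\<lambda>k. euler k t x)"

lemma grp:
  assumes "x \<in> S"
  shows "(\<lambda>k. euler k t x) \<longlonglongrightarrow> grp t x" "grp t x \<in> S"
proof -
  obtain l where l: "l \<in> S" "(\<lambda>k. euler k t x) \<longlonglongrightarrow> l"
    using completeE[OF complete_S _ euler_Cauchy[OF assms, of t]] contrD(1)[OF contr_euler assms]
    by metis
  then show "(\<lambda>k. euler k t x) \<longlonglongrightarrow> grp t x" "grp t x \<in> S"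
    by (auto simp: grp_def limI)
qed

lemma contr_grp: "contr (grp t)"
  unfolding contr_def
proof (intro conjI ballI allI)
  fix x assume x: "x \<in> S"
  show "grp t x \<in> S" by (rule grp(2)[OF x])
  show "norm (grp t x) \<le> norm x"
    by (rule LIMSEQ_le_const2[OF tendsto_norm[OF grp(1)[OF x]]])
       (use contrD(2)[OF contr_euler x] in blast)
  show "grp t (a *\<^sub>R x) = a *\<^sub>R grp t x" for a
    using LIMSEQ_unique[OF grp(1)[of "a *\<^sub>R x" t]] tendsto_scaleR[OF tendsto_const grp(1)[OF x], of a t]
    by (simp add: contrD(3)[OF contr_euler x] S_scale x)
  fix y assume y: "y \<in> S"
  show "grp t (x + y) = grp t x + grp t y"
    using LIMSEQ_unique[OF grp(1)[of "x + y" t]] tendsto_add[OF grp(1)[OF x] grp(1)[OF y]]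
    by (simp add: contrD(4)[OF contr_euler x y] S_add x y)
qed

lemma contr_eqI:
  assumes "contr P" "contr Q" and eq: "\<And>x y z. D2 x y z \<Longrightarrow> P x = Q x" and x: "x \<in> S"
  shows "P x = Q x"
proof -
  have "norm (P x - Q x) \<le> e" if "e > 0" for e
  proof -
    from that have e2: "e / 2 > 0" by simp
    obtain x' y' z' where x': "D2 x' y' z'" "norm (x - x') < e / 2"
      using D2_dense[OF x e2] .
    have S': "x' \<in> S" using D2_S(1)[OF x'(1)] .
    have "P x - Q x = P (x - x') - Q (x - x')"
      using eq[OF x'(1)] by (simp add: contrD(5) assms S')
    also have "norm \<dots> \<le> norm (x - x') + norm (x - x')"
      by (intro order_trans[OF norm_triangle_ineq4] add_mono contrD(2) assms S_diff S')
    finally show ?thesis using x'(2) by simp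
  qed
  then show ?thesis using field_le_epsilon[of "norm (P x - Q x)" 0] by simp
qed

lemma grp_add:
  assumes "x \<in> S"
  shows "grp (t + s) x = grp t (grp s x)"
proof -
  have "grp (t + s) x = (grp t \<circ> grp s) x"
  proof (rule contr_eqI[OF contr_grp contr_comp[OF contr_grp contr_grp] _ assms])
    fix x y z assume D: "D2 x y z"
    have x: "x \<in> S" using D2_S(1)[OF D] .
    \<comment> \<open>For commuting maps the power of the composite splits, which turns a product of
      single steps into a product of Euler approximations.\<close>
    have split: "((P \<circ> Q) ^^ n) v = (P ^^ n) ((Q ^^ n) v)"
      if "contr P" "contr Q" "\<And>v. v \<in> S \<Longrightarrow> P (Q v) = Q (P v)" "v \<in> S" for P Q n v
    proof (induction n)
      case (Suc n)
      have Qn: "P ((Q ^^ m) w) = (Q ^^ m) (P w)" if "w \<in> S" for w m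
        by (induction m) (auto simp: \<open>\<And>v. v \<in> S \<Longrightarrow> P (Q v) = Q (P v)\<close> contrD(1)[OF contr_funpow[OF \<open>contr Q\<close>] that])
      have Pn: "Q ((P ^^ m) w) = (P ^^ m) (Q w)" if "w \<in> S" for w m
        by (induction m) (auto simp: \<open>\<And>v. v \<in> S \<Longrightarrow> P (Q v) = Q (P v)\<close>[symmetric] contrD(1)[OF contr_funpow[OF \<open>contr P\<close>] that])
      show ?case using Suc Pn contrD(1)[OF contr_funpow[OF \<open>contr Q\<close>] \<open>v \<in> S\<close>] by simp
    qed simp
    have "(\<lambda>k. norm (euler k t (euler k s x) - euler k (t + s) x)) \<longlonglongrightarrow> 0"
    proof (rule tendsto_sandwich[OF _ _ tendsto_const])
      show "(\<lambda>k. 2 * (\<bar>t\<bar> + \<bar>s\<bar>)\<^sup>2 * norm z / 2 ^ k) \<longlonglongrightarrow> 0" by real_asymp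
      show "\<forall>\<^sub>F k in sequentially. norm (euler k t (euler k s x) - euler k (t + s) x)
          \<le> 2 * (\<bar>t\<bar> + \<bar>s\<bar>)\<^sup>2 * norm z / 2 ^ k"
      proof (intro always_eventually allI)
        fix k
        let ?P = "resolv (t / 2 ^ k)" and ?Q = "resolv (s / 2 ^ k)"
        have "norm (((?P \<circ> ?Q) ^^ (2 ^ k)) x - (resolv ((t + s) / 2 ^ k) ^^ (2 ^ k)) x)
           \<le> real (2 ^ k) * norm ((?P \<circ> ?Q) x - resolv ((t + s) / 2 ^ k) x)"
          by (rule telescope) (auto intro!: contr_comp contr_resolv x simp: resolv_commute resolv_S)
        also have "\<dots> \<le> real (2 ^ k) * (2 * (\<bar>t / 2 ^ k\<bar> + \<bar>s / 2 ^ k\<bar>)\<^sup>2 * norm z)"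
          using resolv_near_mult[OF D, of "t / 2 ^ k" "s / 2 ^ k"]
          by (intro mult_left_mono) (simp_all add: add_divide_distrib)
        also have "\<dots> = 2 * (\<bar>t\<bar> + \<bar>s\<bar>)\<^sup>2 * norm z / 2 ^ k"
          by (simp add: power2_eq_square field_simps)
        finally show "norm (euler k t (euler k s x) - euler k (t + s) x)
          \<le> 2 * (\<bar>t\<bar> + \<bar>s\<bar>)\<^sup>2 * norm z / 2 ^ k"
          unfolding euler_def by (simp add: split contr_resolv resolv_commute x)
      qed
    qed simp
    then have 1: "(\<lambda>k. euler k t (euler k s x) - euler k (t + s) x) \<longlonglongrightarrow> 0"
      by (rule tendsto_norm_zero_cancel)
    \<comment> \<open>The inner argument may be replaced by its limit because
      \<open>euler k t\<close> is a contraction for every \<open>k\<close>.\<close>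
    have 2: "(\<lambda>k. euler k t (euler k s x) - euler k t (grp s x)) \<longlonglongrightarrow> 0"
    proof (rule tendsto_norm_zero_cancel, rule tendsto_sandwich[OF _ _ tendsto_const])
      show "(\<lambda>k. norm (euler k s x - grp s x)) \<longlonglongrightarrow> 0"
        using grp(1)[OF x, of s] by (simp add: LIM_zero tendsto_norm_zero)
      show "\<forall>\<^sub>F k in sequentially. norm (euler k t (euler k s x) - euler k t (grp s x)) \<le> norm (euler k s x - grp s x)"
        using contrD(5)[OF contr_euler] contrD(1)[OF contr_euler x] grp(2)[OF x]
          contrD(2)[OF contr_euler S_diff]
        by (intro always_eventually allI) metis
    qed simp
    have "(\<lambda>k. (euler k t (euler k s x) - euler k t (grp s x))
         - (euler k t (euler k s x) - euler k (t + s) x) + euler k t (grp s x)) \<longlonglongrightarrow> 0 - 0 + grp t (grp s x)"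
      by (intro tendsto_add tendsto_diff 1 2 grp x)
    then have "(\<lambda>k. euler k (t + s) x) \<longlonglongrightarrow> grp t (grp s x)" by simp
    then show "grp (t + s) x = (grp t \<circ> grp s) x"
      using LIMSEQ_unique[OF grp(1)[OF x]] by simp
  qed
  then show ?thesis by simp
qed

lemma grp_0 [simp]: "x \<in> S \<Longrightarrow> grp 0 x = x"
proof -
  assume x: "x \<in> S"
  have "(resolv 0 ^^ n) x = x" for n by (induction n) auto
  then show ?thesis using LIMSEQ_unique[OF grp(1)[OF x, of 0]] by (simp add: euler_def)
qed

lemma grp_inverse: "x \<in> S \<Longrightarrow> grp t (grp (- t) x) = x"
  using grp_add[of x t "- t"] by simp

text \<open>Both the map at \<open>t\<close> and its inverse at \<open>- t\<close> are
  contractions.\<close>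

lemma grp_norm: "x \<in> S \<Longrightarrow> norm (grp t x) = norm x"
  using contrD(2)[OF contr_grp, of x t] contrD(2)[OF contr_grp, of "grp t x" "- t"]
    grp_inverse[of x "- t"] grp(2)[of x t] by simp

lemma grp_lipschitz:
  assumes "(x, y) \<in> G"
  shows "norm (grp t x - x) \<le> \<bar>t\<bar> * norm y"
proof (rule LIMSEQ_le_const2)
  show "(\<lambda>k. norm (euler k t x - x)) \<longlonglongrightarrow> norm (grp t x - x)"
    by (intro tendsto_intros grp G_S(1)[OF assms])
  show "\<exists>N. \<forall>k\<ge>N. norm (euler k t x - x) \<le> \<bar>t\<bar> * norm y"
  proof (intro exI allI impI)
    fix k
    have "norm (euler k t x - x) \<le> real (2 ^ k) * norm (resolv (t / 2 ^ k) x - x)"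
      unfolding euler_def using telescope[OF contr_resolv contr_id _ G_S(1)[OF assms], of "t / 2 ^ k" "2 ^ k"]
      by simp
    also have "\<dots> = \<bar>t\<bar> * norm (resolv (t / 2 ^ k) y)"
      by (simp add: resolv_G(1)[OF assms, of "t / 2 ^ k"])
    also have "\<dots> \<le> \<bar>t\<bar> * norm y" using resolv_norm[OF G_S(2)[OF assms]] by (simp add: mult_left_mono)
    finally show "norm (euler k t x - x) \<le> \<bar>t\<bar> * norm y" .
  qed
qed

text \<open>\<open>euler 0\<close> is a single resolvent. Passing from level 0 to the limit costs
  \<open>4 t^2\<close> times the norm of \<open>z\<close>, and the expansion of the resolvent costs
  once more \<open>t^2\<close> times that norm.\<close>

lemma grp_quadratic:
  assumes D: "D2 x y z"
  shows "norm (grp t x - x - t *\<^sub>R y) \<le> 5 * t\<^sup>2 * norm z"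
proof (rule LIMSEQ_le_const2)
  show "(\<lambda>k. norm (euler k t x - x - t *\<^sub>R y)) \<longlonglongrightarrow> norm (grp t x - x - t *\<^sub>R y)"
    by (intro tendsto_intros grp D2_S(1)[OF D])
  show "\<exists>N. \<forall>k\<ge>N. norm (euler k t x - x - t *\<^sub>R y) \<le> 5 * t\<^sup>2 * norm z"
  proof (intro exI allI impI)
    fix k
    have "norm (euler (0 + k) t x - euler 0 t x) \<le> 4 * t\<^sup>2 * norm z * (1 / 2 ^ 0 - 1 / 2 ^ (0 + k))"
      by (rule euler_diff[OF D])
    also have "\<dots> \<le> 4 * t\<^sup>2 * norm z" by (intro mult_left_le) auto
    finally have "norm (euler k t x - resolv t x) \<le> 4 * t\<^sup>2 * norm z" by (simp add: euler_def)
    moreover have "norm (resolv t x - x - t *\<^sub>R y) \<le> t\<^sup>2 * norm z"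
      using resolv_norm[OF D2_S(3)[OF D]] by (simp add: D2_resolv[OF D] mult_left_mono)
    moreover have eq: "euler k t x - x - t *\<^sub>R y = (euler k t x - resolv t x) + (resolv t x - x - t *\<^sub>R y)"
      by simp
    have "norm (euler k t x - x - t *\<^sub>R y)
        \<le> norm (euler k t x - resolv t x) + norm (resolv t x - x - t *\<^sub>R y)"
      unfolding eq by (rule norm_triangle_ineq)
    ultimately show "norm (euler k t x - x - t *\<^sub>R y) \<le> 5 * t\<^sup>2 * norm z" by linarith
  qed
qed

text \<open>For \<open>x\<close> in the domain of \<open>G\<close> only, split off
  \<open>R x\<close>, which lies in the domain of the square. The remainder \<open>x - R x\<close>
  has image \<open>y - R y\<close> of arbitrarily small norm, and the Lipschitz bound gives it a
  difference quotient of at most that size.\<close>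

lemma grp_derivative:
  assumes xy: "(x, y) \<in> G"
  shows "((\<lambda>t. (grp t x - x) /\<^sub>R t) \<longlongrightarrow> y) (at 0)"
proof (rule tendstoI)
  fix e :: real assume e: "e > 0"
  obtain h where h: "h \<noteq> 0" "norm (resolv h y - y) < e / 4"
    using resolv_approx[OF G_S(2)[OF xy], of "e / 4"] e by auto
  obtain z where D: "D2 (resolv h x) (resolv h y) z"
    using D2_resolv_G[OF xy h(1)] by blast
  have d: "e / (4 * (5 * norm z + 1)) > 0"
  proof -
    have "5 * norm z + 1 > 0" using norm_ge_zero[of z] by linarith
    then show ?thesis using e by simp
  qed
  have bound: "dist ((grp t x - x) /\<^sub>R t) y < e" if t: "t \<noteq> 0" "\<bar>t\<bar> < e / (4 * (5 * norm z + 1))" for t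
  proof -
    have "norm (grp t (x - resolv h x) - (x - resolv h x)) \<le> \<bar>t\<bar> * norm (y - resolv h y)"
      by (rule grp_lipschitz[OF G_diff[OF xy resolv_G(2)[OF xy]]])
    moreover have "norm (grp t (resolv h x) - resolv h x - t *\<^sub>R resolv h y) \<le> 5 * t\<^sup>2 * norm z"
      by (rule grp_quadratic[OF D])
    moreover have "grp t x - x - t *\<^sub>R y = (grp t (x - resolv h x) - (x - resolv h x))
        + (grp t (resolv h x) - resolv h x - t *\<^sub>R resolv h y) + t *\<^sub>R (resolv h y - y)"
      using G_S(1)[OF xy] by (simp add: contrD(5)[OF contr_grp] resolv_S algebra_simps)
    then have "norm (grp t x - x - t *\<^sub>R y) \<le> norm (grp t (x - resolv h x) - (x - resolv h x))
        + norm (grp t (resolv h x) - resolv h x - t *\<^sub>R resolv h y) + norm (t *\<^sub>R (resolv h y - y))"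
      by (metis norm_triangle_le norm_triangle_ineq order_refl add_right_mono)
    ultimately have "norm (grp t x - x - t *\<^sub>R y)
        \<le> \<bar>t\<bar> * norm (y - resolv h y) + 5 * t\<^sup>2 * norm z + \<bar>t\<bar> * norm (resolv h y - y)"
      by simp
    also have "\<dots> = \<bar>t\<bar> * (2 * norm (resolv h y - y) + \<bar>t\<bar> * (5 * norm z))"
      by (simp add: norm_minus_commute algebra_simps power2_eq_square abs_mult_self_eq)
    also have "\<dots> < \<bar>t\<bar> * e"
    proof (rule mult_strict_left_mono)
      have "\<bar>t\<bar> * (5 * norm z) \<le> \<bar>t\<bar> * (5 * norm z + 1)" by (intro mult_left_mono) auto
      also have "\<dots> \<le> e / (4 * (5 * norm z + 1)) * (5 * norm z + 1)"
        using t(2) by (intro mult_right_mono) auto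
      also have "\<dots> = e / 4" using norm_ge_zero[of z] by (simp add: field_simps add_nonneg_eq_0_iff)
      finally show "2 * norm (resolv h y - y) + \<bar>t\<bar> * (5 * norm z) < e" using h(2) e by linarith
    qed (use t in simp)
    finally have "norm (grp t x - x - t *\<^sub>R y) < \<bar>t\<bar> * e" .
    moreover have "(grp t x - x) /\<^sub>R t - y = (grp t x - x - t *\<^sub>R y) /\<^sub>R t"
      using t by (simp add: scaleR_diff_right)
    ultimately show ?thesis using t by (simp add: dist_norm) (simp add: divide_simps mult.commute)
  qed
  show "\<forall>\<^sub>F t in at 0. dist ((grp t x - x) /\<^sub>R t) y < e"
    unfolding eventually_at using bound d by (auto simp: dist_real_def)
qed

text \<open>The generator of the limit cannot be larger than \<open>G\<close>: solving
  \<open>v - G v = x - y\<close> leaves a vector \<open>u = x - v\<close> whose orbit has derivative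
  \<open>u\<close> at 0. An orbit of constant norm cannot start to grow like that unless
  \<open>u = 0\<close>.\<close>

lemma grp_derivative_iff:
  assumes x: "x \<in> S" and y: "y \<in> S"
  shows "((\<lambda>t. (grp t x - x) /\<^sub>R t) \<longlongrightarrow> y) (at 0) \<longleftrightarrow> (x, y) \<in> G"
proof
  assume lim: "((\<lambda>t. (grp t x - x) /\<^sub>R t) \<longlongrightarrow> y) (at 0)"
  obtain v w where vw: "(v, w) \<in> G" "v - 1 *\<^sub>R w = x - y"
    using range_full[of "x - y" 1] x y by auto
  let ?u = "x - v"
  have u: "?u \<in> S" using x G_S(1)[OF vw(1)] by blast
  have "((\<lambda>t. (grp t x - x) /\<^sub>R t - (grp t v - v) /\<^sub>R t) \<longlongrightarrow> y - w) (at 0)"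
    by (intro tendsto_diff lim grp_derivative[OF vw(1)])
  moreover have "(grp t x - x) /\<^sub>R t - (grp t v - v) /\<^sub>R t = (grp t ?u - ?u) /\<^sub>R t" for t
    by (simp add: contrD(5)[OF contr_grp] x G_S(1)[OF vw(1)] algebra_simps)
  moreover have "y - w = ?u" using vw(2) by (simp add: algebra_simps)
  ultimately have lim_u: "((\<lambda>t. (grp t ?u - ?u) /\<^sub>R t) \<longlongrightarrow> ?u) (at 0)" by simp
  have "norm ?u \<le> 0"
  proof (rule ccontr)
    assume "\<not> norm ?u \<le> 0"
    then have "norm ?u > 0" by simp
    then have "\<forall>\<^sub>F t in at 0. norm ((grp t ?u - ?u) /\<^sub>R t - ?u) < norm ?u"
      using tendstoD[OF lim_u] by (simp add: dist_norm)
    then obtain d where d: "d > 0" "\<And>t. t \<noteq> 0 \<Longrightarrow> \<bar>t\<bar> < d \<Longrightarrow> norm ((grp t ?u - ?u) /\<^sub>R t - ?u) < norm ?u"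
      unfolding eventually_at by (auto simp: dist_real_def)
    define t where "t = d / 2"
    have t: "t > 0" "\<bar>t\<bar> < d" using d(1) by (auto simp: t_def)
    \<comment> \<open>For small positive \<open>t\<close> the orbit is so close to
      \<open>(1 + t) u\<close> that its norm would have to exceed the norm of
      \<open>u\<close>.\<close>
    have "(1 + t) *\<^sub>R ?u = grp t ?u - t *\<^sub>R ((grp t ?u - ?u) /\<^sub>R t - ?u)"
      using t by (simp add: algebra_simps)
    then have "norm ((1 + t) *\<^sub>R ?u) \<le> norm (grp t ?u) + t * norm ((grp t ?u - ?u) /\<^sub>R t - ?u)"
      using t by (metis norm_triangle_ineq4 norm_scaleR abs_of_pos)
    also have "\<dots> < norm ?u + t * norm ?u"
      using d(2)[of t] t u by (simp add: grp_norm)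
    finally have "(1 + t) * norm ?u < norm ?u + t * norm ?u" using t by simp
    then show False by (simp add: algebra_simps)
  qed
  then have "x = v" by simp
  moreover from this have "y = w" using vw(2) by simp
  ultimately show "(x, y) \<in> G" using vw(1) by simp
qed (rule grp_derivative)

lemma grp_continuous:
  assumes x: "x \<in> S"
  shows "((\<lambda>t. grp t x) \<longlongrightarrow> grp s x) (at s)"
proof (rule tendstoI)
  fix e :: real assume e: "e > 0"
  obtain y z where yz: "(y, z) \<in> G" "norm (x - y) < e / 3"
    using dense[OF x, of "e / 3"] e by auto
  have z1: "norm z + 1 > 0" using norm_ge_zero[of z] by linarith
  show "\<forall>\<^sub>F t in at s. dist (grp t x) (grp s x) < e"
    unfolding eventually_at
  proof (intro exI conjI ballI impI)
    show "e / 3 / (norm z + 1) > 0" using e z1 by simp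
    fix t assume "t \<noteq> s \<and> dist t s < e / 3 / (norm z + 1)"
    then have t: "\<bar>t - s\<bar> < e / 3 / (norm z + 1)" by (simp add: dist_real_def)
    have y: "y \<in> S" using G_S(1)[OF yz(1)] .
    have "norm (grp (t - s) y - y) \<le> \<bar>t - s\<bar> * norm z" by (rule grp_lipschitz[OF yz(1)])
    also have "\<dots> \<le> \<bar>t - s\<bar> * (norm z + 1)" by (simp add: mult_left_mono)
    also have "\<dots> < e / 3 / (norm z + 1) * (norm z + 1)"
      by (rule mult_strict_right_mono[OF t z1])
    also have "\<dots> = e / 3" using z1 by (metis less_irrefl nonzero_eq_divide_eq)
    finally have 1: "norm (grp (t - s) y - y) < e / 3" .
    have "grp t x - grp s x = grp s (grp (t - s) x - x)"
      using grp_add[OF x, of s "t - s"] by (simp add: contrD(5)[OF contr_grp] grp x)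
    then have "norm (grp t x - grp s x) = norm (grp (t - s) x - x)"
      using grp_norm[of "grp (t - s) x - x" s] grp(2)[OF x] x by auto
    also have "grp (t - s) x - x = grp (t - s) (x - y) + (grp (t - s) y - y) + (y - x)"
      by (simp add: contrD(5)[OF contr_grp] x y)
    also have "norm \<dots> \<le> norm (x - y) + norm (grp (t - s) y - y) + norm (y - x)"
      using grp_norm[OF S_diff[OF x y], of "t - s"]
      by (metis norm_triangle_le norm_triangle_ineq order_refl add_right_mono)
    also have "\<dots> < e" using 1 yz(2) by (simp add: norm_minus_commute)
    finally show "dist (grp t x) (grp s x) < e" by (simp add: dist_norm)
  qed
qed

text \<open>An isometry commuting with \<open>G\<close> commutes with the resolvents, hence with the
  Euler approximations and their limit. It is applied to multiplication by the imaginary unit, which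
  the real structure of the locale does not see.\<close>

lemma grp_intertwine:
  assumes I_S: "\<And>x. x \<in> S \<Longrightarrow> I x \<in> S" and I_norm: "\<And>x y. x \<in> S \<Longrightarrow> y \<in> S \<Longrightarrow> norm (I x - I y) = norm (x - y)"
    and I_lin: "\<And>x y h. x \<in> S \<Longrightarrow> y \<in> S \<Longrightarrow> I (x - h *\<^sub>R y) = I x - h *\<^sub>R I y"
    and I_G: "\<And>x y. (x, y) \<in> G \<Longrightarrow> (I x, I y) \<in> G"
    and x: "x \<in> S"
  shows "grp t (I x) = I (grp t x)"
proof -
  have res: "resolv h (I x) = I (resolv h x)" if x: "x \<in> S" for h x
  proof (cases "h = 0")
    case False
    obtain w where w: "(resolv h x, w) \<in> G" "resolv h x - h *\<^sub>R w = x"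
      using resolv_obtain[OF x False] .
    then show ?thesis using resolv_eq[OF I_G[OF w(1)], of h] I_lin[OF G_S(1)[OF w(1)] G_S(2)[OF w(1)], of h] by simp
  qed simp
  have "(resolv h ^^ n) (I x) = I ((resolv h ^^ n) x)" for h n
    by (induction n) (auto simp: res contrD(1)[OF contr_funpow[OF contr_resolv] x])
  then have eq: "euler k t (I x) = I (euler k t x)" for k
    by (simp add: euler_def)
  have "(\<lambda>k. norm (euler k t x - grp t x)) \<longlonglongrightarrow> 0"
    using grp(1)[OF x, of t] by (simp add: LIM_zero tendsto_norm_zero)
  then have "(\<lambda>k. norm (euler k t (I x) - I (grp t x))) \<longlonglongrightarrow> 0"
    by (simp add: eq I_norm contrD(1)[OF contr_euler x] grp(2)[OF x])
  then have "(\<lambda>k. euler k t (I x)) \<longlonglongrightarrow> I (grp t x)"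
    by (simp add: LIM_zero_iff tendsto_norm_zero_iff)
  then show ?thesis using LIMSEQ_unique[OF grp(1)[OF I_S[OF x], of t]] by simp
qed

end

section \<open>Hilbert space identities and completeness for representatives\<close>

section \<open>The space \<open>L\<^sup>2\<close>\<close>

lemma L2_measurable [measurable_dest]: "u \<in> L2 \<mu> \<Longrightarrow> u \<in> borel_measurable \<mu>"
  and L2_integrable: "u \<in> L2 \<mu> \<Longrightarrow> integrable \<mu> (\<lambda>x. (cmod (u x))\<^sup>2)"
  by (simp_all add: L2_def)

lemma borel_measurable_cnj [measurable (raw)]:
  "f \<in> borel_measurable M \<Longrightarrow> (\<lambda>x. cnj (f x)) \<in> borel_measurable M"
  by (rule borel_measurable_continuous_on[where f = cnj]) (auto intro: continuous_intros)

lemma L2_inner_integrable: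
  assumes u: "u \<in> L2 \<mu>" and v: "v \<in> L2 \<mu>"
  shows "integrable \<mu> (\<lambda>x. u x * cnj (v x))"
proof (rule Bochner_Integration.integrable_bound)
  show "integrable \<mu> (\<lambda>x. (cmod (u x))\<^sup>2 + (cmod (v x))\<^sup>2)"
    by (intro Bochner_Integration.integrable_add L2_integrable u v)
  have [measurable]: "u \<in> borel_measurable \<mu>" "v \<in> borel_measurable \<mu>"
    using u v by (auto dest: L2_measurable)
  show "(\<lambda>x. u x * cnj (v x)) \<in> borel_measurable \<mu>" by measurable
  show "AE x in \<mu>. norm (u x * cnj (v x)) \<le> norm ((cmod (u x))\<^sup>2 + (cmod (v x))\<^sup>2)"
  proof (rule AE_I2)
    fix x
    have "2 * (cmod (u x) * cmod (v x)) \<le> (cmod (u x))\<^sup>2 + (cmod (v x))\<^sup>2"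
      using sum_squares_bound[of "cmod (u x)" "cmod (v x)"] by simp
    moreover have "0 \<le> cmod (u x) * cmod (v x)" by simp
    ultimately have "cmod (u x) * cmod (v x) \<le> (cmod (u x))\<^sup>2 + (cmod (v x))\<^sup>2" by linarith
    then show "norm (u x * cnj (v x)) \<le> norm ((cmod (u x))\<^sup>2 + (cmod (v x))\<^sup>2)"
      by (simp add: norm_mult)
  qed
qed

lemma L2_norm_nonneg [simp]: "0 \<le> L2_norm \<mu> u"
  by (simp add: L2_norm_def)

lemma L2_norm_square: "(L2_norm \<mu> u)\<^sup>2 = (\<integral>x. (cmod (u x))\<^sup>2 \<partial>\<mu>)"
  by (simp add: L2_norm_def)

lemma L2_scale:
  assumes "u \<in> L2 \<mu>"
  shows "(\<lambda>x. c * u x) \<in> L2 \<mu>"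
proof -
  have [measurable]: "u \<in> borel_measurable \<mu>" using assms by (auto dest: L2_measurable)
  have "integrable \<mu> (\<lambda>x. (cmod c)\<^sup>2 * (cmod (u x))\<^sup>2)"
    using L2_integrable[OF assms] by simp
  then show ?thesis by (simp add: L2_def norm_mult power_mult_distrib)
qed

lemma L2_add:
  assumes u: "u \<in> L2 \<mu>" and v: "v \<in> L2 \<mu>"
  shows "(\<lambda>x. u x + v x) \<in> L2 \<mu>"
proof -
  have [measurable]: "u \<in> borel_measurable \<mu>" "v \<in> borel_measurable \<mu>"
    using assms by (auto dest: L2_measurable)
  have "integrable \<mu> (\<lambda>x. (cmod (u x + v x))\<^sup>2)"
  proof (rule Bochner_Integration.integrable_bound)
    show "integrable \<mu> (\<lambda>x. 2 * (cmod (u x))\<^sup>2 + 2 * (cmod (v x))\<^sup>2)"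
      by (intro Bochner_Integration.integrable_add integrable_mult_right L2_integrable u v)
    show "AE x in \<mu>. norm ((cmod (u x + v x))\<^sup>2) \<le> norm (2 * (cmod (u x))\<^sup>2 + 2 * (cmod (v x))\<^sup>2)"
    proof (rule AE_I2)
      fix x
      have "(cmod (u x + v x))\<^sup>2 \<le> (cmod (u x) + cmod (v x))\<^sup>2"
        by (intro power_mono norm_triangle_ineq) simp
      also have "\<dots> \<le> 2 * (cmod (u x))\<^sup>2 + 2 * (cmod (v x))\<^sup>2"
        using sum_squares_bound[of "cmod (u x)" "cmod (v x)"] by (simp add: power2_sum)
      finally show "norm ((cmod (u x + v x))\<^sup>2) \<le> norm (2 * (cmod (u x))\<^sup>2 + 2 * (cmod (v x))\<^sup>2)"
        by simp
    qed
  qed measurable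
  then show ?thesis by (simp add: L2_def)
qed

lemma L2_zero: "(\<lambda>x. 0) \<in> L2 \<mu>"
  by (simp add: L2_def)

lemma L2_lin: "u \<in> L2 \<mu> \<Longrightarrow> v \<in> L2 \<mu> \<Longrightarrow> (\<lambda>x. a * u x + b * v x) \<in> L2 \<mu>"
  by (intro L2_add L2_scale)

lemma L2_diff: "u \<in> L2 \<mu> \<Longrightarrow> v \<in> L2 \<mu> \<Longrightarrow> (\<lambda>x. u x - v x) \<in> L2 \<mu>"
  using L2_lin[of u \<mu> v 1 "-1"] by simp

lemma L2_norm_cong_AE:
  assumes "u \<in> borel_measurable \<mu>" "v \<in> borel_measurable \<mu>" "AE x in \<mu>. u x = v x"
  shows "L2_norm \<mu> u = L2_norm \<mu> v"
  unfolding L2_norm_def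
  by (intro arg_cong[where f = sqrt] integral_cong_AE) (use assms in auto)

lemma L2_inner_cong_AE:
  assumes [measurable]: "u \<in> borel_measurable \<mu>" "v \<in> borel_measurable \<mu>"
    "u' \<in> borel_measurable \<mu>" "v' \<in> borel_measurable \<mu>"
    and "AE x in \<mu>. u x = u' x" "AE x in \<mu>. v x = v' x"
  shows "L2_inner \<mu> u v = L2_inner \<mu> u' v'"
  unfolding L2_inner_def by (intro integral_cong_AE) (use assms in auto)

lemma L2_norm_eq_0_iff:
  assumes "u \<in> L2 \<mu>"
  shows "L2_norm \<mu> u = 0 \<longleftrightarrow> (AE x in \<mu>. u x = 0)"
  unfolding L2_norm_def
  by (simp add: integral_nonneg_eq_0_iff_AE[OF L2_integrable[OF assms]])

lemma L2_inner_lin: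
  assumes "u \<in> L2 \<mu>" "v \<in> L2 \<mu>" "w \<in> L2 \<mu>"
  shows "L2_inner \<mu> (\<lambda>x. a * u x + b * v x) w = a * L2_inner \<mu> u w + b * L2_inner \<mu> v w"
proof -
  have "L2_inner \<mu> (\<lambda>x. a * u x + b * v x) w
      = (\<integral>x. a * (u x * cnj (w x)) + b * (v x * cnj (w x)) \<partial>\<mu>)"
    unfolding L2_inner_def by (simp add: algebra_simps)
  also have "\<dots> = a * L2_inner \<mu> u w + b * L2_inner \<mu> v w"
    unfolding L2_inner_def
    by (subst Bochner_Integration.integral_add)
       (auto intro!: L2_inner_integrable assms integrable_mult_right)
  finally show ?thesis .
qed

lemma L2_inner_commute: "L2_inner \<mu> u v = cnj (L2_inner \<mu> v u)"
  unfolding L2_inner_def by (simp flip: Bochner_Integration.integral_cnj add: mult.commute)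

lemma L2_inner_scale: "L2_inner \<mu> (\<lambda>x. a * u x) w = a * L2_inner \<mu> u w"
  unfolding L2_inner_def by (simp add: mult.assoc)

lemma L2_inner_scale_right: "L2_inner \<mu> u (\<lambda>x. a * w x) = cnj a * L2_inner \<mu> u w"
  by (metis L2_inner_commute L2_inner_scale complex_cnj_cnj complex_cnj_mult)

lemma L2_inner_lin_right:
  assumes "u \<in> L2 \<mu>" "v \<in> L2 \<mu>" "w \<in> L2 \<mu>"
  shows "L2_inner \<mu> w (\<lambda>x. a * u x + b * v x) = cnj a * L2_inner \<mu> w u + cnj b * L2_inner \<mu> w v"
proof -
  have "L2_inner \<mu> w (\<lambda>x. a * u x + b * v x) = cnj (L2_inner \<mu> (\<lambda>x. a * u x + b * v x) w)"
    by (rule L2_inner_commute)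
  also have "\<dots> = cnj a * cnj (L2_inner \<mu> u w) + cnj b * cnj (L2_inner \<mu> v w)"
    by (simp add: L2_inner_lin assms)
  also have "\<dots> = cnj a * L2_inner \<mu> w u + cnj b * L2_inner \<mu> w v"
    by (simp flip: L2_inner_commute)
  finally show ?thesis .
qed

lemma L2_inner_self: "L2_inner \<mu> u u = of_real ((L2_norm \<mu> u)\<^sup>2)"
  unfolding L2_norm_square L2_inner_def
  by (subst integral_complex_of_real[symmetric]) (simp add: complex_norm_square del: of_real_power)

lemma L2_norm_scale: "L2_norm \<mu> (\<lambda>x. c * u x) = cmod c * L2_norm \<mu> u"
  by (simp add: L2_norm_def norm_mult power_mult_distrib real_sqrt_mult)

text \<open>The polarised square; the triangle inequality, the parallelogram law and the norm
  identity for \<open>1 + i c H\<close> are read off from it.\<close>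

lemma L2_norm_lin_square:
  assumes u: "u \<in> L2 \<mu>" and v: "v \<in> L2 \<mu>"
  shows "(L2_norm \<mu> (\<lambda>x. u x + c * v x))\<^sup>2
     = (L2_norm \<mu> u)\<^sup>2 + 2 * Re (cnj c * L2_inner \<mu> u v) + (cmod c)\<^sup>2 * (L2_norm \<mu> v)\<^sup>2"
proof -
  have uv: "(\<lambda>x. 1 * u x + c * v x) \<in> L2 \<mu>" by (rule L2_lin[OF u v])
  have "complex_of_real ((L2_norm \<mu> (\<lambda>x. 1 * u x + c * v x))\<^sup>2)
     = L2_inner \<mu> u u + cnj c * L2_inner \<mu> u v + c * (L2_inner \<mu> v u + cnj c * L2_inner \<mu> v v)"
    unfolding L2_inner_self[symmetric]
    by (simp only: L2_inner_lin[OF u v uv] L2_inner_lin_right[OF u v u] L2_inner_lin_right[OF u v v]) simp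
  also have "L2_inner \<mu> v u = cnj (L2_inner \<mu> u v)" by (rule L2_inner_commute)
  finally have "Re (complex_of_real ((L2_norm \<mu> (\<lambda>x. 1 * u x + c * v x))\<^sup>2))
     = Re (L2_inner \<mu> u u + cnj c * L2_inner \<mu> u v + c * (cnj (L2_inner \<mu> u v) + cnj c * L2_inner \<mu> v v))"
    by simp
  moreover have c2: "(cmod c)\<^sup>2 = Re c * Re c + Im c * Im c"
    using cmod_power2[of c] by (simp only: power2_eq_square)
  ultimately show ?thesis unfolding c2 by (simp add: L2_inner_self power2_eq_square algebra_simps)
qed

lemma L2_Cauchy_Schwarz:
  assumes u: "u \<in> L2 \<mu>" and v: "v \<in> L2 \<mu>"
  shows "cmod (L2_inner \<mu> u v) \<le> L2_norm \<mu> u * L2_norm \<mu> v"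
proof (cases "L2_norm \<mu> u = 0 \<or> L2_norm \<mu> v = 0")
  case True
  then have "AE x in \<mu>. u x * cnj (v x) = 0"
  proof
    assume "L2_norm \<mu> u = 0"
    then have "AE x in \<mu>. u x = 0" using L2_norm_eq_0_iff[OF u] by simp
    then show ?thesis by eventually_elim simp
  next
    assume "L2_norm \<mu> v = 0"
    then have "AE x in \<mu>. v x = 0" using L2_norm_eq_0_iff[OF v] by simp
    then show ?thesis by eventually_elim simp
  qed
  then have "L2_inner \<mu> u v = 0" unfolding L2_inner_def by (rule integral_eq_zero_AE)
  then show ?thesis by (simp add: L2_norm_def)
next
  case False
  define a b where "a = L2_norm \<mu> u" and "b = L2_norm \<mu> v"
  have ab: "a > 0" "b > 0" using False L2_norm_nonneg[of \<mu> u] L2_norm_nonneg[of \<mu> v]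
    unfolding a_def b_def by linarith+
  have "cmod (L2_inner \<mu> u v) \<le> (\<integral>x. norm (u x * cnj (v x)) \<partial>\<mu>)"
    unfolding L2_inner_def by (rule integral_norm_bound)
  \<comment> \<open>Young's inequality with weights \<open>b / (2 a)\<close> and
    \<open>a / (2 b)\<close>: after integration each of the two terms contributes half of
    \<open>a b\<close>.\<close>
  also have "\<dots> \<le> (\<integral>x. b / (2 * a) * (cmod (u x))\<^sup>2 + a / (2 * b) * (cmod (v x))\<^sup>2 \<partial>\<mu>)"
  proof (rule integral_mono)
    show "integrable \<mu> (\<lambda>x. norm (u x * cnj (v x)))"
      by (intro integrable_norm L2_inner_integrable u v)
    show "integrable \<mu> (\<lambda>x. b / (2 * a) * (cmod (u x))\<^sup>2 + a / (2 * b) * (cmod (v x))\<^sup>2)"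
      by (intro Bochner_Integration.integrable_add integrable_mult_right L2_integrable u v)
    fix x
    have "2 * ((b * cmod (u x)) * (a * cmod (v x))) \<le> (b * cmod (u x))\<^sup>2 + (a * cmod (v x))\<^sup>2"
      using sum_squares_bound[of "b * cmod (u x)" "a * cmod (v x)"] by simp
    then show "norm (u x * cnj (v x)) \<le> b / (2 * a) * (cmod (u x))\<^sup>2 + a / (2 * b) * (cmod (v x))\<^sup>2"
      using ab by (simp add: norm_mult field_simps power2_eq_square)
  qed
  also have "\<dots> = b / (2 * a) * a\<^sup>2 + a / (2 * b) * b\<^sup>2"
    unfolding a_def b_def L2_norm_square
    by (subst Bochner_Integration.integral_add)
       (auto intro!: integrable_mult_right L2_integrable u v)
  also have "\<dots> = a * b" using ab by (simp add: power2_eq_square field_simps)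
  finally show ?thesis by (simp add: a_def b_def)
qed

lemma L2_norm_triangle:
  assumes u: "u \<in> L2 \<mu>" and v: "v \<in> L2 \<mu>"
  shows "L2_norm \<mu> (\<lambda>x. u x + v x) \<le> L2_norm \<mu> u + L2_norm \<mu> v"
proof (rule power2_le_imp_le)
  have "(L2_norm \<mu> (\<lambda>x. u x + v x))\<^sup>2 = (L2_norm \<mu> u)\<^sup>2 + 2 * Re (L2_inner \<mu> u v) + (L2_norm \<mu> v)\<^sup>2"
    using L2_norm_lin_square[OF u v, of 1] by simp
  moreover have "Re (L2_inner \<mu> u v) \<le> L2_norm \<mu> u * L2_norm \<mu> v"
    using complex_Re_le_cmod[of "L2_inner \<mu> u v"] L2_Cauchy_Schwarz[OF u v] by linarith
  ultimately show "(L2_norm \<mu> (\<lambda>x. u x + v x))\<^sup>2 \<le> (L2_norm \<mu> u + L2_norm \<mu> v)\<^sup>2"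
    by (simp add: power2_sum)
qed simp

lemma L2_norm_minus_commute: "L2_norm \<mu> (\<lambda>x. u x - v x) = L2_norm \<mu> (\<lambda>x. v x - u x)"
  by (simp add: L2_norm_def norm_minus_commute)

lemma L2_norm_diff_triangle:
  assumes "u \<in> L2 \<mu>" "v \<in> L2 \<mu>" "w \<in> L2 \<mu>"
  shows "L2_norm \<mu> (\<lambda>x. u x - w x) \<le> L2_norm \<mu> (\<lambda>x. u x - v x) + L2_norm \<mu> (\<lambda>x. v x - w x)"
  using L2_norm_triangle[of "\<lambda>x. u x - v x" \<mu> "\<lambda>x. v x - w x"] by (simp add: assms L2_diff)

lemma L2_nn_integral:
  assumes "u \<in> L2 \<mu>"
  shows "(\<integral>\<^sup>+x. ennreal ((cmod (u x))\<^sup>2) \<partial>\<mu>) = ennreal ((L2_norm \<mu> u)\<^sup>2)"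
  unfolding L2_norm_square by (rule nn_integral_eq_integral[OF L2_integrable[OF assms]]) simp

lemma L2_I_nn_integral:
  assumes u: "u \<in> borel_measurable \<mu>"
    and le: "(\<integral>\<^sup>+x. ennreal ((cmod (u x))\<^sup>2) \<partial>\<mu>) \<le> ennreal (c\<^sup>2)" and c: "c \<ge> 0"
  shows "u \<in> L2 \<mu>" "L2_norm \<mu> u \<le> c"
proof -
  have "integrable \<mu> (\<lambda>x. (cmod (u x))\<^sup>2)"
    by (rule integrableI_bounded) (use u le in \<open>auto simp: less_top[symmetric] top_unique\<close>)
  then show 1: "u \<in> L2 \<mu>" using u by (simp add: L2_def)
  show "L2_norm \<mu> u \<le> c"
    using le unfolding L2_nn_integral[OF 1] by (intro power2_le_imp_le[OF _ c]) simp
qed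

text \<open>Riesz-Fischer for representatives: a rapidly converging subsequence converges almost
  everywhere, and Fatou's lemma bounds the distance of each late member to the pointwise
  limit.\<close>

proposition L2_complete:
  assumes u: "\<And>n. u n \<in> L2 \<mu>"
    and Cauchy: "\<And>e. e > 0 \<Longrightarrow> \<exists>N. \<forall>m\<ge>N. \<forall>n\<ge>N. L2_norm \<mu> (\<lambda>x. u m x - u n x) < e"
  obtains l where "l \<in> L2 \<mu>" "(\<lambda>n. L2_norm \<mu> (\<lambda>x. u n x - l x)) \<longlonglongrightarrow> 0"
proof -
  have [measurable]: "u n \<in> borel_measurable \<mu>" for n using u by (auto dest: L2_measurable)
  have "\<forall>k. \<exists>N. \<forall>m\<ge>N. \<forall>n\<ge>N. L2_norm \<mu> (\<lambda>x. u m x - u n x) < (1/8) ^ k"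
    by (intro allI Cauchy) simp
  then obtain N where N: "\<And>k m n. m \<ge> N k \<Longrightarrow> n \<ge> N k \<Longrightarrow> L2_norm \<mu> (\<lambda>x. u m x - u n x) < (1/8) ^ k"
    by metis
  \<comment> \<open>Partial sums of the thresholds give an index sequence with
    \<open>r j \<ge> N k\<close> for all \<open>j \<ge> k\<close>, without a recursive
    choice.\<close>
  define r where "r k = (\<Sum>j\<le>k. N j)" for k
  have r: "r j \<ge> N k" if "j \<ge> k" for j k
    unfolding r_def by (rule member_le_sum[of k "{..j}" N]) (use that in auto)
  define d where "d k x = u (r (Suc k)) x - u (r k) x" for k x
  have [measurable]: "d k \<in> borel_measurable \<mu>" for k unfolding d_def by measurable
  have dL2: "d k \<in> L2 \<mu>" for k unfolding d_def by (intro L2_diff u)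
  have dn: "(L2_norm \<mu> (d k))\<^sup>2 \<le> (1/8) ^ k" for k
  proof -
    have "L2_norm \<mu> (d k) \<le> (1/8) ^ k"
      unfolding d_def using N[of k "r (Suc k)" "r k"] r by simp
    then have "(L2_norm \<mu> (d k))\<^sup>2 \<le> ((1/8) ^ k)\<^sup>2" by (intro power_mono) auto
    also have "\<dots> \<le> (1/8) ^ k" by (simp add: power2_eq_square power_le_one mult_left_le)
    finally show ?thesis .
  qed
  \<comment> \<open>The weights \<open>4^k\<close> still leave a convergent series, because the
    squared norms of the increments are below \<open>(1/8)^k\<close>; and they force the increments
    at almost every point to decay like \<open>(1/2)^k\<close>.\<close>
  have "(\<integral>\<^sup>+x. (\<Sum>k. ennreal (4 ^ k * (cmod (d k x))\<^sup>2)) \<partial>\<mu>)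
     = (\<Sum>k. \<integral>\<^sup>+x. ennreal (4 ^ k * (cmod (d k x))\<^sup>2) \<partial>\<mu>)"
    by (intro nn_integral_suminf) measurable
  also have "\<dots> = (\<Sum>k. ennreal (4 ^ k * (L2_norm \<mu> (d k))\<^sup>2))"
    by (simp add: ennreal_mult nn_integral_cmult L2_nn_integral[OF dL2])
  also have "\<dots> \<le> (\<Sum>k. ennreal ((1/2) ^ k))"
  proof (intro suminf_le ennreal_leI)
    fix k
    have "4 ^ k * (L2_norm \<mu> (d k))\<^sup>2 \<le> 4 ^ k * (1/8) ^ k" by (intro mult_left_mono dn) simp
    also have "\<dots> = (1/2) ^ k" by (simp flip: power_mult_distrib)
    finally show "4 ^ k * (L2_norm \<mu> (d k))\<^sup>2 \<le> (1/2) ^ k" .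
  qed auto
  also have "\<dots> = ennreal (\<Sum>k. (1/2) ^ k)"
    by (intro suminf_ennreal2) (auto intro!: summable_geometric)
  also have "\<dots> < \<infinity>" by simp
  finally have "AE x in \<mu>. (\<Sum>k. ennreal (4 ^ k * (cmod (d k x))\<^sup>2)) \<noteq> \<infinity>"
    by (intro nn_integral_PInf_AE) auto
  then have conv: "AE x in \<mu>. convergent (\<lambda>k. u (r k) x)"
  proof eventually_elim
    case (elim x)
    have sm: "summable (\<lambda>k. 4 ^ k * (cmod (d k x))\<^sup>2)"
      by (rule summable_suminf_not_top) (use elim in auto)
    from summable_imp_Bseq[OF sm] obtain C where C: "\<And>k. norm (4 ^ k * (cmod (d k x))\<^sup>2) \<le> C"
      by (elim BseqE) blast
    have dk: "norm (d k x) \<le> sqrt C * (1/2) ^ k" for k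
    proof (rule power2_le_imp_le)
      have "4 ^ k * (cmod (d k x))\<^sup>2 \<le> C" using C[of k] by simp
      then have "(cmod (d k x))\<^sup>2 \<le> C * (1/4) ^ k" by (simp add: field_simps power_one_over)
      moreover have "C \<ge> 0" using C[of 0] norm_ge_zero order_trans by blast
      moreover have "((1/2) ^ k)\<^sup>2 = (1/4::real) ^ k" by (simp add: power2_eq_square flip: power_mult_distrib)
      ultimately show "(norm (d k x))\<^sup>2 \<le> (sqrt C * (1/2) ^ k)\<^sup>2" by (simp add: power_mult_distrib)
    next
      have "C \<ge> 0" using C[of 0] norm_ge_zero order_trans by blast
      then show "0 \<le> sqrt C * (1/2) ^ k" by simp
    qed
    have "summable (\<lambda>k. d k x)"
      by (rule summable_comparison_test'[OF _ dk]) (auto intro!: summable_mult summable_geometric)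
    then have "convergent (\<lambda>n. \<Sum>k<n. d k x)" by (simp add: summable_iff_convergent)
    moreover have "(\<Sum>k<n. d k x) = u (r n) x - u (r 0) x" for n
      unfolding d_def by (rule sum_lessThan_telescope)
    ultimately have "convergent (\<lambda>n. (u (r n) x - u (r 0) x) + u (r 0) x)"
      by (intro convergent_add convergent_const) simp
    then show ?case by simp
  qed
  define l where "l x = lim (\<lambda>k. u (r k) x)" for x
  have [measurable]: "l \<in> borel_measurable \<mu>"
    unfolding l_def by (intro borel_measurable_lim_metric) simp
  have tail: "(\<lambda>x. u n x - l x) \<in> L2 \<mu> \<and> L2_norm \<mu> (\<lambda>x. u n x - l x) \<le> (1/8) ^ k" if n: "n \<ge> N k" for n k
  proof -
    have "(\<integral>\<^sup>+x. ennreal ((cmod (u n x - l x))\<^sup>2) \<partial>\<mu>)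
        = (\<integral>\<^sup>+x. liminf (\<lambda>j. ennreal ((cmod (u n x - u (r j) x))\<^sup>2)) \<partial>\<mu>)"
    proof (rule nn_integral_cong_AE)
      from conv show "AE x in \<mu>. ennreal ((cmod (u n x - l x))\<^sup>2) = liminf (\<lambda>j. ennreal ((cmod (u n x - u (r j) x))\<^sup>2))"
      proof eventually_elim
        case (elim x)
        then have "(\<lambda>j. u (r j) x) \<longlonglongrightarrow> l x" by (simp add: l_def convergent_LIMSEQ_iff)
        then have "(\<lambda>j. ennreal ((cmod (u n x - u (r j) x))\<^sup>2)) \<longlonglongrightarrow> ennreal ((cmod (u n x - l x))\<^sup>2)"
          by (intro tendsto_intros)
        then show ?case using lim_imp_Liminf[OF sequentially_bot] by metis
      qed
    qed
    also have "\<dots> \<le> liminf (\<lambda>j. \<integral>\<^sup>+x. ennreal ((cmod (u n x - u (r j) x))\<^sup>2) \<partial>\<mu>)"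
      by (intro nn_integral_liminf) measurable
    also have "\<dots> = liminf (\<lambda>j. ennreal ((L2_norm \<mu> (\<lambda>x. u n x - u (r j) x))\<^sup>2))"
      by (simp add: L2_nn_integral[OF L2_diff[OF u u]])
    also have "\<dots> \<le> liminf (\<lambda>j::nat. ennreal (((1/8) ^ k)\<^sup>2))"
    proof (rule Liminf_mono)
      show "\<forall>\<^sub>F j in sequentially. ennreal ((L2_norm \<mu> (\<lambda>x. u n x - u (r j) x))\<^sup>2) \<le> ennreal (((1/8) ^ k)\<^sup>2)"
        unfolding eventually_sequentially
      proof (intro exI allI impI)
        fix j assume "k \<le> j"
        then have "L2_norm \<mu> (\<lambda>x. u n x - u (r j) x) < (1/8) ^ k" using N[OF n r] by simp
        then show "ennreal ((L2_norm \<mu> (\<lambda>x. u n x - u (r j) x))\<^sup>2) \<le> ennreal (((1/8) ^ k)\<^sup>2)"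
          by (intro ennreal_leI power_mono) auto
      qed
    qed
    also have "\<dots> = ennreal (((1/8) ^ k)\<^sup>2)" by (simp add: Liminf_const)
    finally have le: "(\<integral>\<^sup>+x. ennreal ((cmod (u n x - l x))\<^sup>2) \<partial>\<mu>) \<le> ennreal (((1/8) ^ k)\<^sup>2)" .
    show ?thesis using L2_I_nn_integral[OF _ le] by simp
  qed
  show ?thesis
  proof (rule that)
    have "(\<lambda>x. u (N 0) x - (u (N 0) x - l x)) \<in> L2 \<mu>"
      using tail[of 0 "N 0"] L2_diff[OF u[of "N 0"], of "\<lambda>x. u (N 0) x - l x"] by blast
    then show "l \<in> L2 \<mu>" by simp
    show "(\<lambda>n. L2_norm \<mu> (\<lambda>x. u n x - l x)) \<longlonglongrightarrow> 0"
    proof (rule LIMSEQ_I)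
      fix e :: real assume "e > 0"
      then obtain k where "(1/8) ^ k < e" using real_arch_pow_inv[of e "1/8"] by auto
      then show "\<exists>no. \<forall>n\<ge>no. norm (L2_norm \<mu> (\<lambda>x. u n x - l x) - 0) < e"
        using tail[of k] by (intro exI[of _ "N k"]) (auto intro: le_less_trans)
    qed
  qed
qed

section \<open>Self-adjoint graphs and surjectivity of \<open>1 + i c H\<close>\<close>

section \<open>Self-adjoint operators\<close>

lemma self_adjoint_L2:
  assumes "self_adjoint \<mu> H" "(u, h) \<in> H"
  shows "u \<in> L2 \<mu>" "h \<in> L2 \<mu>"
  using assms unfolding self_adjoint_def adjoint_op_def by blast+

lemma self_adjoint_mem_iff:
  assumes "self_adjoint \<mu> H"
  shows "(v, k) \<in> H \<longleftrightarrow> v \<in> L2 \<mu> \<and> k \<in> L2 \<mu> \<and> (\<forall>(u, h)\<in>H. L2_inner \<mu> h v = L2_inner \<mu> u k)"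
proof -
  have "(v, k) \<in> H \<longleftrightarrow> (v, k) \<in> adjoint_op \<mu> H" using assms unfolding self_adjoint_def by simp
  then show ?thesis unfolding adjoint_op_def by simp
qed

text \<open>Since \<open>H\<close> equals its adjoint, a pair belongs to \<open>H\<close> as soon as
  it is symmetric against all of \<open>H\<close>. Linearity, invariance under changes on null sets
  and closedness of \<open>H\<close> all come from this test.\<close>

lemma self_adjoint_memI:
  assumes "self_adjoint \<mu> H" "v \<in> L2 \<mu>" "k \<in> L2 \<mu>"
    and "\<And>u h. (u, h) \<in> H \<Longrightarrow> L2_inner \<mu> h v = L2_inner \<mu> u k"
  shows "(v, k) \<in> H"
  using assms(2-) self_adjoint_mem_iff[OF assms(1), of v k] by blast

lemma self_adjoint_symmetric:
  assumes "self_adjoint \<mu> H" "(u, h) \<in> H" "(v, k) \<in> H"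
  shows "L2_inner \<mu> h v = L2_inner \<mu> u k"
  using assms self_adjoint_mem_iff[OF assms(1), of v k] by blast

lemma self_adjoint_lin:
  assumes sa: "self_adjoint \<mu> H" and uh: "(u, h) \<in> H" and vk: "(v, k) \<in> H"
  shows "(\<lambda>x. a * u x + b * v x, \<lambda>x. a * h x + b * k x) \<in> H"
proof -
  note L = self_adjoint_L2[OF sa]
  have "L2_inner \<mu> h' (\<lambda>x. a * u x + b * v x) = L2_inner \<mu> u' (\<lambda>x. a * h x + b * k x)"
    if "(u', h') \<in> H" for u' h'
    using self_adjoint_symmetric[OF sa that uh] self_adjoint_symmetric[OF sa that vk]
    by (simp add: L2_inner_lin_right L[OF uh] L[OF vk] L[OF that])
  then show ?thesis
    by (intro self_adjoint_memI[OF sa] L2_lin L[OF uh] L[OF vk])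
qed

lemma self_adjoint_cong_AE:
  assumes sa: "self_adjoint \<mu> H" and uh: "(u, h) \<in> H"
    and v: "v \<in> L2 \<mu>" "AE x in \<mu>. u x = v x" and k: "k \<in> L2 \<mu>" "AE x in \<mu>. h x = k x"
  shows "(v, k) \<in> H"
proof -
  note L = self_adjoint_L2[OF sa]
  have "L2_inner \<mu> h' v = L2_inner \<mu> u' k" if "(u', h') \<in> H" for u' h'
  proof -
    have "L2_inner \<mu> h' v = L2_inner \<mu> h' u" "L2_inner \<mu> u' h = L2_inner \<mu> u' k"
      using v k L[OF uh] L[OF that] by (auto intro!: L2_inner_cong_AE simp: L2_measurable eq_commute)
    then show ?thesis using self_adjoint_symmetric[OF sa that uh] by simp
  qed
  then show ?thesis by (intro self_adjoint_memI[OF sa] v k)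
qed

lemma tendsto_L2_inner:
  assumes "\<And>n. u n \<in> L2 \<mu>" "l \<in> L2 \<mu>" "v \<in> L2 \<mu>" "(\<lambda>n. L2_norm \<mu> (\<lambda>x. u n x - l x)) \<longlonglongrightarrow> 0"
  shows "(\<lambda>n. L2_inner \<mu> v (u n)) \<longlonglongrightarrow> L2_inner \<mu> v l"
proof -
  have "(\<lambda>n. L2_inner \<mu> v (u n) - L2_inner \<mu> v l) \<longlonglongrightarrow> 0"
  proof (rule Lim_null_comparison)
    show "(\<lambda>n. L2_norm \<mu> v * L2_norm \<mu> (\<lambda>x. u n x - l x)) \<longlonglongrightarrow> 0"
      using tendsto_mult_left[OF assms(4), of "L2_norm \<mu> v"] by simp
    have "norm (L2_inner \<mu> v (u n) - L2_inner \<mu> v l) \<le> L2_norm \<mu> v * L2_norm \<mu> (\<lambda>x. u n x - l x)" for n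
      using L2_Cauchy_Schwarz[OF assms(3) L2_diff[OF assms(1,2)], of n]
        L2_inner_lin_right[OF assms(1)[of n] assms(2,3), of 1 "-1"] by simp
    then show "\<forall>\<^sub>F n in sequentially. norm (L2_inner \<mu> v (u n) - L2_inner \<mu> v l) \<le> L2_norm \<mu> v * L2_norm \<mu> (\<lambda>x. u n x - l x)"
      by simp
  qed
  then show ?thesis by (simp add: LIM_zero_iff)
qed

lemma self_adjoint_closed:
  assumes sa: "self_adjoint \<mu> H" and uh: "\<And>n. (u n, h n) \<in> H"
    and v: "v \<in> L2 \<mu>" "(\<lambda>n. L2_norm \<mu> (\<lambda>x. u n x - v x)) \<longlonglongrightarrow> 0"
    and k: "k \<in> L2 \<mu>" "(\<lambda>n. L2_norm \<mu> (\<lambda>x. h n x - k x)) \<longlonglongrightarrow> 0"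
  shows "(v, k) \<in> H"
proof -
  note L = self_adjoint_L2[OF sa]
  have "L2_inner \<mu> h' v = L2_inner \<mu> u' k" if "(u', h') \<in> H" for u' h'
  proof -
    have "(\<lambda>n. L2_inner \<mu> h' (u n)) \<longlonglongrightarrow> L2_inner \<mu> h' v"
      by (rule tendsto_L2_inner[OF L(1)[OF uh] v(1) L(2)[OF that] v(2)])
    moreover have "(\<lambda>n. L2_inner \<mu> u' (h n)) \<longlonglongrightarrow> L2_inner \<mu> u' k"
      by (rule tendsto_L2_inner[OF L(2)[OF uh] k(1) L(1)[OF that] k(2)])
    moreover have "L2_inner \<mu> h' (u n) = L2_inner \<mu> u' (h n)" for n
      by (rule self_adjoint_symmetric[OF sa that uh])
    ultimately show ?thesis using LIMSEQ_unique by auto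
  qed
  then show ?thesis by (intro self_adjoint_memI[OF sa] v k)
qed

lemma self_adjoint_inner_real:
  assumes "self_adjoint \<mu> H" "(u, h) \<in> H"
  shows "Im (L2_inner \<mu> u h) = 0"
  using self_adjoint_symmetric[OF assms assms(2)] L2_inner_commute[of \<mu> u h]
  by (metis Reals_cnj_iff complex_is_Real_iff)

text \<open>The cross term is a multiple of the imaginary part of the inner product of
  \<open>u\<close> and \<open>h\<close>, which vanishes by symmetry. The identity bounds
  \<open>1 + i c H\<close> from below and controls \<open>u\<close> and \<open>h\<close>
  separately.\<close>

lemma self_adjoint_norm:
  assumes sa: "self_adjoint \<mu> H" and uh: "(u, h) \<in> H"
  shows "(L2_norm \<mu> (\<lambda>x. u x + \<i> * of_real c * h x))\<^sup>2 = (L2_norm \<mu> u)\<^sup>2 + c\<^sup>2 * (L2_norm \<mu> h)\<^sup>2"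
  using L2_norm_lin_square[OF self_adjoint_L2[OF sa uh], of "\<i> * of_real c"] self_adjoint_inner_real[OF sa uh]
  by (simp add: norm_mult)

lemma L2_parallelogram:
  assumes u: "u \<in> L2 \<mu>" and v: "v \<in> L2 \<mu>"
  shows "(L2_norm \<mu> (\<lambda>x. u x + v x))\<^sup>2 + (L2_norm \<mu> (\<lambda>x. u x - v x))\<^sup>2
     = 2 * (L2_norm \<mu> u)\<^sup>2 + 2 * (L2_norm \<mu> v)\<^sup>2"
  using L2_norm_lin_square[OF u v, of 1] L2_norm_lin_square[OF u v, of "-1"] by simp

text \<open>The range is closed by \<open>self_adjoint_norm\<close>; the remainder of the best approximation of \<open>g\<close> is an
  eigenvector of \<open>H\<close> with a purely imaginary eigenvalue, hence zero.\<close>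

lemma self_adjoint_range:
  assumes sa: "self_adjoint \<mu> H" and g: "g \<in> L2 \<mu>" and c: "c \<noteq> (0::real)"
  obtains u h where "(u, h) \<in> H" "AE x in \<mu>. u x + \<i> * of_real c * h x = g x"
proof -
  note L = self_adjoint_L2[OF sa]
  define w :: "('a \<Rightarrow> complex) \<Rightarrow> ('a \<Rightarrow> complex) \<Rightarrow> 'a \<Rightarrow> complex" where "w u h x = u x + \<i> * of_real c * h x" for u h x
  have wL2: "w u h \<in> L2 \<mu>" if "(u, h) \<in> H" for u h
    unfolding w_def by (intro L2_add L2_scale L[OF that])
  have w_norm: "(L2_norm \<mu> (w u h))\<^sup>2 = (L2_norm \<mu> u)\<^sup>2 + c\<^sup>2 * (L2_norm \<mu> h)\<^sup>2" if "(u, h) \<in> H" for u h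
    unfolding w_def by (rule self_adjoint_norm[OF sa that])
  have w_lin: "w (\<lambda>x. a * u x + b * u' x) (\<lambda>x. a * h x + b * h' x) x = a * w u h x + b * w u' h' x" for a b u u' h h' x
    by (simp add: w_def algebra_simps)
  \<comment> \<open>Squared distances from \<open>g\<close> to the range of
    \<open>1 + i c H\<close>; a minimising sequence leads to the best approximation.\<close>
  define D where "D = (\<lambda>(u, h). (L2_norm \<mu> (\<lambda>x. g x - w u h x))\<^sup>2) ` H"
  have "(\<lambda>x. 0, \<lambda>x. 0) \<in> H"
    by (rule self_adjoint_memI[OF sa L2_zero L2_zero]) (simp add: L2_inner_def)
  then have D_ne: "D \<noteq> {}" unfolding D_def by auto
  have D_bdd: "bdd_below D" unfolding D_def by (intro bdd_belowI[of _ 0]) auto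
  have D_le: "Inf D \<le> (L2_norm \<mu> (\<lambda>x. g x - w u h x))\<^sup>2" if "(u, h) \<in> H" for u h
    by (rule cInf_lower[OF _ D_bdd]) (use that in \<open>auto simp: D_def\<close>)
  have "\<exists>u h. (u, h) \<in> H \<and> (L2_norm \<mu> (\<lambda>x. g x - w u h x))\<^sup>2 < Inf D + 1 / Suc n" for n
  proof -
    have "\<exists>d\<in>D. d < Inf D + 1 / Suc n" by (rule cInf_lessD[OF D_ne]) simp
    then show ?thesis unfolding D_def by auto
  qed
  then obtain u h where uh: "\<And>n. (u n, h n) \<in> H"
    and lt: "\<And>n. (L2_norm \<mu> (\<lambda>x. g x - w (u n) (h n) x))\<^sup>2 < Inf D + 1 / Suc n"
    by metis
  have diffH: "(\<lambda>x. u m x - u n x, \<lambda>x. h m x - h n x) \<in> H" for m n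
    using self_adjoint_lin[OF sa uh uh, of 1 m "-1" n] by simp
  \<comment> \<open>Parallelogram law for two remainders: their half sum is again a remainder, with
    squared norm at least \<open>Inf D\<close>, so their difference is small.\<close>
  have close: "(L2_norm \<mu> (w (\<lambda>x. u m x - u n x) (\<lambda>x. h m x - h n x)))\<^sup>2 \<le> 2 / Suc m + 2 / Suc n" for m n
  proof -
    let ?a = "\<lambda>x. g x - w (u m) (h m) x" and ?b = "\<lambda>x. g x - w (u n) (h n) x"
    let ?u = "\<lambda>x. (1/2) * u m x + (1/2) * u n x" and ?h = "\<lambda>x. (1/2) * h m x + (1/2) * h n x"
    have "?a \<in> L2 \<mu>" "?b \<in> L2 \<mu>" by (intro L2_diff g wL2[OF uh])+
    then have par: "(L2_norm \<mu> (\<lambda>x. ?a x + ?b x))\<^sup>2 + (L2_norm \<mu> (\<lambda>x. ?b x - ?a x))\<^sup>2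
        = 2 * (L2_norm \<mu> ?a)\<^sup>2 + 2 * (L2_norm \<mu> ?b)\<^sup>2"
      using L2_parallelogram[of ?a \<mu> ?b] L2_norm_minus_commute[of \<mu> ?a ?b] by simp
    have mid: "(?u, ?h) \<in> H" by (rule self_adjoint_lin[OF sa uh uh])
    have "?a x + ?b x = 2 * (g x - w ?u ?h x)" for x
      unfolding w_lin by (simp add: algebra_simps)
    then have "L2_norm \<mu> (\<lambda>x. ?a x + ?b x) = cmod 2 * L2_norm \<mu> (\<lambda>x. g x - w ?u ?h x)"
      by (simp only: L2_norm_scale)
    then have "(L2_norm \<mu> (\<lambda>x. ?a x + ?b x))\<^sup>2 = 4 * (L2_norm \<mu> (\<lambda>x. g x - w ?u ?h x))\<^sup>2"
      by (simp only: power_mult_distrib) simp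
    with D_le[OF mid] have 1: "4 * Inf D \<le> (L2_norm \<mu> (\<lambda>x. ?a x + ?b x))\<^sup>2" by linarith
    have "?b x - ?a x = w (\<lambda>x. u m x - u n x) (\<lambda>x. h m x - h n x) x" for x
      by (simp add: w_def algebra_simps)
    then have "(L2_norm \<mu> (w (\<lambda>x. u m x - u n x) (\<lambda>x. h m x - h n x)))\<^sup>2 = (L2_norm \<mu> (\<lambda>x. ?b x - ?a x))\<^sup>2"
      by (simp add: L2_norm_def)
    with par 1 lt[of m] lt[of n] show ?thesis by linarith
  qed
  \<comment> \<open>The vector in the range controls both components, so \<open>u n\<close> and
    \<open>h n\<close> are Cauchy and not only their combination.\<close>
  have close_u: "(L2_norm \<mu> (\<lambda>x. u m x - u n x))\<^sup>2 \<le> 2 / Suc m + 2 / Suc n" for m n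
    using close[of m n] w_norm[OF diffH, of m n] zero_le_power2[of "c * L2_norm \<mu> (\<lambda>x. h m x - h n x)"]
    unfolding power_mult_distrib by linarith
  have close_h: "(L2_norm \<mu> (\<lambda>x. h m x - h n x))\<^sup>2 \<le> (2 / Suc m + 2 / Suc n) / c\<^sup>2" for m n
  proof -
    have "c\<^sup>2 * (L2_norm \<mu> (\<lambda>x. h m x - h n x))\<^sup>2 \<le> 2 / Suc m + 2 / Suc n"
      using close[of m n] w_norm[OF diffH, of m n] zero_le_power2[of "L2_norm \<mu> (\<lambda>x. u m x - u n x)"]
      by linarith
    moreover have "c\<^sup>2 > 0" using c by simp
    ultimately show ?thesis by (simp add: pos_le_divide_eq mult.commute)
  qed
  have CauchyI: "\<exists>N. \<forall>m\<ge>N. \<forall>n\<ge>N. L2_norm \<mu> (\<lambda>x. f m x - f n x) < e"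
    if bd: "\<And>m n. (L2_norm \<mu> (\<lambda>x. f m x - f n x))\<^sup>2 \<le> (2 / Suc m + 2 / Suc n) / d" and d: "d > 0" and e: "e > 0"
    for f :: "nat \<Rightarrow> 'a \<Rightarrow> complex" and d e :: real
  proof -
    obtain N :: nat where "4 / (d * e\<^sup>2) < N" using reals_Archimedean2 by blast
    then have "4 / (d * e\<^sup>2) < Suc N" by simp
    then have N: "4 / Suc N < d * e\<^sup>2" using d e by (simp add: field_simps)
    show ?thesis
    proof (intro exI allI impI)
      fix m n assume mn: "N \<le> m" "N \<le> n"
      have "2 / Suc m \<le> 2 / Suc N" "2 / Suc n \<le> 2 / Suc N" using mn by (auto intro!: divide_left_mono)
      then have "2 / Suc m + 2 / Suc n < d * e\<^sup>2" using N by simp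
      then have "(2 / Suc m + 2 / Suc n) / d < e\<^sup>2" using d by (simp add: pos_divide_less_eq mult.commute)
      with bd[of m n] have "(L2_norm \<mu> (\<lambda>x. f m x - f n x))\<^sup>2 < e\<^sup>2" by linarith
      then show "L2_norm \<mu> (\<lambda>x. f m x - f n x) < e" using e by (simp add: power_less_imp_less_base)
    qed
  qed
  obtain U where U: "U \<in> L2 \<mu>" "(\<lambda>n. L2_norm \<mu> (\<lambda>x. u n x - U x)) \<longlonglongrightarrow> 0"
    by (rule L2_complete[OF L(1)[OF uh] CauchyI[of u 1]]) (use close_u in auto)
  obtain K where K: "K \<in> L2 \<mu>" "(\<lambda>n. L2_norm \<mu> (\<lambda>x. h n x - K x)) \<longlonglongrightarrow> 0"
    by (rule L2_complete[OF L(2)[OF uh] CauchyI[of h "c\<^sup>2"]]) (use close_h c in auto)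
  have UK: "(U, K) \<in> H" by (rule self_adjoint_closed[OF sa uh U K])
  define r where "r x = g x - w U K x" for x
  have r: "r \<in> L2 \<mu>" unfolding r_def by (intro L2_diff g wL2 UK)
  have r_min: "(L2_norm \<mu> r)\<^sup>2 \<le> Inf D"
  proof (rule LIMSEQ_le_const)
    have "(\<lambda>n. L2_norm \<mu> (\<lambda>x. g x - w (u n) (h n) x) + (L2_norm \<mu> (\<lambda>x. u n x - U x) + \<bar>c\<bar> * L2_norm \<mu> (\<lambda>x. h n x - K x))) 
      \<longlonglongrightarrow> sqrt (Inf D) + (0 + \<bar>c\<bar> * 0)"
    proof (intro tendsto_add tendsto_mult tendsto_const U K)
      have "(\<lambda>n. (L2_norm \<mu> (\<lambda>x. g x - w (u n) (h n) x))\<^sup>2) \<longlonglongrightarrow> Inf D"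
      proof (rule tendsto_sandwich[OF always_eventually always_eventually tendsto_const])
        show "(\<lambda>n. Inf D + 1 / Suc n) \<longlonglongrightarrow> Inf D" by real_asymp
      qed (use D_le[OF uh] lt in \<open>auto intro: less_imp_le\<close>)
      then have "(\<lambda>n. sqrt ((L2_norm \<mu> (\<lambda>x. g x - w (u n) (h n) x))\<^sup>2)) \<longlonglongrightarrow> sqrt (Inf D)"
        by (rule tendsto_real_sqrt)
      then show "(\<lambda>n. L2_norm \<mu> (\<lambda>x. g x - w (u n) (h n) x)) \<longlonglongrightarrow> sqrt (Inf D)" by simp
    qed
    then have "(\<lambda>n. (L2_norm \<mu> (\<lambda>x. g x - w (u n) (h n) x) + (L2_norm \<mu> (\<lambda>x. u n x - U x) + \<bar>c\<bar> * L2_norm \<mu> (\<lambda>x. h n x - K x)))\<^sup>2) 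
      \<longlonglongrightarrow> (sqrt (Inf D) + (0 + \<bar>c\<bar> * 0))\<^sup>2" by (rule tendsto_power)
    moreover have "0 \<le> Inf D" by (rule cInf_greatest[OF D_ne]) (auto simp: D_def)
    ultimately show "(\<lambda>n. (L2_norm \<mu> (\<lambda>x. g x - w (u n) (h n) x) + (L2_norm \<mu> (\<lambda>x. u n x - U x) + \<bar>c\<bar> * L2_norm \<mu> (\<lambda>x. h n x - K x)))\<^sup>2) \<longlonglongrightarrow> Inf D"
      by simp
    have "L2_norm \<mu> r \<le> L2_norm \<mu> (\<lambda>x. g x - w (u n) (h n) x) + (L2_norm \<mu> (\<lambda>x. u n x - U x) + \<bar>c\<bar> * L2_norm \<mu> (\<lambda>x. h n x - K x))" for n
    proof -
      have dif: "(\<lambda>x. (u n x - U x) + \<i> * of_real c * (h n x - K x)) \<in> L2 \<mu>"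
        by (intro L2_add L2_scale L2_diff L[OF uh] U K)
      have "r x = (g x - w (u n) (h n) x) + ((u n x - U x) + \<i> * of_real c * (h n x - K x))" for x
        by (simp add: r_def w_def algebra_simps)
      then have "L2_norm \<mu> r = L2_norm \<mu> (\<lambda>x. (g x - w (u n) (h n) x) + ((u n x - U x) + \<i> * of_real c * (h n x - K x)))"
        by (simp add: L2_norm_def)
      also have "\<dots> \<le> L2_norm \<mu> (\<lambda>x. g x - w (u n) (h n) x) + L2_norm \<mu> (\<lambda>x. (u n x - U x) + \<i> * of_real c * (h n x - K x))"
        by (intro L2_norm_triangle L2_diff g wL2 uh dif)
      also have "L2_norm \<mu> (\<lambda>x. (u n x - U x) + \<i> * of_real c * (h n x - K x))
          \<le> L2_norm \<mu> (\<lambda>x. u n x - U x) + L2_norm \<mu> (\<lambda>x. \<i> * of_real c * (h n x - K x))"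
        by (intro L2_norm_triangle L2_scale L2_diff L[OF uh] U K)
      finally show ?thesis by (simp add: L2_norm_scale norm_mult)
    qed
    then show "\<exists>N. \<forall>n\<ge>N. (L2_norm \<mu> r)\<^sup>2 \<le> (L2_norm \<mu> (\<lambda>x. g x - w (u n) (h n) x) + (L2_norm \<mu> (\<lambda>x. u n x - U x) + \<bar>c\<bar> * L2_norm \<mu> (\<lambda>x. h n x - K x)))\<^sup>2"
      by (intro exI[of _ 0] allI impI power_mono) auto
  qed
  have orth: "L2_inner \<mu> (w u' h') r = 0" if uh': "(u', h') \<in> H" for u' h'
  proof (rule ccontr)
    let ?p = "L2_inner \<mu> r (w u' h')"
    assume "L2_inner \<mu> (w u' h') r \<noteq> 0"
    then have p: "?p \<noteq> 0" using L2_inner_commute[of \<mu> "w u' h'" r] by auto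
    \<comment> \<open>Step length for a variation along the projection coefficient, small enough
      that the quadratic term stays below half of the linear gain.\<close>
    define s where "s = 1 / ((L2_norm \<mu> (w u' h'))\<^sup>2 + 1)"
    have N1: "(L2_norm \<mu> (w u' h'))\<^sup>2 + 1 > 0" by (simp add: add_nonneg_pos)
    have s: "s > 0" "s * (L2_norm \<mu> (w u' h'))\<^sup>2 < 1" using N1 by (auto simp: s_def)
    define z where "z = of_real s * ?p"
    have "(\<lambda>x. 1 * U x + z * u' x, \<lambda>x. 1 * K x + z * h' x) \<in> H" by (rule self_adjoint_lin[OF sa UK uh'])
    from D_le[OF this] have "Inf D \<le> (L2_norm \<mu> (\<lambda>x. g x - (1 * w U K x + z * w u' h' x)))\<^sup>2"
      unfolding w_lin .
    also have "\<dots> = (L2_norm \<mu> (\<lambda>x. r x + (- z) * w u' h' x))\<^sup>2"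
      by (simp add: r_def algebra_simps)
    also have "\<dots> = (L2_norm \<mu> r)\<^sup>2 + 2 * Re (cnj (- z) * ?p) + (cmod (- z))\<^sup>2 * (L2_norm \<mu> (w u' h'))\<^sup>2"
      by (rule L2_norm_lin_square[OF r wL2[OF uh']])
    finally have ge: "0 \<le> 2 * Re (cnj (- z) * ?p) + (cmod z)\<^sup>2 * (L2_norm \<mu> (w u' h'))\<^sup>2"
      using r_min by simp
    have "cnj (- z) * ?p = of_real (- (s * (cmod ?p)\<^sup>2))"
      unfolding z_def of_real_minus of_real_mult complex_norm_square by (simp add: mult_ac)
    then have re: "Re (cnj (- z) * ?p) = - (s * (cmod ?p)\<^sup>2)" by (simp only: Re_complex_of_real)
    have zz: "(cmod z)\<^sup>2 = s * (s * (cmod ?p)\<^sup>2)"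
      unfolding z_def using s by (simp add: norm_mult power2_eq_square)
    have "s * (s * (cmod ?p)\<^sup>2) * (L2_norm \<mu> (w u' h'))\<^sup>2 = (s * (cmod ?p)\<^sup>2) * (s * (L2_norm \<mu> (w u' h'))\<^sup>2)"
      by (simp only: mult_ac)
    then have "2 * (s * (cmod ?p)\<^sup>2) \<le> (s * (cmod ?p)\<^sup>2) * (s * (L2_norm \<mu> (w u' h'))\<^sup>2)"
      using ge unfolding re zz by linarith
    also have "\<dots> \<le> (s * (cmod ?p)\<^sup>2) * 1" using s by (intro mult_left_mono) auto
    finally show False using s p by (simp add: mult_le_0_iff)
  qed
  \<comment> \<open>Orthogonality to the range says that the adjoint of \<open>1 + i c H\<close>
    annihilates \<open>r\<close>, which as a symmetry condition against \<open>H\<close> reads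
    \<open>H r = - (i / c) r\<close>.\<close>
  have "(r, \<lambda>x. (- \<i> / of_real c) * r x) \<in> H"
  proof (rule self_adjoint_memI[OF sa r L2_scale[OF r]])
    fix u' h' assume uh': "(u', h') \<in> H"
    have "L2_inner \<mu> (\<lambda>x. 1 * u' x + \<i> * of_real c * h' x) r = 0"
      using orth[OF uh'] by (simp add: w_def[abs_def])
    then have "L2_inner \<mu> u' r + \<i> * of_real c * L2_inner \<mu> h' r = 0"
      unfolding L2_inner_lin[OF L[OF uh'] r] by simp
    then have "L2_inner \<mu> u' r = - (\<i> * of_real c * L2_inner \<mu> h' r)" by (simp add: eq_neg_iff_add_eq_0)
    then have "\<i> / of_real c * L2_inner \<mu> u' r = L2_inner \<mu> h' r" using c by simp
    then show "L2_inner \<mu> h' r = L2_inner \<mu> u' (\<lambda>x. (- \<i> / of_real c) * r x)"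
      unfolding L2_inner_scale_right by simp
  qed
  from self_adjoint_inner_real[OF sa this] have "Im (\<i> / of_real c * of_real ((L2_norm \<mu> r)\<^sup>2)) = 0"
    unfolding L2_inner_scale_right L2_inner_self by simp
  then have "L2_norm \<mu> r = 0" using c by simp
  then have "AE x in \<mu>. r x = 0" using L2_norm_eq_0_iff[OF r] by simp
  then have "AE x in \<mu>. U x + \<i> * of_real c * K x = g x"
    by eventually_elim (simp add: r_def w_def)
  then show ?thesis using UK that by blast
qed

section \<open>Transport of the abstract group to functions\<close>

section \<open>Stone's theorem\<close>

lemma L2_minus_ii: "u \<in> L2 \<mu> \<Longrightarrow> (\<lambda>x. - (\<i> * u x)) \<in> L2 \<mu>"
  using L2_scale[of u \<mu> "- \<i>"] by simp

text \<open>The map \<open>u \<mapsto> \<langle>u, \<cdot>\<rangle>\<close> identifies the elements of \<open>L\<^sup>2\<close> with bounded functions on the unit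
  ball of \<open>L\<^sup>2\<close>. This turns equality almost everywhere into equality in a normed space.\<close>

definition L2_emb :: "'a measure \<Rightarrow> ('a \<Rightarrow> complex) \<Rightarrow> ('a \<Rightarrow> complex) discrete \<Rightarrow>\<^sub>C complex" where
  "L2_emb \<mu> u = Bcontfun (\<lambda>v. if of_discrete v \<in> L2 \<mu> \<and> L2_norm \<mu> (of_discrete v) \<le> 1
     then L2_inner \<mu> u (of_discrete v) else 0)"

text \<open>\<open>Bcontfun\<close> is meaningful here: Cauchy-Schwarz bounds the pairing on the
  unit ball, and continuity is automatic because the domain carries the discrete topology.\<close>

lemma apply_L2_emb:
  assumes u: "u \<in> L2 \<mu>"
  shows "apply_bcontfun (L2_emb \<mu> u) v = (if of_discrete v \<in> L2 \<mu> \<and> L2_norm \<mu> (of_discrete v) \<le> 1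
     then L2_inner \<mu> u (of_discrete v) else 0)" (is "_ = ?f v")
proof -
  have "?f \<in> bcontfun"
  proof (rule bcontfun_normI)
    show "continuous_on UNIV ?f"
      by (simp add: continuous_on_open_vimage open_discrete)
    show "norm (?f v) \<le> L2_norm \<mu> u" for v
      using L2_Cauchy_Schwarz[OF u, of "of_discrete v"]
        mult_left_mono[of "L2_norm \<mu> (of_discrete v)" 1 "L2_norm \<mu> u"]
      by auto
  qed
  then show ?thesis unfolding L2_emb_def by (simp add: Bcontfun_inverse)
qed

lemma norm_L2_emb:
  assumes u: "u \<in> L2 \<mu>"
  shows "norm (L2_emb \<mu> u) = L2_norm \<mu> u"
proof (rule antisym)
  show "norm (L2_emb \<mu> u) \<le> L2_norm \<mu> u"
  proof (rule norm_bound)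
    show "norm (apply_bcontfun (L2_emb \<mu> u) v) \<le> L2_norm \<mu> u" for v
      using L2_Cauchy_Schwarz[OF u, of "of_discrete v"]
        mult_left_mono[of "L2_norm \<mu> (of_discrete v)" 1 "L2_norm \<mu> u"]
      by (auto simp: apply_L2_emb[OF u])
  qed
  show "L2_norm \<mu> u \<le> norm (L2_emb \<mu> u)"
  proof (cases "L2_norm \<mu> u = 0")
    case False
    define v where "v = (\<lambda>x. of_real (1 / L2_norm \<mu> u) * u x)"
    have v: "v \<in> L2 \<mu>" unfolding v_def by (rule L2_scale[OF u])
    have "L2_norm \<mu> v = 1" unfolding v_def L2_norm_scale using False by (simp add: norm_divide)
    moreover have "L2_inner \<mu> u v = of_real (L2_norm \<mu> u)"
      unfolding v_def L2_inner_scale_right L2_inner_self using False by (simp add: power2_eq_square)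
    ultimately have "norm (apply_bcontfun (L2_emb \<mu> u) (discrete v)) = L2_norm \<mu> u"
      using v by (simp add: apply_L2_emb[OF u] discrete_inverse)
    then show ?thesis using norm_bounded[of "L2_emb \<mu> u" "discrete v"] by simp
  qed simp
qed

lemma L2_emb_lin:
  assumes u: "u \<in> L2 \<mu>" and v: "v \<in> L2 \<mu>"
  shows "L2_emb \<mu> (\<lambda>x. of_real a * u x + of_real b * v x) = a *\<^sub>R L2_emb \<mu> u + b *\<^sub>R L2_emb \<mu> v"
  by (rule bcontfun_eqI)
     (simp add: apply_L2_emb u v L2_lin L2_inner_lin plus_bcontfun.rep_eq scaleR_bcontfun.rep_eq scaleR_conv_of_real)

lemma L2_emb_add: "u \<in> L2 \<mu> \<Longrightarrow> v \<in> L2 \<mu> \<Longrightarrow> L2_emb \<mu> (\<lambda>x. u x + v x) = L2_emb \<mu> u + L2_emb \<mu> v"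
  using L2_emb_lin[of u \<mu> v 1 1] by simp

lemma L2_emb_diff: "u \<in> L2 \<mu> \<Longrightarrow> v \<in> L2 \<mu> \<Longrightarrow> L2_emb \<mu> (\<lambda>x. u x - v x) = L2_emb \<mu> u - L2_emb \<mu> v"
  using L2_emb_lin[of u \<mu> v 1 "-1"] by simp

lemma L2_emb_scale: "u \<in> L2 \<mu> \<Longrightarrow> L2_emb \<mu> (\<lambda>x. of_real a * u x) = a *\<^sub>R L2_emb \<mu> u"
  using L2_emb_lin[of u \<mu> u a 0] by simp

lemma dist_L2_emb:
  "u \<in> L2 \<mu> \<Longrightarrow> v \<in> L2 \<mu> \<Longrightarrow> norm (L2_emb \<mu> u - L2_emb \<mu> v) = L2_norm \<mu> (\<lambda>x. u x - v x)"
  by (simp add: L2_emb_diff[symmetric] norm_L2_emb L2_diff)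

lemma L2_emb_eq_iff:
  assumes "u \<in> L2 \<mu>" "v \<in> L2 \<mu>"
  shows "L2_emb \<mu> u = L2_emb \<mu> v \<longleftrightarrow> (AE x in \<mu>. u x = v x)"
  using dist_L2_emb[OF assms] L2_norm_eq_0_iff[OF L2_diff[OF assms]] by auto

lemma complete_L2_emb: "complete (L2_emb \<mu> ` L2 \<mu>)"
  unfolding complete_def
proof (intro allI impI, elim conjE)
  fix f :: "nat \<Rightarrow> ('a \<Rightarrow> complex) discrete \<Rightarrow>\<^sub>C complex"
  assume "\<forall>n. f n \<in> L2_emb \<mu> ` L2 \<mu>" and Cauchy: "Cauchy f"
  then have "\<forall>n. \<exists>u. u \<in> L2 \<mu> \<and> f n = L2_emb \<mu> u" by blast
  then obtain u where u: "\<And>n. u n \<in> L2 \<mu>" and fu: "\<And>n. f n = L2_emb \<mu> (u n)" by metis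
  obtain l where l: "l \<in> L2 \<mu>" "(\<lambda>n. L2_norm \<mu> (\<lambda>x. u n x - l x)) \<longlonglongrightarrow> 0"
  proof (rule L2_complete[OF u])
    fix e :: real assume "e > 0"
    from CauchyD[OF Cauchy this] show "\<exists>N. \<forall>m\<ge>N. \<forall>n\<ge>N. L2_norm \<mu> (\<lambda>x. u m x - u n x) < e"
      by (simp add: fu dist_L2_emb u)
  qed
  then have "(\<lambda>n. norm (f n - L2_emb \<mu> l)) \<longlonglongrightarrow> 0" by (simp add: fu dist_L2_emb u)
  then have "f \<longlonglongrightarrow> L2_emb \<mu> l" by (simp add: LIM_zero_iff tendsto_norm_zero_iff)
  then show "\<exists>l\<in>L2_emb \<mu> ` L2 \<mu>. f \<longlonglongrightarrow> l" using l(1) by blast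
qed

text \<open>Lets maps of the embedded space act on functions again; by \<open>L2_emb_eq_iff\<close>
  the choice is immaterial up to null sets.\<close>

definition L2_rep :: "'a measure \<Rightarrow> (('a \<Rightarrow> complex) discrete \<Rightarrow>\<^sub>C complex) \<Rightarrow> 'a \<Rightarrow> complex" where
  "L2_rep \<mu> x = (SOME u. u \<in> L2 \<mu> \<and> L2_emb \<mu> u = x)"

lemma L2_rep:
  assumes "x \<in> L2_emb \<mu> ` L2 \<mu>"
  shows "L2_rep \<mu> x \<in> L2 \<mu>" "L2_emb \<mu> (L2_rep \<mu> x) = x"
proof -
  have "\<exists>u. u \<in> L2 \<mu> \<and> L2_emb \<mu> u = x" using assms by blast
  from someI_ex[OF this] show "L2_rep \<mu> x \<in> L2 \<mu>" "L2_emb \<mu> (L2_rep \<mu> x) = x"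
    by (simp_all add: L2_rep_def)
qed

text \<open>The graph of \<open>- i H\<close>, the generator of the group to be constructed, seen in
  a real normed space.\<close>

definition L2_gen :: "'a measure \<Rightarrow> 'a operator
    \<Rightarrow> ((('a \<Rightarrow> complex) discrete \<Rightarrow>\<^sub>C complex) \<times> (('a \<Rightarrow> complex) discrete \<Rightarrow>\<^sub>C complex)) set" where
  "L2_gen \<mu> H = (\<lambda>(u, h). (L2_emb \<mu> u, L2_emb \<mu> (\<lambda>x. - \<i> * h x))) ` H"

text \<open>The embedding forgets values on null sets. A pair of \<open>H\<close> is recovered from
  its image because a self-adjoint graph is stable under such changes in both components.\<close>

lemma L2_gen_iff:
  assumes sa: "self_adjoint \<mu> H" and u: "u \<in> L2 \<mu>" and h: "h \<in> L2 \<mu>"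
  shows "(L2_emb \<mu> u, L2_emb \<mu> (\<lambda>x. - \<i> * h x)) \<in> L2_gen \<mu> H \<longleftrightarrow> (u, h) \<in> H"
proof
  assume "(L2_emb \<mu> u, L2_emb \<mu> (\<lambda>x. - \<i> * h x)) \<in> L2_gen \<mu> H"
  then obtain v k where vk: "(v, k) \<in> H" "L2_emb \<mu> v = L2_emb \<mu> u"
      "L2_emb \<mu> (\<lambda>x. - \<i> * k x) = L2_emb \<mu> (\<lambda>x. - \<i> * h x)"
    unfolding L2_gen_def by auto
  note L = self_adjoint_L2[OF sa vk(1)]
  have "AE x in \<mu>. v x = u x" using vk(2) L2_emb_eq_iff[OF L(1) u] by simp
  moreover have "AE x in \<mu>. - \<i> * k x = - \<i> * h x"
    using vk(3) L2_emb_eq_iff[OF L2_scale[OF L(2)] L2_scale[OF h]] by blast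
  then have "AE x in \<mu>. k x = h x" by simp
  ultimately show "(u, h) \<in> H" by (intro self_adjoint_cong_AE[OF sa vk(1)] u h)
qed (auto simp: L2_gen_def)

text \<open>Dissipativity is \<open>self_adjoint_norm\<close> and solvability is
  \<open>self_adjoint_range\<close>. Both hold for real \<open>c\<close> of either sign, which is
  why a group arises.\<close>

lemma isometric_generator_L2:
  assumes sa: "self_adjoint \<mu> H"
  shows "isometric_generator (L2_emb \<mu> ` L2 \<mu>) (L2_gen \<mu> H)"
proof
  note L = self_adjoint_L2[OF sa]
  show "subspace (L2_emb \<mu> ` L2 \<mu>)"
    unfolding subspace_def
  proof (intro conjI ballI allI)
    have "L2_emb \<mu> (\<lambda>x. 0) = 0"
      using L2_emb_scale[OF L2_zero, of \<mu> 0] by simp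
    then show "0 \<in> L2_emb \<mu> ` L2 \<mu>" using L2_zero image_iff by metis
  next
    fix x y assume "x \<in> L2_emb \<mu> ` L2 \<mu>" "y \<in> L2_emb \<mu> ` L2 \<mu>"
    then obtain u v where "u \<in> L2 \<mu>" "v \<in> L2 \<mu>" "x = L2_emb \<mu> u" "y = L2_emb \<mu> v" by blast
    then have "x + y = L2_emb \<mu> (\<lambda>x. u x + v x)" "(\<lambda>x. u x + v x) \<in> L2 \<mu>"
      by (auto simp: L2_emb_add L2_add)
    then show "x + y \<in> L2_emb \<mu> ` L2 \<mu>" by blast
  next
    fix a x assume "x \<in> L2_emb \<mu> ` L2 \<mu>"
    then obtain u where "u \<in> L2 \<mu>" "x = L2_emb \<mu> u" by blast
    then have "a *\<^sub>R x = L2_emb \<mu> (\<lambda>x. of_real a * u x)" "(\<lambda>x. of_real a * u x) \<in> L2 \<mu>"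
      by (auto simp: L2_emb_scale L2_scale)
    then show "a *\<^sub>R x \<in> L2_emb \<mu> ` L2 \<mu>" by blast
  qed
  show "complete (L2_emb \<mu> ` L2 \<mu>)" by (rule complete_L2_emb)
  have lin: "a *\<^sub>R p + b *\<^sub>R q \<in> L2_gen \<mu> H" if pq: "p \<in> L2_gen \<mu> H" "q \<in> L2_gen \<mu> H" for a b p q
  proof -
    obtain u h v k where uh: "(u, h) \<in> H" and vk: "(v, k) \<in> H"
      and p: "p = (L2_emb \<mu> u, L2_emb \<mu> (\<lambda>x. - \<i> * h x))" and q: "q = (L2_emb \<mu> v, L2_emb \<mu> (\<lambda>x. - \<i> * k x))"
      using pq unfolding L2_gen_def by auto
    have "L2_emb \<mu> (\<lambda>x. - \<i> * (of_real a * h x + of_real b * k x))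
        = L2_emb \<mu> (\<lambda>x. of_real a * (- \<i> * h x) + of_real b * (- \<i> * k x))"
      by (simp add: algebra_simps)
    also have "\<dots> = a *\<^sub>R L2_emb \<mu> (\<lambda>x. - \<i> * h x) + b *\<^sub>R L2_emb \<mu> (\<lambda>x. - \<i> * k x)"
      by (intro L2_emb_lin L2_scale L[OF uh] L[OF vk])
    finally have "a *\<^sub>R p + b *\<^sub>R q = (L2_emb \<mu> (\<lambda>x. of_real a * u x + of_real b * v x),
        L2_emb \<mu> (\<lambda>x. - \<i> * (of_real a * h x + of_real b * k x)))"
      by (simp add: p q L2_emb_lin L[OF uh] L[OF vk])
    then show ?thesis
      using self_adjoint_lin[OF sa uh vk, of "of_real a" "of_real b"] unfolding L2_gen_def by force
  qed
  have "\<exists>u h. (u, h) \<in> H"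
    using sa L2_zero[of \<mu>] unfolding self_adjoint_def densely_defined_def by (meson DomainE zero_less_one)
  then have ne: "\<exists>p. p \<in> L2_gen \<mu> H" unfolding L2_gen_def by auto
  show "subspace (L2_gen \<mu> H)"
    unfolding subspace_def
    using lin[of _ _ 0 0] lin[of _ _ 1 1] lin[of _ _ _ 0] ne by auto
  show "L2_gen \<mu> H \<subseteq> L2_emb \<mu> ` L2 \<mu> \<times> L2_emb \<mu> ` L2 \<mu>"
    unfolding L2_gen_def using L by (auto intro!: imageI L2_minus_ii)
  show "\<exists>(y, z)\<in>L2_gen \<mu> H. norm (x - y) < e" if xe: "x \<in> L2_emb \<mu> ` L2 \<mu>" "e > 0" for x e
  proof -
    obtain u where u: "u \<in> L2 \<mu>" "x = L2_emb \<mu> u" using xe by blast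
    obtain v k where "(v, k) \<in> H" "L2_norm \<mu> (\<lambda>x. u x - v x) < e"
      using sa u(1) xe(2) unfolding self_adjoint_def densely_defined_def by (meson DomainE)
    then show ?thesis using L u by (force simp: L2_gen_def dist_L2_emb)
  qed
  \<comment> \<open>Turns the abstract \<open>x - c G x\<close> into \<open>u + i c h\<close>, the
    combination treated for self-adjoint operators.\<close>
  have emb: "L2_emb \<mu> u - c *\<^sub>R L2_emb \<mu> (\<lambda>x. - \<i> * h x) = L2_emb \<mu> (\<lambda>x. u x + \<i> * of_real c * h x)"
    if "(u, h) \<in> H" for u h c
    using L2_emb_lin[OF L(1)[OF that] L2_scale[OF L(2)[OF that]], of 1 "- c" "- \<i>"] by (simp add: mult_ac)
  show "norm x \<le> norm (x - c *\<^sub>R y)" if "(x, y) \<in> L2_gen \<mu> H" for x y c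
  proof -
    obtain u h where uh: "(u, h) \<in> H" "x = L2_emb \<mu> u" "y = L2_emb \<mu> (\<lambda>x. - \<i> * h x)"
      using \<open>(x, y) \<in> L2_gen \<mu> H\<close> unfolding L2_gen_def by auto
    have "(L2_norm \<mu> u)\<^sup>2 \<le> (L2_norm \<mu> (\<lambda>x. u x + \<i> * of_real c * h x))\<^sup>2"
      unfolding self_adjoint_norm[OF sa uh(1)] by simp
    then have "L2_norm \<mu> u \<le> L2_norm \<mu> (\<lambda>x. u x + \<i> * of_real c * h x)"
      by (rule power2_le_imp_le) simp
    then show ?thesis
      unfolding uh(2,3) emb[OF uh(1)] by (simp add: norm_L2_emb L[OF uh(1)] L2_add L2_scale)
  qed
  show "\<exists>(x, y)\<in>L2_gen \<mu> H. x - c *\<^sub>R y = g" if g: "g \<in> L2_emb \<mu> ` L2 \<mu>" "c \<noteq> 0" for g c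
  proof -
    obtain f where f: "f \<in> L2 \<mu>" "g = L2_emb \<mu> f" using g by blast
    obtain u h where uh: "(u, h) \<in> H" "AE x in \<mu>. u x + \<i> * of_real c * h x = f x"
      using self_adjoint_range[OF sa f(1) g(2)] .
    have "L2_emb \<mu> u - c *\<^sub>R L2_emb \<mu> (\<lambda>x. - \<i> * h x) = g"
      unfolding emb[OF uh(1)] f(2)
      using L2_emb_eq_iff[OF L2_add[OF L(1)[OF uh(1)] L2_scale[OF L(2)[OF uh(1)]]] f(1)] uh(2) by blast
    then show ?thesis using uh(1) unfolding L2_gen_def by force
  qed
qed

lemma Stone_exists:
  assumes sa: "self_adjoint \<mu> H"
  shows "\<exists>U. unitary_group \<mu> U \<and> group_hamiltonian \<mu> U = H"
proof -
  interpret isometric_generator "L2_emb \<mu> ` L2 \<mu>" "L2_gen \<mu> H"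
    by (rule isometric_generator_L2[OF sa])
  let ?S = "L2_emb \<mu> ` L2 \<mu>"
  note L = self_adjoint_L2[OF sa]
  define U where "U t u = L2_rep \<mu> (grp t (L2_emb \<mu> u))" for t u
  have U: "U t u \<in> L2 \<mu>" "L2_emb \<mu> (U t u) = grp t (L2_emb \<mu> u)" if "u \<in> L2 \<mu>" for t u
    using L2_rep[OF grp(2)[of "L2_emb \<mu> u" t]] that by (auto simp: U_def)
  \<comment> \<open>Multiplication by the imaginary unit on the embedded space;
    \<open>L2_rep\<close> alters a function on a null set only.\<close>
  define I where "I x = L2_emb \<mu> (\<lambda>y. \<i> * L2_rep \<mu> x y)" for x
  have I: "I (L2_emb \<mu> u) = L2_emb \<mu> (\<lambda>x. \<i> * u x)" if u: "u \<in> L2 \<mu>" for u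
  proof -
    have r: "L2_rep \<mu> (L2_emb \<mu> u) \<in> L2 \<mu>" "L2_emb \<mu> (L2_rep \<mu> (L2_emb \<mu> u)) = L2_emb \<mu> u"
      using L2_rep[of "L2_emb \<mu> u" \<mu>] u by auto
    then have "AE x in \<mu>. L2_rep \<mu> (L2_emb \<mu> u) x = u x" using L2_emb_eq_iff[OF _ u] by blast
    then have "AE x in \<mu>. \<i> * L2_rep \<mu> (L2_emb \<mu> u) x = \<i> * u x" by simp
    then show ?thesis unfolding I_def using L2_emb_eq_iff[OF L2_scale[OF r(1)] L2_scale[OF u]] by blast
  qed
  have grp_I: "grp t (I x) = I (grp t x)" if "x \<in> ?S" for t x
  proof (rule grp_intertwine[OF _ _ _ _ that])
    fix x y h assume "x \<in> ?S"
    then obtain u where u: "u \<in> L2 \<mu>" "x = L2_emb \<mu> u" by blast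
    show "I x \<in> ?S" using u by (auto simp: I L2_scale)
    assume "y \<in> ?S"
    then obtain v where v: "v \<in> L2 \<mu>" "y = L2_emb \<mu> v" by blast
    have "L2_norm \<mu> (\<lambda>x. \<i> * u x - \<i> * v x) = L2_norm \<mu> (\<lambda>x. u x - v x)"
      using L2_norm_scale[of \<mu> \<i> "\<lambda>x. u x - v x"] by (simp add: algebra_simps)
    then show "norm (I x - I y) = norm (x - y)"
      by (simp add: u v I dist_L2_emb L2_scale)
    have "x - h *\<^sub>R y = L2_emb \<mu> (\<lambda>x. u x - of_real h * v x)"
      using L2_emb_lin[OF u(1) v(1), of 1 "- h"] by (simp add: u v)
    then have "I (x - h *\<^sub>R y) = L2_emb \<mu> (\<lambda>x. \<i> * (u x - of_real h * v x))"
      by (simp add: I u v L2_diff L2_scale)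
    also have "\<dots> = L2_emb \<mu> (\<lambda>x. of_real 1 * (\<i> * u x) + of_real (- h) * (\<i> * v x))"
      by (simp add: algebra_simps)
    also have "\<dots> = I x - h *\<^sub>R I y"
      using L2_emb_lin[OF L2_scale[OF u(1), of \<i>] L2_scale[OF v(1), of \<i>], of 1 "- h"] by (simp add: u v I)
    finally show "I (x - h *\<^sub>R y) = I x - h *\<^sub>R I y" .
  next
    fix x y assume "(x, y) \<in> L2_gen \<mu> H"
    then obtain u h where uh: "(u, h) \<in> H" "x = L2_emb \<mu> u" "y = L2_emb \<mu> (\<lambda>x. - \<i> * h x)"
      unfolding L2_gen_def by auto
    have "(\<lambda>x. \<i> * u x, \<lambda>x. \<i> * h x) \<in> H" using self_adjoint_lin[OF sa uh(1) uh(1), of \<i> 0] by simp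
    then show "(I x, I y) \<in> L2_gen \<mu> H"
      unfolding uh(2,3) I[OF L(1)[OF uh(1)]] I[OF L2_scale[OF L(2)[OF uh(1)]]]
      by (force simp: L2_gen_def mult_ac)
  qed
  \<comment> \<open>A complex scalar acts as \<open>Re a + Im a I\<close> on the embedded side, so
    real linearity and commutation with \<open>I\<close> give complex linearity.\<close>
  have emb_scale: "L2_emb \<mu> (\<lambda>x. a * u x) = Re a *\<^sub>R L2_emb \<mu> u + Im a *\<^sub>R I (L2_emb \<mu> u)" if u: "u \<in> L2 \<mu>" for a u
  proof -
    have eq: "a * u x = of_real (Re a) * u x + of_real (Im a) * (\<i> * u x)" for x
      by (subst complex_eq[of a]) (simp add: algebra_simps)
    show ?thesis
      unfolding I[OF u] eq by (rule L2_emb_lin[OF u L2_scale[OF u]])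
  qed
  have SI: "x \<in> ?S \<Longrightarrow> I x \<in> ?S" for x using L2_rep(1)[of x] by (auto simp: I_def L2_scale)
  have emb_scale_U: "L2_emb \<mu> (U t (\<lambda>x. a * u x)) = L2_emb \<mu> (\<lambda>x. a * U t u x)" if u: "u \<in> L2 \<mu>" for t a u
  proof -
    have e: "L2_emb \<mu> u \<in> ?S" using u by blast
    have "grp t (Re a *\<^sub>R L2_emb \<mu> u + Im a *\<^sub>R I (L2_emb \<mu> u))
       = Re a *\<^sub>R grp t (L2_emb \<mu> u) + Im a *\<^sub>R I (grp t (L2_emb \<mu> u))"
      using contrD(4)[OF contr_grp S_scale[OF e] S_scale[OF SI[OF e]]]
      by (simp add: contrD(3)[OF contr_grp e] contrD(3)[OF contr_grp SI[OF e]] grp_I[OF e])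
    then show ?thesis
      by (simp add: U u L2_scale emb_scale)
  qed
  have "unitary_group \<mu> U"
    unfolding unitary_group_def unitary_op_def
  proof (intro conjI ballI allI)
    fix t u assume u: "u \<in> L2 \<mu>"
    show "U t u \<in> L2 \<mu>" by (rule U(1)[OF u])
    show "L2_norm \<mu> (U t u) = L2_norm \<mu> u"
      using grp_norm[of "L2_emb \<mu> u" t] norm_L2_emb[OF u] norm_L2_emb[OF U(1)[OF u], of t] U(2)[OF u, of t] u by simp
  next
    fix t u v a b assume u: "u \<in> L2 \<mu>" and v: "v \<in> L2 \<mu>"
    have "L2_emb \<mu> (U t (\<lambda>y. a * u y + b * v y))
       = grp t (L2_emb \<mu> (\<lambda>x. a * u x) + L2_emb \<mu> (\<lambda>x. b * v x))"
      by (simp add: U u v L2_add L2_scale L2_emb_add)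
    also have "\<dots> = L2_emb \<mu> (U t (\<lambda>x. a * u x)) + L2_emb \<mu> (U t (\<lambda>x. b * v x))"
      by (subst contrD(4)[OF contr_grp]) (auto simp: u v L2_scale U)
    also have "\<dots> = L2_emb \<mu> (\<lambda>x. a * U t u x + b * U t v x)"
      by (simp add: emb_scale_U u v U L2_emb_add L2_scale)
    finally show "AE x in \<mu>. U t (\<lambda>y. a * u y + b * v y) x = a * U t u x + b * U t v x"
      by (subst (asm) L2_emb_eq_iff) (auto intro!: U L2_lin u v)
  next
    fix t v assume v: "v \<in> L2 \<mu>"
    have "L2_emb \<mu> (U t (U (- t) v)) = L2_emb \<mu> v"
      using v by (simp add: U grp_inverse)
    then have "AE x in \<mu>. U t (U (- t) v) x = v x" by (subst (asm) L2_emb_eq_iff) (auto intro!: U v)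
    then show "\<exists>u\<in>L2 \<mu>. AE x in \<mu>. U t u x = v x" using U(1)[OF v] by blast
  next
    fix u assume u: "u \<in> L2 \<mu>"
    have "L2_emb \<mu> (U 0 u) = L2_emb \<mu> u" using u by (simp add: U)
    then show "AE x in \<mu>. U 0 u x = u x" by (subst (asm) L2_emb_eq_iff) (auto intro!: U u)
  next
    fix s t u assume u: "u \<in> L2 \<mu>"
    have "L2_emb \<mu> (U (s + t) u) = L2_emb \<mu> (U s (U t u))" using u by (simp add: U grp_add)
    then show "AE x in \<mu>. U (s + t) u x = U s (U t u) x" by (subst (asm) L2_emb_eq_iff) (auto intro!: U u)
  next
    fix u s assume u: "u \<in> L2 \<mu>"
    have "((\<lambda>t. norm (grp t (L2_emb \<mu> u) - grp s (L2_emb \<mu> u))) \<longlongrightarrow> 0) (at s)"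
      using grp_continuous[of "L2_emb \<mu> u" s] u by (simp add: LIM_zero tendsto_norm_zero)
    then show "((\<lambda>t. L2_norm \<mu> (\<lambda>x. U t u x - U s u x)) \<longlongrightarrow> 0) (at s)"
      by (simp add: dist_L2_emb[symmetric] U u)
  qed
  moreover have "group_hamiltonian \<mu> U = H"
  proof (intro set_eqI, clarify)
    fix u h
    show "(u, h) \<in> group_hamiltonian \<mu> U \<longleftrightarrow> (u, h) \<in> H"
    proof (cases "u \<in> L2 \<mu> \<and> h \<in> L2 \<mu>")
      case True
      then have u: "u \<in> L2 \<mu>" and h: "h \<in> L2 \<mu>" by auto
      have "L2_norm \<mu> (\<lambda>x. (U t u x - u x) / of_real t + \<i> * h x)
          = norm ((grp t (L2_emb \<mu> u) - L2_emb \<mu> u) /\<^sub>R t - L2_emb \<mu> (\<lambda>x. - \<i> * h x))" for t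
      proof -
        have "(grp t (L2_emb \<mu> u) - L2_emb \<mu> u) /\<^sub>R t = L2_emb \<mu> (\<lambda>x. of_real (inverse t) * (U t u x - u x))"
          by (simp only: L2_emb_scale L2_diff L2_emb_diff U u)
        then show ?thesis
          by (simp only: dist_L2_emb L2_scale L2_diff U u h)
             (simp add: field_simps)
      qed
      then have "(u, h) \<in> group_hamiltonian \<mu> U \<longleftrightarrow>
         ((\<lambda>t. (grp t (L2_emb \<mu> u) - L2_emb \<mu> u) /\<^sub>R t) \<longlongrightarrow> L2_emb \<mu> (\<lambda>x. - \<i> * h x)) (at 0)"
        unfolding group_hamiltonian_def by (simp add: u h LIM_zero_iff tendsto_norm_zero_iff)
      also have "\<dots> \<longleftrightarrow> (L2_emb \<mu> u, L2_emb \<mu> (\<lambda>x. - \<i> * h x)) \<in> L2_gen \<mu> H"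
        by (rule grp_derivative_iff) (use u h in \<open>auto intro!: imageI L2_minus_ii\<close>)
      also have "\<dots> \<longleftrightarrow> (u, h) \<in> H" by (rule L2_gen_iff[OF sa u h])
      finally show ?thesis .
    qed (use L in \<open>auto simp: group_hamiltonian_def\<close>)
  qed
  ultimately show ?thesis by blast
qed

text \<open>Existence gives the choice operator its meaning. Everything later about
  \<open>exp_group\<close> goes through these two properties.\<close>

lemma exp_group:
  assumes "self_adjoint \<mu> H"
  shows "unitary_group \<mu> (exp_group \<mu> H)" "group_hamiltonian \<mu> (exp_group \<mu> H) = H"
  using someI_ex[OF Stone_exists[OF assms]] by (simp_all add: exp_group_def)

section \<open>Approximate eigenvectors and the norm of a difference of groups\<close>

section \<open>Comparison of unitary groups\<close>

lemma unitary_groupD: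
  assumes "unitary_group \<mu> U" "u \<in> L2 \<mu>"
  shows "U t u \<in> L2 \<mu>" "L2_norm \<mu> (U t u) = L2_norm \<mu> u"
    "AE x in \<mu>. U 0 u x = u x" "AE x in \<mu>. U (s + t) u x = U s (U t u) x"
    "v \<in> L2 \<mu> \<Longrightarrow> AE x in \<mu>. U t (\<lambda>y. a * u y + b * v y) x = a * U t u x + b * U t v x"
    "((\<lambda>t. L2_norm \<mu> (\<lambda>x. U t u x - U s u x)) \<longlongrightarrow> 0) (at s)"
  using assms unfolding unitary_group_def unitary_op_def by blast+

lemma exp_ii_difference_quotient:
  "((\<lambda>s. cmod ((exp (- \<i> * of_real l * of_real s) - 1) / of_real s + \<i> * of_real l)) \<longlongrightarrow> 0) (at (0::real))"
proof -
  have "((\<lambda>z. exp (- \<i> * of_real l * z)) has_field_derivative (- \<i> * of_real l)) (at (of_real 0))"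
    by (auto intro!: derivative_eq_intros)
  then have "((\<lambda>s. exp (- \<i> * of_real l * of_real s)) has_vector_derivative (- \<i> * of_real l)) (at (0::real))"
    by (rule has_vector_derivative_real_field)
  then have lim: "(\<lambda>s. norm (exp (- \<i> * of_real l * of_real (0 + s)) - exp (- \<i> * of_real l * of_real 0)
       - s *\<^sub>R (- \<i> * of_real l)) / norm s) \<midarrow>0\<rightarrow> (0::real)"
    unfolding has_vector_derivative_def has_derivative_at by blast
  show ?thesis
  proof (rule Lim_transform_eventually[OF lim])
    show "\<forall>\<^sub>F s in at 0. norm (exp (- \<i> * of_real l * of_real (0 + s)) - exp (- \<i> * of_real l * of_real 0)
       - s *\<^sub>R (- \<i> * of_real l)) / norm s = cmod ((exp (- \<i> * of_real l * of_real s) - 1) / of_real s + \<i> * of_real l)"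
      unfolding eventually_at
    proof (intro exI[of _ 1] conjI ballI impI)
      fix s :: real assume s: "s \<noteq> 0 \<and> dist s 0 < 1"
      have "(exp (- \<i> * of_real l * of_real s) - 1) / of_real s + \<i> * of_real l
          = (exp (- \<i> * of_real l * of_real s) - 1 - s *\<^sub>R (- \<i> * of_real l)) / of_real s"
        using s by (simp add: field_simps scaleR_conv_of_real)
      then show "norm (exp (- \<i> * of_real l * of_real (0 + s)) - exp (- \<i> * of_real l * of_real 0)
       - s *\<^sub>R (- \<i> * of_real l)) / norm s = cmod ((exp (- \<i> * of_real l * of_real s) - 1) / of_real s + \<i> * of_real l)"
        by (simp add: norm_divide)
    qed simp
  qed
qed

text \<open>The distance between the two orbits is subadditive in time, so it is enough to know its
  derivative at 0.\<close>

proposition unitary_group_phase_bound: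
  assumes U: "unitary_group \<mu> U" and uh: "(u, h) \<in> group_hamiltonian \<mu> U"
  shows "L2_norm \<mu> (\<lambda>x. U t u x - exp (- \<i> * of_real l * of_real t) * u x)
     \<le> \<bar>t\<bar> * L2_norm \<mu> (\<lambda>x. h x - of_real l * u x)"
proof -
  note D = unitary_groupD[OF U]
  have u: "u \<in> L2 \<mu>" and h: "h \<in> L2 \<mu>"
    and gen: "((\<lambda>s. L2_norm \<mu> (\<lambda>x. (U s u x - u x) / of_real s + \<i> * h x)) \<longlongrightarrow> 0) (at 0)"
    using uh unfolding group_hamiltonian_def by auto
  define e where "e s = exp (- \<i> * of_real l * of_real s)" for s :: real
  define A where "A s = L2_norm \<mu> (\<lambda>x. U s u x - e s * u x)" for s
  have e_norm: "cmod (e s) = 1" for s by (simp add: e_def)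
  have AL2: "(\<lambda>x. U s u x - e s * u x) \<in> L2 \<mu>" for s by (intro L2_diff L2_scale D u)
  \<comment> \<open>The time \<open>s + r\<close> is reached through time \<open>r\<close>: the
    deviation at time \<open>r\<close> is carried along by the isometry \<open>U s\<close>, and the
    deviation at time \<open>s\<close> is multiplied by a phase of modulus 1.\<close>
  have step: "A (s + r) \<le> A r + A s" for s r
  proof -
    let ?v = "\<lambda>x. U r u x - e r * u x"
    have "AE x in \<mu>. U s (\<lambda>y. 1 * U r u y + (- e r) * u y) x = 1 * U s (U r u) x + (- e r) * U s u x"
      by (rule D(5)[OF D(1)[OF u] u])
    with D(4)[OF u, of s r] have ae: "AE x in \<mu>. U (s + r) u x - e (s + r) * u x = U s ?v x + e r * (U s u x - e s * u x)"
    proof eventually_elim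
      case (elim x)
      have "e (s + r) = e r * e s" by (simp add: e_def exp_add[symmetric] algebra_simps)
      with elim show ?case by (simp add: algebra_simps)
    qed
    have "A (s + r) = L2_norm \<mu> (\<lambda>x. U s ?v x + e r * (U s u x - e s * u x))"
      unfolding A_def
      by (rule L2_norm_cong_AE[OF _ _ ae])
         (intro L2_measurable AL2 L2_add L2_scale D)+
    also have "\<dots> \<le> L2_norm \<mu> (U s ?v) + L2_norm \<mu> (\<lambda>x. e r * (U s u x - e s * u x))"
      by (intro L2_norm_triangle L2_scale D AL2)
    also have "\<dots> = A r + A s"
      by (simp add: D(2)[OF AL2] L2_norm_scale e_norm A_def)
    finally show ?thesis .
  qed
  have A0: "A 0 = 0"
  proof -
    have "AE x in \<mu>. U 0 u x - e 0 * u x = 0" using D(3)[OF u] by eventually_elim (simp add: e_def)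
    then show ?thesis unfolding A_def using L2_norm_eq_0_iff[OF AL2] by blast
  qed
  have A_mult: "A (real n * s) \<le> real n * A s" for n s
  proof (induction n)
    case (Suc n)
    have "A (real (Suc n) * s) = A (real n * s + s)" by (simp add: algebra_simps)
    also have "\<dots> \<le> A s + A (real n * s)" by (rule step)
    finally show ?case using Suc by (simp add: algebra_simps)
  qed (simp add: A0)
  show ?thesis
  proof (cases "t = 0")
    case True
    then show ?thesis using A0 by (simp add: A_def e_def)
  next
    case False
    define q where "q s = cmod ((e s - 1) / of_real s + \<i> * of_real l)" for s :: real
    \<comment> \<open>A bound for \<open>A s / |s|\<close> by three defects: of the difference
      quotient, of the eigenvalue equation, and of the phase. The first and the last vanish as
      \<open>s\<close> tends to 0.\<close>
    define B where "B s = L2_norm \<mu> (\<lambda>x. (U s u x - u x) / of_real s + \<i> * h x)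
       + L2_norm \<mu> (\<lambda>x. h x - of_real l * u x) + q s * L2_norm \<mu> u" for s :: real
    have A_le: "A s \<le> \<bar>s\<bar> * B s" if s: "s \<noteq> 0" for s
    proof -
      let ?p = "\<lambda>x. (U s u x - u x) / of_real s + \<i> * h x"
        and ?q = "\<lambda>x. - \<i> * (h x - of_real l * u x)"
        and ?r = "\<lambda>x. - ((e s - 1) / of_real s + \<i> * of_real l) * u x"
      have pL2: "?p \<in> L2 \<mu>"
        using L2_add[OF L2_scale[OF L2_diff[OF D(1)[OF u] u], of "1 / of_real s"] L2_scale[OF h, of \<i>]]
        by simp
      have qL2: "?q \<in> L2 \<mu>" by (intro L2_scale L2_diff h u)
      have rL2: "?r \<in> L2 \<mu>" by (rule L2_scale[OF u])
      have eq: "U s u x - e s * u x = of_real s * ((?p x + ?q x) + ?r x)" for x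
        using s by (simp add: field_simps)
      have A_eq: "A s = \<bar>s\<bar> * L2_norm \<mu> (\<lambda>x. (?p x + ?q x) + ?r x)"
        unfolding A_def eq L2_norm_scale by simp
      have "L2_norm \<mu> (\<lambda>x. (?p x + ?q x) + ?r x) \<le> L2_norm \<mu> (\<lambda>x. ?p x + ?q x) + L2_norm \<mu> ?r"
        by (intro L2_norm_triangle L2_add pL2 qL2 rL2)
      moreover have "L2_norm \<mu> (\<lambda>x. ?p x + ?q x) \<le> L2_norm \<mu> ?p + L2_norm \<mu> ?q"
        by (intro L2_norm_triangle pL2 qL2)
      moreover have "L2_norm \<mu> ?p + L2_norm \<mu> ?q + L2_norm \<mu> ?r = B s"
        unfolding L2_norm_scale norm_minus_cancel B_def q_def by simp
      ultimately have "L2_norm \<mu> (\<lambda>x. (?p x + ?q x) + ?r x) \<le> B s" by linarith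
      then show ?thesis unfolding A_eq by (rule mult_left_mono) simp
    qed
    have "(q \<longlongrightarrow> 0) (at 0)" unfolding q_def[abs_def] e_def by (rule exp_ii_difference_quotient)
    then have "(B \<longlongrightarrow> 0 + L2_norm \<mu> (\<lambda>x. h x - of_real l * u x) + 0 * L2_norm \<mu> u) (at 0)"
      unfolding B_def[abs_def] by (intro tendsto_add tendsto_mult gen tendsto_const)
    then have B_lim: "(B \<longlongrightarrow> L2_norm \<mu> (\<lambda>x. h x - of_real l * u x)) (at 0)" by simp
    \<comment> \<open>Subdividing \<open>t\<close> into \<open>n + 1\<close> equal steps replaces
      \<open>B\<close> at \<open>t\<close> by \<open>B\<close> at arbitrarily small times, hence by
      its limit at 0.\<close>
    have "filterlim (\<lambda>n. t / real (Suc n)) (at 0) sequentially"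
      unfolding filterlim_at
    proof
      show "(\<lambda>n. t / real (Suc n)) \<longlonglongrightarrow> 0" by real_asymp
    qed (use False in auto)
    from filterlim_compose[OF B_lim this]
    have "(\<lambda>n. \<bar>t\<bar> * B (t / real (Suc n))) \<longlonglongrightarrow> \<bar>t\<bar> * L2_norm \<mu> (\<lambda>x. h x - of_real l * u x)"
      by (intro tendsto_mult_left)
    moreover have "A t \<le> \<bar>t\<bar> * B (t / real (Suc n))" for n
    proof -
      have "A t = A (real (Suc n) * (t / real (Suc n)))" by simp
      also have "\<dots> \<le> real (Suc n) * A (t / real (Suc n))" by (rule A_mult)
      also have "\<dots> \<le> real (Suc n) * (\<bar>t / real (Suc n)\<bar> * B (t / real (Suc n)))"
        using False by (intro mult_left_mono A_le) auto
      also have "\<dots> = \<bar>t\<bar> * B (t / real (Suc n))" by (simp add: abs_divide)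
      finally show ?thesis .
    qed
    ultimately have "A t \<le> \<bar>t\<bar> * L2_norm \<mu> (\<lambda>x. h x - of_real l * u x)"
      by (intro LIMSEQ_le_const) auto
    then show ?thesis by (simp add: A_def e_def)
  qed
qed

lemma op_norm_diff_le_2:
  assumes U: "unitary_group \<mu> U" and U': "unitary_group \<mu> U'"
  shows "op_norm \<mu> (\<lambda>u x. U t u x - U' t u x) \<le> 2"
  unfolding op_norm_def
proof (rule SUP_least, clarify)
  fix u assume u: "u \<in> L2 \<mu>" "L2_norm \<mu> u \<le> 1"
  have "L2_norm \<mu> (\<lambda>x. U t u x + (- 1) * U' t u x) \<le> L2_norm \<mu> (U t u) + L2_norm \<mu> (\<lambda>x. (- 1) * U' t u x)"
    by (intro L2_norm_triangle L2_scale unitary_groupD[OF U] unitary_groupD[OF U'] u)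
  also have "\<dots> \<le> 2"
    using u by (simp only: L2_norm_scale unitary_groupD(2)[OF U u(1)] unitary_groupD(2)[OF U' u(1)]) simp
  finally show "ennreal (L2_norm \<mu> (\<lambda>x. U t u x - U' t u x)) \<le> 2"
    using ennreal_leI[of _ 2] by simp
qed

lemma op_norm_diff_ge:
  assumes U: "unitary_group \<mu> U" and U': "unitary_group \<mu> U'" and u: "u \<in> L2 \<mu>" "L2_norm \<mu> u > 0"
  shows "ennreal (L2_norm \<mu> (\<lambda>x. U t u x - U' t u x) / L2_norm \<mu> u) \<le> op_norm \<mu> (\<lambda>u x. U t u x - U' t u x)"
proof -
  define c :: complex where "c = of_real (1 / L2_norm \<mu> u)"
  define v where "v = (\<lambda>x. c * u x)"
  have c: "cmod c = 1 / L2_norm \<mu> u" using u(2) unfolding c_def norm_of_real by simp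
  have v: "v \<in> L2 \<mu>" unfolding v_def by (rule L2_scale[OF u(1)])
  have nv: "L2_norm \<mu> v = 1" unfolding v_def L2_norm_scale c using u(2) by simp
  have ae: "AE x in \<mu>. G t v x = c * G t u x" if "unitary_group \<mu> G" for G
    using unitary_groupD(5)[OF that u(1) u(1), of t c 0] by (simp add: v_def)
  have "L2_norm \<mu> (\<lambda>x. U t v x - U' t v x) = L2_norm \<mu> (\<lambda>x. c * (U t u x - U' t u x))"
  proof (rule L2_norm_cong_AE)
    show "AE x in \<mu>. U t v x - U' t v x = c * (U t u x - U' t u x)"
      using ae[OF U] ae[OF U'] by eventually_elim (simp add: algebra_simps)
  qed (intro L2_measurable L2_diff L2_scale unitary_groupD[OF U] unitary_groupD[OF U'] u v)+
  also have "\<dots> = L2_norm \<mu> (\<lambda>x. U t u x - U' t u x) / L2_norm \<mu> u"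
    by (simp add: L2_norm_scale c)
  finally show ?thesis
    unfolding op_norm_def using v nv by (intro SUP_upper2[of v]) auto
qed

text \<open>For a fixed vector the norm is continuous in \<open>t\<close> by strong continuity, and
  a supremum of such functions has open strict superlevel sets. This is all the regularity in time
  that the essential supremum requires.\<close>

lemma open_op_norm_diff_greater:
  assumes U: "unitary_group \<mu> U" and U': "unitary_group \<mu> U'"
  shows "open {t. y < op_norm \<mu> (\<lambda>u x. U t u x - U' t u x)}"
proof -
  define n where "n u t = L2_norm \<mu> (\<lambda>x. U t u x - U' t u x)" for u t
  have cont: "continuous_on UNIV (n u)" if u: "u \<in> L2 \<mu>" for u
    unfolding continuous_on_def
  proof (intro ballI)
    fix s :: real
    note D = unitary_groupD(1)[OF U u] and D' = unitary_groupD(1)[OF U' u]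
    let ?a = "\<lambda>t. L2_norm \<mu> (\<lambda>x. U t u x - U s u x)" and ?b = "\<lambda>t. L2_norm \<mu> (\<lambda>x. U' t u x - U' s u x)"
    have bound: "n u r \<le> n u t + (L2_norm \<mu> (\<lambda>x. U r u x - U t u x) + L2_norm \<mu> (\<lambda>x. U' r u x - U' t u x))" for r t
      using L2_norm_diff_triangle[OF D[of r] D[of t] D'[of r]] L2_norm_diff_triangle[OF D[of t] D'[of t] D'[of r]]
        L2_norm_minus_commute[of \<mu> "U' r u" "U' t u"]
      by (simp add: n_def)
    have "(n u \<longlongrightarrow> n u s) (at s)"
    proof (rule LIM_zero_cancel, rule Lim_null_comparison)
      show "((\<lambda>t. ?a t + ?b t) \<longlongrightarrow> 0) (at s)"
        using tendsto_add[OF unitary_groupD(6)[OF U u] unitary_groupD(6)[OF U' u]] by simp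
      have "norm (n u t - n u s) \<le> ?a t + ?b t" for t
        using bound[of s t] bound[of t s] L2_norm_minus_commute[of \<mu> "U' s u" "U' t u"]
          L2_norm_minus_commute[of \<mu> "U s u" "U t u"] by (simp add: abs_le_iff)
      then show "\<forall>\<^sub>F t in at s. norm (n u t - n u s) \<le> ?a t + ?b t" by simp
    qed
    then show "(n u \<longlongrightarrow> n u s) (at s within UNIV)" by simp
  qed
  have "{t. y < op_norm \<mu> (\<lambda>u x. U t u x - U' t u x)}
     = (\<Union>u\<in>{u \<in> L2 \<mu>. L2_norm \<mu> u \<le> 1}. {t. y < ennreal (n u t)})"
    unfolding op_norm_def n_def less_SUP_iff by auto
  also have "open \<dots>"
  proof (intro open_UN ballI)
    fix u assume "u \<in> {u \<in> L2 \<mu>. L2_norm \<mu> u \<le> 1}"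
    then have "continuous_on UNIV (\<lambda>t. ennreal (n u t))"
      using cont by (intro continuous_on_ennreal) auto
    from open_Collect_less[OF continuous_on_const this] show "open {t. y < ennreal (n u t)}" .
  qed
  finally show ?thesis .
qed

text \<open>An open superlevel set containing an interior point of the interval has positive measure
  there, so the essential supremum cannot lie below a value taken at an interior point.\<close>

lemma esssup_lsc_bounds:
  fixes f :: "real \<Rightarrow> ennreal"
  assumes op: "\<And>y. open {t. y < f t}"
  shows "\<And>c. (\<And>t. f t \<le> c) \<Longrightarrow> esssup (lebesgue_on {0..T}) f \<le> c"
    and "\<And>t. 0 < t \<Longrightarrow> t < T \<Longrightarrow> f t \<le> esssup (lebesgue_on {0..T}) f"
proof -
  let ?M = "lebesgue_on {0..T}"
  have f: "f \<in> borel_measurable ?M"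
  proof (rule measurable_restrict_space1, rule borel_measurableI_greater)
    fix y
    show "{t \<in> space lebesgue. y < f t} \<in> sets lebesgue"
      using op[of y] by (simp add: borel_open)
  qed
  show "esssup ?M f \<le> c" if "\<And>t. f t \<le> c" for c
    by (rule esssup_I[OF f]) (simp add: that)
  show "f t \<le> esssup ?M f" if t: "0 < t" "t < T" for t
  proof (rule ccontr)
    assume "\<not> f t \<le> esssup ?M f"
    then have lt: "esssup ?M f < f t" by simp
    define Q where "Q = {s. esssup ?M f < f s} \<inter> {0<..<T}"
    have Q: "open Q" "t \<in> Q" unfolding Q_def using op lt t by auto
    have "emeasure ?M {s \<in> space ?M. esssup ?M f < f s} = 0" by (rule esssup_zero_measure)
    moreover have "{s \<in> space ?M. esssup ?M f < f s} = {s. esssup ?M f < f s} \<inter> {0..T}" by auto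
    moreover have "{s. esssup ?M f < f s} \<in> sets lebesgue" using op[of "esssup ?M f"] by (simp add: borel_open)
    ultimately have "emeasure lebesgue ({s. esssup ?M f < f s} \<inter> {0..T}) = 0"
      by (subst (asm) emeasure_restrict_space) auto
    moreover have "emeasure lebesgue Q \<le> emeasure lebesgue ({s. esssup ?M f < f s} \<inter> {0..T})"
      using op[of "esssup ?M f"] unfolding Q_def by (intro emeasure_mono) (auto simp: borel_open)
    ultimately have "emeasure lebesgue Q = 0" by simp
    then have "negligible Q" using Q(1) by (simp add: negligible_iff_emeasure0 borel_open)
    then show False using open_not_negligible[OF Q(1)] Q(2) by blast
  qed
qed

text \<open>At time \<open>pi / l\<close> the perturbed orbit \<open>v\<close> is near
  \<open>- u\<close> and the free orbit \<open>w\<close> is near \<open>u\<close>, each with error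
  at most \<open>pi / l\<close> times the norm of \<open>h\<close>. The triangle inequality along
  \<open>- u\<close>, \<open>v\<close>, \<open>w\<close>, \<open>u\<close> leaves twice the norm of
  \<open>u\<close> minus both errors.\<close>

proposition op_norm_diff_near_2:
  assumes H: "self_adjoint \<mu> H" and H': "self_adjoint \<mu> H'"
    and uh: "(u, h) \<in> H" and uh': "(u, \<lambda>x. h x + of_real l * u x) \<in> H'"
    and l: "l > 0" and u: "L2_norm \<mu> u > 0"
  shows "ennreal (2 - 2 * pi * L2_norm \<mu> h / (l * L2_norm \<mu> u))
     \<le> op_norm \<mu> (\<lambda>u x. exp_group \<mu> H' (pi / l) u x - exp_group \<mu> H (pi / l) u x)"
proof -
  note U = exp_group[OF H] and U' = exp_group[OF H']
  have uL: "u \<in> L2 \<mu>" using self_adjoint_L2[OF H uh] by simp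
  define t where "t = pi / l"
  have t: "t > 0" "l * t = pi" using l by (auto simp: t_def)
  let ?v = "exp_group \<mu> H' t u" and ?w = "exp_group \<mu> H t u"
  have v: "?v \<in> L2 \<mu>" and w: "?w \<in> L2 \<mu>"
    by (rule unitary_groupD(1)[OF U'(1) uL], rule unitary_groupD(1)[OF U(1) uL])
  have "- \<i> * of_real l * of_real t = - (\<i> * of_real (l * t))" by simp
  then have "exp (- \<i> * of_real l * of_real t) = (-1 :: complex)"
    unfolding t(2) by (simp only: exp_minus exp_pi_i') simp
  then have "L2_norm \<mu> (\<lambda>x. ?v x - (-1) * u x) \<le> \<bar>t\<bar> * L2_norm \<mu> (\<lambda>x. (h x + of_real l * u x) - of_real l * u x)"
    using unitary_group_phase_bound[OF U'(1), of u "\<lambda>x. h x + of_real l * u x" t l] uh' U'(2) by simp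
  then have 1: "L2_norm \<mu> (\<lambda>x. ?v x - (-1) * u x) \<le> t * L2_norm \<mu> h" using t by simp
  \<comment> \<open>The free orbit is compared with a constant phase, the case of eigenvalue
    0.\<close>
  have 2: "L2_norm \<mu> (\<lambda>x. ?w x - u x) \<le> t * L2_norm \<mu> h"
    using unitary_group_phase_bound[OF U(1), of u h t 0] uh U(2) t by simp
  have "L2_norm \<mu> (\<lambda>x. (-1) * u x - u x) \<le> L2_norm \<mu> (\<lambda>x. (-1) * u x - ?v x) + L2_norm \<mu> (\<lambda>x. ?v x - u x)"
    by (intro L2_norm_diff_triangle L2_scale uL v)
  also have "L2_norm \<mu> (\<lambda>x. ?v x - u x) \<le> L2_norm \<mu> (\<lambda>x. ?v x - ?w x) + L2_norm \<mu> (\<lambda>x. ?w x - u x)"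
    by (intro L2_norm_diff_triangle uL v w)
  also have "L2_norm \<mu> (\<lambda>x. (-1) * u x - ?v x) = L2_norm \<mu> (\<lambda>x. ?v x - (-1) * u x)"
    by (rule L2_norm_minus_commute)
  also have "L2_norm \<mu> (\<lambda>x. (-1) * u x - u x) = 2 * L2_norm \<mu> u"
    using L2_norm_scale[of \<mu> "-2" u] by simp
  finally have "2 * L2_norm \<mu> u - 2 * t * L2_norm \<mu> h \<le> L2_norm \<mu> (\<lambda>x. ?v x - ?w x)"
    using 1 2 by linarith
  then have "(2 * L2_norm \<mu> u - 2 * t * L2_norm \<mu> h) / L2_norm \<mu> u \<le> L2_norm \<mu> (\<lambda>x. ?v x - ?w x) / L2_norm \<mu> u"
    using u by (intro divide_right_mono) auto
  moreover have "(2 * L2_norm \<mu> u - 2 * t * L2_norm \<mu> h) / L2_norm \<mu> u = 2 - 2 * pi * L2_norm \<mu> h / (l * L2_norm \<mu> u)"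
    using u l by (simp add: t_def field_simps)
  ultimately have "2 - 2 * pi * L2_norm \<mu> h / (l * L2_norm \<mu> u) \<le> L2_norm \<mu> (\<lambda>x. ?v x - ?w x) / L2_norm \<mu> u"
    by simp
  from order_trans[OF ennreal_leI[OF this] op_norm_diff_ge[OF U'(1) U(1) uL u]]
  show ?thesis unfolding t_def .
qed

section \<open>Stability of self-adjointness under a bounded real multiplier\<close>

section \<open>Bounded perturbations\<close>

lemma L2_mult_bounded:
  assumes u: "u \<in> L2 \<mu>" and W: "W \<in> borel_measurable \<mu>" "\<And>x. \<bar>W x\<bar> \<le> B"
  shows "(\<lambda>x. of_real (W x) * u x) \<in> L2 \<mu>"
proof -
  have [measurable]: "u \<in> borel_measurable \<mu>" "W \<in> borel_measurable \<mu>"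
    using u W by (auto dest: L2_measurable)
  have "integrable \<mu> (\<lambda>x. (cmod (of_real (W x) * u x))\<^sup>2)"
  proof (rule Bochner_Integration.integrable_bound)
    show "integrable \<mu> (\<lambda>x. B\<^sup>2 * (cmod (u x))\<^sup>2)" by (intro integrable_mult_right L2_integrable u)
    show "AE x in \<mu>. norm ((cmod (of_real (W x) * u x))\<^sup>2) \<le> norm (B\<^sup>2 * (cmod (u x))\<^sup>2)"
    proof (rule AE_I2)
      fix x
      have "\<bar>W x\<bar>\<^sup>2 \<le> B\<^sup>2" by (rule power_mono[OF W(2)]) simp
      then show "norm ((cmod (of_real (W x) * u x))\<^sup>2) \<le> norm (B\<^sup>2 * (cmod (u x))\<^sup>2)"
        by (simp add: norm_mult power_mult_distrib mult_right_mono)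
    qed
  qed measurable
  then show ?thesis by (simp add: L2_def)
qed

text \<open>A pair \<open>(v, k)\<close> is adjoint to \<open>H'\<close> exactly when
  \<open>(v, k - W v)\<close> is adjoint to \<open>H\<close>, since a bounded real multiplier is
  symmetric on all of \<open>L2\<close>. The graph of \<open>H'\<close> is described up to null
  sets, the form in which Schroedinger operators are given.\<close>

lemma self_adjoint_bounded_perturbation:
  assumes sa: "self_adjoint \<mu> H" and W: "W \<in> borel_measurable \<mu>" "\<And>x. \<bar>W x\<bar> \<le> B"
    and H': "\<And>u k. (u, k) \<in> H' \<longleftrightarrow> k \<in> L2 \<mu> \<and> (\<exists>h. (u, h) \<in> H \<and> (AE x in \<mu>. k x = h x + of_real (W x) * u x))"
  shows "self_adjoint \<mu> H'"
proof -
  note L = self_adjoint_L2[OF sa]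
  have Wu: "(\<lambda>x. of_real (W x) * u x) \<in> L2 \<mu>" if "u \<in> L2 \<mu>" for u
    by (rule L2_mult_bounded[OF that W])
  have W_sym: "L2_inner \<mu> (\<lambda>x. of_real (W x) * u x) v = L2_inner \<mu> u (\<lambda>x. of_real (W x) * v x)" for u v
    unfolding L2_inner_def by (simp add: mult_ac)
  have mem: "(u, \<lambda>x. h x + of_real (W x) * u x) \<in> H'" if "(u, h) \<in> H" for u h
    unfolding H' using that by (auto intro!: L2_add Wu L[OF that])
  have inner_sum: "L2_inner \<mu> (\<lambda>x. h x + of_real (W x) * u x) v
      = L2_inner \<mu> h v + L2_inner \<mu> u (\<lambda>x. of_real (W x) * v x)"
    if "h \<in> L2 \<mu>" "u \<in> L2 \<mu>" "v \<in> L2 \<mu>" for h u v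
    using L2_inner_lin[OF that(1) Wu[OF that(2)] that(3), of 1 1] by (simp add: W_sym)
  have "densely_defined \<mu> H'"
    unfolding densely_defined_def
  proof (intro ballI allI impI)
    fix u and e :: real assume "u \<in> L2 \<mu>" "0 < e"
    then obtain v where "v \<in> Domain H" "L2_norm \<mu> (\<lambda>x. u x - v x) < e"
      using sa unfolding self_adjoint_def densely_defined_def by blast
    then show "\<exists>v\<in>Domain H'. L2_norm \<mu> (\<lambda>x. u x - v x) < e" using mem by blast
  qed
  moreover have "adjoint_op \<mu> H' = H'"
  proof (intro set_eqI, clarify)
    fix v k
    show "(v, k) \<in> adjoint_op \<mu> H' \<longleftrightarrow> (v, k) \<in> H'"
    proof
      assume "(v, k) \<in> adjoint_op \<mu> H'"
      then have v: "v \<in> L2 \<mu>" and k: "k \<in> L2 \<mu>"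
        and eq: "\<And>u h. (u, h) \<in> H' \<Longrightarrow> L2_inner \<mu> h v = L2_inner \<mu> u k"
        unfolding adjoint_op_def by blast+
      let ?k = "\<lambda>x. k x - of_real (W x) * v x"
      have "(v, ?k) \<in> H"
      proof (rule self_adjoint_memI[OF sa v])
        show "?k \<in> L2 \<mu>" by (intro L2_diff k Wu v)
        fix u h assume uh: "(u, h) \<in> H"
        have "L2_inner \<mu> h v + L2_inner \<mu> u (\<lambda>x. of_real (W x) * v x) = L2_inner \<mu> u k"
          using eq[OF mem[OF uh]] by (simp add: inner_sum L[OF uh] v)
        moreover have "L2_inner \<mu> u ?k = L2_inner \<mu> u k - L2_inner \<mu> u (\<lambda>x. of_real (W x) * v x)"
          using L2_inner_lin_right[OF k Wu[OF v] L(1)[OF uh], of 1 "-1"] by simp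
        ultimately show "L2_inner \<mu> h v = L2_inner \<mu> u ?k" by (metis add_diff_cancel_right')
      qed
      then show "(v, k) \<in> H'" unfolding H' using k by (intro conjI exI[of _ ?k]) auto
    next
      assume "(v, k) \<in> H'"
      then obtain k0 where k: "k \<in> L2 \<mu>" and vk0: "(v, k0) \<in> H"
        and kae: "AE x in \<mu>. k x = k0 x + of_real (W x) * v x" unfolding H' by blast
      have "L2_inner \<mu> h v = L2_inner \<mu> u k" if uh: "(u, h) \<in> H'" for u h
      proof -
        from uh obtain h0 where h: "h \<in> L2 \<mu>" and uh0: "(u, h0) \<in> H"
          and hae: "AE x in \<mu>. h x = h0 x + of_real (W x) * u x" unfolding H' by blast
        note u = L[OF uh0] and v = L[OF vk0]
        have "L2_inner \<mu> h v = L2_inner \<mu> (\<lambda>x. h0 x + of_real (W x) * u x) v"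
          by (intro L2_inner_cong_AE L2_measurable L2_add Wu u v h) (use hae in auto)
        also have "\<dots> = L2_inner \<mu> u k0 + L2_inner \<mu> u (\<lambda>x. of_real (W x) * v x)"
          by (simp add: inner_sum u v self_adjoint_symmetric[OF sa uh0 vk0])
        also have "\<dots> = L2_inner \<mu> u (\<lambda>x. k0 x + of_real (W x) * v x)"
          using L2_inner_lin_right[OF v(2) Wu[OF v(1)] u(1), of 1 1] by simp
        also have "\<dots> = L2_inner \<mu> u k"
          by (intro L2_inner_cong_AE L2_measurable L2_add Wu u v k) (use kae in auto)
        finally show ?thesis .
      qed
      then show "(v, k) \<in> adjoint_op \<mu> H'"
        unfolding adjoint_op_def using k L(1)[OF vk0] by auto
    qed
  qed
  ultimately show ?thesis unfolding self_adjoint_def by simp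
qed

section \<open>Closure properties of smoothness, cut-offs and inverse matrices\<close>

section \<open>Calculus of smooth functions\<close>

text \<open>Derivatives at a point of an open set depend on nearby values only, so smoothness on the
  set ignores what a function does outside it.\<close>

lemma times_differentiable_on_cong:
  assumes "open S" "\<And>x. x \<in> S \<Longrightarrow> f x = g x"
  shows "times_differentiable_on k f S \<longleftrightarrow> times_differentiable_on k g S"
proof -
  have *: "times_differentiable_on k g S"
    if "times_differentiable_on k f S" "\<And>x. x \<in> S \<Longrightarrow> f x = g x" for f g
    using that
  proof (induction k arbitrary: f g)
    case 0
    then show ?case using continuous_on_cong[of S S f g] by simp
  next
    case (Suc k)
    have der: "(g has_derivative frechet_derivative f (at x)) (at x)" if x: "x \<in> S" for x
    proof (rule has_derivative_transform_within_open[OF _ assms(1) x])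
      show "(f has_derivative frechet_derivative f (at x)) (at x)"
        using Suc.prems(1) x frechet_derivative_works by auto
    qed (use Suc.prems(2) in auto)
    then have "frechet_derivative g (at x) = frechet_derivative f (at x)" if "x \<in> S" for x
      using frechet_derivative_at that by metis
    then have "times_differentiable_on k (\<lambda>x. frechet_derivative g (at x) v) S" for v
      using Suc.IH[of "\<lambda>x. frechet_derivative f (at x) v" "\<lambda>x. frechet_derivative g (at x) v"] Suc.prems(1)
      by simp
    then show ?case using der by (auto simp: differentiable_def)
  qed
  show ?thesis using *[of f g] *[of g f] assms(2) by auto
qed

lemma times_differentiable_on_subset:
  "times_differentiable_on k f S \<Longrightarrow> T \<subseteq> S \<Longrightarrow> times_differentiable_on k f T"
  by (induction k arbitrary: f) (auto intro: continuous_on_subset)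

lemma times_differentiable_on_Un:
  assumes "open S" "open T" "times_differentiable_on k f S" "times_differentiable_on k f T"
  shows "times_differentiable_on k f (S \<union> T)"
  using assms(3,4) by (induction k arbitrary: f) (auto intro: continuous_on_open_Un assms(1,2))

lemma times_differentiable_on_Suc_imp:
  "times_differentiable_on (Suc k) f S \<Longrightarrow> times_differentiable_on k f S"
proof (induction k arbitrary: f)
  case 0
  then show ?case
    by (auto intro!: continuous_at_imp_continuous_on differentiable_imp_continuous_within)
next
  case (Suc k)
  then show ?case unfolding times_differentiable_on.simps(2)[of "Suc k"] times_differentiable_on.simps(2)[of k]
    by blast
qed

text \<open>The definition speaks of \<open>frechet_derivative\<close>; on an open set any known
  derivative may take its place, which is how the inductions on the order proceed.\<close>

lemma times_differentiable_on_SucI: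
  assumes "open S" "\<And>x. x \<in> S \<Longrightarrow> (f has_derivative f' x) (at x)"
    and "\<And>v. times_differentiable_on k (\<lambda>x. f' x v) S"
  shows "times_differentiable_on (Suc k) f S"
proof -
  have "frechet_derivative f (at x) = f' x" if "x \<in> S" for x
    using frechet_derivative_at[OF assms(2)[OF that]] by simp
  then have "times_differentiable_on k (\<lambda>x. frechet_derivative f (at x) v) S" for v
    using assms(3)[of v] times_differentiable_on_cong[OF assms(1), of "\<lambda>x. f' x v" "\<lambda>x. frechet_derivative f (at x) v"]
    by simp
  then show ?thesis using assms(2) by (auto simp: differentiable_def)
qed

lemma times_differentiable_on_SucD:
  assumes "times_differentiable_on (Suc k) f S" "x \<in> S"
  shows "(f has_derivative frechet_derivative f (at x)) (at x)"
  using assms frechet_derivative_works by auto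

lemma times_differentiable_on_const: "times_differentiable_on k (\<lambda>x. c) S"
  by (induction k arbitrary: c) auto

lemma times_differentiable_on_add:
  assumes "open S" "times_differentiable_on k f S" "times_differentiable_on k g S"
  shows "times_differentiable_on k (\<lambda>x. f x + g x) S"
  using assms(2,3)
proof (induction k arbitrary: f g)
  case (Suc k)
  show ?case
    by (rule times_differentiable_on_SucI[OF assms(1) has_derivative_add])
       (use Suc in \<open>auto intro: times_differentiable_on_SucD\<close>)
qed (auto intro: continuous_on_add)

lemma (in bounded_linear) times_differentiable_on_compose:
  assumes "open S" "times_differentiable_on k g S"
  shows "times_differentiable_on k (\<lambda>x. f (g x)) S"
  using assms(2)
proof (induction k arbitrary: g)
  case (Suc k)
  show ?case
    by (rule times_differentiable_on_SucI[OF assms(1) has_derivative])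
       (use Suc in \<open>auto intro: times_differentiable_on_SucD\<close>)
qed (auto intro: continuous_on)

lemma (in bounded_bilinear) times_differentiable_on_mult:
  assumes "open S" "times_differentiable_on k f S" "times_differentiable_on k g S"
  shows "times_differentiable_on k (\<lambda>x. prod (f x) (g x)) S"
  using assms(2,3)
proof (induction k arbitrary: f g)
  case (Suc k)
  note * = times_differentiable_on_Suc_imp[OF Suc.prems(1)] times_differentiable_on_Suc_imp[OF Suc.prems(2)]
  show ?case
  proof (rule times_differentiable_on_SucI[OF assms(1) FDERIV])
    fix v
    show "times_differentiable_on k (\<lambda>x. prod (f x) (frechet_derivative g (at x) v)
        + prod (frechet_derivative f (at x) v) (g x)) S"
      by (intro times_differentiable_on_add[OF assms(1)] Suc.IH *) (use Suc.prems in auto)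
  qed (use Suc.prems in \<open>auto intro: times_differentiable_on_SucD\<close>)
qed (auto intro: continuous_on)

lemmas times_differentiable_on_times = bounded_bilinear.times_differentiable_on_mult[OF bounded_bilinear_mult]
lemmas times_differentiable_on_scaleR = bounded_bilinear.times_differentiable_on_mult[OF bounded_bilinear_scaleR]

lemma times_differentiable_on_sum:
  assumes "open S" "\<And>i. i \<in> I \<Longrightarrow> times_differentiable_on k (f i) S"
  shows "times_differentiable_on k (\<lambda>x. \<Sum>i\<in>I. f i x) S"
  using assms(2)
  by (induction I rule: infinite_finite_induct)
     (auto intro!: times_differentiable_on_const times_differentiable_on_add[OF assms(1)])

lemma times_differentiable_on_prod:
  fixes f :: "'i \<Rightarrow> 'a::real_normed_vector \<Rightarrow> real"
  assumes "open S" "\<And>i. i \<in> I \<Longrightarrow> times_differentiable_on k (f i) S"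
  shows "times_differentiable_on k (\<lambda>x. \<Prod>i\<in>I. f i x) S"
  using assms(2)
  by (induction I rule: infinite_finite_induct)
     (auto intro!: times_differentiable_on_const times_differentiable_on_times[OF assms(1)])

text \<open>The derivative is a composition in which both linear maps vary with \<open>x\<close>.
  Expanding the inner one in \<open>Basis\<close> turns it into a finite sum of products of
  functions that the induction hypothesis covers; hence the Euclidean space in the middle.\<close>

lemma times_differentiable_on_o:
  fixes g :: "'e::real_normed_vector \<Rightarrow> 'm::euclidean_space" and f :: "'m \<Rightarrow> 'f::real_normed_vector"
  assumes S: "open S" and T: "open T" and gST: "g ` S \<subseteq> T"
    and "times_differentiable_on k g S" "times_differentiable_on k f T"
  shows "times_differentiable_on k (f \<circ> g) S"
  using assms(4,5)
proof (induction k arbitrary: f)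
  case 0
  then show ?case using gST continuous_on_compose2[of T f S g] by (auto simp: o_def)
next
  case (Suc k)
  let ?D = "frechet_derivative"
  have f: "(f has_derivative ?D f (at (g x))) (at (g x))" and g: "(g has_derivative ?D g (at x)) (at x)"
    if "x \<in> S" for x
    using that gST Suc.prems by (auto intro!: times_differentiable_on_SucD)
  show ?case
  proof (rule times_differentiable_on_SucI[OF S])
    fix x assume x: "x \<in> S"
    interpret lf: bounded_linear "?D f (at (g x))" using f[OF x] by (rule has_derivative_bounded_linear)
    have "(f \<circ> g has_derivative ?D f (at (g x)) \<circ> ?D g (at x)) (at x)"
      by (rule diff_chain_at[OF g[OF x] f[OF x]])
    moreover have "?D f (at (g x)) \<circ> ?D g (at x) = (\<lambda>v. \<Sum>b\<in>Basis. (?D g (at x) v \<bullet> b) *\<^sub>R (?D f (at (g x)) b))"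
    proof
      fix v
      have "?D f (at (g x)) (?D g (at x) v) = ?D f (at (g x)) (\<Sum>b\<in>Basis. (?D g (at x) v \<bullet> b) *\<^sub>R b)"
        by (simp add: euclidean_representation)
      then show "(?D f (at (g x)) \<circ> ?D g (at x)) v = (\<Sum>b\<in>Basis. (?D g (at x) v \<bullet> b) *\<^sub>R (?D f (at (g x)) b))"
        by (simp add: lf.sum lf.scaleR)
    qed
    ultimately show "(f \<circ> g has_derivative (\<lambda>v. \<Sum>b\<in>Basis. (?D g (at x) v \<bullet> b) *\<^sub>R (?D f (at (g x)) b))) (at x)"
      by simp
  next
    fix v
    show "times_differentiable_on k (\<lambda>x. \<Sum>b\<in>Basis. (?D g (at x) v \<bullet> b) *\<^sub>R (?D f (at (g x)) b)) S"
    proof (intro times_differentiable_on_sum times_differentiable_on_scaleR S)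
      fix b :: 'm
      show "times_differentiable_on k (\<lambda>x. ?D g (at x) v \<bullet> b) S"
        by (intro bounded_linear.times_differentiable_on_compose[OF bounded_linear_inner_left S])
           (use Suc.prems in simp)
      show "times_differentiable_on k (\<lambda>x. ?D f (at (g x)) b) S"
        using Suc.IH[of "\<lambda>y. ?D f (at y) b"] Suc.prems times_differentiable_on_Suc_imp[OF Suc.prems(1)]
        by (simp add: o_def)
    qed
  qed
qed

lemma times_differentiable_on_Suc_real:
  fixes f :: "real \<Rightarrow> real"
  assumes "open S" "\<And>x. x \<in> S \<Longrightarrow> (f has_real_derivative f' x) (at x)" "times_differentiable_on k f' S"
  shows "times_differentiable_on (Suc k) f S"
proof (rule times_differentiable_on_SucI[OF assms(1)])
  show "(f has_derivative (*) (f' x)) (at x)" if "x \<in> S" for x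
    using assms(2)[OF that] by (rule has_field_derivative_imp_has_derivative)
  show "times_differentiable_on k (\<lambda>x. f' x * v) S" for v
    by (intro times_differentiable_on_times assms times_differentiable_on_const)
qed

lemma smooth_on_inverse: "smooth_on (- {0}) (inverse :: real \<Rightarrow> real)"
  unfolding smooth_on_def
proof
  fix k
  show "times_differentiable_on k (inverse :: real \<Rightarrow> real) (- {0})"
  proof (induction k)
    case (Suc k)
    show ?case
    proof (rule times_differentiable_on_Suc_real)
      show "(inverse has_real_derivative (- 1) * (inverse x * inverse x)) (at x)" if "x \<in> - {0}" for x
        using DERIV_inverse[of x] that by (simp add: power2_eq_square)
      show "times_differentiable_on k (\<lambda>x. (- 1) * (inverse x * inverse x)) (- {0 :: real})"
        by (intro times_differentiable_on_times times_differentiable_on_const Suc) auto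
    qed auto
  qed (auto intro: continuous_intros)
qed

lemma smooth_on_sqrt: "smooth_on {0<..} sqrt"
  unfolding smooth_on_def
proof
  fix k
  show "times_differentiable_on k sqrt {0<..}"
  proof (induction k)
    case (Suc k)
    show ?case
    proof (rule times_differentiable_on_Suc_real)
      show "(sqrt has_real_derivative (1 / 2) * (inverse \<circ> sqrt) x) (at x)" if "x \<in> {0<..}" for x
        using DERIV_real_sqrt[of x] that by (simp add: field_simps)
      have "times_differentiable_on k (inverse \<circ> sqrt) {0<..}"
        by (rule times_differentiable_on_o[of _ "- {0}"])
           (use Suc smooth_on_inverse in \<open>auto simp: smooth_on_def\<close>)
      then show "times_differentiable_on k (\<lambda>x. (1 / 2) * (inverse \<circ> sqrt) x) {0<..}"
        by (intro times_differentiable_on_times times_differentiable_on_const) (auto simp: o_def)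
    qed auto
  qed (auto intro!: continuous_intros)
qed

lemma smooth_on_cong: "open S \<Longrightarrow> (\<And>x. x \<in> S \<Longrightarrow> f x = g x) \<Longrightarrow> smooth_on S f \<longleftrightarrow> smooth_on S g"
  unfolding smooth_on_def using times_differentiable_on_cong by blast

lemma smooth_on_subset: "smooth_on S f \<Longrightarrow> T \<subseteq> S \<Longrightarrow> smooth_on T f"
  unfolding smooth_on_def using times_differentiable_on_subset by blast

lemma smooth_on_Un: "open S \<Longrightarrow> open T \<Longrightarrow> smooth_on S f \<Longrightarrow> smooth_on T f \<Longrightarrow> smooth_on (S \<union> T) f"
  unfolding smooth_on_def using times_differentiable_on_Un by blast

lemma smooth_on_const: "smooth_on S (\<lambda>x. c)"
  by (simp add: smooth_on_def times_differentiable_on_const)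

lemma smooth_on_add: "open S \<Longrightarrow> smooth_on S f \<Longrightarrow> smooth_on S g \<Longrightarrow> smooth_on S (\<lambda>x. f x + g x)"
  by (simp add: smooth_on_def times_differentiable_on_add)

lemma smooth_on_mult:
  fixes f g :: "'a::real_normed_vector \<Rightarrow> real"
  shows "open S \<Longrightarrow> smooth_on S f \<Longrightarrow> smooth_on S g \<Longrightarrow> smooth_on S (\<lambda>x. f x * g x)"
  by (simp add: smooth_on_def times_differentiable_on_times)

lemma smooth_on_inner:
  "open S \<Longrightarrow> smooth_on S f \<Longrightarrow> smooth_on S g \<Longrightarrow> smooth_on S (\<lambda>x. f x \<bullet> g x)"
  by (simp add: smooth_on_def bounded_bilinear.times_differentiable_on_mult[OF bounded_bilinear_inner])

lemma smooth_on_sum: "open S \<Longrightarrow> (\<And>i. i \<in> I \<Longrightarrow> smooth_on S (f i)) \<Longrightarrow> smooth_on S (\<lambda>x. \<Sum>i\<in>I. f i x)"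
  by (simp add: smooth_on_def times_differentiable_on_sum)

lemma smooth_on_prod:
  fixes f :: "'i \<Rightarrow> 'a::real_normed_vector \<Rightarrow> real"
  shows "open S \<Longrightarrow> (\<And>i. i \<in> I \<Longrightarrow> smooth_on S (f i)) \<Longrightarrow> smooth_on S (\<lambda>x. \<Prod>i\<in>I. f i x)"
  by (simp add: smooth_on_def times_differentiable_on_prod)

lemma smooth_on_o:
  fixes g :: "'e::real_normed_vector \<Rightarrow> 'm::euclidean_space"
  shows "open S \<Longrightarrow> open T \<Longrightarrow> g ` S \<subseteq> T \<Longrightarrow> smooth_on S g \<Longrightarrow> smooth_on T f \<Longrightarrow> smooth_on S (f \<circ> g)"
  unfolding smooth_on_def using times_differentiable_on_o by blast

lemma smooth_on_ident: "open S \<Longrightarrow> smooth_on S (\<lambda>x. x)"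
  unfolding smooth_on_def
proof
  fix k assume "open S"
  then show "times_differentiable_on k (\<lambda>x. x) S"
    by (cases k) (auto intro!: times_differentiable_on_SucI times_differentiable_on_const has_derivative_ident continuous_on_id)
qed

lemma smooth_on_continuous_on: "smooth_on S f \<Longrightarrow> continuous_on S f"
  unfolding smooth_on_def using times_differentiable_on.simps(1) by blast

lemma smooth_on_has_derivative:
  "smooth_on S f \<Longrightarrow> x \<in> S \<Longrightarrow> (f has_derivative frechet_derivative f (at x)) (at x)"
  unfolding smooth_on_def using times_differentiable_on_SucD by blast

lemma smooth_on_frechet_derivative:
  "smooth_on S f \<Longrightarrow> smooth_on S (\<lambda>x. frechet_derivative f (at x) v)"
  unfolding smooth_on_def using times_differentiable_on.simps(2) by blast

lemma smooth_on_real_inverse: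
  fixes f :: "'a::real_normed_vector \<Rightarrow> real"
  assumes "open S" "smooth_on S f" "\<And>x. x \<in> S \<Longrightarrow> f x \<noteq> 0"
  shows "smooth_on S (\<lambda>x. inverse (f x))"
  using smooth_on_o[OF assms(1) _ _ assms(2) smooth_on_inverse] assms(3) by (force simp: o_def)

lemma smooth_on_real_sqrt:
  assumes "open S" "smooth_on S f" "\<And>x. x \<in> S \<Longrightarrow> f x > 0"
  shows "smooth_on S (\<lambda>x. sqrt (f x))"
  using smooth_on_o[OF assms(1) _ _ assms(2) smooth_on_sqrt] assms(3) by (force simp: o_def)

subsection \<open>A smooth plateau function\<close>

text \<open>The family \<open>p (1 / x) * exp (- 1 / x)\<close>, extended by zero to \<open>x \<le> 0\<close>, is closed under derivatives.\<close>

definition flat :: "real poly \<Rightarrow> real \<Rightarrow> real" where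
  "flat p x = (if x > 0 then poly p (1 / x) * exp (- (1 / x)) else 0)"

text \<open>From the right \<open>1 / x\<close> tends to infinity and every monomial in it loses
  against the exponential; from the left the function is zero.\<close>

lemma flat_tendsto_0: "((\<lambda>x. flat p x) \<longlongrightarrow> 0) (at 0)"
proof -
  have pos: "((\<lambda>x. poly p (1 / x) * exp (- (1 / x))) \<longlongrightarrow> 0) (at_right 0)"
  proof (induction p)
    case (pCons a p)
    have mono: "((\<lambda>x::real. (1 / x) ^ n * exp (- (1 / x))) \<longlongrightarrow> 0) (at_right 0)" for n
    proof -
      have "((\<lambda>x::real. x ^ n / exp x) \<longlongrightarrow> 0) at_top" by (rule tendsto_power_div_exp_0)
      moreover have "filterlim (\<lambda>x::real. 1 / x) at_top (at_right 0)"
        using filterlim_inverse_at_top_right by (simp add: inverse_eq_divide)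
      ultimately show ?thesis
        using filterlim_compose by (fastforce simp: exp_minus divide_inverse)
    qed
    have "((\<lambda>x::real. \<Sum>i\<le>degree (pCons a p). coeff (pCons a p) i * ((1 / x) ^ i * exp (- (1 / x)))) \<longlongrightarrow>
        (\<Sum>i\<le>degree (pCons a p). coeff (pCons a p) i * 0)) (at_right 0)"
      by (intro tendsto_sum tendsto_mult tendsto_const mono)
    then show ?case by (simp add: poly_altdef sum_distrib_right mult.assoc del: coeff_pCons)
  qed simp
  have "((\<lambda>x. flat p x) \<longlongrightarrow> 0) (at_right 0)"
    by (rule Lim_transform_eventually[OF pos]) (auto simp: flat_def eventually_at_filter)
  moreover have "((\<lambda>x. flat p x) \<longlongrightarrow> 0) (at_left 0)"
    by (rule Lim_transform_eventually[OF tendsto_const]) (auto simp: flat_def eventually_at_filter)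
  ultimately show ?thesis by (simp add: filterlim_split_at)
qed

text \<open>For positive \<open>x\<close> the chain rule through \<open>1 / x\<close> turns
  \<open>p\<close> into \<open>X^2 (p - p')\<close>. At 0 the difference quotient is itself the flat
  function of \<open>X p\<close>, which tends to 0.\<close>

lemma flat_derivative: "(flat p has_real_derivative flat ([:0, 0, 1:] * (p - pderiv p)) x) (at x)"
proof -
  consider "x > 0" | "x < 0" | "x = 0" by linarith
  then show ?thesis
  proof cases
    case 1
    have "((\<lambda>x. poly p (1 / x) * exp (- (1 / x))) has_real_derivative
       poly ([:0, 0, 1:] * (p - pderiv p)) (1 / x) * exp (- (1 / x))) (at x)"
      using 1 by (auto intro!: derivative_eq_intros simp: field_simps power2_eq_square)
    then have "(flat p has_real_derivative poly ([:0, 0, 1:] * (p - pderiv p)) (1 / x) * exp (- (1 / x))) (at x)"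
      by (rule has_field_derivative_transform_within_open[of _ _ _ "{0<..}"]) (use 1 in \<open>auto simp: flat_def\<close>)
    then show ?thesis using 1 by (simp add: flat_def)
  next
    case 2
    have "((\<lambda>x. 0) has_real_derivative 0) (at x)" by simp
    then have "(flat p has_real_derivative 0) (at x)"
      by (rule has_field_derivative_transform_within_open[of _ _ _ "{..<0}"]) (use 2 in \<open>auto simp: flat_def\<close>)
    then show ?thesis using 2 by (simp add: flat_def)
  next
    case 3
    have "((\<lambda>h. (flat p (0 + h) - flat p 0) / h) \<longlongrightarrow> 0) (at 0)"
    proof (rule Lim_transform_eventually[OF flat_tendsto_0[of "[:0, 1:] * p"]])
      show "\<forall>\<^sub>F h in at 0. flat ([:0, 1:] * p) h = (flat p (0 + h) - flat p 0) / h"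
        by (auto simp: eventually_at_filter flat_def)
    qed
    then show ?thesis using 3 by (simp add: DERIV_def flat_def)
  qed
qed

lemma smooth_on_flat: "smooth_on UNIV (flat p)"
  unfolding smooth_on_def
proof
  fix k
  show "times_differentiable_on k (flat p) UNIV"
  proof (induction k arbitrary: p)
    case 0
    show ?case
      using DERIV_continuous[OF flat_derivative[of p]] by (simp add: continuous_on_eq_continuous_at)
  next
    case (Suc k)
    show ?case by (rule times_differentiable_on_Suc_real[OF _ flat_derivative Suc]) simp
  qed
qed

text \<open>The inner \<open>flat\<close> is zero on the unit ball and at least \<open>1 / 2\<close>
  outside the ball of radius 2, so the outer argument runs from \<open>1 / 2\<close> down to
  nonpositive values; the first factor normalises the value on the unit ball to 1. Subtraction is
  written with \<open>- 1\<close> to suit the rules for sums and products.\<close>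

definition plateau :: "'a::euclidean_space \<Rightarrow> real" where
  "plateau x = inverse (flat 1 (1 / 2)) * flat 1 (1 / 2 + (- 1) * flat 1 (x \<bullet> x + (- 1)))"

lemma smooth_on_plateau: "smooth_on UNIV (plateau :: 'a::euclidean_space \<Rightarrow> real)"
proof -
  have 1: "smooth_on UNIV (\<lambda>x::'a. x \<bullet> x + (- 1))"
    by (intro smooth_on_add smooth_on_inner smooth_on_ident smooth_on_const) auto
  have "smooth_on UNIV (flat 1 \<circ> (\<lambda>x::'a. x \<bullet> x + (- 1)))"
    by (rule smooth_on_o[OF _ _ _ 1 smooth_on_flat]) auto
  then have 2: "smooth_on UNIV (\<lambda>x::'a. 1 / 2 + (- 1) * flat 1 (x \<bullet> x + (- 1)))"
    by (intro smooth_on_add smooth_on_mult smooth_on_const) (auto simp: o_def)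
  have "smooth_on UNIV (flat 1 \<circ> (\<lambda>x::'a. 1 / 2 + (- 1) * flat 1 (x \<bullet> x + (- 1))))"
    by (rule smooth_on_o[OF _ _ _ 2 smooth_on_flat]) auto
  then have "smooth_on UNIV (\<lambda>x::'a. inverse (flat 1 (1 / 2)) * flat 1 (1 / 2 + (- 1) * flat 1 (x \<bullet> x + (- 1))))"
    by (intro smooth_on_mult smooth_on_const) (auto simp: o_def)
  then show ?thesis by (simp add: plateau_def[abs_def])
qed

lemma plateau_eq_1: "norm x \<le> 1 \<Longrightarrow> plateau x = 1"
proof -
  assume "norm x \<le> 1"
  then have "x \<bullet> x \<le> 1" by (simp add: dot_square_norm power_le_one)
  then show ?thesis by (simp add: plateau_def flat_def)
qed

lemma plateau_eq_0: "norm x \<ge> 2 \<Longrightarrow> plateau x = 0"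
proof -
  assume "norm x \<ge> 2"
  then have "2\<^sup>2 \<le> (norm x)\<^sup>2" by (intro power_mono) auto
  then have x: "x \<bullet> x \<ge> 4" by (simp add: dot_square_norm)
  then have "- (1 / (x \<bullet> x + (- 1))) \<ge> - (1 / 3)" by (simp add: field_simps)
  \<comment> \<open>The tangent bound \<open>1 + y \<le> exp y\<close> gives at least
    \<open>2 / 3\<close>, more than the \<open>1 / 2\<close> that makes the outer argument
    nonpositive.\<close>
  then have "1 + - (1 / 3) \<le> exp (- (1 / (x \<bullet> x + (- 1))))"
    using exp_ge_add_one_self[of "- (1 / (x \<bullet> x + (- 1)))"] by linarith
  then have "flat 1 (x \<bullet> x + (- 1)) \<ge> 1 / 2" using x by (simp add: flat_def)
  then show ?thesis unfolding plateau_def flat_def[of 1 "1 / 2 + _"] by simp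
qed

lemma plateau_bounds: "0 \<le> plateau x" "plateau x \<le> 1"
proof -
  have f0: "flat 1 y \<ge> 0" for y by (simp add: flat_def)
  have f_half: "flat 1 (1 / 2) > 0" by (simp add: flat_def)
  show "0 \<le> plateau x" unfolding plateau_def by (intro mult_nonneg_nonneg f0) (use f_half in simp)
  have mono: "flat 1 y \<le> flat 1 (1 / 2)" if "y \<le> 1 / 2" for y
  proof (cases "y > 0")
    case True
    then have "1 / (1 / 2) \<le> 1 / y" using that by (intro divide_left_mono) auto
    then show ?thesis using True by (simp add: flat_def)
  qed (simp add: flat_def)
  have "flat 1 (1 / 2 + (- 1) * flat 1 (x \<bullet> x + (- 1))) \<le> flat 1 (1 / 2)" by (rule mono) (simp add: f0)
  then show "plateau x \<le> 1" unfolding plateau_def using f_half by (simp add: field_simps)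
qed

subsection \<open>Determinants and inverse matrices\<close>

lemma smooth_on_det:
  fixes A :: "'a::real_normed_vector \<Rightarrow> real^'n^'n"
  assumes "open S" "\<And>i j. smooth_on S (\<lambda>x. A x $ i $ j)"
  shows "smooth_on S (\<lambda>x. det (A x))"
  unfolding det_def
  by (intro smooth_on_sum smooth_on_mult smooth_on_prod smooth_on_const assms)

lemma matrix_inv_mult:
  fixes A :: "real^'n^'n"
  assumes "invertible A"
  shows "A ** matrix_inv A = mat 1" "matrix_inv A ** A = mat 1"
  using someI_ex[OF assms[unfolded invertible_def]] unfolding matrix_inv_def by auto

text \<open>Cramer's rule for the columns of the identity: entries of the inverse are quotients of
  polynomials in the entries of \<open>A\<close>, from which smoothness of the inverse metric
  follows.\<close>

lemma matrix_inv_component: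
  fixes A :: "real^'n^'n"
  assumes "det A \<noteq> 0"
  shows "matrix_inv A $ i $ j = det (\<chi> k l. if l = i then axis j 1 $ k else A $ k $ l) * inverse (det A)"
proof -
  have "A ** matrix_inv A = mat 1"
    using assms by (simp add: invertible_det_nz[symmetric] matrix_inv_mult)
  then have "A *v (matrix_inv A *v axis j 1) = axis j 1"
    by (simp add: matrix_vector_mul_assoc)
  then have "matrix_inv A *v axis j 1 = (\<chi> i. det (\<chi> k l. if l = i then axis j 1 $ k else A $ k $ l) / det A)"
    using cramer[OF assms] by blast
  then have "(matrix_inv A *v axis j 1) $ i = det (\<chi> k l. if l = i then axis j 1 $ k else A $ k $ l) / det A"
    by simp
  then show ?thesis by (simp add: matrix_vector_mult_basis column_def divide_inverse)
qed

lemma smooth_on_matrix_inv: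
  fixes A :: "'a::real_normed_vector \<Rightarrow> real^'n^'n"
  assumes S: "open S" and A: "\<And>i j. smooth_on S (\<lambda>x. A x $ i $ j)" and "\<And>x. x \<in> S \<Longrightarrow> det (A x) \<noteq> 0"
  shows "smooth_on S (\<lambda>x. matrix_inv (A x) $ i $ j)"
proof -
  have "smooth_on S (\<lambda>x. det (\<chi> k l. if l = i then axis j 1 $ k else A x $ k $ l) * inverse (det (A x)))"
  proof (intro smooth_on_mult smooth_on_real_inverse smooth_on_det S A assms(3))
    fix k l
    show "smooth_on S (\<lambda>x. (\<chi> k l. if l = i then axis j 1 $ k else A x $ k $ l) $ k $ l)"
      by (cases "l = i") (auto simp: A smooth_on_const)
  qed
  then show ?thesis
    using smooth_on_cong[OF S, of "\<lambda>x. matrix_inv (A x) $ i $ j"] assms(3) by (simp add: matrix_inv_component)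
qed

section \<open>Change of variables over an arbitrary finite index type\<close>

section \<open>Change of variables\<close>

text \<open>Conjugation by \<open>r\<close> is a sign-preserving bijection between the permutations
  of the two index types, so the Leibniz sums agree term by term.\<close>

lemma det_reindex:
  fixes A :: "real^'n^'n" and r :: "'m::finite \<Rightarrow> 'n::finite"
  assumes r: "bij r"
  shows "det (\<chi> i j. A $ r i $ r j) = det A"
proof -
  let ?m = "\<lambda>p x. if x \<in> (UNIV :: 'n set) then r (p (inv_into UNIV r x)) else x"
  have m: "?m p = map_permutation UNIV r p" for p
    using r by (auto simp: map_permutation_def bij_def fun_eq_iff)
  have bb: "bij_betw ?m {p. p permutes UNIV} {p. p permutes UNIV}"
    by (rule bij_betw_permutations) (use r in simp)
  have "det A = (\<Sum>p | p permutes UNIV. of_int (sign (?m p)) * (\<Prod>i\<in>UNIV. A $ i $ ?m p i))"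
    unfolding det_def by (rule sum.reindex_bij_betw[OF bb, symmetric])
  also have "\<dots> = (\<Sum>p | p permutes UNIV. of_int (sign p) * (\<Prod>i\<in>UNIV. A $ r i $ r (p i)))"
  proof (intro sum.cong refl arg_cong2[where f = "(*)"])
    fix p :: "'m \<Rightarrow> 'm" assume "p \<in> {p. p permutes UNIV}"
    then have "sign (?m p) = sign p"
      unfolding m using r by (intro sign_map_permutation) (auto simp: bij_def)
    then show "of_int (sign (?m p)) = (of_int (sign p) :: real)" by simp
    have "(\<Prod>i\<in>UNIV. A $ i $ ?m p i) = (\<Prod>i\<in>UNIV. A $ r i $ ?m p (r i))"
      by (rule prod.reindex_bij_betw[symmetric, of r UNIV UNIV]) (use r in simp)
    then show "(\<Prod>i\<in>UNIV. A $ i $ ?m p i) = (\<Prod>i\<in>UNIV. A $ r i $ r (p i))"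
      using r by (simp add: bij_is_inj inv_f_f)
  qed
  finally show ?thesis by (simp add: det_def)
qed

text \<open>The underlying equivalence relates finite measure of the image to integrability of the
  Jacobian. It gives the value when the image has finite measure; otherwise a finite integral would
  make the image finite too, so both sides are infinite.\<close>

lemma emeasure_image_wellorder:
  fixes f :: "real^'n::{finite,wellorder} \<Rightarrow> real^'n::_"
  assumes S: "S \<in> sets borel" and fS: "f ` S \<in> sets borel"
    and der: "\<And>x. x \<in> S \<Longrightarrow> (f has_derivative f' x) (at x within S)" and inj: "inj_on f S"
    and meas: "(\<lambda>x. indicator S x * \<bar>det (matrix (f' x))\<bar>) \<in> borel_measurable borel"
  shows "emeasure lborel (f ` S) = (\<integral>\<^sup>+x\<in>S. ennreal \<bar>det (matrix (f' x))\<bar> \<partial>lborel)"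
proof -
  let ?d = "\<lambda>x. \<bar>det (matrix (f' x))\<bar>"
  have S': "S \<in> sets lebesgue" using S by auto
  have iff: "f ` S \<in> lmeasurable \<and> measure lebesgue (f ` S) = m \<longleftrightarrow> (?d has_integral m) S" for m
    by (rule has_measure_differentiable_image[OF S' der inj])
  have em: "emeasure lebesgue (f ` S) = emeasure lborel (f ` S)"
    using fS by simp
  show ?thesis
  proof (cases "emeasure lborel (f ` S) < \<infinity>")
    case True
    then have lm: "f ` S \<in> lmeasurable"
      using em sets_completionI_sets[of "f ` S" lborel] fS by (simp add: fmeasurable_def)
    have "(?d has_integral measure lebesgue (f ` S)) S"
      by (rule iff[THEN iffD1]) (intro conjI lm refl)
    from nn_integral_has_integral_lebesgue'[OF _ this]
    show ?thesis using emeasure_eq_measure2[OF lm] unfolding em by simp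
  next
    case False
    have "(\<integral>\<^sup>+x. ennreal (indicator S x * ?d x) \<partial>lborel) = \<infinity>"
    proof (rule ccontr)
      assume "(\<integral>\<^sup>+x. ennreal (indicator S x * ?d x) \<partial>lborel) \<noteq> \<infinity>"
      then have "(\<lambda>x. indicator S x * ?d x) integrable_on UNIV"
        by (intro nn_integral_integrable_on meas) (auto simp: less_top)
      then have "(\<lambda>x. if x \<in> S then ?d x else 0) integrable_on UNIV"
        by (rule integrable_eq) (auto simp: indicator_def)
      then have "?d integrable_on S" by (simp add: integrable_restrict_UNIV)
      then have "(?d has_integral integral S ?d) S" by (simp add: has_integral_integral)
      from iff[THEN iffD2, OF this] have "f ` S \<in> lmeasurable" by simp
      then have "emeasure lebesgue (f ` S) < \<infinity>" by (rule fmeasurableD2[THEN less_top[THEN iffD1], folded infinity_ennreal_def])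
      then show False using False em by simp
    qed
    moreover have "ennreal (indicator S x * ?d x) = ennreal (?d x) * indicator S x" for x
      by (simp add: indicator_def)
    ultimately show ?thesis using False by (simp add: less_top[symmetric])
  qed
qed

text \<open>The change of variables theorems of the library need a well-ordered index type. An arbitrary
  finite index type is therefore replaced by a copy with an arbitrary linear order.\<close>

typedef 'd ordered = "UNIV :: 'd set" morphisms of_ordered to_ordered ..

instance ordered :: (finite) finite
proof
  have "(UNIV :: 'a ordered set) = range to_ordered"
    by (metis UNIV_eq_I of_ordered_inverse rangeI)
  then show "finite (UNIV :: 'a ordered set)" by (metis finite_imageI finite)
qed

text \<open>Any injection into the naturals serves: the order that it induces is well founded
  because that of the naturals is.\<close>

definition ordered_index :: "'d::finite ordered \<Rightarrow> nat" where
  "ordered_index = (SOME f. inj f)"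

lemma inj_ordered_index: "inj (ordered_index :: 'd::finite ordered \<Rightarrow> nat)"
proof -
  have "\<exists>f :: 'd ordered \<Rightarrow> nat. inj f"
    using finite_imp_inj_to_nat_seg[OF finite[of "UNIV :: 'd ordered set"]] by blast
  then show ?thesis unfolding ordered_index_def by (rule someI_ex)
qed

instantiation ordered :: (finite) wellorder
begin

definition less_eq_ordered :: "'a ordered \<Rightarrow> 'a ordered \<Rightarrow> bool" where
  "less_eq_ordered x y \<longleftrightarrow> ordered_index x \<le> ordered_index y"

definition less_ordered :: "'a ordered \<Rightarrow> 'a ordered \<Rightarrow> bool" where
  "less_ordered x y \<longleftrightarrow> ordered_index x < ordered_index y"

instance
proof
  fix P :: "'a ordered \<Rightarrow> bool" and a
  assume "\<And>x. (\<And>y. y < x \<Longrightarrow> P y) \<Longrightarrow> P x"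
  then show "P a"
    unfolding less_ordered_def by (induction "ordered_index a" arbitrary: a rule: less_induct) blast
qed (auto simp: less_eq_ordered_def less_ordered_def intro: injD[OF inj_ordered_index])

end

definition ordered_vec :: "real^'d \<Rightarrow> real^('d::finite ordered)" where
  "ordered_vec x = (\<chi> i. x $ of_ordered i)"

definition unordered_vec :: "real^('d::finite ordered) \<Rightarrow> real^'d" where
  "unordered_vec x = (\<chi> i. x $ to_ordered i)"

lemma ordered_vec_inverse [simp]: "unordered_vec (ordered_vec x) = x" "ordered_vec (unordered_vec y) = y"
  by (simp_all add: ordered_vec_def unordered_vec_def to_ordered_inverse of_ordered_inverse)

lemma bounded_linear_ordered_vec: "bounded_linear ordered_vec"
  by (rule linear_conv_bounded_linear[THEN iffD1], rule linearI)
     (simp_all add: ordered_vec_def vec_eq_iff)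

lemma bounded_linear_unordered_vec: "bounded_linear unordered_vec"
  by (rule linear_conv_bounded_linear[THEN iffD1], rule linearI)
     (simp_all add: unordered_vec_def vec_eq_iff)

lemma bij_of_ordered: "bij of_ordered"
  by (metis bijI' of_ordered_inject to_ordered_inverse UNIV_I)

lemma prod_Basis_vec: "(\<Prod>b\<in>Basis. x \<bullet> b) = (\<Prod>i\<in>UNIV. (x :: real^'n) $ i)"
proof -
  have "(\<Prod>b\<in>(\<lambda>i. axis i 1 :: real^'n) ` UNIV. x \<bullet> b) = (\<Prod>i\<in>UNIV. x \<bullet> axis i 1)"
    by (subst prod.reindex) (auto simp: inj_on_def axis_eq_axis)
  moreover have "(Basis :: (real^'n) set) = (\<lambda>i. axis i 1) ` UNIV"
    by (auto simp: Basis_vec_def)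
  ultimately show ?thesis by (simp add: inner_axis)
qed

text \<open>Relabelling coordinates maps boxes to boxes with the same side lengths, and Lebesgue
  measure is determined by its values on boxes.\<close>

lemma distr_ordered_vec: "distr lborel borel (ordered_vec :: real^'d \<Rightarrow> _) = (lborel :: (real^('d::finite ordered)) measure)"
proof (rule lborel_eqI[symmetric])
  have [measurable]: "(ordered_vec :: real^'d \<Rightarrow> _) \<in> borel_measurable borel"
    by (intro borel_measurable_continuous_onI linear_continuous_on bounded_linear_ordered_vec)
  fix l u :: "real^('d ordered)"
  assume le: "\<And>b. b \<in> Basis \<Longrightarrow> l \<bullet> b \<le> u \<bullet> b"
  have le': "l $ i \<le> u $ i" for i using le[of "axis i 1"] by (simp add: inner_axis axis_in_Basis_iff)
  have "ordered_vec -` box l u = box (unordered_vec l) (unordered_vec u)"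
  proof (intro set_eqI iffI)
    fix x :: "real^'d" assume "x \<in> ordered_vec -` box l u"
    then have "l $ i < x $ of_ordered i \<and> x $ of_ordered i < u $ i" for i
      by (simp add: mem_box_cart ordered_vec_def)
    from this[of "to_ordered i" for i] show "x \<in> box (unordered_vec l) (unordered_vec u)"
      by (simp add: mem_box_cart unordered_vec_def to_ordered_inverse)
  next
    fix x :: "real^'d" assume "x \<in> box (unordered_vec l) (unordered_vec u)"
    then have "l $ to_ordered i < x $ i \<and> x $ i < u $ to_ordered i" for i
      by (simp add: mem_box_cart unordered_vec_def)
    from this[of "of_ordered i" for i] show "x \<in> ordered_vec -` box l u"
      by (simp add: mem_box_cart ordered_vec_def of_ordered_inverse)
  qed
  then have "emeasure (distr lborel borel ordered_vec) (box l u) = emeasure lborel (box (unordered_vec l) (unordered_vec u))"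
    by (simp add: emeasure_distr)
  also have "\<dots> = (\<Prod>b\<in>Basis. (unordered_vec u - unordered_vec l) \<bullet> b)"
    by (rule emeasure_lborel_box)
       (auto simp: Basis_vec_def inner_axis unordered_vec_def le')
  also have "(\<Prod>b\<in>Basis. (unordered_vec u - unordered_vec l) \<bullet> b) = (\<Prod>i\<in>UNIV. u $ to_ordered i - l $ to_ordered i)"
    by (subst prod_Basis_vec) (simp add: unordered_vec_def)
  also have "\<dots> = (\<Prod>i\<in>UNIV. u $ i - l $ i)"
  proof (rule prod.reindex_bij_betw)
    show "bij_betw to_ordered UNIV UNIV"
      by (metis bijI' to_ordered_inject of_ordered_inverse UNIV_I)
  qed
  also have "\<dots> = (\<Prod>b\<in>Basis. (u - l) \<bullet> b)" by (subst prod_Basis_vec) simp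
  finally show "emeasure (distr lborel borel ordered_vec) (box l u) = (\<Prod>b\<in>Basis. (u - l) \<bullet> b)" .
qed simp

text \<open>The map is conjugated by the relabelling, which preserves the measure and, by
  \<open>det_reindex\<close>, the Jacobian determinant.\<close>

lemma emeasure_image_derivative:
  fixes f :: "real^'d::finite \<Rightarrow> real^'d"
  assumes S: "S \<in> sets borel" and fS: "f ` S \<in> sets borel"
    and der: "\<And>x. x \<in> S \<Longrightarrow> (f has_derivative f' x) (at x within S)" and inj: "inj_on f S"
    and meas: "(\<lambda>x. indicator S x * \<bar>det (matrix (f' x))\<bar>) \<in> borel_measurable borel"
  shows "emeasure lborel (f ` S) = (\<integral>\<^sup>+x\<in>S. ennreal \<bar>det (matrix (f' x))\<bar> \<partial>lborel)"
proof -
  let ?o = "ordered_vec :: real^'d \<Rightarrow> _" and ?u = "unordered_vec :: _ \<Rightarrow> real^'d"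
  interpret o: bounded_linear ?o by (rule bounded_linear_ordered_vec)
  interpret u: bounded_linear ?u by (rule bounded_linear_unordered_vec)
  have [measurable]: "?o \<in> borel_measurable borel" "?u \<in> borel_measurable borel"
    by (intro borel_measurable_continuous_onI linear_continuous_on bounded_linear_ordered_vec bounded_linear_unordered_vec)+
  have img: "?o ` X = ?u -` X" for X
    by (auto simp: image_iff) (metis ordered_vec_inverse(2))
  have vimg: "?o -` (?o ` X) = X" for X by (auto simp: img)
  have img_borel: "?o ` X \<in> sets borel" if "X \<in> sets borel" for X
    unfolding img using measurable_sets[OF _ that, of ?u borel] by simp
  have em: "emeasure lborel (?o ` X) = emeasure lborel X" if "X \<in> sets borel" for X
    by (subst distr_ordered_vec[symmetric]) (simp add: emeasure_distr img_borel that vimg)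
  define F where "F = ?o \<circ> f \<circ> ?u"
  define F' where "F' y = ?o \<circ> f' (?u y) \<circ> ?u" for y
  have det_F': "det (matrix (F' y)) = det (matrix (f' (?u y)))" for y
  proof -
    have "?u (axis j 1) = axis (of_ordered j) 1" for j
      by (simp add: unordered_vec_def vec_eq_iff axis_def) (metis of_ordered_inverse to_ordered_inverse UNIV_I)
    then have "matrix (F' y) = (\<chi> i j. matrix (f' (?u y)) $ of_ordered i $ of_ordered j)"
      unfolding matrix_def F'_def comp_def by (simp only: ordered_vec_def vec_lambda_beta)
    then show ?thesis by (simp add: det_reindex[OF bij_of_ordered])
  qed
  have FS: "F ` (?o ` S) = ?o ` (f ` S)" by (simp add: F_def image_comp o_def)
  have "emeasure lborel (F ` (?o ` S)) = (\<integral>\<^sup>+y\<in>?o ` S. ennreal \<bar>det (matrix (F' y))\<bar> \<partial>lborel)"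
  proof (rule emeasure_image_wellorder)
    show "?o ` S \<in> sets borel" "F ` (?o ` S) \<in> sets borel"
      unfolding FS by (intro img_borel S fS)+
    show "inj_on F (?o ` S)"
      using inj unfolding F_def inj_on_def by (auto dest!: arg_cong[where f = ?u])
    have "(\<lambda>y. (\<lambda>x. indicator S x * \<bar>det (matrix (f' x))\<bar>) (?u y)) \<in> borel_measurable borel"
      by (rule measurable_compose[OF _ meas]) measurable
    then show "(\<lambda>y. indicator (?o ` S) y * \<bar>det (matrix (F' y))\<bar>) \<in> borel_measurable borel"
      by (simp add: det_F' img indicator_vimage comp_def)
    fix y assume y: "y \<in> ?o ` S"
    then have uy: "?u y \<in> S" by (simp add: img)
    have "(f \<circ> ?u has_derivative f' (?u y) \<circ> ?u) (at y within ?o ` S)"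
      by (rule diff_chain_within[OF u.has_derivative[OF has_derivative_ident]])
         (use der[OF uy] in \<open>simp add: image_image\<close>)
    then have "((\<lambda>y. ?o ((f \<circ> ?u) y)) has_derivative (\<lambda>v. ?o ((f' (?u y) \<circ> ?u) v))) (at y within ?o ` S)"
      by (rule o.has_derivative)
    then show "(F has_derivative F' y) (at y within ?o ` S)" by (simp add: F_def F'_def comp_def)
  qed
  also have "\<dots> = (\<integral>\<^sup>+y. ennreal (indicator S (?u y) * \<bar>det (matrix (f' (?u y)))\<bar>) \<partial>distr lborel borel ?o)"
    unfolding distr_ordered_vec det_F' img by (intro nn_integral_cong) (auto simp: indicator_def)
  also have "\<dots> = (\<integral>\<^sup>+x. ennreal (indicator S (?u (?o x)) * \<bar>det (matrix (f' (?u (?o x))))\<bar>) \<partial>lborel)"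
  proof -
    have "(\<lambda>y. (\<lambda>x. indicator S x * \<bar>det (matrix (f' x))\<bar>) (?u y)) \<in> borel_measurable borel"
      by (rule measurable_compose[OF _ meas]) measurable
    then have "(\<lambda>y. ennreal (indicator S (?u y) * \<bar>det (matrix (f' (?u y)))\<bar>)) \<in> borel_measurable borel"
      by (intro measurable_compose[OF _ measurable_ennreal])
    then show ?thesis by (intro nn_integral_distr) (simp_all del: ordered_vec_inverse)
  qed
  also have "\<dots> = (\<integral>\<^sup>+x\<in>S. ennreal \<bar>det (matrix (f' x))\<bar> \<partial>lborel)"
    by (intro nn_integral_cong) (auto simp: indicator_def)
  finally show ?thesis unfolding FS using em[OF fS] by simp
qed

section \<open>Existence and uniqueness of the measure \<open>vol\<close>\<close>

section \<open>The Riemannian volume\<close>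

text \<open>The segment from the identity to \<open>A\<close> consists of positive definite, hence
  invertible, matrices. The determinant is continuous along it, starts at 1 and never
  vanishes.\<close>

lemma det_pos_definite:
  fixes A :: "real^'n^'n"
  assumes pos: "\<And>v. v \<noteq> 0 \<Longrightarrow> 0 < v \<bullet> (A *v v)"
  shows "det A > 0"
proof -
  define B where "B t = t *\<^sub>R A + (1 - t) *\<^sub>R mat 1" for t :: real
  have Bv: "B t *v v = t *\<^sub>R (A *v v) + (1 - t) *\<^sub>R v" for t v
    by (simp add: B_def matrix_vector_mult_add_rdistrib scaleR_matrix_vector_assoc[symmetric])
  have nz: "det (B t) \<noteq> 0" if t: "0 \<le> t" "t \<le> 1" for t
  proof -
    have "v = 0" if "B t *v v = 0" for v
    proof (rule ccontr)
      assume v: "v \<noteq> 0"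
      have "0 = v \<bullet> (B t *v v)" using that by simp
      also have "\<dots> = t * (v \<bullet> (A *v v)) + (1 - t) * (v \<bullet> v)" by (simp add: Bv inner_add_right)
      finally have "t * (v \<bullet> (A *v v)) + (1 - t) * (v \<bullet> v) = 0" by simp
      moreover have "t * (v \<bullet> (A *v v)) \<ge> 0" "(1 - t) * (v \<bullet> v) \<ge> 0" using t pos[OF v] by auto
      ultimately have "t * (v \<bullet> (A *v v)) = 0" "(1 - t) * (v \<bullet> v) = 0" by linarith+
      then show False using pos[OF v] v by auto
    qed
    then have "invertible (B t)"
      using matrix_left_invertible_ker[of "B t"] invertible_left_inverse[of "B t"] by blast
    then show ?thesis by (simp add: invertible_det_nz)
  qed
  have cont: "continuous_on {0..1} (\<lambda>t. det (B t))"
    unfolding det_def B_def by (intro continuous_intros)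
  have B0: "B 0 = mat 1" and B1: "B 1 = A" by (simp_all add: B_def)
  show ?thesis
  proof (rule ccontr)
    assume "\<not> det A > 0"
    then have "det (B 1) \<le> 0" "0 \<le> det (B 0)" by (simp_all add: B0 B1 det_I)
    then obtain t where "0 \<le> t" "t \<le> 1" "det (B t) = 0"
      using IVT2'[of "\<lambda>t. det (B t)" 1 0 0] cont by auto
    then show False using nz by blast
  qed
qed

locale riemannian_mfd =
  fixes M :: "('a::{t2_space, second_countable_topology}, 'd::finite) riemannian"
  assumes riemannian: "riemannian_manifold M"
begin

lemma charts_cover: "(\<Union>c\<in>atlas M. fst c) = UNIV"
  and chart_open: "c \<in> atlas M \<Longrightarrow> open (fst c)"
  and chart_image_open: "c \<in> atlas M \<Longrightarrow> open (chart_image c)"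
  and chart_homeomorphism: "c \<in> atlas M \<Longrightarrow> homeomorphism (fst c) (chart_image c) (snd c) (chart_inv c)"
  and smooth_transition: "c \<in> atlas M \<Longrightarrow> c' \<in> atlas M \<Longrightarrow>
    smooth_on (snd c ` (fst c \<inter> fst c')) (transition c c')"
  and smooth_metric: "c \<in> atlas M \<Longrightarrow> smooth_on (chart_image c) (\<lambda>y. metric M c (chart_inv c y) $ i $ j)"
  and metric_symmetric: "c \<in> atlas M \<Longrightarrow> p \<in> fst c \<Longrightarrow> transpose (metric M c p) = metric M c p"
  and metric_pos: "c \<in> atlas M \<Longrightarrow> p \<in> fst c \<Longrightarrow> v \<noteq> 0 \<Longrightarrow> 0 < v \<bullet> (metric M c p *v v)"
  and metric_transform: "c \<in> atlas M \<Longrightarrow> c' \<in> atlas M \<Longrightarrow> p \<in> fst c \<Longrightarrow> p \<in> fst c' \<Longrightarrow>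
    metric M c p = transpose (matrix (frechet_derivative (transition c c') (at (snd c p)))) ** metric M c' p **
      matrix (frechet_derivative (transition c c') (at (snd c p)))"
proof -
  have sm: "smooth_atlas (atlas M)"
    and met: "\<forall>c\<in>atlas M.
        (\<forall>i j. smooth_on (chart_image c) (\<lambda>y. metric M c (chart_inv c y) $ i $ j)) \<and>
        (\<forall>p\<in>fst c. transpose (metric M c p) = metric M c p \<and>
           (\<forall>v. v \<noteq> 0 \<longrightarrow> 0 < v \<bullet> (metric M c p *v v)))"
    and tr: "\<forall>c\<in>atlas M. \<forall>c'\<in>atlas M. \<forall>p\<in>fst c \<inter> fst c'.
        metric M c p = transpose (matrix (frechet_derivative (transition c c') (at (snd c p)))) ** metric M c' p **
      matrix (frechet_derivative (transition c c') (at (snd c p)))"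
    using riemannian unfolding riemannian_manifold_def Let_def by blast+
  from sm show "(\<Union>c\<in>atlas M. fst c) = UNIV"
    "c \<in> atlas M \<Longrightarrow> open (fst c)" "c \<in> atlas M \<Longrightarrow> open (chart_image c)"
    "c \<in> atlas M \<Longrightarrow> homeomorphism (fst c) (chart_image c) (snd c) (chart_inv c)"
    "c \<in> atlas M \<Longrightarrow> c' \<in> atlas M \<Longrightarrow> smooth_on (snd c ` (fst c \<inter> fst c')) (transition c c')"
    unfolding smooth_atlas_def by blast+
  from met show "c \<in> atlas M \<Longrightarrow> smooth_on (chart_image c) (\<lambda>y. metric M c (chart_inv c y) $ i $ j)"
    "c \<in> atlas M \<Longrightarrow> p \<in> fst c \<Longrightarrow> transpose (metric M c p) = metric M c p"
    "c \<in> atlas M \<Longrightarrow> p \<in> fst c \<Longrightarrow> v \<noteq> 0 \<Longrightarrow> 0 < v \<bullet> (metric M c p *v v)"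
    by blast+
  from tr show "c \<in> atlas M \<Longrightarrow> c' \<in> atlas M \<Longrightarrow> p \<in> fst c \<Longrightarrow> p \<in> fst c' \<Longrightarrow>
    metric M c p = transpose (matrix (frechet_derivative (transition c c') (at (snd c p)))) ** metric M c' p **
      matrix (frechet_derivative (transition c c') (at (snd c p)))" by blast
qed

lemma chart_inv_left: "c \<in> atlas M \<Longrightarrow> p \<in> fst c \<Longrightarrow> chart_inv c (snd c p) = p"
  and chart_inv_right: "c \<in> atlas M \<Longrightarrow> y \<in> chart_image c \<Longrightarrow> snd c (chart_inv c y) = y"
  and chart_inv_mem: "c \<in> atlas M \<Longrightarrow> y \<in> chart_image c \<Longrightarrow> chart_inv c y \<in> fst c"
  and chart_continuous: "c \<in> atlas M \<Longrightarrow> continuous_on (fst c) (snd c)"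
  and chart_inv_continuous: "c \<in> atlas M \<Longrightarrow> continuous_on (chart_image c) (chart_inv c)"
  using chart_homeomorphism[of c] unfolding homeomorphism_def by blast+

lemma chart_mem: "p \<in> fst c \<Longrightarrow> snd c p \<in> chart_image c"
  by (simp add: chart_image_def)

lemma chart_image_iff:
  "c \<in> atlas M \<Longrightarrow> B \<subseteq> fst c \<Longrightarrow> y \<in> snd c ` B \<longleftrightarrow> y \<in> chart_image c \<and> chart_inv c y \<in> B"
proof
  assume c: "c \<in> atlas M" and B: "B \<subseteq> fst c"
  show "y \<in> chart_image c \<and> chart_inv c y \<in> B" if "y \<in> snd c ` B"
    using that B chart_inv_left[OF c] chart_mem[of _ c] by auto
  show "y \<in> snd c ` B" if y: "y \<in> chart_image c \<and> chart_inv c y \<in> B"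
    using chart_inv_right[OF c, of y] y by (intro image_eqI[of _ _ "chart_inv c y"]) auto
qed

lemma inj_on_chart: "c \<in> atlas M \<Longrightarrow> inj_on (snd c) (fst c)"
  using chart_inv_left by (intro inj_on_inverseI[of _ "chart_inv c"])

lemma chart_image_subset_open:
  assumes c: "c \<in> atlas M" and U: "open U" "U \<subseteq> fst c"
  shows "open (snd c ` U)"
proof -
  have "snd c ` U = chart_inv c -` U \<inter> chart_image c"
    by (intro set_eqI) (simp only: chart_image_iff[OF c U(2)] Int_iff vimage_eq conj_commute)
  moreover have "open (chart_inv c -` U \<inter> chart_image c)"
    by (rule continuous_on_open_vimage[OF chart_image_open[OF c], THEN iffD1, rule_format,
          OF chart_inv_continuous[OF c] U(1)])
  ultimately show ?thesis by simp
qed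

lemma transition_chart: "c \<in> atlas M \<Longrightarrow> p \<in> fst c \<Longrightarrow> transition c c' (snd c p) = snd c' p"
  by (simp add: transition_def chart_inv_left)

lemma open_overlap: "c \<in> atlas M \<Longrightarrow> c' \<in> atlas M \<Longrightarrow> open (snd c ` (fst c \<inter> fst c'))"
  by (intro chart_image_subset_open) (auto intro: chart_open)

lemma det_metric_pos: "c \<in> atlas M \<Longrightarrow> p \<in> fst c \<Longrightarrow> det (metric M c p) > 0"
  using metric_pos det_pos_definite by blast

lemma volume_density_pos: "c \<in> atlas M \<Longrightarrow> y \<in> chart_image c \<Longrightarrow> volume_density M c y > 0"
  by (simp add: volume_density_def det_metric_pos chart_inv_mem)

lemma smooth_volume_density: "c \<in> atlas M \<Longrightarrow> smooth_on (chart_image c) (volume_density M c)"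
  unfolding volume_density_def[abs_def]
  by (intro smooth_on_real_sqrt smooth_on_det smooth_metric chart_image_open det_metric_pos chart_inv_mem)

text \<open>Determinants in the transformation law of the metric produce the squared Jacobian; its
  root is the factor of the change of variables formula.\<close>

lemma volume_density_transform:
  assumes "c \<in> atlas M" "c' \<in> atlas M" "p \<in> fst c" "p \<in> fst c'"
  shows "volume_density M c (snd c p) = volume_density M c' (snd c' p)
      * \<bar>det (matrix (frechet_derivative (transition c c') (at (snd c p))))\<bar>"
  using assms unfolding volume_density_def
  by (simp only: chart_inv_left metric_transform[OF assms] det_mul det_transpose)
     (simp add: real_sqrt_mult mult.commute)

lemma transition_has_derivative:
  assumes "c \<in> atlas M" "c' \<in> atlas M" "p \<in> fst c" "p \<in> fst c'"
  shows "(transition c c' has_derivative frechet_derivative (transition c c') (at (snd c p))) (at (snd c p))"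
  by (rule smooth_on_has_derivative[OF smooth_transition]) (use assms in auto)

text \<open>Outside the chart image the values of \<open>chart_inv\<close> are uncontrolled. One
  constant value there makes the map Borel measurable on the whole space, so that measures can be
  pushed forward along it.\<close>

definition chart_inv' :: "('a, 'd) chart \<Rightarrow> real^'d \<Rightarrow> 'a" where
  "chart_inv' c y = (if y \<in> chart_image c then chart_inv c y else undefined)"

lemma measurable_chart_inv' [measurable]:
  assumes "c \<in> atlas M"
  shows "chart_inv' c \<in> borel_measurable borel"
proof -
  have O: "{y \<in> space borel. y \<in> chart_image c} \<in> sets borel"
    using chart_image_open[OF assms] by (simp add: borel_open)
  have "chart_inv c \<in> borel_measurable (restrict_space borel (chart_image c))"
    by (rule borel_measurable_continuous_on_restrict[OF chart_inv_continuous[OF assms]])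
  then show ?thesis
    unfolding chart_inv'_def[abs_def]
    by (subst measurable_If_restrict_space_iff[OF O]) simp
qed

lemma chart_image_borel: "c \<in> atlas M \<Longrightarrow> chart_image c \<in> sets borel"
  and chart_borel: "c \<in> atlas M \<Longrightarrow> fst c \<in> sets borel"
  by (simp_all add: chart_image_open chart_open borel_open)

lemma chart_subset_borel:
  assumes c: "c \<in> atlas M" and B: "B \<in> sets borel" "B \<subseteq> fst c"
  shows "snd c ` B \<in> sets borel"
proof -
  have "snd c ` B = chart_image c \<inter> (chart_inv' c -` B \<inter> space borel)"
    by (intro set_eqI) (simp add: chart_image_iff[OF c B(2)] chart_inv'_def cong: conj_cong)
  then show ?thesis
    using measurable_sets[OF measurable_chart_inv'[OF c] B(1)] chart_image_borel[OF c] by auto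
qed

text \<open>The candidate for the volume restricted to one chart; \<open>density_vol\<close> shows
  that it is this restriction.\<close>

definition chart_measure :: "('a, 'd) chart \<Rightarrow> 'a measure" where
  "chart_measure c = distr (density lborel (\<lambda>y. ennreal (volume_density M c y) * indicator (chart_image c) y)) borel (chart_inv' c)"

lemma measurable_volume_density [measurable]:
  assumes c: "c \<in> atlas M"
  shows "(\<lambda>y. volume_density M c y * indicator (chart_image c) y) \<in> borel_measurable borel"
proof -
  have "(\<lambda>y. indicator (chart_image c) y *\<^sub>R volume_density M c y) \<in> borel_measurable borel"
    by (intro borel_measurable_continuous_on_indicator smooth_on_continuous_on smooth_volume_density c chart_image_borel)
  then show ?thesis by (simp add: mult.commute)
qed

lemma measurable_volume_density_ennreal [measurable]:
  assumes c: "c \<in> atlas M"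
  shows "(\<lambda>y. ennreal (volume_density M c y) * indicator (chart_image c) y) \<in> borel_measurable borel"
proof -
  have "(\<lambda>y. ennreal (volume_density M c y * indicator (chart_image c) y)) \<in> borel_measurable borel"
    by (intro measurable_compose[OF measurable_volume_density[OF c] measurable_ennreal])
  then show ?thesis by (rule measurable_cong[THEN iffD1, rotated]) (auto simp: indicator_def)
qed

lemma emeasure_chart_measure:
  assumes c: "c \<in> atlas M" and B: "B \<in> sets borel"
  shows "emeasure (chart_measure c) B = (\<integral>\<^sup>+y\<in>snd c ` (B \<inter> fst c). ennreal (volume_density M c y) \<partial>lborel)"
proof -
  have "chart_inv' c -` B \<in> sets borel"
    using measurable_sets[OF measurable_chart_inv'[OF c] B] by simp
  then have "emeasure (chart_measure c) B
     = (\<integral>\<^sup>+y. ennreal (volume_density M c y) * indicator (chart_image c) y * indicator (chart_inv' c -` B) y \<partial>lborel)"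
    unfolding chart_measure_def using c B
    by (subst emeasure_distr) (simp_all add: emeasure_density)
  also have "\<dots> = (\<integral>\<^sup>+y\<in>snd c ` (B \<inter> fst c). ennreal (volume_density M c y) \<partial>lborel)"
    by (intro nn_integral_cong)
       (simp add: indicator_def chart_image_iff[OF c, of "B \<inter> fst c"] chart_inv_mem[OF c] chart_inv'_def)
  finally show ?thesis .
qed

text \<open>Change of variables for sets says that two measures agree: Lebesgue measure on the image
  of \<open>B\<close> in \<open>c'\<close>, and the pushforward of the Jacobian density under the
  transition map. Integrating \<open>h\<close> against both gives the formula for functions.\<close>

lemma nn_integral_transition:
  assumes c: "c \<in> atlas M" and c': "c' \<in> atlas M" and B: "B \<in> sets borel" "B \<subseteq> fst c" "B \<subseteq> fst c'"
    and h: "h \<in> borel_measurable borel"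
  shows "(\<integral>\<^sup>+y\<in>snd c' ` B. h y \<partial>lborel)
    = (\<integral>\<^sup>+y\<in>snd c ` B. h (transition c c' y) * ennreal \<bar>det (matrix (frechet_derivative (transition c c') (at y)))\<bar> \<partial>lborel)"
proof -
  let ?t = "transition c c'" and ?O = "snd c ` (fst c \<inter> fst c')"
  let ?d = "\<lambda>y. \<bar>det (matrix (frechet_derivative ?t (at y)))\<bar>"
  have O: "open ?O" by (rule open_overlap[OF c c'])
  have smooth: "smooth_on ?O ?t" by (rule smooth_transition[OF c c'])
  have "continuous_on ?O (\<lambda>y. det (matrix (frechet_derivative ?t (at y))))"
  proof (rule smooth_on_continuous_on, rule smooth_on_det[OF O])
    fix i j
    show "smooth_on ?O (\<lambda>y. matrix (frechet_derivative ?t (at y)) $ i $ j)"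
      using smooth_on_inner[OF O smooth_on_frechet_derivative[OF smooth] smooth_on_const, of "axis j 1" "axis i 1"]
      by (simp add: matrix_def inner_axis)
  qed
  then have d_cont: "continuous_on ?O ?d" by (rule continuous_on_rabs)
  have t_meas: "(\<lambda>y. indicator X y *\<^sub>R ?t y) \<in> borel_measurable borel" 
    and d_meas: "(\<lambda>y. indicator X y *\<^sub>R ?d y) \<in> borel_measurable borel" if "X \<in> sets borel" "X \<subseteq> ?O" for X
    using continuous_on_subset[OF smooth_on_continuous_on[OF smooth] that(2)] continuous_on_subset[OF d_cont that(2)] that
    by (auto intro!: borel_measurable_continuous_on_indicator simp del: real_scaleR_def)
  have img: "?t ` snd c ` X = snd c' ` X" if "X \<subseteq> fst c" for X
    unfolding image_image using that by (intro image_cong) (auto simp: transition_chart[OF c])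
  have BO: "snd c ` X \<subseteq> ?O" if "X \<subseteq> B" for X using that B by auto
  have em: "emeasure lborel (snd c' ` X) = (\<integral>\<^sup>+y\<in>snd c ` X. ennreal (?d y) \<partial>lborel)"
    if X: "X \<in> sets borel" "X \<subseteq> B" for X
  proof -
    have bX: "snd c ` X \<in> sets borel" by (rule chart_subset_borel[OF c]) (use X B in auto)
    have Xc: "X \<subseteq> fst c" using X B by auto
    have "emeasure lborel (?t ` snd c ` X) = (\<integral>\<^sup>+y\<in>snd c ` X. ennreal (?d y) \<partial>lborel)"
    proof (rule emeasure_image_derivative[OF bX])
      show "?t ` snd c ` X \<in> sets borel"
        unfolding img[OF Xc] by (rule chart_subset_borel[OF c']) (use X B in auto)
      show "(?t has_derivative frechet_derivative ?t (at y)) (at y within snd c ` X)" if "y \<in> snd c ` X" for y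
        by (rule has_derivative_at_withinI) (use that BO[OF X(2)] smooth_on_has_derivative[OF smooth] in auto)
      show "inj_on ?t (snd c ` X)"
      proof (rule inj_onI)
        fix x y assume "x \<in> snd c ` X" "y \<in> snd c ` X" "?t x = ?t y"
        then obtain p q where "p \<in> X" "q \<in> X" "x = snd c p" "y = snd c q" "snd c' p = snd c' q"
          using Xc by (auto simp: transition_chart[OF c] subset_iff)
        then show "x = y" using inj_onD[OF inj_on_chart[OF c']] X B by (metis subsetD)
      qed
      show "(\<lambda>y. indicator (snd c ` X) y * ?d y) \<in> borel_measurable borel"
        using d_meas[OF bX BO[OF X(2)]] by simp
    qed
    then show ?thesis unfolding img[OF Xc] .
  qed
  define S where "S = snd c ` B"
  have S: "S \<in> sets borel" "S \<subseteq> ?O" unfolding S_def using chart_subset_borel[OF c B(1,2)] BO by auto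
  \<comment> \<open>The transition map is cut off to 0 outside \<open>S\<close> to obtain a Borel
    map on the whole space; the density \<open>D\<close> is zero where the values differ.\<close>
  define F where "F y = indicator S y *\<^sub>R ?t y" for y
  have F [measurable]: "F \<in> borel_measurable borel" unfolding F_def[abs_def] by (rule t_meas[OF S])
  define D where "D y = ennreal (indicator S y *\<^sub>R ?d y)" for y
  have dS [measurable]: "D \<in> borel_measurable borel"
    unfolding D_def[abs_def] by (intro measurable_compose[OF d_meas[OF S] measurable_ennreal])
  have S' [measurable]: "snd c' ` B \<in> sets borel" by (rule chart_subset_borel[OF c' B(1,3)])
  have ind: "D y = ennreal (?d y) * indicator S y" for y
    by (simp add: D_def indicator_def)
  have "distr (density lborel D) borel F = density lborel (indicator (snd c' ` B))"
  proof (rule measure_eqI)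
    fix A assume "A \<in> sets (distr (density lborel D) borel F)"
    then have A: "A \<in> sets borel" by simp
    \<comment> \<open>The part of \<open>B\<close> that the coordinates of \<open>c'\<close> send
      into \<open>A\<close>; its two chart images are the sets to which change of variables is
      applied.\<close>
    define X where "X = {p \<in> B. snd c' p \<in> A}"
    have "snd c' ` X = snd c' ` B \<inter> A" unfolding X_def by auto
    have FA: "F -` A \<in> sets borel" using measurable_sets[OF F A] by simp
    have "X = B \<inter> (\<lambda>p. indicator (fst c') p *\<^sub>R snd c' p) -` A"
      unfolding X_def using B by (auto simp: indicator_def)
    moreover have "(\<lambda>p. indicator (fst c') p *\<^sub>R snd c' p) \<in> borel_measurable borel"
      by (intro borel_measurable_continuous_on_indicator chart_continuous[OF c'] chart_borel c')
    ultimately have X: "X \<in> sets borel" "X \<subseteq> B"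
      using measurable_sets[of "\<lambda>p. indicator (fst c') p *\<^sub>R snd c' p" borel borel A] A B(1) by (auto simp: X_def)
    have XS: "y \<in> snd c ` X \<longleftrightarrow> y \<in> S \<and> F y \<in> A" for y
    proof -
      have "F (snd c p) = snd c' p" if "p \<in> B" for p
        using that B(2) by (auto simp: F_def S_def transition_chart[OF c])
      then show ?thesis unfolding X_def S_def by auto
    qed
    have "emeasure (distr (density lborel D) borel F) A
      = (\<integral>\<^sup>+y. D y * indicator (F -` A) y \<partial>lborel)"
      using A FA by (subst emeasure_distr) (simp_all add: emeasure_density)
    also have "\<dots> = (\<integral>\<^sup>+y\<in>snd c ` X. ennreal (?d y) \<partial>lborel)"
      by (intro nn_integral_cong) (simp add: ind indicator_def XS)
    also have "\<dots> = emeasure lborel (snd c' ` X)" by (rule em[OF X, symmetric])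
    also have "\<dots> = emeasure (density lborel (indicator (snd c' ` B))) A"
      using A S' \<open>snd c' ` X = snd c' ` B \<inter> A\<close>
      by (subst emeasure_density) (simp_all add: indicator_inter_arith[symmetric])
    finally show "emeasure (distr (density lborel D) borel F) A
      = emeasure (density lborel (indicator (snd c' ` B))) A" .
  qed simp
  then have "(\<integral>\<^sup>+y. h y \<partial>density lborel (indicator (snd c' ` B)))
     = (\<integral>\<^sup>+y. h y \<partial>distr (density lborel D) borel F)" by simp
  also have "\<dots> = (\<integral>\<^sup>+y. h (F y) \<partial>density lborel D)"
    using h by (intro nn_integral_distr) simp_all
  also have "\<dots> = (\<integral>\<^sup>+y. D y * h (F y) \<partial>lborel)"
    using h by (intro nn_integral_density) (auto intro: measurable_compose[OF F])
  also have "\<dots> = (\<integral>\<^sup>+y\<in>snd c ` B. h (?t y) * ennreal (?d y) \<partial>lborel)"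
    by (intro nn_integral_cong) (auto simp: ind indicator_def F_def S_def mult.commute)
  finally show ?thesis
    using h S' by (subst (asm) nn_integral_density) (simp_all add: mult.commute)
qed

text \<open>The density of \<open>c\<close> is that of \<open>c'\<close> times the Jacobian, which
  is exactly the integrand produced by the change of variables.\<close>

lemma chart_measure_agree:
  assumes c: "c \<in> atlas M" and c': "c' \<in> atlas M" and B: "B \<in> sets borel" "B \<subseteq> fst c" "B \<subseteq> fst c'"
  shows "emeasure (chart_measure c) B = emeasure (chart_measure c') B"
proof -
  let ?t = "transition c c'"
  have Bc: "B \<inter> fst c = B" "B \<inter> fst c' = B" using B by auto
  have "emeasure (chart_measure c') B
     = (\<integral>\<^sup>+y\<in>snd c' ` B. (ennreal (volume_density M c' y) * indicator (chart_image c') y) \<partial>lborel)"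
  proof -
    have "snd c' ` B \<subseteq> chart_image c'" using B(3) by (auto simp: chart_image_def)
    then show ?thesis
      unfolding emeasure_chart_measure[OF c' B(1)] Bc by (intro nn_integral_cong) (auto simp: indicator_def)
  qed
  also have "\<dots> = (\<integral>\<^sup>+y\<in>snd c ` B. (ennreal (volume_density M c' (?t y)) * indicator (chart_image c') (?t y))
       * ennreal \<bar>det (matrix (frechet_derivative ?t (at y)))\<bar> \<partial>lborel)"
    by (rule nn_integral_transition[OF c c' B measurable_volume_density_ennreal[OF c']])
  also have "\<dots> = (\<integral>\<^sup>+y\<in>snd c ` B. ennreal (volume_density M c y) \<partial>lborel)"
  proof (intro nn_integral_cong)
    fix y
    show "ennreal (volume_density M c' (?t y)) * indicator (chart_image c') (?t y)
       * ennreal \<bar>det (matrix (frechet_derivative ?t (at y)))\<bar> * indicator (snd c ` B) y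
       = ennreal (volume_density M c y) * indicator (snd c ` B) y"
    proof (cases "y \<in> snd c ` B")
      case True
      then obtain p where p: "p \<in> B" "y = snd c p" by blast
      then have pc: "p \<in> fst c" "p \<in> fst c'" using B by auto
      have "volume_density M c' (snd c' p) \<ge> 0"
        using volume_density_pos[OF c' chart_mem[OF pc(2)]] by simp
      then show ?thesis
        using True volume_density_transform[OF c c' pc] chart_mem[OF pc(2)]
        by (simp add: p transition_chart[OF c pc(1)] ennreal_mult)
    qed simp
  qed
  also have "\<dots> = emeasure (chart_measure c) B" unfolding emeasure_chart_measure[OF c B(1)] Bc ..
  finally show ?thesis by simp
qed

text \<open>Second countability enters here, through the Lindelof property.\<close>

lemma countable_charts:
  "\<exists>c :: nat \<Rightarrow> ('a, 'd) chart. (\<forall>n. c n \<in> atlas M) \<and> (\<Union>n. fst (c n)) = UNIV"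
proof -
  obtain F where F: "F \<subseteq> fst ` atlas M" "countable F" "\<Union>F = \<Union>(fst ` atlas M)"
    by (rule Lindelof[of "fst ` atlas M"]) (auto intro: chart_open)
  then obtain C where C: "C \<subseteq> atlas M" "countable C" "F = fst ` C"
    by (meson countable_subset_image)
  have ne: "C \<noteq> {}" using F C charts_cover by auto
  show ?thesis
  proof (intro exI[of _ "from_nat_into C"] conjI allI)
    show "from_nat_into C n \<in> atlas M" for n using from_nat_into[OF ne] C(1) by auto
    show "(\<Union>n. fst (from_nat_into C n)) = UNIV"
      using range_from_nat_into[OF ne C(2)] F(3) C(3) charts_cover by (metis image_image)
  qed
qed

text \<open>A countable Borel partition subordinate to the charts plays the part of a partition of
  unity for gluing the chart measures.\<close>

lemma chart_partition:
  "\<exists>(c :: nat \<Rightarrow> ('a, 'd) chart) (A :: nat \<Rightarrow> 'a set). (\<forall>n. c n \<in> atlas M \<and> A n \<in> sets borel \<and> A n \<subseteq> fst (c n))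
     \<and> disjoint_family A \<and> (\<Union>n. A n) = UNIV"
proof -
  from countable_charts obtain c :: "nat \<Rightarrow> ('a, 'd) chart"
    where c: "\<And>n. c n \<in> atlas M" "(\<Union>n. fst (c n)) = UNIV" by (elim exE conjE) blast
  let ?A = "disjointed (\<lambda>n. fst (c n))"
  have "range (\<lambda>n. fst (c n)) \<subseteq> sets borel"
    by (intro image_subsetI chart_borel c)
  then have "range ?A \<subseteq> sets borel" by (rule sets.range_disjointed_sets)
  then have "?A n \<in> sets borel" for n by (auto simp: image_subset_iff)
  moreover have "(\<Union>n. ?A n) = UNIV" using c(2) UN_disjointed_eq[of "\<lambda>n. fst (c n)"] by simp
  ultimately show ?thesis
    by (intro exI[of _ c] exI[of _ ?A] conjI allI c(1) disjointed_subset disjoint_family_disjointed)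
qed

text \<open>The property under the description operator in \<open>vol\<close>, named so that
  existence and uniqueness can be stated.\<close>

definition is_volume :: "'a measure \<Rightarrow> bool" where
  "is_volume \<mu> \<longleftrightarrow> sets \<mu> = sets borel \<and>
     (\<forall>c\<in>atlas M. \<forall>B\<in>sets borel. B \<subseteq> fst c \<longrightarrow>
        emeasure \<mu> B = (\<integral>\<^sup>+ y\<in>snd c ` B. ennreal (volume_density M c y) \<partial>lborel))"

lemma is_volume_unique:
  assumes "is_volume \<mu>" "is_volume \<nu>"
  shows "\<mu> = \<nu>"
proof (rule measure_eqI)
  have s: "sets \<mu> = sets borel" "sets \<nu> = sets borel" using assms by (auto simp: is_volume_def)
  then show "sets \<mu> = sets \<nu>" by simp
  fix B assume "B \<in> sets \<mu>"
  then have B: "B \<in> sets borel" using s by simp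
  from chart_partition obtain c :: "nat \<Rightarrow> ('a, 'd) chart" and A :: "nat \<Rightarrow> 'a set"
    where c: "\<And>n. c n \<in> atlas M" and A: "\<And>n. A n \<in> sets borel" "\<And>n. A n \<subseteq> fst (c n)"
    and disA: "disjoint_family A" and UnA: "(\<Union>n. A n) = UNIV" by (elim exE conjE) blast
  have dis: "disjoint_family (\<lambda>n. B \<inter> A n)" using disA unfolding disjoint_family_on_def by auto
  have "(\<Union>n. B \<inter> A n) = B \<inter> (\<Union>n. A n)" by blast
  then have Un: "(\<Union>n. B \<inter> A n) = B" using UnA by simp
  have "emeasure \<kappa> B = (\<Sum>n. \<integral>\<^sup>+ y\<in>snd (c n) ` (B \<inter> A n). ennreal (volume_density M (c n) y) \<partial>lborel)"
    if k: "is_volume \<kappa>" for \<kappa>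
  proof -
    have em: "emeasure \<kappa> (B \<inter> A n) = (\<integral>\<^sup>+ y\<in>snd (c n) ` (B \<inter> A n). ennreal (volume_density M (c n) y) \<partial>lborel)" for n
      by (rule k[unfolded is_volume_def, THEN conjunct2, rule_format]) (use c A B in auto)
    have "emeasure \<kappa> B = (\<Sum>n. emeasure \<kappa> (B \<inter> A n))"
    proof (subst suminf_emeasure[OF _ dis])
      show "range (\<lambda>n. B \<inter> A n) \<subseteq> sets \<kappa>" using k A(1) B unfolding is_volume_def by auto
    qed (simp only: Un)
    then show ?thesis by (simp only: em)
  qed
  from this[OF assms(1)] this[OF assms(2)] show "emeasure \<mu> B = emeasure \<nu> B" by simp
qed

text \<open>Each piece of the partition is measured in its own chart and the values are summed.
  Agreement of the chart measures on overlaps shows that a Borel set inside any chart receives the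
  prescribed value.\<close>

lemma is_volume_exists: "\<exists>\<mu>. is_volume \<mu>"
proof -
  from chart_partition obtain c :: "nat \<Rightarrow> ('a, 'd) chart" and A :: "nat \<Rightarrow> 'a set"
    where c: "\<And>n. c n \<in> atlas M" and A: "\<And>n. A n \<in> sets borel" "\<And>n. A n \<subseteq> fst (c n)"
    and disA: "disjoint_family A" and UnA: "(\<Union>n. A n) = UNIV" by (elim exE conjE) blast
  define f where "f B = (\<Sum>n. emeasure (chart_measure (c n)) (B \<inter> A n))" for B
  define \<mu> where "\<mu> = measure_of UNIV (sets borel) f"
  have sets_cm: "sets (chart_measure d) = sets borel" for d by (simp add: chart_measure_def)
  have sets_\<mu>: "sets \<mu> = sets borel"
    unfolding \<mu>_def using sets.sets_measure_of_eq[of "borel :: 'a measure" f] by simp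
  have em: "emeasure \<mu> B = f B" if B: "B \<in> sets borel" for B
  proof (rule emeasure_measure_of[OF \<mu>_def])
    show "positive (sets \<mu>) f" by (simp add: positive_def f_def)
    show "countably_additive (sets \<mu>) f"
      unfolding countably_additive_def sets_\<mu>
    proof (intro allI impI)
      fix B :: "nat \<Rightarrow> 'a set" assume B: "range B \<subseteq> sets borel" "disjoint_family B" "\<Union> (range B) \<in> sets borel"
      \<comment> \<open>One sum is written as an integral over the counting measure, so that the
        interchange of the two sums becomes integration of a series of nonnegative
        functions.\<close>
      have "(\<Sum>i. f (B i)) = (\<integral>\<^sup>+i. (\<Sum>n. emeasure (chart_measure (c n)) (B i \<inter> A n)) \<partial>count_space UNIV)"
        by (simp add: nn_integral_count_space_nat f_def)
      also have "\<dots> = (\<Sum>n. \<integral>\<^sup>+i. emeasure (chart_measure (c n)) (B i \<inter> A n) \<partial>count_space UNIV)"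
        by (rule nn_integral_suminf) simp
      also have "\<dots> = (\<Sum>n. \<Sum>i. emeasure (chart_measure (c n)) (B i \<inter> A n))"
        by (simp add: nn_integral_count_space_nat)
      also have "\<dots> = (\<Sum>n. emeasure (chart_measure (c n)) (\<Union>i. B i \<inter> A n))"
      proof (intro suminf_cong suminf_emeasure)
        fix n
        show "range (\<lambda>i. B i \<inter> A n) \<subseteq> sets (chart_measure (c n))"
          using B A unfolding sets_cm by auto
        show "disjoint_family (\<lambda>i. B i \<inter> A n)"
          using B(2) unfolding disjoint_family_on_def by auto
      qed
      also have "\<dots> = f (\<Union> (range B))"
      proof -
        have "(\<Union>i. B i \<inter> A n) = \<Union> (range B) \<inter> A n" for n by auto
        then show ?thesis by (simp only: f_def)
      qed
      finally show "(\<Sum>i. f (B i)) = f (\<Union> (range B))" .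
    qed
    show "B \<in> sets \<mu>" using B sets_\<mu> by simp
  qed auto
  have "is_volume \<mu>"
    unfolding is_volume_def
  proof (intro conjI ballI impI sets_\<mu>)
    fix d B assume d: "d \<in> atlas M" and B: "B \<in> sets borel" "B \<subseteq> fst d"
    have "emeasure \<mu> B = (\<Sum>n. emeasure (chart_measure d) (B \<inter> A n))"
      unfolding em[OF B(1)] f_def
      by (intro suminf_cong chart_measure_agree c d) (use A B in auto)
    also have "\<dots> = emeasure (chart_measure d) (\<Union>n. B \<inter> A n)"
    proof (rule suminf_emeasure)
      show "range (\<lambda>n. B \<inter> A n) \<subseteq> sets (chart_measure d)" using A B unfolding sets_cm by auto
      show "disjoint_family (\<lambda>n. B \<inter> A n)" using disA unfolding disjoint_family_on_def by auto
    qed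
    also have "(\<Union>n. B \<inter> A n) = B \<inter> (\<Union>n. A n)" by blast
    also have "\<dots> = B" using UnA by simp
    also have "emeasure (chart_measure d) B = (\<integral>\<^sup>+ y\<in>snd d ` B. ennreal (volume_density M d y) \<partial>lborel)"
      unfolding emeasure_chart_measure[OF d B(1)] using B(2) by (simp add: Int_absorb2)
    finally show "emeasure \<mu> B = (\<integral>\<^sup>+ y\<in>snd d ` B. ennreal (volume_density M d y) \<partial>lborel)" .
  qed
  then show ?thesis by (rule exI)
qed

lemma is_volume_vol: "is_volume (vol M)"
proof -
  have ex1: "\<exists>!\<mu>. is_volume \<mu>"
  proof (rule ex_ex1I)
    show "\<exists>\<mu>. is_volume \<mu>" by (rule is_volume_exists)
    show "\<mu> = \<nu>" if "is_volume \<mu>" "is_volume \<nu>" for \<mu> \<nu>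
      by (rule is_volume_unique[OF that])
  qed
  have "vol M = (THE \<mu>. is_volume \<mu>)" unfolding vol_def is_volume_def ..
  then show ?thesis using theI'[OF ex1] by (simp only:)
qed

lemma sets_vol: "sets (vol M) = sets borel"
  using is_volume_vol by (simp add: is_volume_def)

lemma space_vol [simp]: "space (vol M) = UNIV"
  using sets_eq_imp_space_eq[OF sets_vol] by simp

lemma measurable_vol: "borel_measurable (vol M) = borel_measurable borel"
  by (rule measurable_cong_sets[OF sets_vol refl])

lemma density_vol:
  assumes c: "c \<in> atlas M"
  shows "density (vol M) (indicator (fst c)) = chart_measure c"
proof (rule measure_eqI)
  show s: "sets (density (vol M) (indicator (fst c))) = sets (chart_measure c)"
    by (simp add: sets_vol chart_measure_def)
  fix B assume "B \<in> sets (density (vol M) (indicator (fst c)))"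
  then have B: "B \<in> sets borel" by (simp add: sets_vol)
  have "emeasure (density (vol M) (indicator (fst c))) B = emeasure (vol M) (B \<inter> fst c)"
    using B chart_borel[OF c]
    by (subst emeasure_density) (simp_all add: sets_vol measurable_vol indicator_inter_arith[symmetric] Int_commute)
  also have "\<dots> = emeasure (chart_measure c) B"
    using is_volume_vol c B chart_borel[OF c] emeasure_chart_measure[OF c B] unfolding is_volume_def by auto
  finally show "emeasure (density (vol M) (indicator (fst c))) B = emeasure (chart_measure c) B" .
qed

end

section \<open>Divergence theorem with compact support\<close>

section \<open>Integration by parts\<close>

lemma integrable_continuous_compact_support:
  fixes g :: "'a::euclidean_space \<Rightarrow> real"
  assumes "continuous_on U g" "compact K" "K \<subseteq> U" "\<And>y. y \<in> U - K \<Longrightarrow> g y = 0"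
  shows "integrable lborel (\<lambda>y. indicator U y * g y)"
proof -
  have "integrable lborel (\<lambda>y. indicator K y *\<^sub>R g y)"
    by (rule borel_integrable_compact[OF assms(2) continuous_on_subset[OF assms(1,3)]])
  moreover have "(\<lambda>y. indicator K y *\<^sub>R g y) = (\<lambda>y. indicator U y * g y)"
    using assms(3,4) by (auto simp: indicator_def fun_eq_iff)
  ultimately show ?thesis by metis
qed

text \<open>By translation invariance the integrals of the difference quotients vanish.\<close>

lemma integral_directional_derivative_eq_0:
  fixes F :: "'a::euclidean_space \<Rightarrow> real"
  assumes der: "\<And>y. (F has_derivative F' y) (at y)" and cont: "continuous_on UNIV (\<lambda>y. F' y v)"
    and K: "compact K" and F0: "\<And>y. y \<notin> K \<Longrightarrow> F y = 0"
  shows "(\<integral>y. F' y v \<partial>lborel) = 0"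
proof -
  have F'0: "F' y v = 0" if y: "y \<notin> K" for y
  proof -
    have "((\<lambda>_. 0) has_derivative (\<lambda>_. 0)) (at y)" by simp
    then have "(F has_derivative (\<lambda>_. 0)) (at y)"
      by (rule has_derivative_transform_within_open[where s = "- K"])
         (use y F0 K in \<open>auto simp: compact_imp_closed open_Compl\<close>)
    from has_derivative_unique[OF der this] show ?thesis by (simp add: fun_eq_iff)
  qed
  have F_cont: "continuous_on UNIV F"
    using der has_derivative_continuous continuous_at_imp_continuous_on by blast
  obtain B where B: "\<And>y. \<bar>F' y v\<bar> \<le> B"
  proof -
    have "bounded ((\<lambda>y. F' y v) ` K)"
      by (intro compact_imp_bounded compact_continuous_image continuous_on_subset[OF cont] K) simp
    then obtain B where "\<And>y. y \<in> K \<Longrightarrow> norm (F' y v) \<le> B" by (auto simp: bounded_iff)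
    then have "\<bar>F' y v\<bar> \<le> max B 0" for y using F'0[of y] by (cases "y \<in> K") fastforce+
    then show ?thesis using that by blast
  qed
  obtain R where R: "\<And>y. y \<in> K \<Longrightarrow> norm y \<le> R"
    using compact_imp_bounded[OF K] by (auto simp: bounded_iff)
  \<comment> \<open>The steps lie in \<open>(0, 1]\<close>, so the supports of all difference
    quotients stay in one ball of radius \<open>R + norm v\<close>.\<close>
  define h where "h n = inverse (real (Suc n))" for n
  have h: "h n > 0" "h n \<le> 1" for n by (auto simp: h_def field_simps)
  define D where "D n y = (F (y + h n *\<^sub>R v) - F y) / h n" for n y
  have F_int: "integrable lborel F"
  proof -
    have "integrable lborel (\<lambda>y. indicator UNIV y * F y)"
      by (rule integrable_continuous_compact_support[OF F_cont K]) (auto simp: F0)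
    then show ?thesis by simp
  qed
  have shift: "integrable lborel (\<lambda>y. F (y + a))" "(\<integral>y. F (y + a) \<partial>lborel) = (\<integral>y. F y \<partial>lborel)" for a
  proof -
    have eq: "distr lborel borel ((+) a) = (lborel :: 'a measure)" by (rule lborel_distr_plus)
    have m: "F \<in> borel_measurable borel" using F_int by auto
    have "integrable (distr lborel borel ((+) a)) F" unfolding eq by (rule F_int)
    then show "integrable lborel (\<lambda>y. F (y + a))"
      using m by (subst (asm) integrable_distr_eq) (auto simp: add.commute)
    have "(\<integral>y. F y \<partial>distr lborel borel ((+) a)) = (\<integral>y. F (a + y) \<partial>lborel)"
      using m by (intro integral_distr) auto
    then show "(\<integral>y. F (y + a) \<partial>lborel) = (\<integral>y. F y \<partial>lborel)" unfolding eq by (simp add: add.commute)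
  qed
  have D_int: "(\<integral>y. D n y \<partial>lborel) = 0" for n
    unfolding D_def using shift F_int by simp
  have "(\<lambda>n. \<integral>y. D n y \<partial>lborel) \<longlonglongrightarrow> (\<integral>y. F' y v \<partial>lborel)"
  proof (rule integral_dominated_convergence)
    show "(\<lambda>y. F' y v) \<in> borel_measurable lborel"
      using borel_measurable_continuous_onI[OF cont] by simp
    show "D n \<in> borel_measurable lborel" for n
      unfolding D_def using shift(1) F_int by (intro borel_measurable_divide borel_measurable_diff) auto
    show "integrable lborel (\<lambda>y. indicator (cball 0 (R + norm v)) y *\<^sub>R B)"
      by (intro borel_integrable_compact continuous_on_const) simp
    show "AE y in lborel. (\<lambda>n. D n y) \<longlonglongrightarrow> F' y v"
    proof (rule AE_I2)
      fix y
      have "((\<lambda>t. F (y + t *\<^sub>R v)) has_derivative (\<lambda>t. F' (y + 0 *\<^sub>R v) (t *\<^sub>R v))) (at 0)"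
        by (rule has_derivative_compose[where g = F and f = "\<lambda>t. y + t *\<^sub>R v"])
           (auto intro!: derivative_eq_intros der[of "y + 0 *\<^sub>R v", simplified])
      then have "((\<lambda>t. F (y + t *\<^sub>R v)) has_real_derivative F' y v) (at 0)"
        using linear_scale[OF has_derivative_linear[OF der]]
        by (simp add: has_field_derivative_def mult.commute[of _ "F' y v"])
      then have "((\<lambda>t. (F (y + t *\<^sub>R v) - F y) / t) \<longlongrightarrow> F' y v) (at 0)"
        by (simp add: DERIV_def)
      moreover have "filterlim h (at 0) sequentially"
        unfolding filterlim_at h_def[abs_def] using LIMSEQ_inverse_real_of_nat by auto
      ultimately show "(\<lambda>n. D n y) \<longlonglongrightarrow> F' y v"
        unfolding D_def by (rule filterlim_compose)
    qed
    fix n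
    show "AE y in lborel. norm (D n y) \<le> indicator (cball 0 (R + norm v)) y *\<^sub>R B"
    proof (rule AE_I2)
      fix y
      have "\<bar>F (y + h n *\<^sub>R v) - F y\<bar> \<le> h n * B"
      proof -
        \<comment> \<open>The mean value theorem along \<open>v\<close> bounds the difference
          quotients by the bound \<open>B\<close> of the derivative, which provides the dominating
          function.\<close>
        have "\<exists>t. 0 < t \<and> t < h n \<and> F (y + h n *\<^sub>R v) - F (y + 0 *\<^sub>R v) = (h n - 0) * F' (y + t *\<^sub>R v) v"
        proof (rule MVT2[OF h(1)])
          fix t :: real
          have "((\<lambda>t. F (y + t *\<^sub>R v)) has_derivative (\<lambda>s. F' (y + t *\<^sub>R v) (s *\<^sub>R v))) (at t)"
            by (rule has_derivative_compose[where g = F and f = "\<lambda>t. y + t *\<^sub>R v"])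
               (auto intro!: derivative_eq_intros der)
          then show "((\<lambda>t. F (y + t *\<^sub>R v)) has_real_derivative F' (y + t *\<^sub>R v) v) (at t)"
            using linear_scale[OF has_derivative_linear[OF der]]
            by (simp add: has_field_derivative_def mult.commute[of _ "F' _ v"])
        qed
        then obtain t where "F (y + h n *\<^sub>R v) - F y = h n * F' (y + t *\<^sub>R v) v" by auto
        then show ?thesis using B[of "y + t *\<^sub>R v"] h(1)[of n] by (simp add: abs_mult mult_left_mono)
      qed
      then have "\<bar>D n y\<bar> \<le> B" using h(1)[of n] by (simp add: D_def abs_divide divide_le_eq mult.commute)
      moreover have "D n y = 0" if "y \<notin> cball 0 (R + norm v)"
      proof -
        have y: "norm y > R + norm v" using that by simp
        then have "norm y > R" using norm_ge_zero[of v] by linarith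
        have "norm y \<le> norm (y + h n *\<^sub>R v) + norm (h n *\<^sub>R v)"
          using norm_triangle_ineq4[of "y + h n *\<^sub>R v" "h n *\<^sub>R v"] by simp
        moreover have "norm (h n *\<^sub>R v) \<le> norm v"
          using h[of n] mult_right_mono[of "h n" 1 "norm v"] by simp
        ultimately have "norm (y + h n *\<^sub>R v) > R" using y by linarith
        then have "y + h n *\<^sub>R v \<notin> K" "y \<notin> K"
          using R[of "y + h n *\<^sub>R v"] R[of y] \<open>norm y > R\<close> by auto
        then show ?thesis by (simp add: D_def F0)
      qed
      ultimately show "norm (D n y) \<le> indicator (cball 0 (R + norm v)) y *\<^sub>R B"
        by (cases "y \<in> cball 0 (R + norm v)") auto
    qed
  qed
  then show ?thesis using LIMSEQ_unique[OF _ tendsto_const] by (simp add: D_int)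
qed

lemma smooth_on_partial: "smooth_on S f \<Longrightarrow> smooth_on S (partial i f)"
  unfolding partial_def[abs_def] by (rule smooth_on_frechet_derivative)

lemma frechet_derivative_transform:
  assumes "open U" "y \<in> U" "\<And>x. x \<in> U \<Longrightarrow> f x = g x"
  shows "frechet_derivative f (at y) = frechet_derivative g (at y)"
proof -
  have "(f has_derivative D) (at y) \<longleftrightarrow> (g has_derivative D) (at y)" for D
    using has_derivative_transform_within_open[OF _ assms(1,2), of f D UNIV g]
      has_derivative_transform_within_open[OF _ assms(1,2), of g D UNIV f] assms(3) by auto
  then show ?thesis unfolding frechet_derivative_def by simp
qed

lemma partial_transform:
  "open U \<Longrightarrow> y \<in> U \<Longrightarrow> (\<And>x. x \<in> U \<Longrightarrow> f x = g x) \<Longrightarrow> partial i f y = partial i g y"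
  unfolding partial_def using frechet_derivative_transform by metis

lemma partial_eq_0:
  assumes "open U" "compact K" "y \<in> U - K" "\<And>x. x \<in> U - K \<Longrightarrow> f x = 0"
  shows "partial i f y = 0"
proof -
  have "partial i f y = partial i (\<lambda>_. 0) y"
    by (rule partial_transform[of "U - K"]) (use assms in \<open>auto simp: open_Diff compact_imp_closed\<close>)
  then show ?thesis by (simp add: partial_def)
qed

text \<open>The product of \<open>\<phi>\<close> with a component of the field, extended by zero, is
  supported in \<open>K\<close>, so its partial derivative integrates to 0; the product rule gives
  the rest. Either factor may carry the support, since Green's formula is used in both
  directions.\<close>

lemma divergence_by_parts:
  fixes X :: "'d::finite \<Rightarrow> real^'d \<Rightarrow> real"
  assumes U: "open U" and X: "\<And>i. smooth_on U (X i)" and \<phi>: "smooth_on U \<phi>"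
    and K: "compact K" "K \<subseteq> U"
    and supp: "(\<forall>y\<in>U - K. \<phi> y = 0) \<or> (\<forall>y\<in>U - K. \<forall>i. X i y = 0)"
  shows "(\<integral>y. indicator U y * (\<phi> y * (\<Sum>i\<in>UNIV. partial i (X i) y)) \<partial>lborel)
    = - (\<integral>y. indicator U y * (\<Sum>i\<in>UNIV. X i y * partial i \<phi> y) \<partial>lborel)"
proof -
  have pc: "continuous_on U (partial i f)" if "smooth_on U f" for i and f :: "real^'d \<Rightarrow> real"
    by (intro smooth_on_continuous_on smooth_on_partial that)
  note cont = smooth_on_continuous_on[OF X] smooth_on_continuous_on[OF \<phi>] pc[OF X] pc[OF \<phi>]
  have dX: "partial i (X i) y = 0" if "\<forall>y\<in>U - K. \<forall>i. X i y = 0" "y \<in> U - K" for i y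
    by (rule partial_eq_0[OF U K(1) that(2)]) (use that in blast)
  have d\<phi>: "partial i \<phi> y = 0" if "\<forall>y\<in>U - K. \<phi> y = 0" "y \<in> U - K" for i y
    by (rule partial_eq_0[OF U K(1) that(2)]) (use that in blast)
  have int1: "integrable lborel (\<lambda>y. indicator U y * (\<phi> y * partial i (X i) y))" for i
    by (rule integrable_continuous_compact_support[OF _ K])
       (use supp dX in \<open>auto intro!: continuous_on_mult cont\<close>)
  have int2: "integrable lborel (\<lambda>y. indicator U y * (X i y * partial i \<phi> y))" for i
    by (rule integrable_continuous_compact_support[OF _ K])
       (use supp d\<phi> in \<open>auto intro!: continuous_on_mult cont\<close>)
  have zero: "(\<integral>y. indicator U y * (\<phi> y * partial i (X i) y) + indicator U y * (X i y * partial i \<phi> y) \<partial>lborel) = 0" for i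
  proof -
    define F where "F y = (if y \<in> U then \<phi> y * X i y else 0)" for y
    define F' where "F' y v = (if y \<in> U then \<phi> y * frechet_derivative (X i) (at y) v
       + frechet_derivative \<phi> (at y) v * X i y else 0)" for y v
    have F0: "F y = 0" if "y \<notin> K" for y using supp that by (auto simp: F_def)
    have oK: "open (- K)" using K by (simp add: compact_imp_closed open_Compl)
    have der: "(F has_derivative F' y) (at y)" for y
    proof (cases "y \<in> U")
      case True
      have "((\<lambda>y. \<phi> y * X i y) has_derivative F' y) (at y)"
        using has_derivative_mult[OF smooth_on_has_derivative[OF \<phi> True] smooth_on_has_derivative[OF X[of i] True]]
        by (simp add: F'_def[abs_def] True)
      then show ?thesis
        by (rule has_derivative_transform_within_open[OF _ U True]) (simp add: F_def)
    next
      case False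
      then have yK: "y \<in> - K" using K(2) by auto
      have "((\<lambda>_. 0) has_derivative (\<lambda>_. 0)) (at y)" by simp
      then have "(F has_derivative (\<lambda>_. 0)) (at y)"
        by (rule has_derivative_transform_within_open[OF _ oK yK]) (simp add: F0)
      then show ?thesis using False by (simp add: F'_def[abs_def])
    qed
    have eq: "F' y (axis i 1) = indicator U y * (\<phi> y * partial i (X i) y) + indicator U y * (X i y * partial i \<phi> y)" for y
      by (simp add: F'_def partial_def indicator_def mult.commute)
    \<comment> \<open>Continuity is checked on two open sets that cover the space: \<open>U\<close>,
      where the product rule applies, and the complement of \<open>K\<close>, where the derivative
      is zero.\<close>
    have "continuous_on (U \<union> - K) (\<lambda>y. F' y (axis i 1))"
    proof (rule continuous_on_open_Un[OF U oK])
      have "continuous_on U (\<lambda>y. \<phi> y * partial i (X i) y + X i y * partial i \<phi> y)"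
        by (intro continuous_on_add continuous_on_mult cont)
      then show "continuous_on U (\<lambda>y. F' y (axis i 1))"
        by (rule continuous_on_eq) (simp add: eq)
      have "F' y (axis i 1) = 0" if "y \<in> - K" for y
        unfolding eq using supp dX[of y i] d\<phi>[of y i] that by (cases "y \<in> U") auto
      then show "continuous_on (- K) (\<lambda>y. F' y (axis i 1))"
        using continuous_on_eq[OF continuous_on_const[of "- K" 0], of "\<lambda>y. F' y (axis i 1)"] by simp
    qed
    moreover have "U \<union> - K = UNIV" using K(2) by auto
    ultimately have "(\<integral>y. F' y (axis i 1) \<partial>lborel) = 0"
      by (intro integral_directional_derivative_eq_0[OF der _ K(1) F0]) simp_all
    then show ?thesis by (simp add: eq)
  qed
  have "(\<integral>y. indicator U y * (\<phi> y * (\<Sum>i\<in>UNIV. partial i (X i) y)) \<partial>lborel)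
      = (\<Sum>i\<in>UNIV. \<integral>y. indicator U y * (\<phi> y * partial i (X i) y) \<partial>lborel)"
    by (simp only: sum_distrib_left) (rule Bochner_Integration.integral_sum, rule int1)
  also have "\<dots> = (\<Sum>i\<in>UNIV. - (\<integral>y. indicator U y * (X i y * partial i \<phi> y) \<partial>lborel))"
  proof (rule sum.cong[OF refl])
    fix i
    show "(\<integral>y. indicator U y * (\<phi> y * partial i (X i) y) \<partial>lborel) = - (\<integral>y. indicator U y * (X i y * partial i \<phi> y) \<partial>lborel)"
      using zero[of i] Bochner_Integration.integral_add[OF int1[of i] int2[of i]] by linarith
  qed
  also have "\<dots> = - (\<integral>y. indicator U y * (\<Sum>i\<in>UNIV. X i y * partial i \<phi> y) \<partial>lborel)"
    by (simp only: sum_negf sum_distrib_left) (subst Bochner_Integration.integral_sum, rule int2, rule refl)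
  finally show ?thesis .
qed

section \<open>Green's formula within one chart\<close>

section \<open>The Laplacian in a chart\<close>

context riemannian_mfd
begin

lemma integral_vol_chart:
  fixes f :: "'a \<Rightarrow> real"
  assumes c: "c \<in> atlas M" and f: "f \<in> borel_measurable borel"
  shows "(\<integral>p. indicator (fst c) p * f p \<partial>vol M)
      = (\<integral>y. indicator (chart_image c) y * (volume_density M c y * f (chart_inv c y)) \<partial>lborel)"
    and "integrable (vol M) (\<lambda>p. indicator (fst c) p * f p)
      \<longleftrightarrow> integrable lborel (\<lambda>y. indicator (chart_image c) y * (volume_density M c y * f (chart_inv c y)))"
proof -
  let ?w = "\<lambda>y. volume_density M c y * indicator (chart_image c) y"
  have w0: "?w y \<ge> 0" for y using volume_density_pos[OF c, of y] by (simp add: indicator_def less_imp_le)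
  have dens: "density (vol M) (\<lambda>p. ennreal (indicator (fst c) p)) = distr (density lborel (\<lambda>y. ennreal (?w y))) borel (chart_inv' c)"
  proof -
    have "(\<lambda>y. ennreal (?w y)) = (\<lambda>y. ennreal (volume_density M c y) * indicator (chart_image c) y)"
      by (auto simp: indicator_def)
    moreover have "(\<lambda>p. ennreal (indicator (fst c) p)) = indicator (fst c)" by (auto simp: indicator_def)
    ultimately show ?thesis using density_vol[OF c] by (simp add: chart_measure_def)
  qed
  have meas: "f \<in> borel_measurable (vol M)" "(indicator (fst c) :: 'a \<Rightarrow> real) \<in> borel_measurable (vol M)"
    using f chart_borel[OF c] by (auto simp: measurable_vol)
  have meas': "(\<lambda>y. f (chart_inv' c y)) \<in> borel_measurable borel"
    by (rule measurable_compose[OF measurable_chart_inv'[OF c] f])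
  have pt: "?w y * f (chart_inv' c y) = indicator (chart_image c) y * (volume_density M c y * f (chart_inv c y))" for y
    by (simp add: indicator_def chart_inv'_def)
  have "(\<integral>p. indicator (fst c) p * f p \<partial>vol M) = (\<integral>p. f p \<partial>density (vol M) (\<lambda>p. ennreal (indicator (fst c) p)))"
    by (subst integral_density) (use meas in auto)
  also have "\<dots> = (\<integral>y. f (chart_inv' c y) \<partial>density lborel (\<lambda>y. ennreal (?w y)))"
    unfolding dens by (rule integral_distr) (use measurable_chart_inv'[OF c] f in auto)
  also have "\<dots> = (\<integral>y. ?w y * f (chart_inv' c y) \<partial>lborel)"
    by (subst integral_density) (use w0 measurable_volume_density[OF c] meas' in auto)
  finally show "(\<integral>p. indicator (fst c) p * f p \<partial>vol M)
      = (\<integral>y. indicator (chart_image c) y * (volume_density M c y * f (chart_inv c y)) \<partial>lborel)"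
    unfolding pt .
  have "integrable (vol M) (\<lambda>p. indicator (fst c) p * f p) \<longleftrightarrow> integrable (density (vol M) (\<lambda>p. ennreal (indicator (fst c) p))) f"
    by (subst integrable_density) (use meas in auto)
  also have "\<dots> \<longleftrightarrow> integrable (density lborel (\<lambda>y. ennreal (?w y))) (\<lambda>y. f (chart_inv' c y))"
    unfolding dens by (rule integrable_distr_eq) (use measurable_chart_inv'[OF c] f in auto)
  also have "\<dots> \<longleftrightarrow> integrable lborel (\<lambda>y. ?w y * f (chart_inv' c y))"
    by (subst integrable_density) (use w0 measurable_volume_density[OF c] meas' in auto)
  finally show "integrable (vol M) (\<lambda>p. indicator (fst c) p * f p)
      \<longleftrightarrow> integrable lborel (\<lambda>y. indicator (chart_image c) y * (volume_density M c y * f (chart_inv c y)))"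
    unfolding pt .
qed

definition chart_smooth :: "('a, 'd) chart \<Rightarrow> ('a \<Rightarrow> real) \<Rightarrow> bool" where
  "chart_smooth c f \<longleftrightarrow> smooth_on (chart_image c) (f \<circ> chart_inv c)"

text \<open>The coefficients of the Laplacian in divergence form: the root of the determinant of the
  metric times the inverse metric.\<close>

definition coeff_matrix :: "('a, 'd) chart \<Rightarrow> 'd \<Rightarrow> 'd \<Rightarrow> real^'d \<Rightarrow> real" where
  "coeff_matrix c i j y = volume_density M c y * matrix_inv (metric M c (chart_inv c y)) $ i $ j"

text \<open>The Riemannian inner product of the two gradients, expressed through the differentials
  and the inverse metric.\<close>

definition grad_inner :: "('a, 'd) chart \<Rightarrow> ('a \<Rightarrow> real) \<Rightarrow> ('a \<Rightarrow> real) \<Rightarrow> 'a \<Rightarrow> real" where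
  "grad_inner c f g p = (\<chi> i. partial i (f \<circ> chart_inv c) (snd c p)) \<bullet>
     (matrix_inv (metric M c p) *v (\<chi> j. partial j (g \<circ> chart_inv c) (snd c p)))"

lemma smooth_coeff_matrix: "c \<in> atlas M \<Longrightarrow> smooth_on (chart_image c) (coeff_matrix c i j)"
  unfolding coeff_matrix_def[abs_def]
proof (intro smooth_on_mult smooth_volume_density smooth_on_matrix_inv smooth_metric chart_image_open)
  fix y assume "c \<in> atlas M" "y \<in> chart_image c"
  then show "det (metric M c (chart_inv c y)) \<noteq> 0"
    using det_metric_pos[OF _ chart_inv_mem, of c y] by simp
qed

lemma matrix_inv_metric:
  assumes "c \<in> atlas M" "p \<in> fst c"
  shows "metric M c p ** matrix_inv (metric M c p) = mat 1" "matrix_inv (metric M c p) ** metric M c p = mat 1"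
    "transpose (matrix_inv (metric M c p)) = matrix_inv (metric M c p)"
proof -
  let ?g = "metric M c p" and ?h = "matrix_inv (metric M c p)"
  have "invertible ?g" using det_metric_pos[OF assms] by (simp add: invertible_det_nz)
  then show 1: "?g ** ?h = mat 1" and 2: "?h ** ?g = mat 1" by (auto intro: matrix_inv_mult)
  have "transpose (?g ** ?h) = mat 1" using 1 by (simp add: transpose_mat)
  then have "transpose ?h ** ?g = mat 1" by (simp add: matrix_transpose_mul metric_symmetric[OF assms])
  then have "transpose ?h ** (?g ** ?h) = ?h" by (simp add: matrix_mul_assoc)
  then show "transpose ?h = ?h" by (simp add: 1)
qed

lemma volume_density_grad_inner:
  assumes "c \<in> atlas M" "y \<in> chart_image c"
  shows "volume_density M c y * grad_inner c f g (chart_inv c y)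
    = (\<Sum>i\<in>UNIV. (\<Sum>j\<in>UNIV. coeff_matrix c i j y * partial j (g \<circ> chart_inv c) y) * partial i (f \<circ> chart_inv c) y)"
  unfolding grad_inner_def chart_inv_right[OF assms] inner_vec_def matrix_vector_mult_def coeff_matrix_def
  by (simp add: sum_distrib_left sum_distrib_right mult_ac)

text \<open>The volume weight cancels the division in the Laplacian and leaves a pure divergence, to
  which integration by parts applies.\<close>

lemma volume_density_laplacian:
  assumes "c \<in> atlas M" "y \<in> chart_image c"
  shows "volume_density M c y * laplacian_in_chart M c f (chart_inv c y)
    = (\<Sum>i\<in>UNIV. partial i (\<lambda>y. \<Sum>j\<in>UNIV. coeff_matrix c i j y * partial j (f \<circ> chart_inv c) y) y)"
  unfolding laplacian_in_chart_def chart_inv_right[OF assms] coeff_matrix_def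
  using volume_density_pos[OF assms] by simp

lemma smooth_flux:
  assumes c: "c \<in> atlas M" and f: "chart_smooth c f"
  shows "smooth_on (chart_image c) (\<lambda>y. \<Sum>j\<in>UNIV. coeff_matrix c i j y * partial j (f \<circ> chart_inv c) y)"
  by (intro smooth_on_sum smooth_on_mult smooth_coeff_matrix smooth_on_partial chart_image_open c)
     (use f in \<open>simp add: chart_smooth_def\<close>)

lemma continuous_on_chart:
  assumes c: "c \<in> atlas M" and h: "continuous_on (chart_image c) h" and g: "\<And>p. p \<in> fst c \<Longrightarrow> g p = h (snd c p)"
  shows "continuous_on (fst c) g"
proof -
  have "continuous_on (fst c) (\<lambda>p. h (snd c p))"
    by (rule continuous_on_compose2[OF h chart_continuous[OF c]]) (auto simp: chart_mem)
  then show ?thesis by (rule continuous_on_eq) (simp add: g)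
qed

lemma continuous_laplacian:
  assumes c: "c \<in> atlas M" and f: "chart_smooth c f"
  shows "continuous_on (fst c) (laplacian_in_chart M c f)"
proof (rule continuous_on_chart[OF c])
  show "continuous_on (chart_image c) (\<lambda>y. (\<Sum>i\<in>UNIV. partial i (\<lambda>y. \<Sum>j\<in>UNIV. coeff_matrix c i j y * partial j (f \<circ> chart_inv c) y) y)
     / volume_density M c y)"
    using volume_density_pos[OF c]
    by (intro continuous_on_divide smooth_on_continuous_on smooth_on_sum smooth_on_partial smooth_flux
        smooth_volume_density c f chart_image_open) fastforce
qed (simp add: laplacian_in_chart_def coeff_matrix_def)

lemma continuous_chart_smooth:
  assumes c: "c \<in> atlas M" and f: "chart_smooth c f"
  shows "continuous_on (fst c) f"
  by (rule continuous_on_chart[OF c smooth_on_continuous_on[OF f[unfolded chart_smooth_def]]])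
     (simp add: chart_inv_left[OF c])

lemma continuous_grad_inner:
  assumes c: "c \<in> atlas M" and f: "chart_smooth c f" and g: "chart_smooth c g"
  shows "continuous_on (fst c) (grad_inner c f g)"
proof (rule continuous_on_chart[OF c])
  show "continuous_on (chart_image c) (\<lambda>y. (\<Sum>i\<in>UNIV. (\<Sum>j\<in>UNIV. coeff_matrix c i j y * partial j (g \<circ> chart_inv c) y) * partial i (f \<circ> chart_inv c) y)
     / volume_density M c y)"
    using volume_density_pos[OF c] f
    by (intro continuous_on_divide smooth_on_continuous_on smooth_on_sum smooth_on_mult smooth_on_partial smooth_flux
        smooth_volume_density c g chart_image_open) (fastforce simp: chart_smooth_def)+
  fix p assume p: "p \<in> fst c"
  have "volume_density M c (snd c p) \<noteq> 0" using volume_density_pos[OF c chart_mem[OF p]] by simp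
  then show "grad_inner c f g p = (\<Sum>i\<in>UNIV. (\<Sum>j\<in>UNIV. coeff_matrix c i j (snd c p) * partial j (g \<circ> chart_inv c) (snd c p)) * partial i (f \<circ> chart_inv c) (snd c p))
     / volume_density M c (snd c p)"
    using volume_density_grad_inner[OF c chart_mem[OF p], of f g] by (simp add: chart_inv_left[OF c p] field_simps)
qed

lemma indicator_borel_measurable:
  fixes g :: "'a \<Rightarrow> real"
  assumes "N \<in> sets borel" "continuous_on N g"
  shows "(\<lambda>p. indicator N p * g p) \<in> borel_measurable borel"
  using borel_measurable_continuous_on_indicator[OF assms] by simp

lemma grad_inner_commute:
  assumes "c \<in> atlas M" "p \<in> fst c"
  shows "grad_inner c f g p = grad_inner c g f p"
  unfolding grad_inner_def
  by (metis dot_lmul_matrix inner_commute matrix_inv_metric(3)[OF assms] vector_transpose_matrix)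

text \<open>Integration by parts in coordinates with the flux of \<open>f\<close> as vector field.
  If \<open>f\<close> carries the support instead of \<open>g\<close>, its derivatives and hence the
  flux vanish off the same compact set.\<close>

lemma chart_green:
  assumes c: "c \<in> atlas M" and f: "chart_smooth c f" and g: "chart_smooth c g"
    and K: "compact K" "K \<subseteq> fst c" and supp: "(\<forall>p\<in>fst c - K. g p = 0) \<or> (\<forall>p\<in>fst c - K. f p = 0)"
  shows "(\<integral>p. indicator (fst c) p * (g p * laplacian_in_chart M c f p) \<partial>vol M)
    = - (\<integral>p. indicator (fst c) p * grad_inner c g f p \<partial>vol M)"
proof -
  let ?U = "chart_image c" and ?X = "\<lambda>i y. \<Sum>j\<in>UNIV. coeff_matrix c i j y * partial j (f \<circ> chart_inv c) y"
  have reindicate: "(\<lambda>p. indicator (fst c) p * h p) = (\<lambda>p. indicator (fst c) p * (indicator (fst c) p * h p))" for h :: "'a \<Rightarrow> real"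
    by (auto simp: indicator_def)
  have chart: "(\<integral>p. indicator (fst c) p * h p \<partial>vol M) = (\<integral>y. indicator ?U y * (volume_density M c y * h (chart_inv c y)) \<partial>lborel)"
    if "continuous_on (fst c) h" for h
    by (subst reindicate, subst integral_vol_chart(1)[OF c indicator_borel_measurable[OF chart_borel[OF c] that]])
       (auto intro!: Bochner_Integration.integral_cong simp: indicator_def chart_inv_mem[OF c])
  have K': "compact (snd c ` K)" "snd c ` K \<subseteq> ?U"
    using compact_continuous_image[OF continuous_on_subset[OF chart_continuous[OF c] K(2)] K(1)] K(2)
    by (auto simp: chart_image_def)
  have out: "chart_inv c y \<in> fst c - K" if "y \<in> ?U - snd c ` K" for y
    using that chart_inv_mem[OF c, of y] chart_inv_right[OF c, of y] by (auto simp: image_iff)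
  have zeroX: "?X i y = 0" if "\<forall>p\<in>fst c - K. f p = 0" "y \<in> ?U - snd c ` K" for i y
  proof -
    have "partial j (f \<circ> chart_inv c) y = 0" for j
      by (rule partial_eq_0[OF chart_image_open[OF c] K'(1) that(2)]) (use that(1) out in auto)
    then show ?thesis by simp
  qed
  have supp': "(\<forall>y\<in>?U - snd c ` K. (g \<circ> chart_inv c) y = 0) \<or> (\<forall>y\<in>?U - snd c ` K. \<forall>i. ?X i y = 0)"
    using supp
  proof
    assume "\<forall>p\<in>fst c - K. g p = 0"
    then show ?thesis using out by auto
  next
    assume "\<forall>p\<in>fst c - K. f p = 0"
    then show ?thesis using zeroX by blast
  qed
  have cont: "continuous_on (fst c) (\<lambda>p. g p * laplacian_in_chart M c f p)" "continuous_on (fst c) (grad_inner c g f)"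
    by (intro continuous_on_mult continuous_chart_smooth continuous_laplacian continuous_grad_inner c f g)+
  have "(\<integral>p. indicator (fst c) p * (g p * laplacian_in_chart M c f p) \<partial>vol M)
     = (\<integral>y. indicator ?U y * ((g \<circ> chart_inv c) y * (\<Sum>i\<in>UNIV. partial i (?X i) y)) \<partial>lborel)"
    unfolding chart[OF cont(1)]
  proof (rule Bochner_Integration.integral_cong[OF refl])
    fix y
    show "indicator ?U y * (volume_density M c y * (g (chart_inv c y) * laplacian_in_chart M c f (chart_inv c y)))
      = indicator ?U y * ((g \<circ> chart_inv c) y * (\<Sum>i\<in>UNIV. partial i (?X i) y))"
      using volume_density_laplacian[OF c, of y f] by (cases "y \<in> ?U") (auto simp: mult_ac)
  qed
  also have "\<dots> = - (\<integral>y. indicator ?U y * (\<Sum>i\<in>UNIV. ?X i y * partial i (g \<circ> chart_inv c) y) \<partial>lborel)"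
    by (rule divergence_by_parts[OF chart_image_open[OF c] smooth_flux[OF c f] g[unfolded chart_smooth_def] K' supp'])
  also have "(\<integral>y. indicator ?U y * (\<Sum>i\<in>UNIV. ?X i y * partial i (g \<circ> chart_inv c) y) \<partial>lborel)
      = (\<integral>p. indicator (fst c) p * grad_inner c g f p \<partial>vol M)"
    unfolding chart[OF cont(2)]
  proof (rule Bochner_Integration.integral_cong[OF refl])
    fix y
    show "indicator ?U y * (\<Sum>i\<in>UNIV. ?X i y * partial i (g \<circ> chart_inv c) y)
      = indicator ?U y * (volume_density M c y * grad_inner c g f (chart_inv c y))"
      using volume_density_grad_inner[OF c, of y g f] by (cases "y \<in> ?U") auto
  qed
  finally show ?thesis .
qed

end

section \<open>Chart independence and the weak Laplacian of a bump\<close>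

section \<open>The Laplace-Beltrami operator\<close>

context riemannian_mfd
begin

text \<open>Chain rule: differentials pull back along the transition map by the transposed
  Jacobian.\<close>

lemma partial_chart_change:
  assumes c: "c \<in> atlas M" and c': "c' \<in> atlas M" and p: "p \<in> fst c" "p \<in> fst c'"
    and f: "chart_smooth c' f"
  shows "(\<chi> i. partial i (f \<circ> chart_inv c) (snd c p))
    = transpose (matrix (frechet_derivative (transition c c') (at (snd c p)))) *v (\<chi> i. partial i (f \<circ> chart_inv c') (snd c' p))"
proof -
  let ?t = "transition c c'" and ?y = "snd c p" and ?z = "snd c' p"
  let ?T = "frechet_derivative ?t (at ?y)" and ?F = "frechet_derivative (f \<circ> chart_inv c') (at ?z)"
  have t: "(?t has_derivative ?T) (at ?y)" by (rule transition_has_derivative[OF c c' p])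
  have "(f \<circ> chart_inv c' has_derivative ?F) (at ?z)"
    by (rule smooth_on_has_derivative[OF f[unfolded chart_smooth_def] chart_mem[OF p(2)]])
  then have F: "(f \<circ> chart_inv c' has_derivative ?F) (at (?t ?y))"
    by (simp only: transition_chart[OF c p(1)])
  have linF: "linear ?F" using F by (rule has_derivative_linear)
  have "((f \<circ> chart_inv c') \<circ> ?t has_derivative ?F \<circ> ?T) (at ?y)"
    by (rule diff_chain_at[OF t F])
  then have "(f \<circ> chart_inv c has_derivative ?F \<circ> ?T) (at ?y)"
  proof (rule has_derivative_transform_within_open[OF _ open_overlap[OF c c']])
    show "?y \<in> snd c ` (fst c \<inter> fst c')" using p by blast
    fix x assume "x \<in> snd c ` (fst c \<inter> fst c')"
    then obtain q where "q \<in> fst c" "q \<in> fst c'" "x = snd c q" by blast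
    then show "((f \<circ> chart_inv c') \<circ> ?t) x = (f \<circ> chart_inv c) x"
      by (simp add: transition_chart[OF c] chart_inv_left[OF c] chart_inv_left[OF c'])
  qed
  then have der: "frechet_derivative (f \<circ> chart_inv c) (at ?y) = ?F \<circ> ?T"
    by (rule frechet_derivative_at[symmetric])
  have "partial i (f \<circ> chart_inv c) ?y = (\<Sum>k\<in>UNIV. matrix ?T $ k $ i * partial k (f \<circ> chart_inv c') ?z)" for i
  proof -
    have "?T (axis i 1) = (\<Sum>k\<in>UNIV. (?T (axis i 1) $ k) *\<^sub>R axis k 1)"
      by (simp add: vec_eq_iff axis_def if_distrib sum.delta cong: if_cong)
    then have "?F (?T (axis i 1)) = ?F (\<Sum>k\<in>UNIV. (?T (axis i 1) $ k) *\<^sub>R axis k 1)" by (rule arg_cong)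
    also have "\<dots> = (\<Sum>k\<in>UNIV. (?T (axis i 1) $ k) * ?F (axis k 1))"
      by (simp add: linear_sum[OF linF] linear_scale[OF linF])
    finally show ?thesis by (simp add: partial_def der matrix_def)
  qed
  then show ?thesis by (simp add: vec_eq_iff matrix_vector_mult_def transpose_def)
qed

text \<open>Let \<open>w\<close> be the coordinate gradient of \<open>g\<close> in \<open>c\<close>.
  The transformation laws of metric and differential show that \<open>J w\<close> is the gradient in
  \<open>c'\<close>, and pairing with the differential of \<open>f\<close> moves \<open>J\<close>
  across.\<close>

lemma grad_inner_chart_change:
  assumes c: "c \<in> atlas M" and c': "c' \<in> atlas M" and p: "p \<in> fst c" "p \<in> fst c'"
    and f: "chart_smooth c' f" and g: "chart_smooth c' g"
  shows "grad_inner c f g p = grad_inner c' f g p"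
proof -
  let ?J = "matrix (frechet_derivative (transition c c') (at (snd c p)))"
  let ?G = "metric M c p" and ?G' = "metric M c' p"
  let ?vf = "\<chi> i. partial i (f \<circ> chart_inv c) (snd c p)" and ?vg = "\<chi> i. partial i (g \<circ> chart_inv c) (snd c p)"
  let ?vf' = "\<chi> i. partial i (f \<circ> chart_inv c') (snd c' p)" and ?vg' = "\<chi> i. partial i (g \<circ> chart_inv c') (snd c' p)"
  define w where "w = matrix_inv ?G *v ?vg"
  have G: "?G = transpose ?J ** ?G' ** ?J" by (rule metric_transform[OF c c' p])
  have "det ?G \<noteq> 0" using det_metric_pos[OF c p(1)] by simp
  then have "det (transpose ?J) \<noteq> 0" unfolding G by (simp add: det_mul)
  then have inj: "x = y" if "transpose ?J *v x = transpose ?J *v y" for x y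
    using that invertible_det_nz[of "transpose ?J"] matrix_left_invertible_injective[of "transpose ?J"]
    by (auto simp: invertible_def inj_def)
  have "?G *v w = ?vg"
    unfolding w_def matrix_vector_mul_assoc matrix_inv_metric(1)[OF c p(1)] by simp
  then have "transpose ?J *v (?G' *v (?J *v w)) = transpose ?J *v ?vg'"
    unfolding G partial_chart_change[OF c c' p g] by (simp add: matrix_vector_mul_assoc matrix_mul_assoc)
  then have "?G' *v (?J *v w) = ?vg'" by (rule inj)
  then have "matrix_inv ?G' *v (?G' *v (?J *v w)) = matrix_inv ?G' *v ?vg'" by simp
  then have Jw: "?J *v w = matrix_inv ?G' *v ?vg'"
    unfolding matrix_vector_mul_assoc matrix_mul_assoc matrix_inv_metric(2)[OF c' p(2)] by simp
  have "grad_inner c f g p = (transpose ?J *v ?vf') \<bullet> w"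
    unfolding grad_inner_def w_def partial_chart_change[OF c c' p f] ..
  also have "\<dots> = ?vf' \<bullet> (?J *v w)"
    by (metis dot_lmul_matrix vector_transpose_matrix transpose_transpose)
  also have "\<dots> = grad_inner c' f g p" unfolding grad_inner_def Jw ..
  finally show ?thesis .
qed

definition chart_fun :: "('a, 'd) chart \<Rightarrow> (real^'d \<Rightarrow> real) \<Rightarrow> 'a \<Rightarrow> real" where
  "chart_fun c w p = (if p \<in> fst c then w (snd c p) else 0)"

lemma smooth_fun_iff: "smooth_fun M f \<longleftrightarrow> (\<forall>c\<in>atlas M. chart_smooth c f)"
  by (simp add: smooth_fun_def chart_smooth_def)

lemma compact_chart_inv:
  assumes "c \<in> atlas M" "compact K" "K \<subseteq> chart_image c"
  shows "compact (chart_inv c ` K)" "chart_inv c ` K \<subseteq> fst c"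
  using compact_continuous_image[OF continuous_on_subset[OF chart_inv_continuous[OF assms(1)] assms(3)] assms(2)]
    chart_inv_mem[OF assms(1)] assms(3) by auto

lemma chart_fun_support:
  assumes "c \<in> atlas M" "K \<subseteq> chart_image c" "\<And>y. y \<notin> K \<Longrightarrow> w y = 0" "p \<notin> chart_inv c ` K"
  shows "chart_fun c w p = 0"
proof (cases "p \<in> fst c")
  case True
  have "snd c p \<notin> K" using assms(4) chart_inv_left[OF assms(1) True] by (metis image_eqI)
  then show ?thesis by (simp add: chart_fun_def assms(3))
qed (simp add: chart_fun_def)

text \<open>Any chart is covered by two open sets: the overlap, where the function is
  \<open>w\<close> after a transition map, and the complement of the support, where it is zero. The
  support is closed because it is compact and the manifold is Hausdorff.\<close>

lemma smooth_chart_fun: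
  assumes c: "c \<in> atlas M" and w: "smooth_on UNIV w" and K: "compact K" "K \<subseteq> chart_image c"
    and w0: "\<And>y. y \<notin> K \<Longrightarrow> w y = 0"
  shows "smooth_fun M (chart_fun c w)"
  unfolding smooth_fun_iff chart_smooth_def
proof
  fix c' assume c': "c' \<in> atlas M"
  let ?U = "snd c' ` (fst c' \<inter> fst c)" and ?L = "chart_inv c ` K"
  let ?V = "snd c' ` (fst c' - ?L)"
  have L: "closed ?L" by (intro compact_imp_closed compact_chart_inv c K)
  have U: "open ?U" by (rule open_overlap[OF c' c])
  have V: "open ?V" by (rule chart_image_subset_open[OF c']) (use chart_open[OF c'] L in auto)
  have "smooth_on ?U (w \<circ> transition c' c)"
    by (rule smooth_on_o[OF U open_UNIV _ smooth_transition[OF c' c] w]) simp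
  then have sU: "smooth_on ?U (chart_fun c w \<circ> chart_inv c')"
  proof (rule smooth_on_cong[OF U, THEN iffD1, rotated])
    fix x assume "x \<in> ?U"
    then obtain q where "q \<in> fst c'" "q \<in> fst c" "x = snd c' q" by blast
    then show "(w \<circ> transition c' c) x = (chart_fun c w \<circ> chart_inv c') x"
      by (simp add: transition_chart[OF c'] chart_inv_left[OF c'] chart_fun_def)
  qed
  have sV: "smooth_on ?V (chart_fun c w \<circ> chart_inv c')"
  proof (rule smooth_on_cong[OF V, THEN iffD1, rotated, OF smooth_on_const])
    fix x assume "x \<in> ?V"
    then obtain q where "q \<in> fst c'" "q \<notin> ?L" "x = snd c' q" by blast
    then show "0 = (chart_fun c w \<circ> chart_inv c') x"
      using chart_fun_support[OF c K(2) w0] by (simp add: chart_inv_left[OF c'])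
  qed
  have "(fst c' \<inter> fst c) \<union> (fst c' - ?L) = fst c'"
    using compact_chart_inv(2)[OF c K] by auto
  then have "?U \<union> ?V = chart_image c'"
    unfolding chart_image_def by (simp flip: image_Un)
  then show "smooth_on (chart_image c') (chart_fun c w \<circ> chart_inv c')"
    using smooth_on_Un[OF U V sU sV] by simp
qed

lemma smooth_on_scaled_plateau: "smooth_on UNIV (\<lambda>y. plateau ((1 / r) *\<^sub>R (y - a)))"
proof -
  have "smooth_on UNIV (\<lambda>y. (1 / r) *\<^sub>R (y - a))"
  proof -
    have "times_differentiable_on k (\<lambda>y. y + (- a)) UNIV" for k
      by (intro times_differentiable_on_add times_differentiable_on_const)
         (use smooth_on_ident[of UNIV] in \<open>auto simp: smooth_on_def\<close>)
    then have "times_differentiable_on k (\<lambda>y. (1 / r) *\<^sub>R (y + (- a))) UNIV" for k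
      by (intro times_differentiable_on_scaleR times_differentiable_on_const) auto
    then show ?thesis by (simp add: smooth_on_def)
  qed
  from smooth_on_o[OF open_UNIV open_UNIV _ this smooth_on_plateau] show ?thesis by (simp add: o_def)
qed

text \<open>The density is positive, so a null set of this kind would have a negligible nonempty
  open image in coordinates.\<close>

lemma emeasure_chart_open_pos:
  assumes c: "c \<in> atlas M" and U: "open U" "U \<subseteq> fst c" "U \<noteq> {}"
  shows "emeasure (vol M) U \<noteq> 0"
proof
  assume "emeasure (vol M) U = 0"
  then have "(\<integral>\<^sup>+ y\<in>snd c ` U. ennreal (volume_density M c y) \<partial>lborel) = 0"
    using is_volume_vol c U by (auto simp: is_volume_def borel_open)
  moreover have "(\<integral>\<^sup>+ y\<in>snd c ` U. ennreal (volume_density M c y) \<partial>lborel)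
     = (\<integral>\<^sup>+ y. ennreal (volume_density M c y) * indicator (chart_image c) y * indicator (snd c ` U) y \<partial>lborel)"
    using U(2) by (intro nn_integral_cong) (auto simp: indicator_def chart_image_def)
  ultimately have int0: "(\<integral>\<^sup>+ y. ennreal (volume_density M c y) * indicator (chart_image c) y * indicator (snd c ` U) y \<partial>lborel) = 0"
    by simp
  have V: "open (snd c ` U)" by (rule chart_image_subset_open[OF c U(1,2)])
  have "(\<lambda>y. ennreal (volume_density M c y) * indicator (chart_image c) y * indicator (snd c ` U) y) \<in> borel_measurable lborel"
    using borel_measurable_times_ennreal[OF measurable_volume_density_ennreal[OF c] borel_measurable_indicator[of "snd c ` U" borel]] V
    by (simp add: borel_open)
  from nn_integral_0_iff_AE[OF this] int0
  have "AE y in lborel. ennreal (volume_density M c y) * indicator (chart_image c) y * indicator (snd c ` U) y = 0" by simp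
  then have "AE y in lborel. y \<notin> snd c ` U"
  proof eventually_elim
    case (elim y)
    show ?case
    proof
      assume y: "y \<in> snd c ` U"
      then have "y \<in> chart_image c" using U(2) by (auto simp: chart_image_def)
      then show False using elim y volume_density_pos[OF c, of y] by (simp add: indicator_def)
    qed
  qed
  then have "snd c ` U \<in> null_sets lborel" using V by (simp add: AE_iff_null_sets borel_open)
  then have "negligible (snd c ` U)" by (simp add: negligible_iff_null_sets null_sets_completionI)
  then show False using open_not_negligible[OF V] U(3) by simp
qed

text \<open>By Green's formula the difference of the two Laplacians is orthogonal to bump functions in the
  overlap, since the inner product of the gradients does not depend on the chart.\<close>

lemma laplacian_in_chart_le:
  assumes c: "c \<in> atlas M" and c': "c' \<in> atlas M" and p: "p \<in> fst c" "p \<in> fst c'"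
    and f: "smooth_fun M f"
  shows "laplacian_in_chart M c f p \<le> laplacian_in_chart M c' f p"
proof (rule ccontr)
  let ?N = "fst c \<inter> fst c'"
  define D where "D q = laplacian_in_chart M c f q - laplacian_in_chart M c' f q" for q
  assume "\<not> ?thesis"
  then have Dp: "D p > 0" by (simp add: D_def)
  have fc: "chart_smooth c f" "chart_smooth c' f" using f c c' by (auto simp: smooth_fun_iff)
  have oN: "open ?N" using chart_open[OF c] chart_open[OF c'] by auto
  have contD: "continuous_on ?N D"
    unfolding D_def
    by (intro continuous_on_diff continuous_on_subset[OF continuous_laplacian[OF c fc(1)]]
        continuous_on_subset[OF continuous_laplacian[OF c' fc(2)]]) auto
  \<comment> \<open>The open set on which the first Laplacian exceeds the second; the bump is placed
    inside it.\<close>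
  define P where "P = D -` {0<..} \<inter> ?N"
  have oP: "open P"
    unfolding P_def using continuous_on_open_vimage[OF oN, of D] contD open_greaterThan by blast
  have pP: "p \<in> P" using p Dp by (simp add: P_def)
  have "open (snd c ` P)" by (rule chart_image_subset_open[OF c oP]) (auto simp: P_def)
  then obtain e where e: "e > 0" "cball (snd c p) e \<subseteq> snd c ` P"
    using pP open_contains_cball[of "snd c ` P"] by blast
  define r where "r = e / 2"
  have r: "r > 0" using e by (simp add: r_def)
  define w where "w y = plateau ((1 / r) *\<^sub>R (y - snd c p))" for y
  define K where "K = cball (snd c p) e"
  have K: "compact K" "K \<subseteq> chart_image c"
    using e(2) by (auto simp: K_def P_def chart_image_def)
  have w0: "w y = 0" if "y \<notin> K" for y
  proof -
    have "norm (y - snd c p) > e" using that by (simp add: K_def dist_norm norm_minus_commute)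
    then have "norm (y - snd c p) / r \<ge> 2" using r by (simp add: r_def field_simps)
    then have "norm ((1 / r) *\<^sub>R (y - snd c p)) \<ge> 2" using r by simp
    then show ?thesis unfolding w_def by (rule plateau_eq_0)
  qed
  define g where "g = chart_fun c w"
  have g: "smooth_fun M g"
    unfolding g_def by (rule smooth_chart_fun[OF c _ K w0]) (simp_all add: w_def[abs_def] smooth_on_scaled_plateau)
  have gc: "chart_smooth c g" "chart_smooth c' g" using g c c' by (auto simp: smooth_fun_iff)
  define L where "L = chart_inv c ` K"
  have L: "compact L" unfolding L_def by (rule compact_chart_inv(1)[OF c K])
  have LP: "L \<subseteq> P"
  proof
    fix q assume "q \<in> L"
    then obtain s where "s \<in> P" "q = chart_inv c (snd c s)" using e(2) by (auto simp: L_def K_def)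
    then show "q \<in> P" by (simp add: P_def chart_inv_left[OF c])
  qed
  then have LN: "L \<subseteq> fst c" "L \<subseteq> fst c'" by (auto simp: P_def)
  have g0: "g q = 0" if "q \<notin> L" for q
    using that chart_fun_support[OF c K(2) w0] by (simp add: g_def L_def)
  \<comment> \<open>The right-hand side does not depend on \<open>d\<close>: in the overlap the
    gradient products agree, and at points of the chart outside the overlap \<open>g\<close>
    vanishes on a neighbourhood.\<close>
  have green: "(\<integral>q. indicator (fst d) q * (g q * laplacian_in_chart M d f q) \<partial>vol M)
      = - (\<integral>q. indicator ?N q * grad_inner c g f q \<partial>vol M)" 
    if d: "d \<in> atlas M" "d = c \<or> d = c'" for d
  proof -
    have fd: "chart_smooth d f" "chart_smooth d g" using f g d by (auto simp: smooth_fun_iff)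
    have Ld: "L \<subseteq> fst d" using LN d(2) by auto
    have "(\<integral>q. indicator (fst d) q * (g q * laplacian_in_chart M d f q) \<partial>vol M)
      = - (\<integral>q. indicator (fst d) q * grad_inner d g f q \<partial>vol M)"
      by (rule chart_green[OF d(1) fd L Ld]) (use g0 in auto)
    also have "(\<integral>q. indicator (fst d) q * grad_inner d g f q \<partial>vol M) = (\<integral>q. indicator ?N q * grad_inner c g f q \<partial>vol M)"
    proof (rule Bochner_Integration.integral_cong[OF refl])
      fix q
      show "indicator (fst d) q * grad_inner d g f q = indicator ?N q * grad_inner c g f q"
      proof (cases "q \<in> ?N")
        case True
        then have "grad_inner c g f q = grad_inner c' g f q"
          by (intro grad_inner_chart_change[OF c c' _ _ gc(2) fc(2)]) auto
        then show ?thesis using True d(2) by auto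
      next
        case False
        show ?thesis
        proof (cases "q \<in> fst d")
          case True
          have "chart_image d - snd d ` L = snd d ` (fst d - L)"
            using inj_on_image_set_diff[OF inj_on_chart[OF d(1)], of "fst d" L] Ld by (simp add: chart_image_def)
          moreover have "q \<in> fst d - L" using True False LN by auto
          ultimately have q: "snd d q \<in> chart_image d - snd d ` L" by blast
          have "partial i (g \<circ> chart_inv d) (snd d q) = 0" for i
          proof (rule partial_eq_0[OF chart_image_open[OF d(1)] _ q])
            show "compact (snd d ` L)"
              by (intro compact_continuous_image L continuous_on_subset[OF chart_continuous[OF d(1)] Ld])
            fix x assume x: "x \<in> chart_image d - snd d ` L"
            then have "chart_inv d x \<notin> L" using chart_inv_right[OF d(1), of x] by (metis DiffE image_eqI)
            then show "(g \<circ> chart_inv d) x = 0" by (simp add: g0)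
          qed
          then have "grad_inner d g f q = 0" by (simp add: grad_inner_def inner_vec_def)
          then show ?thesis using False by simp
        qed (use False in simp)
      qed
    qed
    finally show ?thesis .
  qed
  have int: "integrable (vol M) (\<lambda>q. indicator (fst d) q * (g q * laplacian_in_chart M d f q))"
    if d: "d \<in> atlas M" "d = c \<or> d = c'" for d
  proof -
    have fd: "chart_smooth d f" "chart_smooth d g" using f g d by (auto simp: smooth_fun_iff)
    have Ld: "L \<subseteq> fst d" using LN d(2) by auto
    let ?h = "\<lambda>q. g q * laplacian_in_chart M d f q"
    have h: "continuous_on (fst d) ?h"
      by (intro continuous_on_mult continuous_chart_smooth continuous_laplacian d fd)
    have "integrable lborel (\<lambda>y. indicator (chart_image d) y * (volume_density M d y * ?h (chart_inv d y)))"
    proof (rule integrable_continuous_compact_support[of _ _ "snd d ` L"])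
      show "continuous_on (chart_image d) (\<lambda>y. volume_density M d y * ?h (chart_inv d y))"
        by (intro continuous_on_mult smooth_on_continuous_on[OF smooth_volume_density] d(1)
             continuous_on_compose2[OF h chart_inv_continuous]) (auto intro: chart_inv_mem d)
      show "compact (snd d ` L)"
        by (intro compact_continuous_image L continuous_on_subset[OF chart_continuous[OF d(1)] Ld])
      show "snd d ` L \<subseteq> chart_image d" using Ld by (auto simp: chart_image_def)
      fix y assume y: "y \<in> chart_image d - snd d ` L"
      then have "chart_inv d y \<notin> L" using chart_inv_right[OF d(1), of y] by (metis DiffE image_eqI)
      then show "volume_density M d y * ?h (chart_inv d y) = 0" by (simp add: g0)
    qed
    moreover have "(\<lambda>y. indicator (chart_image d) y * (volume_density M d y * ?h (chart_inv d y)))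
       = (\<lambda>y. indicator (chart_image d) y * (volume_density M d y * (indicator (fst d) (chart_inv d y) * ?h (chart_inv d y))))"
      using chart_inv_mem[OF d(1)] by (auto simp: indicator_def fun_eq_iff)
    ultimately have "integrable (vol M) (\<lambda>q. indicator (fst d) q * (indicator (fst d) q * ?h q))"
      using integral_vol_chart(2)[OF d(1) indicator_borel_measurable[OF chart_borel[OF d(1)] h]] by metis
    moreover have "(\<lambda>q. indicator (fst d) q * (indicator (fst d) q * ?h q)) = (\<lambda>q. indicator (fst d) q * ?h q)"
      by (auto simp: indicator_def)
    ultimately show ?thesis by metis
  qed
  have gD: "indicator (fst c) q * (g q * laplacian_in_chart M c f q) - indicator (fst c') q * (g q * laplacian_in_chart M c' f q)
      = g q * D q" for q
    using g0[of q] LN by (cases "q \<in> L") (auto simp: D_def algebra_simps indicator_def)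
  have intgD: "integrable (vol M) (\<lambda>q. g q * D q)"
    using Bochner_Integration.integrable_diff[OF int[OF c] int[OF c']] unfolding gD by simp
  have "(\<integral>q. g q * D q \<partial>vol M) = 0"
    using Bochner_Integration.integral_diff[OF int[OF c] int[OF c']] green[OF c] green[OF c'] unfolding gD by simp
  moreover have "g q * D q \<ge> 0" for q
  proof (cases "q \<in> L")
    case True
    then have "D q > 0" using LP by (auto simp: P_def)
    moreover have "g q \<ge> 0" by (simp add: g_def chart_fun_def w_def plateau_bounds)
    ultimately show ?thesis by simp
  qed (simp add: g0)
  ultimately have "AE q in vol M. g q * D q = 0"
    using integral_nonneg_eq_0_iff_AE[OF intgD] by simp
  \<comment> \<open>On this inner ball the bump is 1 and \<open>D\<close> is positive, so
    \<open>g D = 0\<close> almost everywhere would make a nonempty open set null.\<close>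
  define Q where "Q = {q \<in> fst c. snd c q \<in> ball (snd c p) r}"
  have Qeq: "Q = snd c -` ball (snd c p) r \<inter> fst c" by (auto simp: Q_def)
  have Q: "open Q" "Q \<subseteq> fst c" "p \<in> Q"
    using continuous_on_open_vimage[OF chart_open[OF c], of "snd c"] chart_continuous[OF c] open_ball p(1) r
    unfolding Qeq by auto
  have "g q * D q \<noteq> 0" if q: "q \<in> Q" for q
  proof -
    have "norm (snd c q - snd c p) < r" using q by (simp add: Q_def dist_norm norm_minus_commute)
    then have "norm (snd c q - snd c p) / r \<le> 1" using r by simp
    then have "norm ((1 / r) *\<^sub>R (snd c q - snd c p)) \<le> 1" using r by simp
    from plateau_eq_1[OF this] have "g q = 1" using q by (simp add: g_def chart_fun_def w_def Q_def)
    moreover have "q \<in> L"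
    proof (rule ccontr)
      assume "q \<notin> L"
      then show False using g0 \<open>g q = 1\<close> by simp
    qed
    then have "D q > 0" using LP by (auto simp: P_def)
    ultimately show ?thesis by simp
  qed
  with \<open>AE q in vol M. g q * D q = 0\<close> have "AE q in vol M. q \<notin> Q" by auto
  then have "Q \<in> null_sets (vol M)" using Q by (simp add: AE_iff_null_sets sets_vol borel_open)
  then show False using emeasure_chart_open_pos[OF c Q(1,2)] Q(3) by (auto simp: null_sets_def)
qed

text \<open>The inequality between two charts holds in both orders, so the chart picked by
  \<open>SOME\<close> does not influence the value.\<close>

lemma laplace_beltrami_chart:
  assumes c: "c \<in> atlas M" and p: "p \<in> fst c" and f: "smooth_fun M f"
  shows "laplace_beltrami M f p = laplacian_in_chart M c f p"
proof -
  let ?c = "SOME c. c \<in> atlas M \<and> p \<in> fst c"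
  have c': "?c \<in> atlas M \<and> p \<in> fst ?c" by (rule someI[of _ c]) (use c p in simp)
  then show ?thesis
    unfolding laplace_beltrami_def
    using laplacian_in_chart_le[OF c _ p _ f, of ?c] laplacian_in_chart_le[OF _ c _ p f, of ?c]
    by (intro antisym) auto
qed

text \<open>Green's formula twice, with the symmetry of the gradient product in between. The compact
  support of \<open>u\<close> in the chart removes the boundary terms both times, so the test
  function may extend beyond the chart.\<close>

lemma weak_laplacian_chart_fun:
  assumes c: "c \<in> atlas M" and w: "smooth_on UNIV w" and K: "compact K" "K \<subseteq> chart_image c"
    and w0: "\<And>y. y \<notin> K \<Longrightarrow> w y = 0"
  defines "u \<equiv> chart_fun c w"
  shows "weak_laplacian M (\<lambda>p. of_real (u p)) (\<lambda>p. of_real (indicator (fst c) p * laplacian_in_chart M c u p))"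
  unfolding weak_laplacian_def
proof (intro allI impI)
  fix \<phi> assume "test_fun M \<phi>"
  then have \<phi>: "smooth_fun M \<phi>" by (simp add: test_fun_def)
  have u: "smooth_fun M u" unfolding u_def by (rule smooth_chart_fun[OF c w K w0])
  have uc: "chart_smooth c u" "chart_smooth c \<phi>" using u \<phi> c by (auto simp: smooth_fun_iff)
  let ?L = "chart_inv c ` K"
  note L = compact_chart_inv[OF c K]
  have u0: "u p = 0" if "p \<notin> ?L" for p
    using that chart_fun_support[OF c K(2) w0] by (simp add: u_def)
  have "(\<integral>p. u p * laplace_beltrami M \<phi> p \<partial>vol M) = (\<integral>p. indicator (fst c) p * (u p * laplacian_in_chart M c \<phi> p) \<partial>vol M)"
    by (intro Bochner_Integration.integral_cong refl)
       (auto simp: indicator_def u_def chart_fun_def laplace_beltrami_chart[OF c _ \<phi>])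
  also have "\<dots> = - (\<integral>p. indicator (fst c) p * grad_inner c u \<phi> p \<partial>vol M)"
    by (rule chart_green[OF c uc(2,1) L]) (use u0 in auto)
  also have "(\<integral>p. indicator (fst c) p * grad_inner c u \<phi> p \<partial>vol M) = (\<integral>p. indicator (fst c) p * grad_inner c \<phi> u p \<partial>vol M)"
    by (intro Bochner_Integration.integral_cong refl) (auto simp: indicator_def grad_inner_commute[OF c])
  also have "- \<dots> = (\<integral>p. indicator (fst c) p * (\<phi> p * laplacian_in_chart M c u p) \<partial>vol M)"
    by (rule chart_green[OF c uc L, symmetric]) (use u0 in auto)
  finally have eq: "(\<integral>p. u p * laplace_beltrami M \<phi> p \<partial>vol M)
     = (\<integral>p. indicator (fst c) p * laplacian_in_chart M c u p * \<phi> p \<partial>vol M)" by (simp add: mult_ac)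
  show "(\<integral>x. of_real (u x) * of_real (laplace_beltrami M \<phi> x) \<partial>vol M)
     = (\<integral>x. complex_of_real (indicator (fst c) x * laplacian_in_chart M c u x) * of_real (\<phi> x) \<partial>vol M)"
    unfolding of_real_mult[symmetric] integral_complex_of_real eq ..
qed

end

section \<open>Bumps at scale \<open>s\<close> and their norms\<close>

section \<open>Concentrated test functions\<close>

lemma bounded_compact_support:
  fixes g :: "'a::euclidean_space \<Rightarrow> real"
  assumes "continuous_on UNIV g" "compact K" "\<And>z. z \<notin> K \<Longrightarrow> g z = 0"
  shows "\<exists>B\<ge>0. \<forall>z. \<bar>g z\<bar> \<le> B"
proof -
  have "bounded (g ` K)"
    by (intro compact_imp_bounded compact_continuous_image continuous_on_subset[OF assms(1)] assms(2)) simp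
  then obtain B where B: "\<And>z. z \<in> K \<Longrightarrow> \<bar>g z\<bar> \<le> B" by (auto simp: bounded_iff)
  have "\<bar>g z\<bar> \<le> max B 0" for z using B[of z] assms(3)[of z] by (cases "z \<in> K") fastforce+
  then show ?thesis by (intro exI[of _ "max B 0"]) simp
qed

lemma partial_scaled:
  fixes f :: "real^'d::finite \<Rightarrow> real"
  assumes f: "smooth_on UNIV f"
  shows "partial i (\<lambda>y. k * f (r *\<^sub>R (y - a))) y = k * (r * partial i f (r *\<^sub>R (y - a)))"
proof -
  let ?D = "frechet_derivative f (at (r *\<^sub>R (y - a)))"
  have D: "(f has_derivative ?D) (at (r *\<^sub>R (y - a)))" by (rule smooth_on_has_derivative[OF f]) simp
  have "((\<lambda>y. f (r *\<^sub>R (y - a))) has_derivative (\<lambda>v. ?D (r *\<^sub>R v))) (at y)"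
    by (rule has_derivative_compose[where g = f and f = "\<lambda>y. r *\<^sub>R (y - a)", OF _ D])
       (auto intro!: derivative_eq_intros)
  then have "((\<lambda>y. k * f (r *\<^sub>R (y - a))) has_derivative (\<lambda>v. k * ?D (r *\<^sub>R v))) (at y)"
    by (rule has_derivative_mult_right)
  from frechet_derivative_at[OF this] show ?thesis
    using linear_scale[OF has_derivative_linear[OF D]] by (simp add: partial_def fun_eq_iff)
qed

lemma partial_sum_mult:
  fixes A B :: "'d::finite \<Rightarrow> real^'d \<Rightarrow> real"
  assumes A: "\<And>j. smooth_on U (A j)" and B: "\<And>j. smooth_on U (B j)" and y: "y \<in> U"
  shows "partial i (\<lambda>y. \<Sum>j\<in>UNIV. A j y * B j y) y
    = (\<Sum>j\<in>UNIV. A j y * partial i (B j) y + partial i (A j) y * B j y)"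
proof -
  have "((\<lambda>y. \<Sum>j\<in>UNIV. A j y * B j y) has_derivative
     (\<lambda>v. \<Sum>j\<in>UNIV. A j y * frechet_derivative (B j) (at y) v + frechet_derivative (A j) (at y) v * B j y)) (at y)"
    by (intro has_derivative_sum has_derivative_mult smooth_on_has_derivative[OF A y] smooth_on_has_derivative[OF B y])
  from frechet_derivative_at[OF this] show ?thesis by (simp add: partial_def fun_eq_iff)
qed

text \<open>The sum of the absolute values of all these derivatives is continuous and vanishes
  outside the ball of radius 2, so one constant serves all indices.\<close>

lemma plateau_derivative_bounds:
  "\<exists>B\<ge>0. (\<forall>i z. \<bar>partial i (plateau :: real^'d::finite \<Rightarrow> real) z\<bar> \<le> B)
     \<and> (\<forall>i j z. \<bar>partial i (partial j (plateau :: real^'d \<Rightarrow> real)) z\<bar> \<le> B)"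
proof -
  let ?p = "plateau :: real^'d \<Rightarrow> real"
  let ?g = "\<lambda>z. (\<Sum>i\<in>UNIV. \<bar>partial i ?p z\<bar>) + (\<Sum>i\<in>UNIV. \<Sum>j\<in>UNIV. \<bar>partial i (partial j ?p) z\<bar>)"
  have p0: "?p z = 0" if "z \<in> UNIV - cball 0 2" for z using plateau_eq_0[of z] that by simp
  have p1: "partial i ?p z = 0" if "z \<in> UNIV - cball 0 2" for i z
    by (rule partial_eq_0[OF open_UNIV compact_cball that p0])
  have p2: "partial i (partial j ?p) z = 0" if "z \<in> UNIV - cball 0 2" for i j z
    by (rule partial_eq_0[OF open_UNIV compact_cball that p1])
  have "\<exists>B\<ge>0. \<forall>z. \<bar>?g z\<bar> \<le> B"
  proof (rule bounded_compact_support)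
    show "continuous_on UNIV ?g"
      by (intro continuous_on_add continuous_on_sum continuous_on_rabs smooth_on_continuous_on
          smooth_on_partial smooth_on_plateau)
    show "compact (cball (0 :: real^'d) 2)" by simp
    show "?g z = 0" if "z \<notin> cball 0 2" for z using p1[of z] p2[of z] that by simp
  qed
  then obtain B where B: "B \<ge> 0" "\<And>z. \<bar>?g z\<bar> \<le> B" by blast
  show ?thesis
  proof (intro exI[of _ B] conjI allI B(1))
    fix i j z
    have nn: "(\<Sum>i\<in>UNIV. \<bar>partial i ?p z\<bar>) \<ge> 0" "(\<Sum>i\<in>UNIV. \<Sum>j\<in>UNIV. \<bar>partial i (partial j ?p) z\<bar>) \<ge> 0"
      by (intro sum_nonneg abs_ge_zero)+
    have "\<bar>partial i ?p z\<bar> \<le> (\<Sum>i\<in>UNIV. \<bar>partial i ?p z\<bar>)"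
      by (rule member_le_sum) auto
    then show "\<bar>partial i ?p z\<bar> \<le> B" using B(2)[of z] nn by linarith
    have "\<bar>partial i (partial j ?p) z\<bar> \<le> (\<Sum>j\<in>UNIV. \<bar>partial i (partial j ?p) z\<bar>)"
      by (rule member_le_sum) auto
    also have "\<dots> \<le> (\<Sum>i\<in>UNIV. \<Sum>j\<in>UNIV. \<bar>partial i (partial j ?p) z\<bar>)"
      by (rule member_le_sum[of i UNIV "\<lambda>i. \<Sum>j\<in>UNIV. \<bar>partial i (partial j ?p) z\<bar>"]) (auto intro: sum_nonneg)
    finally show "\<bar>partial i (partial j ?p) z\<bar> \<le> B" using B(2)[of z] nn by linarith
  qed
qed

context riemannian_mfd
begin

lemma smooth_fun_continuous:
  fixes f :: "'a \<Rightarrow> real"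
  assumes "smooth_fun M f"
  shows "continuous_on UNIV f"
proof -
  have "continuous_on (\<Union>c\<in>atlas M. fst c) f"
    using assms by (intro continuous_on_open_UN chart_open continuous_chart_smooth) (auto simp: smooth_fun_iff)
  then show ?thesis by (simp add: charts_cover)
qed

lemma smooth_fun_measurable: "smooth_fun M f \<Longrightarrow> (f :: 'a \<Rightarrow> real) \<in> borel_measurable (vol M)"
  unfolding measurable_vol by (intro borel_measurable_continuous_onI smooth_fun_continuous)

text \<open>If the balls fit into the chart, this is 1 on the coordinate ball of radius
  \<open>s\<close> and 0 outside that of radius \<open>2 s\<close>. The test functions are bumps
  with parameter \<open>s\<close>, the potentials are multiples of bumps with parameter
  \<open>2 s\<close>.\<close>

definition bump :: "('a, 'd) chart \<Rightarrow> real^'d \<Rightarrow> real \<Rightarrow> 'a \<Rightarrow> real" where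
  "bump c a s = chart_fun c (\<lambda>y. plateau ((1 / s) *\<^sub>R (y - a)))"

lemma scaled_plateau_eq_0: "s > 0 \<Longrightarrow> y \<notin> cball a (2 * s) \<Longrightarrow> plateau ((1 / s) *\<^sub>R (y - a)) = 0"
proof -
  assume s: "s > 0" and "y \<notin> cball a (2 * s)"
  then have "norm (y - a) / s \<ge> 2" by (simp add: dist_norm norm_minus_commute field_simps)
  then have "norm ((1 / s) *\<^sub>R (y - a)) \<ge> 2" using s by simp
  then show ?thesis by (rule plateau_eq_0)
qed

lemma scaled_plateau_eq_1: "s > 0 \<Longrightarrow> y \<in> cball a s \<Longrightarrow> plateau ((1 / s) *\<^sub>R (y - a)) = 1"
proof -
  assume s: "s > 0" and "y \<in> cball a s"
  then have "norm (y - a) / s \<le> 1" by (simp add: dist_norm norm_minus_commute)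
  then have "norm ((1 / s) *\<^sub>R (y - a)) \<le> 1" using s by simp
  then show ?thesis by (rule plateau_eq_1)
qed

lemma bump_bounds: "0 \<le> bump c a s p" "bump c a s p \<le> 1"
  by (simp_all add: bump_def chart_fun_def plateau_bounds)

lemma bump_eq_1:
  assumes "c \<in> atlas M" "s > 0" "cball a s \<subseteq> chart_image c" "p \<in> chart_inv c ` cball a s"
  shows "bump c a s p = 1"
proof -
  obtain y where y: "y \<in> cball a s" "p = chart_inv c y" using assms(4) by blast
  then have "y \<in> chart_image c" using assms(3) by blast
  then show ?thesis
    using y scaled_plateau_eq_1[OF assms(2) y(1)]
    by (simp add: bump_def chart_fun_def chart_inv_mem[OF assms(1)] chart_inv_right[OF assms(1)])
qed

lemma bump_eq_0:
  assumes "c \<in> atlas M" "s > 0" "cball a (2 * s) \<subseteq> chart_image c" "p \<notin> chart_inv c ` cball a (2 * s)"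
  shows "bump c a s p = 0"
  unfolding bump_def by (rule chart_fun_support[OF assms(1,3) scaled_plateau_eq_0[OF assms(2)] assms(4)])

lemma smooth_bump:
  assumes "c \<in> atlas M" "s > 0" "cball a (2 * s) \<subseteq> chart_image c"
  shows "smooth_fun M (bump c a s)"
  unfolding bump_def
  by (rule smooth_chart_fun[OF assms(1) smooth_on_scaled_plateau compact_cball assms(3) scaled_plateau_eq_0[OF assms(2)]])

text \<open>On the compact ball of radius \<open>e\<close> the density lies between positive
  constants, so small balls have volume comparable to the Euclidean one. The two-sided bound allows
  the balls of radius \<open>s\<close> and \<open>2 s\<close> to be compared.\<close>

lemma chart_ball_volume:
  assumes c: "c \<in> atlas M" and e: "cball a e \<subseteq> chart_image c" "e > 0"
  shows "\<exists>m>0. \<exists>m'>0. \<forall>s. 0 < s \<and> s \<le> e \<longrightarrow>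
    ennreal (m * s ^ CARD('d)) \<le> emeasure (vol M) (chart_inv c ` cball a s) \<and>
    emeasure (vol M) (chart_inv c ` cball a s) \<le> ennreal (m' * s ^ CARD('d))"
proof -
  let ?w = "volume_density M c"
  have w: "continuous_on (cball a e) ?w"
    by (rule continuous_on_subset[OF smooth_on_continuous_on[OF smooth_volume_density[OF c]] e(1)])
  have ne: "cball a e \<noteq> {}" using e(2) by auto
  obtain y0 where y0: "y0 \<in> cball a e" "\<And>y. y \<in> cball a e \<Longrightarrow> ?w y0 \<le> ?w y"
    using continuous_attains_inf[OF compact_cball ne w] by blast
  obtain y1 where y1: "y1 \<in> cball a e" "\<And>y. y \<in> cball a e \<Longrightarrow> ?w y \<le> ?w y1"
    using continuous_attains_sup[OF compact_cball ne w] by blast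
  have pos: "?w y0 > 0" "?w y1 > 0" using y0 y1 e(1) volume_density_pos[OF c] by blast+
  let ?b = "unit_ball_vol (real CARD('d))"
  have b: "?b > 0" by simp
  have em: "emeasure (vol M) (chart_inv c ` cball a s) = (\<integral>\<^sup>+y\<in>cball a s. ennreal (?w y) \<partial>lborel)"
    if s: "0 < s" "s \<le> e" for s
  proof -
    have sub: "cball a s \<subseteq> chart_image c" using e(1) s by (meson cball_subset_cball_iff dual_order.trans subset_cball)
    have "compact (chart_inv c ` cball a s)" "chart_inv c ` cball a s \<subseteq> fst c"
      by (rule compact_chart_inv[OF c compact_cball sub])+
    moreover have "snd c ` chart_inv c ` cball a s = cball a s"
      using sub chart_inv_right[OF c] by (auto simp: image_image subset_iff intro!: image_eqI)
    ultimately show ?thesis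
      using is_volume_vol c by (auto simp: is_volume_def borel_compact)
  qed
  have ball: "emeasure lborel (cball a s) = ennreal (?b * s ^ CARD('d))" if "0 < s" for s
    using emeasure_cball[of s a] that by simp
  show ?thesis
  proof (rule exI[of _ "?w y0 * ?b"], (intro exI[of _ "?w y1 * ?b"] conjI allI impI; (elim conjE)?))
    show "?w y0 * ?b > 0" "?w y1 * ?b > 0" using pos b by auto
    fix s :: real assume s: "0 < s" "s \<le> e"
    then have sub: "cball a s \<subseteq> cball a e" by (simp add: subset_cball)
    have w_ball: "(\<integral>\<^sup>+y. ennreal x * indicator (cball a s) y \<partial>lborel) = ennreal (x * ?b * s ^ CARD('d))" if "x > 0" for x
      using s that ball[OF s(1)] by (subst nn_integral_cmult_indicator) (auto simp: mult.assoc ennreal_mult less_imp_le)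
    have "ennreal (?w y0 * ?b * s ^ CARD('d)) = (\<integral>\<^sup>+y. ennreal (?w y0) * indicator (cball a s) y \<partial>lborel)"
      by (rule w_ball[OF pos(1), symmetric])
    also have "\<dots> \<le> (\<integral>\<^sup>+y\<in>cball a s. ennreal (?w y) \<partial>lborel)"
      using y0(2) sub by (intro nn_integral_mono) (auto simp: indicator_def intro!: ennreal_leI)
    finally show "ennreal (?w y0 * ?b * s ^ CARD('d)) \<le> emeasure (vol M) (chart_inv c ` cball a s)"
      unfolding em[OF s] .
    have "(\<integral>\<^sup>+y\<in>cball a s. ennreal (?w y) \<partial>lborel) \<le> (\<integral>\<^sup>+y. ennreal (?w y1) * indicator (cball a s) y \<partial>lborel)"
      using y1(2) sub by (intro nn_integral_mono) (auto simp: indicator_def intro!: ennreal_leI)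
    also have "\<dots> = ennreal (?w y1 * ?b * s ^ CARD('d))" by (rule w_ball[OF pos(2)])
    finally show "emeasure (vol M) (chart_inv c ` cball a s) \<le> ennreal (?w y1 * ?b * s ^ CARD('d))"
      unfolding em[OF s] .
  qed
qed

text \<open>First and second derivatives of the rescaled plateau are of size \<open>1 / s\<close>
  and \<open>1 / s^2\<close>, and the coefficients are bounded on the compact ball. As
  \<open>s \<le> e\<close>, the first-order terms are absorbed into \<open>1 / s^2\<close>.\<close>

lemma laplacian_bump_bound:
  assumes c: "c \<in> atlas M" and e: "cball a e \<subseteq> chart_image c" "e > 0"
  shows "\<exists>C\<ge>0. \<forall>s y. 0 < s \<and> s \<le> e \<and> y \<in> cball a e \<longrightarrow>
    \<bar>laplacian_in_chart M c (bump c a s) (chart_inv c y)\<bar> \<le> C / s\<^sup>2"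
proof -
  let ?O = "chart_image c"
  let ?S = "\<lambda>y. (\<Sum>i\<in>UNIV. \<Sum>j\<in>UNIV. \<bar>coeff_matrix c i j y\<bar> + \<bar>partial i (coeff_matrix c i j) y\<bar>) / volume_density M c y"
  have "continuous_on ?O ?S"
    using volume_density_pos[OF c]
    by (intro continuous_on_divide continuous_on_sum continuous_on_add continuous_on_rabs smooth_on_continuous_on
        smooth_on_partial smooth_coeff_matrix smooth_volume_density c) fastforce
  then have "compact (?S ` cball a e)"
    by (intro compact_continuous_image continuous_on_subset[OF _ e(1)] compact_cball)
  then obtain K where K: "\<And>y. y \<in> cball a e \<Longrightarrow> \<bar>?S y\<bar> \<le> K"
    using compact_imp_bounded by (force simp: bounded_iff)
  have K0: "K \<ge> 0" using K[of a] e(2) by (meson abs_ge_zero centre_in_cball less_imp_le order_trans)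
  obtain B where B: "B \<ge> 0" "\<And>i z. \<bar>partial i (plateau :: real^'d \<Rightarrow> real) z\<bar> \<le> B"
    "\<And>i j z. \<bar>partial i (partial j (plateau :: real^'d \<Rightarrow> real)) z\<bar> \<le> B"
    using plateau_derivative_bounds[where 'd = 'd] by blast
  show ?thesis
  proof (intro exI[of _ "K * (B * (1 + e))"] conjI allI impI; (elim conjE)?)
    show "K * (B * (1 + e)) \<ge> 0" using K0 B e(2) by simp
    fix s y assume s: "0 < s" "s \<le> e" and y: "y \<in> cball a e"
    have yO: "y \<in> ?O" using y e(1) by blast
    \<comment> \<open>A common bound for the derivatives: the summand \<open>e\<close> accounts for
      \<open>B / s \<le> B e / s^2\<close>, the summand 1 for the second derivatives.\<close>
    define Q where "Q = B * (1 + e) / s\<^sup>2"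
    define w where "w = (\<lambda>y. plateau ((1 / s) *\<^sub>R (y - a)))"
    have w: "smooth_on UNIV w" unfolding w_def by (rule smooth_on_scaled_plateau)
    have w1: "partial j w = (\<lambda>x. (1 / s) * partial j plateau ((1 / s) *\<^sub>R (x - a)))" for j
      using partial_scaled[OF smooth_on_plateau, of j 1 "1 / s" a] by (simp add: w_def fun_eq_iff)
    have w2: "partial i (partial j w) x = (1 / s) * ((1 / s) * partial i (partial j plateau) ((1 / s) *\<^sub>R (x - a)))" for i j x
      unfolding w1 by (rule partial_scaled[OF smooth_on_partial[OF smooth_on_plateau]])
    have sQ: "(1 / s) * B \<le> Q" "(1 / s) * ((1 / s) * B) \<le> Q"
    proof -
      have "s * B \<le> e * B" using s B by (intro mult_right_mono) auto
      then have "s * B \<le> B * (1 + e)" using B(1) by (simp add: algebra_simps)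
      then show "(1 / s) * B \<le> Q" using s unfolding Q_def by (simp add: divide_simps power2_eq_square mult_ac)
      have "B \<le> B * (1 + e)" using B e(2) by (simp add: algebra_simps)
      then show "(1 / s) * ((1 / s) * B) \<le> Q" using s unfolding Q_def by (simp add: divide_simps power2_eq_square mult_ac)
    qed
    have b1: "\<bar>partial j w y\<bar> \<le> Q" for j
    proof -
      have "\<bar>partial j w y\<bar> \<le> (1 / s) * B"
        unfolding w1 abs_mult using s B(2) by (intro mult_mono) auto
      then show ?thesis using sQ(1) by linarith
    qed
    have b2: "\<bar>partial i (partial j w) y\<bar> \<le> Q" for i j
    proof -
      have "\<bar>partial i (partial j w) y\<bar> \<le> (1 / s) * ((1 / s) * B)"
        unfolding w2 abs_mult using s B by (intro mult_mono) auto
      then show ?thesis using sQ(2) by linarith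
    qed
    have uw: "(bump c a s \<circ> chart_inv c) x = w x" if "x \<in> ?O" for x
      using that by (simp add: bump_def chart_fun_def w_def chart_inv_mem[OF c] chart_inv_right[OF c])
    have pw: "partial j (bump c a s \<circ> chart_inv c) x = partial j w x" if "x \<in> ?O" for j x
      by (rule partial_transform[OF chart_image_open[OF c] that uw])
    have "volume_density M c y * laplacian_in_chart M c (bump c a s) (chart_inv c y)
      = (\<Sum>i\<in>UNIV. partial i (\<lambda>y. \<Sum>j\<in>UNIV. coeff_matrix c i j y * partial j w y) y)"
      unfolding volume_density_laplacian[OF c yO]
      by (intro sum.cong refl partial_transform[OF chart_image_open[OF c] yO]) (simp add: pw)
    also have "\<dots> = (\<Sum>i\<in>UNIV. \<Sum>j\<in>UNIV. coeff_matrix c i j y * partial i (partial j w) y + partial i (coeff_matrix c i j) y * partial j w y)"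
      by (intro sum.cong refl partial_sum_mult[OF smooth_coeff_matrix[OF c] smooth_on_partial yO] smooth_on_subset[OF w]) simp
    finally have eq: "volume_density M c y * laplacian_in_chart M c (bump c a s) (chart_inv c y) = \<dots>" .
    have "\<bar>volume_density M c y * laplacian_in_chart M c (bump c a s) (chart_inv c y)\<bar>
      \<le> (\<Sum>i\<in>UNIV. \<Sum>j\<in>UNIV. (\<bar>coeff_matrix c i j y\<bar> + \<bar>partial i (coeff_matrix c i j) y\<bar>) * Q)"
      unfolding eq
    proof (intro order_trans[OF sum_abs] sum_mono)
      fix i j
      have "\<bar>coeff_matrix c i j y * partial i (partial j w) y + partial i (coeff_matrix c i j) y * partial j w y\<bar>
        \<le> \<bar>coeff_matrix c i j y\<bar> * \<bar>partial i (partial j w) y\<bar> + \<bar>partial i (coeff_matrix c i j) y\<bar> * \<bar>partial j w y\<bar>"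
        using abs_triangle_ineq[of "coeff_matrix c i j y * partial i (partial j w) y" "partial i (coeff_matrix c i j) y * partial j w y"]
        by (simp add: abs_mult)
      also have "\<dots> \<le> \<bar>coeff_matrix c i j y\<bar> * Q + \<bar>partial i (coeff_matrix c i j) y\<bar> * Q"
        by (intro add_mono mult_left_mono b1 b2) auto
      finally show "\<bar>coeff_matrix c i j y * partial i (partial j w) y + partial i (coeff_matrix c i j) y * partial j w y\<bar>
        \<le> (\<bar>coeff_matrix c i j y\<bar> + \<bar>partial i (coeff_matrix c i j) y\<bar>) * Q" by (simp add: algebra_simps)
    qed
    also have "\<dots> = volume_density M c y * (?S y * Q)"
      using volume_density_pos[OF c yO] by (simp add: sum_distrib_right)
    finally have "volume_density M c y * \<bar>laplacian_in_chart M c (bump c a s) (chart_inv c y)\<bar> \<le> volume_density M c y * (?S y * Q)"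
      using volume_density_pos[OF c yO] by (simp add: abs_mult)
    then have "\<bar>laplacian_in_chart M c (bump c a s) (chart_inv c y)\<bar> \<le> ?S y * Q"
      using volume_density_pos[OF c yO] by (rule mult_left_le_imp_le)
    also have "\<dots> \<le> K * Q"
    proof (rule mult_right_mono)
      show "?S y \<le> K" using K[OF y] by linarith
      show "Q \<ge> 0" using B e(2) by (simp add: Q_def)
    qed
    finally show "\<bar>laplacian_in_chart M c (bump c a s) (chart_inv c y)\<bar> \<le> K * (B * (1 + e)) / s\<^sup>2"
      by (simp add: Q_def)
  qed
qed

lemma L2_ball_bound:
  assumes u: "u \<in> borel_measurable (vol M)" and S: "S \<in> sets borel" "emeasure (vol M) S \<le> ennreal v" "v \<ge> 0"
    and bound: "\<And>p. p \<in> S \<Longrightarrow> cmod (u p) \<le> B" "\<And>p. p \<notin> S \<Longrightarrow> u p = 0" and B: "B \<ge> 0"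
  shows "u \<in> L2 (vol M)" "L2_norm (vol M) u \<le> B * sqrt v"
proof -
  have "(\<integral>\<^sup>+p. ennreal ((cmod (u p))\<^sup>2) \<partial>vol M) \<le> (\<integral>\<^sup>+p. ennreal (B\<^sup>2) * indicator S p \<partial>vol M)"
    using bound by (intro nn_integral_mono) (auto simp: indicator_def intro!: ennreal_leI power_mono)
  also have "\<dots> = ennreal (B\<^sup>2) * emeasure (vol M) S"
    by (rule nn_integral_cmult_indicator) (simp add: S sets_vol)
  also have "\<dots> \<le> ennreal (B\<^sup>2) * ennreal v" by (intro mult_left_mono S) simp
  also have "\<dots> = ennreal ((B * sqrt v)\<^sup>2)" using S by (simp add: ennreal_mult[symmetric] power_mult_distrib)
  finally have le: "(\<integral>\<^sup>+p. ennreal ((cmod (u p))\<^sup>2) \<partial>vol M) \<le> ennreal ((B * sqrt v)\<^sup>2)" .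
  show "u \<in> L2 (vol M)" "L2_norm (vol M) u \<le> B * sqrt v"
    using L2_I_nn_integral[OF u le] B S by auto
qed

text \<open>Upper bounds use the volume of the ball of radius \<open>2 s\<close>, which supports
  \<open>u\<close> and \<open>h\<close>; the lower bound for \<open>u\<close> uses the ball of
  radius \<open>s\<close>, where \<open>u\<close> is 1. The quotient of the volume bounds is
  \<open>m' 2^d / m\<close> at every scale, so only the factor \<open>1 / s^2\<close>
  remains.\<close>

proposition concentrated_functions:
  assumes V: "smooth_fun M V"
  shows "\<exists>e C m'. e > 0 \<and> C \<ge> 0 \<and> m' > 0 \<and> (\<forall>s. 0 < s \<and> s \<le> e \<longrightarrow> (\<exists>u h \<phi>. smooth_fun M \<phi> \<and> (\<forall>p. 0 \<le> \<phi> p \<and> \<phi> p \<le> (1::real)) \<and> (\<forall>p. u p \<noteq> 0 \<longrightarrow> \<phi> p = 1)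
       \<and> (u, h) \<in> schroedinger M V (\<lambda>_. 0) \<and> 0 < L2_norm (vol M) u \<and> L2_norm (vol M) h \<le> C / s\<^sup>2 * L2_norm (vol M) u
       \<and> emeasure (vol M) {p. \<phi> p \<noteq> 0} \<le> ennreal (m' * s ^ CARD('d))))"
proof -
  \<comment> \<open>Types are nonempty, so \<open>undefined\<close> is a point of the manifold; the
    bumps concentrate there.\<close>
  obtain c where c: "c \<in> atlas M" "undefined \<in> fst c" using charts_cover by blast
  define a where "a = snd c undefined"
  have "a \<in> chart_image c" unfolding a_def by (rule chart_mem[OF c(2)])
  then obtain e where e: "e > 0" "cball a e \<subseteq> chart_image c"
    using open_contains_cball chart_image_open[OF c(1)] by blast
  obtain m m' where m: "m > 0" "m' > 0"
    and vol_ge: "\<And>s. 0 < s \<Longrightarrow> s \<le> e \<Longrightarrow> ennreal (m * s ^ CARD('d)) \<le> emeasure (vol M) (chart_inv c ` cball a s)"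
    and vol_le: "\<And>s. 0 < s \<Longrightarrow> s \<le> e \<Longrightarrow> emeasure (vol M) (chart_inv c ` cball a s) \<le> ennreal (m' * s ^ CARD('d))"
    using chart_ball_volume[OF c(1) e(2,1)] by blast
  obtain C where C: "C \<ge> 0"
    and lap: "\<And>s y. 0 < s \<Longrightarrow> s \<le> e \<Longrightarrow> y \<in> cball a e \<Longrightarrow> \<bar>laplacian_in_chart M c (bump c a s) (chart_inv c y)\<bar> \<le> C / s\<^sup>2"
    using laplacian_bump_bound[OF c(1) e(2,1)] by blast
  have "compact (V ` chart_inv c ` cball a e)"
    by (intro compact_continuous_image continuous_on_subset[OF smooth_fun_continuous[OF V]]
        compact_chart_inv(1)[OF c(1) compact_cball e(2)]) simp
  then obtain CV where CV: "\<And>y. y \<in> cball a e \<Longrightarrow> \<bar>V (chart_inv c y)\<bar> \<le> CV"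
    using compact_imp_bounded by (force simp: bounded_iff)
  have CV0: "CV \<ge> 0" using CV[of a] e(1) by (meson abs_ge_zero centre_in_cball less_imp_le order_trans)
  \<comment> \<open>The potential is bounded by \<open>CV\<close> near the point, and
    \<open>1 \<le> e^2 / s^2\<close> makes its contribution of the same order as that of the
    Laplacian.\<close>
  define C' where "C' = C + CV * e\<^sup>2"
  have C': "C' \<ge> 0" using C CV0 by (simp add: C'_def)
  define d where "d = CARD('d)"
  show ?thesis
  \<comment> \<open>The plateau \<open>bump c a (2 * s)\<close> reaches out to radius
    \<open>4 s\<close>, which has to stay within \<open>e\<close>; the volume of that ball gives the
    factor \<open>4^d\<close>.\<close>
  proof (rule exI[of _ "e / 4"], rule exI[of _ "C' * sqrt (m' * 2 ^ d / m)"],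
      (intro exI[of _ "m' * 4 ^ d"] conjI allI impI; (elim conjE)?))
    show "e / 4 > 0" "C' * sqrt (m' * 2 ^ d / m) \<ge> 0" "m' * 4 ^ d > 0" using e m C' by auto
    fix s :: real assume s: "0 < s" "s \<le> e / 4"
    have sub: "cball a r \<subseteq> chart_image c" if "r \<le> e" for r using e(2) subset_cball[OF that] by blast
    let ?L = "\<lambda>r. chart_inv c ` cball a r"
    have Lb: "?L r \<in> sets borel" if "r \<le> e" for r
      by (intro borel_compact compact_chart_inv(1)[OF c(1) compact_cball sub[OF that]])
    define u where "u p = complex_of_real (bump c a s p)" for p
    define f where "f p = complex_of_real (indicator (fst c) p * laplacian_in_chart M c (bump c a s) p)" for p
    define h where "h p = - f p + of_real (V p) * u p" for p
    \<comment> \<open>Doubling the radius makes the plateau equal to 1 on the whole support of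
      \<open>u\<close>.\<close>
    define \<phi> where "\<phi> = bump c a (2 * s)"
    have bs: "smooth_fun M (bump c a s)" by (rule smooth_bump[OF c(1) s(1) sub]) (use s in simp)
    have "smooth_fun M \<phi>" unfolding \<phi>_def by (rule smooth_bump[OF c(1) _ sub]) (use s in auto)
    moreover have "0 \<le> \<phi> p \<and> \<phi> p \<le> 1" for p by (simp add: \<phi>_def bump_bounds)
    moreover have "\<phi> p = 1" if "u p \<noteq> 0" for p
    proof -
      have "p \<in> ?L (2 * s)"
        using that bump_eq_0[OF c(1) s(1) sub, of p] s by (force simp: u_def)
      then show ?thesis unfolding \<phi>_def by (intro bump_eq_1[OF c(1) _ sub]) (use s in auto)
    qed
    moreover have "emeasure (vol M) {p. \<phi> p \<noteq> 0} \<le> ennreal (m' * 4 ^ d * s ^ d)"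
    proof -
      have "{p. \<phi> p \<noteq> 0} \<subseteq> ?L (4 * s)"
        using bump_eq_0[OF c(1), of "2 * s" a] sub[of "4 * s"] s by (auto simp: \<phi>_def)
      then have "emeasure (vol M) {p. \<phi> p \<noteq> 0} \<le> emeasure (vol M) (?L (4 * s))"
        by (rule emeasure_mono) (use Lb[of "4 * s"] s in \<open>simp add: sets_vol\<close>)
      also have "\<dots> \<le> ennreal (m' * (4 * s) ^ d)" unfolding d_def by (rule vol_le) (use s in auto)
      finally show ?thesis by (simp add: power_mult_distrib mult_ac)
    qed
    moreover have "(u, h) \<in> schroedinger M V (\<lambda>_. 0) \<and> 0 < L2_norm (vol M) u
       \<and> L2_norm (vol M) h \<le> C' * sqrt (m' * 2 ^ d / m) / s\<^sup>2 * L2_norm (vol M) u"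
    proof -
      define v where "v = m' * (2 * s) ^ d"
      have v: "v \<ge> 0" "emeasure (vol M) (?L (2 * s)) \<le> ennreal v"
        using m s vol_le[of "2 * s"] by (simp_all add: v_def d_def)
      have L2s: "?L (2 * s) \<in> sets borel" by (rule Lb) (use s in simp)
      have bmeas: "bump c a s \<in> borel_measurable (vol M)" by (rule smooth_fun_measurable[OF bs])
      have Vmeas: "V \<in> borel_measurable (vol M)" by (rule smooth_fun_measurable[OF V])
      have umeas: "u \<in> borel_measurable (vol M)" unfolding u_def[abs_def] using bmeas by measurable
      have "(\<lambda>p. indicator (fst c) p * laplacian_in_chart M c (bump c a s) p) \<in> borel_measurable (vol M)"
        unfolding measurable_vol using bs c(1)
        by (intro indicator_borel_measurable chart_borel continuous_laplacian) (auto simp: smooth_fun_iff)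
      then have fmeas: "f \<in> borel_measurable (vol M)" unfolding f_def[abs_def] by measurable
      have u0: "u p = 0" if "p \<notin> ?L (2 * s)" for p
        using bump_eq_0[OF c(1) s(1) sub that] s by (simp add: u_def)
      have u1: "cmod (u p) \<le> 1" for p using bump_bounds[of c a s p] by (simp add: u_def)
      \<comment> \<open>Off the closed ball the bump vanishes on an open set of coordinates, so its
        derivatives, the flux and the divergence of the flux vanish there in turn.\<close>
      have f0: "f p = 0" if "p \<notin> ?L (2 * s)" for p
      proof (cases "p \<in> fst c")
        case True
        have snd: "snd c p \<in> chart_image c - cball a (2 * s)"
          using that chart_mem[OF True] chart_inv_left[OF c(1) True] by (metis Diff_iff image_eqI)
        have d0: "partial j (bump c a s \<circ> chart_inv c) x = 0" if "x \<in> chart_image c - cball a (2 * s)" for j x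
        proof (rule partial_eq_0[OF chart_image_open[OF c(1)] compact_cball that])
          fix z assume z: "z \<in> chart_image c - cball a (2 * s)"
          then show "(bump c a s \<circ> chart_inv c) z = 0"
            using scaled_plateau_eq_0[OF s(1), of z a]
            by (simp add: bump_def chart_fun_def chart_inv_mem[OF c(1)] chart_inv_right[OF c(1)])
        qed
        have "partial i (\<lambda>y. \<Sum>j\<in>UNIV. coeff_matrix c i j y * partial j (bump c a s \<circ> chart_inv c) y) (snd c p) = 0" for i
          by (rule partial_eq_0[OF chart_image_open[OF c(1)] compact_cball snd]) (simp add: d0)
        then have "laplacian_in_chart M c (bump c a s) p = 0"
          by (simp add: laplacian_in_chart_def coeff_matrix_def)
        then show ?thesis by (simp add: f_def)
      qed (simp add: f_def)
      have fb: "cmod (f p) \<le> C / s\<^sup>2" if p: "p \<in> ?L (2 * s)" for p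
      proof -
        obtain y where y: "y \<in> cball a (2 * s)" "p = chart_inv c y" using p by blast
        have "y \<in> cball a e" using y(1) subset_cball[of "2 * s" e a] s by auto
        then have "\<bar>laplacian_in_chart M c (bump c a s) p\<bar> \<le> C / s\<^sup>2"
          using lap[OF s(1)] s y(2) by auto
        then show ?thesis using C by (simp add: f_def abs_mult indicator_def)
      qed
      have Vb: "cmod (of_real (V p) * u p) \<le> CV * e\<^sup>2 / s\<^sup>2" if p: "p \<in> ?L (2 * s)" for p
      proof -
        obtain y where y: "y \<in> cball a (2 * s)" "p = chart_inv c y" using p by blast
        have "y \<in> cball a e" using y(1) subset_cball[of "2 * s" e a] s by auto
        then have "\<bar>V p\<bar> \<le> CV" using CV y(2) by simp
        then have "cmod (of_real (V p) * u p) \<le> CV * 1"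
          unfolding norm_mult using u1[of p] CV0 by (intro mult_mono) auto
        also have "\<dots> \<le> CV * (e\<^sup>2 / s\<^sup>2)"
        proof (rule mult_left_mono[OF _ CV0])
          have "s\<^sup>2 \<le> e\<^sup>2" using s by (intro power_mono) auto
          then show "1 \<le> e\<^sup>2 / s\<^sup>2" using s by (simp add: le_divide_eq)
        qed
        finally show ?thesis by simp
      qed
      have uL2: "u \<in> L2 (vol M)"
        by (rule L2_ball_bound(1)[OF umeas L2s v(2,1) u1 u0]) simp_all
      have fL2: "f \<in> L2 (vol M)"
        by (rule L2_ball_bound(1)[OF fmeas L2s v(2,1) fb f0]) (use C in simp_all)
      have VuL2: "(\<lambda>p. of_real (V p) * u p) \<in> L2 (vol M)"
      proof (rule L2_ball_bound(1)[OF _ L2s v(2,1) Vb])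
        show "(\<lambda>p. of_real (V p) * u p) \<in> borel_measurable (vol M)" using Vmeas umeas by measurable
      qed (use CV0 u0 in simp_all)
      have hmeas: "h \<in> borel_measurable (vol M)" unfolding h_def[abs_def] using Vmeas umeas fmeas by measurable
      have hb: "cmod (h p) \<le> C' / s\<^sup>2" if p: "p \<in> ?L (2 * s)" for p
      proof -
        have "cmod (h p) \<le> cmod (f p) + cmod (of_real (V p) * u p)"
          using norm_triangle_ineq[of "- f p" "of_real (V p) * u p"] by (simp add: h_def)
        also have "\<dots> \<le> C / s\<^sup>2 + CV * e\<^sup>2 / s\<^sup>2" by (intro add_mono fb Vb p)
        finally show ?thesis by (simp add: C'_def add_divide_distrib)
      qed
      have h0: "h p = 0" if "p \<notin> ?L (2 * s)" for p by (simp add: h_def u0[OF that] f0[OF that])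
      have h: "h \<in> L2 (vol M)" "L2_norm (vol M) h \<le> C' / s\<^sup>2 * sqrt v"
        using L2_ball_bound[OF hmeas L2s v(2,1) hb h0] C' by auto
      have "ennreal (m * s ^ d) \<le> emeasure (vol M) (?L s)" unfolding d_def by (rule vol_ge) (use s in auto)
      also have "\<dots> = (\<integral>\<^sup>+p. indicator (?L s) p \<partial>vol M)"
        using Lb[of s] s by (simp add: sets_vol)
      also have "\<dots> \<le> (\<integral>\<^sup>+p. ennreal ((cmod (u p))\<^sup>2) \<partial>vol M)"
      proof (rule nn_integral_mono)
        fix p
        have "u p = 1" if "p \<in> ?L s"
          using bump_eq_1[OF c(1) s(1) sub that] s by (simp add: u_def)
        then show "indicator (?L s) p \<le> ennreal ((cmod (u p))\<^sup>2)" by (auto simp: indicator_def)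
      qed
      finally have "m * s ^ d \<le> (L2_norm (vol M) u)\<^sup>2"
        unfolding L2_nn_integral[OF uL2] by simp
      then have un: "sqrt (m * s ^ d) \<le> L2_norm (vol M) u" using real_le_lsqrt real_sqrt_le_iff
        by (metis L2_norm_nonneg real_sqrt_abs abs_of_nonneg)
      have ms: "m * s ^ d > 0" using m s by simp
      then have upos: "0 < L2_norm (vol M) u" using un real_sqrt_gt_zero[OF ms] by linarith
      have "v = (m' * 2 ^ d / m) * (m * s ^ d)" using m by (simp add: v_def power_mult_distrib)
      then have sv: "sqrt v = sqrt (m' * 2 ^ d / m) * sqrt (m * s ^ d)" by (simp only: real_sqrt_mult)
      have "L2_norm (vol M) h \<le> C' / s\<^sup>2 * (sqrt (m' * 2 ^ d / m) * sqrt (m * s ^ d))"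
        using h(2) unfolding sv .
      also have "\<dots> \<le> C' / s\<^sup>2 * (sqrt (m' * 2 ^ d / m) * L2_norm (vol M) u)"
        using C' m by (intro mult_left_mono un) auto
      finally have hn: "L2_norm (vol M) h \<le> C' * sqrt (m' * 2 ^ d / m) / s\<^sup>2 * L2_norm (vol M) u"
        by (simp add: mult_ac)
      have "weak_laplacian M u f"
        unfolding u_def[abs_def] f_def[abs_def] bump_def
        by (rule weak_laplacian_chart_fun[OF c(1) smooth_on_scaled_plateau compact_cball[of a "2 * s"] sub scaled_plateau_eq_0[OF s(1)]])
           (use s in simp_all)
      then have "(u, h) \<in> schroedinger M V (\<lambda>_. 0)"
        unfolding schroedinger_def using uL2 h(1) VuL2 fL2 by (auto simp: h_def)
      then show ?thesis using upos hn by simp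
    qed
    ultimately have main: "smooth_fun M \<phi> \<and> (\<forall>p. 0 \<le> \<phi> p \<and> \<phi> p \<le> 1) \<and> (\<forall>p. u p \<noteq> 0 \<longrightarrow> \<phi> p = 1)
       \<and> (u, h) \<in> schroedinger M V (\<lambda>_. 0) \<and> 0 < L2_norm (vol M) u
       \<and> L2_norm (vol M) h \<le> C' * sqrt (m' * 2 ^ d / m) / s\<^sup>2 * L2_norm (vol M) u
       \<and> emeasure (vol M) {p. \<phi> p \<noteq> 0} \<le> ennreal (m' * 4 ^ d * s ^ CARD('d))"
      unfolding d_def[symmetric] by simp
    show "\<exists>u h \<phi>. smooth_fun M \<phi> \<and> (\<forall>p. 0 \<le> \<phi> p \<and> \<phi> p \<le> (1::real)) \<and> (\<forall>p. u p \<noteq> 0 \<longrightarrow> \<phi> p = 1)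
       \<and> (u, h) \<in> schroedinger M V (\<lambda>_. 0) \<and> 0 < L2_norm (vol M) u
       \<and> L2_norm (vol M) h \<le> C' * sqrt (m' * 2 ^ d / m) / s\<^sup>2 * L2_norm (vol M) u
       \<and> emeasure (vol M) {p. \<phi> p \<noteq> 0} \<le> ennreal (m' * 4 ^ d * s ^ CARD('d))"
      using main by blast
  qed
qed


section \<open>The perturbed Schroedinger operators\<close>

lemma self_adjoint_schroedinger:
  assumes sa: "self_adjoint (vol M) (schroedinger M V (\<lambda>_. 0))"
    and W: "W \<in> borel_measurable (vol M)" "\<And>p. \<bar>W p\<bar> \<le> B"
  shows "self_adjoint (vol M) (schroedinger M V W)"
\<comment> \<open>The domain is determined by \<open>V\<close> alone, so both operators share it and
  differ by the multiplier \<open>W\<close>; what remains concerns representatives.\<close>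
proof (rule self_adjoint_bounded_perturbation[OF sa W])
  fix u k
  have Wu: "(\<lambda>x. of_real (W x) * u x) \<in> L2 (vol M)" if "u \<in> L2 (vol M)" by (rule L2_mult_bounded[OF that W])
  show "(u, k) \<in> schroedinger M V W \<longleftrightarrow> k \<in> L2 (vol M) \<and>
    (\<exists>h. (u, h) \<in> schroedinger M V (\<lambda>_. 0) \<and> (AE x in vol M. k x = h x + of_real (W x) * u x))"
  proof
    assume "(u, k) \<in> schroedinger M V W"
    then obtain f where u: "u \<in> L2 (vol M)" and k: "k \<in> L2 (vol M)" and Vu: "(\<lambda>x. of_real (V x) * u x) \<in> L2 (vol M)"
      and f: "f \<in> L2 (vol M)" "weak_laplacian M u f"
      and eq: "AE x in vol M. k x = - f x + of_real (V x) * u x + of_real (W x) * u x"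
      unfolding schroedinger_def by blast
    have "(u, \<lambda>x. - f x + of_real (V x) * u x) \<in> schroedinger M V (\<lambda>_. 0)"
      unfolding schroedinger_def using u Vu f L2_add[OF L2_scale[OF f(1), of "- 1"] Vu] by auto
    with k eq show "k \<in> L2 (vol M) \<and>
      (\<exists>h. (u, h) \<in> schroedinger M V (\<lambda>_. 0) \<and> (AE x in vol M. k x = h x + of_real (W x) * u x))" by auto
  next
    assume "k \<in> L2 (vol M) \<and>
      (\<exists>h. (u, h) \<in> schroedinger M V (\<lambda>_. 0) \<and> (AE x in vol M. k x = h x + of_real (W x) * u x))"
    then obtain h f where k: "k \<in> L2 (vol M)" "AE x in vol M. k x = h x + of_real (W x) * u x"
      and u: "u \<in> L2 (vol M)" and Vu: "(\<lambda>x. of_real (V x) * u x) \<in> L2 (vol M)"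
      and f: "f \<in> L2 (vol M)" "weak_laplacian M u f"
      and eq: "AE x in vol M. h x = - f x + of_real (V x) * u x + of_real 0 * u x"
      unfolding schroedinger_def by blast
    have "AE x in vol M. k x = - f x + of_real (V x) * u x + of_real (W x) * u x"
      using k(2) eq by eventually_elim simp
    then show "(u, k) \<in> schroedinger M V W" unfolding schroedinger_def using k(1) u Vu f by blast
  qed
qed

text \<open>Where \<open>u\<close> is nonzero the potential equals \<open>l\<close>, and elsewhere
  both products vanish, so \<open>W u = l u\<close> at every point.\<close>

lemma schroedinger_plus_constant:
  assumes uh: "(u, h) \<in> schroedinger M V (\<lambda>_. 0)" and W: "\<And>p. u p \<noteq> 0 \<Longrightarrow> W p = l"
  shows "(u, \<lambda>p. h p + of_real l * u p) \<in> schroedinger M V W"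
proof -
  obtain f where u: "u \<in> L2 (vol M)" and h: "h \<in> L2 (vol M)" and Vu: "(\<lambda>x. of_real (V x) * u x) \<in> L2 (vol M)"
    and f: "f \<in> L2 (vol M)" "weak_laplacian M u f"
    and eq: "AE x in vol M. h x = - f x + of_real (V x) * u x + of_real 0 * u x"
    using uh unfolding schroedinger_def by blast
  have "AE x in vol M. h x + of_real l * u x = - f x + of_real (V x) * u x + of_real (W x) * u x"
    using eq
  proof eventually_elim
    case (elim x)
    then show ?case using W[of x] by (cases "u x = 0") auto
  qed
  then show ?thesis
    unfolding schroedinger_def using u Vu f L2_add[OF h L2_scale[OF u, of "of_real l"]] by blast
qed

end

section \<open>Norms of the potentials and the two limits\<close>

lemma nn_integral_powr_le:
  assumes W: "W \<in> borel_measurable \<mu>" "\<And>p. \<bar>W p\<bar> \<le> l" "l \<ge> 0" and q: "q > 0"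
    and S: "emeasure \<mu> {p \<in> space \<mu>. W p \<noteq> 0} \<le> ennreal v" "v \<ge> 0"
  shows "(\<integral>\<^sup>+x. ennreal (\<bar>W x\<bar> powr q) \<partial>\<mu>) \<le> ennreal (l powr q * v)"
proof -
  have S': "{p \<in> space \<mu>. W p \<noteq> 0} \<in> sets \<mu>" using W(1) by measurable
  have "(\<integral>\<^sup>+x. ennreal (\<bar>W x\<bar> powr q) \<partial>\<mu>) \<le> (\<integral>\<^sup>+x. ennreal (l powr q) * indicator {p \<in> space \<mu>. W p \<noteq> 0} x \<partial>\<mu>)"
    using W(2) q by (intro nn_integral_mono) (auto simp: indicator_def intro!: ennreal_leI powr_mono2)
  also have "\<dots> = ennreal (l powr q) * emeasure \<mu> {p \<in> space \<mu>. W p \<noteq> 0}"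
    by (rule nn_integral_cmult_indicator[OF S'])
  also have "\<dots> \<le> ennreal (l powr q) * ennreal v" by (intro mult_left_mono S) simp
  also have "\<dots> = ennreal (l powr q * v)" using S by (simp add: ennreal_mult)
  finally show ?thesis .
qed

lemma Lp_norm_le:
  assumes "(\<integral>\<^sup>+x. ennreal (\<bar>W x\<bar> powr p) \<partial>\<mu>) \<le> ennreal a" "a \<ge> 0" "p > 0"
  shows "Lp_norm \<mu> p W \<le> ennreal (a powr (1 / p))"
proof -
  let ?I = "\<integral>\<^sup>+x. ennreal (\<bar>W x\<bar> powr p) \<partial>\<mu>"
  have fin: "?I \<noteq> \<infinity>" using assms(1) by (auto simp: top_unique)
  have "enn2real ?I \<le> a" using enn2real_mono[OF assms(1)] assms(2) by simp
  then show ?thesis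
    unfolding Lp_norm_def Let_def using fin assms(3) by (auto intro!: ennreal_leI powr_mono2)
qed

text \<open>The length scale survives with the positive exponent \<open>q = d - 2 p\<close>, and a
  negative power of \<open>n + 1\<close> beats every power of the logarithm.\<close>

lemma log_power_decay:
  fixes p d :: real
  assumes "2 * p < d" "e > 0"
  shows "(\<lambda>n. (ln (real n + 2) / (e / (real n + 1))\<^sup>2) powr p * (m * (e / (real n + 1)) powr d)) \<longlonglongrightarrow> 0"
proof -
  define q where "q = d - 2 * p"
  have q: "q > 0" using assms by (simp add: q_def)
  have "(\<lambda>n. (real n + 1) powr (- q) * ln (real n + 2) powr p) \<longlonglongrightarrow> 0"
    using q by real_asymp
  then have "(\<lambda>n. m * e powr q * ((real n + 1) powr (- q) * ln (real n + 2) powr p)) \<longlonglongrightarrow> m * e powr q * 0"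
    by (rule tendsto_mult_left)
  moreover have "(ln (real n + 2) / (e / (real n + 1))\<^sup>2) powr p * (m * (e / (real n + 1)) powr d)
      = m * e powr q * ((real n + 1) powr (- q) * ln (real n + 2) powr p)" for n
  proof -
    define x where "x = e / (real n + 1)"
    have x: "x > 0" using assms by (simp add: x_def add_pos_nonneg)
    have l: "ln (real n + 2) \<ge> 0" by simp
    have "(ln (real n + 2) / x\<^sup>2) powr p = ln (real n + 2) powr p / (x powr (2 * p))"
      using x l by (simp add: powr_divide powr_powr flip: powr_numeral)
    moreover have "x powr d = x powr q * x powr (2 * p)" by (simp add: q_def flip: powr_add)
    moreover have "x powr q = e powr q * (real n + 1) powr (- q)"
      using assms by (simp add: x_def powr_divide powr_minus_divide)
    ultimately show ?thesis using x by (simp add: x_def[symmetric] mult_ac)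
  qed
  ultimately show ?thesis by (simp only: mult_zero_right)
qed

theorem theorem4p1:
  fixes M :: "('a::{t2_space, second_countable_topology}, 'd::finite) riemannian"
    and V :: "'a \<Rightarrow> real"
  assumes "riemannian_manifold M"
    and "CARD('d) \<ge> 3"
    and "smooth_fun M V"
    and "\<And>x. V x \<ge> 0"
    and "self_adjoint (vol M) (schroedinger M V (\<lambda>_. 0))"
  shows "\<exists>W :: nat \<Rightarrow> 'a \<Rightarrow> real.
    (\<forall>n. smooth_fun M (W n) \<and> bounded (range (W n))) \<and>
    (\<forall>p::real. 1 \<le> p \<and> p < real CARD('d) / 2 \<longrightarrow>
       (\<lambda>n. Lp_norm (vol M) p (W n)) \<longlonglongrightarrow> 0) \<and>
    (\<forall>T::real. T > 0 \<longrightarrow>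
       (\<lambda>n. esssup (lebesgue_on {0..T})
          (\<lambda>t. op_norm (vol M) (\<lambda>u x.
             exp_group (vol M) (schroedinger M V (W n)) t u x
             - exp_group (vol M) (schroedinger M V (\<lambda>_. 0)) t u x)))
       \<longlonglongrightarrow> 2)"
proof -
  interpret riemannian_mfd M by unfold_locales (rule assms(1))
  note sa = assms(5)
  obtain e C m where eCm: "e > 0" "C \<ge> 0" "m > 0"
    and fam: "\<forall>s. 0 < s \<and> s \<le> e \<longrightarrow> (\<exists>u h \<phi>. smooth_fun M \<phi> \<and> (\<forall>p. 0 \<le> \<phi> p \<and> \<phi> p \<le> (1::real)) \<and> (\<forall>p. u p \<noteq> 0 \<longrightarrow> \<phi> p = 1)
       \<and> (u, h) \<in> schroedinger M V (\<lambda>_. 0) \<and> 0 < L2_norm (vol M) u \<and> L2_norm (vol M) h \<le> C / s\<^sup>2 * L2_norm (vol M) u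
       \<and> emeasure (vol M) {p. \<phi> p \<noteq> 0} \<le> ennreal (m * s ^ CARD('d)))"
    using concentrated_functions[OF assms(3)] by (elim exE conjE)
  define s where "s n = e / (real n + 1)" for n :: nat
  have s: "0 < s n" "s n \<le> e" for n using eCm(1) by (auto simp: s_def field_simps add_pos_nonneg)
  define P where "P n u h \<phi> \<longleftrightarrow> smooth_fun M \<phi> \<and> (\<forall>p. 0 \<le> \<phi> p \<and> \<phi> p \<le> (1::real)) \<and> (\<forall>p. u p \<noteq> 0 \<longrightarrow> \<phi> p = 1)
       \<and> (u, h) \<in> schroedinger M V (\<lambda>_. 0) \<and> 0 < L2_norm (vol M) u \<and> L2_norm (vol M) h \<le> C / (s n)\<^sup>2 * L2_norm (vol M) u
       \<and> emeasure (vol M) {p. \<phi> p \<noteq> 0} \<le> ennreal (m * s n ^ CARD('d))" for n u h \<phi>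
  have "\<forall>n. \<exists>u h \<phi>. P n u h \<phi>" unfolding P_def using fam s by blast
  then obtain u h \<phi> where P: "\<And>n. P n (u n) (h n) (\<phi> n)" by metis
  from P have \<phi>: "\<And>n. smooth_fun M (\<phi> n)" "\<And>n p. 0 \<le> \<phi> n p" "\<And>n p. \<phi> n p \<le> (1::real)"
    and u\<phi>: "\<And>n p. u n p \<noteq> 0 \<Longrightarrow> \<phi> n p = 1" and uh: "\<And>n. (u n, h n) \<in> schroedinger M V (\<lambda>_. 0)"
    and u: "\<And>n. 0 < L2_norm (vol M) (u n)"
    and h: "\<And>n. L2_norm (vol M) (h n) \<le> C / (s n)\<^sup>2 * L2_norm (vol M) (u n)"
    and supp: "\<And>n. emeasure (vol M) {p. \<phi> n p \<noteq> 0} \<le> ennreal (m * s n ^ CARD('d))"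
    unfolding P_def by blast+
  \<comment> \<open>The shift by 2 makes the logarithm positive already at \<open>n = 0\<close>, so
    that \<open>pi / l n\<close> is always a positive time.\<close>
  define l where "l n = ln (real n + 2) / (s n)\<^sup>2" for n
  have l: "l n > 0" for n using s(1)[of n] by (simp add: l_def)
  define W where "W n p = l n * \<phi> n p" for n p
  have W_smooth: "smooth_fun M (W n)" for n
    unfolding smooth_fun_def
  proof
    fix c assume c: "c \<in> atlas M"
    have "smooth_on (chart_image c) (\<phi> n \<circ> chart_inv c)" using \<phi>(1)[of n] c by (simp add: smooth_fun_def)
    from smooth_on_mult[OF chart_image_open[OF c] smooth_on_const this, of "l n"]
    show "smooth_on (chart_image c) (W n \<circ> chart_inv c)" by (simp add: W_def o_def)
  qed
  have W_bound: "\<bar>W n p\<bar> \<le> l n" for n p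
    using l[of n] \<phi>(2,3)[of n p] by (simp add: W_def abs_mult mult_left_le)
  have W_meas: "W n \<in> borel_measurable (vol M)" for n by (rule smooth_fun_measurable[OF W_smooth])
  have saW: "self_adjoint (vol M) (schroedinger M V (W n))" for n
    by (rule self_adjoint_schroedinger[OF sa W_meas W_bound])
  have uhW: "(u n, \<lambda>p. h n p + of_real (l n) * u n p) \<in> schroedinger M V (W n)" for n
    by (rule schroedinger_plus_constant[OF uh]) (simp add: W_def u\<phi>)
  show ?thesis
  proof (intro exI[of _ W] conjI allI impI)
    show "smooth_fun M (W n)" for n by (rule W_smooth)
    show "bounded (range (W n))" for n using W_bound[of n] by (auto simp: bounded_iff)
  next
    fix p :: real assume p: "1 \<le> p \<and> p < real CARD('d) / 2"
    let ?a = "\<lambda>n. l n powr p * (m * s n powr real CARD('d))"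
    have "?a \<longlonglongrightarrow> 0"
      unfolding l_def s_def by (rule log_power_decay) (use p eCm in auto)
    \<comment> \<open>Here \<open>0 powr (1 / p)\<close> is 0, so the bound for the norm tends to 0
      along with the bound for the integral.\<close>
    then have "(\<lambda>n. ?a n powr (1 / p)) \<longlonglongrightarrow> 0 powr (1 / p)"
      using p eCm by (intro tendsto_powr2 tendsto_const) auto
    then have lim: "(\<lambda>n. ennreal (?a n powr (1 / p))) \<longlonglongrightarrow> 0"
      using tendsto_ennrealI by fastforce
    have "Lp_norm (vol M) p (W n) \<le> ennreal (?a n powr (1 / p))" for n
    proof (rule Lp_norm_le)
      have "{p \<in> space (vol M). W n p \<noteq> 0} = {p. \<phi> n p \<noteq> 0}" using l[of n] by (auto simp: W_def)
      then have "emeasure (vol M) {p \<in> space (vol M). W n p \<noteq> 0} \<le> ennreal (m * s n powr real CARD('d))"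
        using supp[of n] s(1)[of n] by (simp add: powr_realpow)
      then show "(\<integral>\<^sup>+x. ennreal (\<bar>W n x\<bar> powr p) \<partial>vol M) \<le> ennreal (?a n)"
        using p l[of n] eCm by (intro nn_integral_powr_le W_meas W_bound) auto
    qed (use p eCm in auto)
    then show "(\<lambda>n. Lp_norm (vol M) p (W n)) \<longlonglongrightarrow> 0"
      by (intro tendsto_sandwich[OF _ _ tendsto_const lim]) (auto intro: always_eventually)
  next
    fix T :: real assume T: "T > 0"
    let ?f = "\<lambda>n t. op_norm (vol M) (\<lambda>u x. exp_group (vol M) (schroedinger M V (W n)) t u x
             - exp_group (vol M) (schroedinger M V (\<lambda>_. 0)) t u x)"
    note U = exp_group(1)[OF sa] and UW = exp_group(1)[OF saW]
    note ess = esssup_lsc_bounds[OF open_op_norm_diff_greater[OF UW U]]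
    have upper: "esssup (lebesgue_on {0..T}) (?f n) \<le> 2" for n
      by (rule ess(1)[OF op_norm_diff_le_2[OF UW U]])
    have "(\<lambda>n. pi / (ln (real n + 2) / (e / (real n + 1))\<^sup>2)) \<longlonglongrightarrow> 0" using eCm(1) by real_asymp
    then have "(\<lambda>n. pi / l n) \<longlonglongrightarrow> 0" by (simp only: l_def s_def)
    \<comment> \<open>The turning time eventually drops below the given \<open>T\<close>, where the
      pointwise bound can be passed to the essential supremum.\<close>
    then have early: "\<forall>\<^sub>F n in sequentially. pi / l n < T" using T by (intro order_tendstoD)
    \<comment> \<open>For small \<open>n\<close> the real number may be negative;
      \<open>ennreal\<close> then truncates it to 0 and the bound is trivial.\<close>
    have lower: "ennreal (2 - 2 * pi * C / ln (real n + 2)) \<le> esssup (lebesgue_on {0..T}) (?f n)" if "pi / l n < T" for n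
    proof -
      have "ln (real n + 2) > 0" by simp
      have "2 * pi * L2_norm (vol M) (h n) / (l n * L2_norm (vol M) (u n)) \<le> 2 * pi * (C / (s n)\<^sup>2 * L2_norm (vol M) (u n)) / (l n * L2_norm (vol M) (u n))"
        using h[of n] u[of n] l[of n] by (intro divide_right_mono mult_left_mono) auto
      \<comment> \<open>The factors \<open>s^2\<close> in the bound for \<open>h\<close> and in
        \<open>l n\<close> cancel, leaving only the logarithm.\<close>
      also have "\<dots> = 2 * pi * C / ln (real n + 2)"
        using u[of n] s(1)[of n] by (simp add: l_def)
      finally have "ennreal (2 - 2 * pi * C / ln (real n + 2))
        \<le> ennreal (2 - 2 * pi * L2_norm (vol M) (h n) / (l n * L2_norm (vol M) (u n)))"
        by (intro ennreal_leI) simp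
      also have "\<dots> \<le> ?f n (pi / l n)"
        by (rule op_norm_diff_near_2[OF sa saW uh uhW l u])
      also have "\<dots> \<le> esssup (lebesgue_on {0..T}) (?f n)"
        by (rule ess(2)) (use l[of n] that in auto)
      finally show ?thesis .
    qed
    have "(\<lambda>n. 2 - 2 * pi * C / ln (real n + 2)) \<longlonglongrightarrow> 2" by real_asymp
    then have "(\<lambda>n. ennreal (2 - 2 * pi * C / ln (real n + 2))) \<longlonglongrightarrow> ennreal 2" by (rule tendsto_ennrealI)
    then have lim: "(\<lambda>n. ennreal (2 - 2 * pi * C / ln (real n + 2))) \<longlonglongrightarrow> 2" by simp
    show "(\<lambda>n. esssup (lebesgue_on {0..T}) (?f n)) \<longlonglongrightarrow> 2"
    proof (rule tendsto_sandwich[OF _ _ lim tendsto_const])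
      show "\<forall>\<^sub>F n in sequentially. ennreal (2 - 2 * pi * C / ln (real n + 2)) \<le> esssup (lebesgue_on {0..T}) (?f n)"
        using early by eventually_elim (rule lower)
    qed (simp add: upper)
  qed
qed

end
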